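(* Let $M$ be a graded $QP$-manifold whose homological vector field $\hat Q=Q^a(x)\,\partial/\partial x^a$ has weight $q$ and whose Poisson bracket $\{\ ,\ \}_P$ has weight $p$. Let $Q'=\theta(\hat Q)=-Q^a(x)x^*_a$ and $P=\frac12P^{ab}(x)x^*_bx^*_a$ be the corresponding even functions on $\Pi T^*M$. Define the total weight on $\Pi T^*M$ as $w+(q-p)d$, where $w$ is the induced weight and $d$ is the fiberwise degree. For arbitrary $\lambda\in\mathbb R$ define the vector field $\hat Q_D=X_{Q'}+\lambda X_P$ on $\Pi T^*M$, where $X_f=\{f,\ \}$ for the canonical Schouten bracket. Then $\Pi T^*M$ with the total weight and the field $\hat Q_D$ is a graded $Q$-manifold (i.e. $\hat Q_D$ is an odd vector field with $\hat Q_D^2=0$), and the homological vector field $\hat Q_D$ has total weight $q$, the same as the weight of $\hat Q$ on $M$.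
   Context: Everything is $\mathbb Z_2$-graded (manifold means supermanifold); tilde denotes parity; $\Pi$ is parity reversion. Graded manifold: a supermanifold with a distinguished class of atlases whose local coordinates $x^a$ (of parity $\tilde a$) carry weights $w(x^a)=w_a\in\mathbb Z$ (independent of parity), functions being smooth in all coordinates and polynomial in coordinates of nonzero weight, such that coordinate changes preserve weight. A vector field $X=X^a\partial_a$ is homogeneous of weight $w(X)$ if $w(X)=w(X^a)-w_a$ for all $a$. On the anticotangent bundle $\Pi T^*M$ with coordinates $x^a$ and odd-conjugate momenta $x^*_a$ (of parity $\tilde a+1$) the canonical Schouten bracket is $$\{f,g\}=(-1)^{(\tilde a+1)(\tilde f+1)}\frac{\partial f}{\partial x^*_a}\frac{\partial g}{\partial x^a}-(-1)^{\tilde a(\tilde f+1)}\frac{\partial f}{\partial x^a}\frac{\partial g}{\partial x^*_a}.$$ The induced weight $w$ on $\Pi T^*M$ is given by $w(x^a)=w_a$, $w(x^*_a)=-w_a$; the fiberwise degree is $d(x^a)=0$, $d(x^*_a)=1$. To a vector field $X=X^a\partial_a$ corresponds $\theta(X)=(-1)^{\tilde X}X^ax^*_a$. A homological vector field is an odd vector field $\hat Q$ with $\hat Q^2=0$; a (graded) $Q$-manifold is a (graded) manifold with a homological vector field. A Poisson bracket on $M$ (even) is given by an even bivector field $P=\frac12P^{ab}(x)x^*_bx^*_a\in C^\infty(\Pi T^*M)$ with $\{P,P\}=0$ via $\{f,g\}_P=\{f,\{P,g\}\}$ (canonical Schouten brackets on the right); its weight is the induced weight of $P$. A graded $QP$-manifold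 is a graded manifold with a homological vector field $\hat Q$ and a Poisson bracket such that $\hat Q$ is a derivation of the bracket.
   Formalization: In a graded manifold, coordinate vector fields of one chart, written in another, must also be homogeneous with coefficients polynomial in the nonzero-weight coordinates; if only coordinate changes are required polynomial, those of ΠT*M can fail to be polynomial. *)

theory Defs
  imports "HOL-Analysis.Analysis"
begin

section \<open>Grassmann algebras\<close>

text \<open>
  An element of the real Grassmann algebra on generators \<open>\<xi>\<^sub>a\<close>, \<open>a :: 'i\<close>, is given by its coefficients
  at the monomials \<open>\<xi>\<^sup>S\<close>, the product of the \<open>\<xi>\<^sub>s\<close> with \<open>s \<in> S\<close> in increasing order.
\<close>

typedef 'i grass = "UNIV :: ('i set \<Rightarrow> real) set"
  morphisms gcoeff Grass by simp

setup_lifting type_definition_grass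

lemma grass_eqI: "(\<And>S. gcoeff f S = gcoeff g S) \<Longrightarrow> f = g"
  by transfer auto

text \<open>\<open>\<xi>\<^sup>T * \<xi>\<^sup>U = (-1)^ginv T U * \<xi>\<^bsup>T \<union> U\<^esup>\<close> for disjoint \<open>T\<close>, \<open>U\<close>.\<close>

definition ginv :: "'i::linorder set \<Rightarrow> 'i set \<Rightarrow> nat" where
  "ginv T U = card {(t, u). t \<in> T \<and> u \<in> U \<and> u < t}"

lemma ginv_empty [simp]: "ginv {} U = 0" "ginv T {} = 0"
  by (simp_all add: ginv_def)

lemma ginv_sum:
  fixes T :: "'i::{finite,linorder} set"
  shows "ginv T U = (\<Sum>t\<in>T. \<Sum>u\<in>U. if u < t then 1 else 0)"
proof -
  have "{(t, u). t \<in> T \<and> u \<in> U \<and> u < t} = Sigma T (\<lambda>t. {u \<in> U. u < t})" by auto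
  then have "ginv T U = (\<Sum>t\<in>T. card {u \<in> U. u < t})" by (simp add: ginv_def)
  also have "\<dots> = (\<Sum>t\<in>T. \<Sum>u\<in>U. if u < t then 1 else 0)"
    by (intro sum.cong refl) (simp add: sum.If_cases Int_def)
  finally show ?thesis .
qed

lemma ginv_Un_left:
  fixes T1 :: "'i::{finite,linorder} set"
  shows "T1 \<inter> T2 = {} \<Longrightarrow> ginv (T1 \<union> T2) U = ginv T1 U + ginv T2 U"
  by (simp add: ginv_sum sum.union_disjoint)

lemma ginv_Un_right:
  fixes T :: "'i::{finite,linorder} set"
  shows "U1 \<inter> U2 = {} \<Longrightarrow> ginv T (U1 \<union> U2) = ginv T U1 + ginv T U2"
  by (simp add: ginv_sum sum.union_disjoint sum.distrib)

instantiation grass :: (type) real_vector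
begin
lift_definition zero_grass :: "'a grass" is "\<lambda>S. 0" .
lift_definition plus_grass :: "'a grass \<Rightarrow> 'a grass \<Rightarrow> 'a grass" is "\<lambda>f g S. f S + g S" .
lift_definition uminus_grass :: "'a grass \<Rightarrow> 'a grass" is "\<lambda>f S. - f S" .
lift_definition minus_grass :: "'a grass \<Rightarrow> 'a grass \<Rightarrow> 'a grass" is "\<lambda>f g S. f S - g S" .
lift_definition scaleR_grass :: "real \<Rightarrow> 'a grass \<Rightarrow> 'a grass" is "\<lambda>r f S. r * f S" .
instance by standard (transfer; auto simp: algebra_simps fun_eq_iff)+
end

lemma grass_double_sum:
  fixes F :: "'i::finite set \<Rightarrow> 'i set \<Rightarrow> 'i set \<Rightarrow> real"
  shows "(\<Sum>T\<in>Pow S. \<Sum>U\<in>Pow T. F U (T - U) (S - T))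
       = (\<Sum>U\<in>Pow S. \<Sum>W\<in>Pow (S - U). F U W (S - U - W))"
proof -
  have "(\<Sum>T\<in>Pow S. \<Sum>U\<in>Pow T. F U (T - U) (S - T))
      = (\<Sum>(T, U)\<in>Sigma (Pow S) Pow. F U (T - U) (S - T))"
    by (simp add: sum.Sigma)
  also have "\<dots> = (\<Sum>(U, W)\<in>Sigma (Pow S) (\<lambda>U. Pow (S - U)). F U W (S - U - W))"
    by (rule sum.reindex_bij_witness[where i="\<lambda>(U, W). (U \<union> W, U)" and j="\<lambda>(T, U). (U, T - U)"])
       (auto intro!: arg_cong[where f="F _ _"])
  also have "\<dots> = (\<Sum>U\<in>Pow S. \<Sum>W\<in>Pow (S - U). F U W (S - U - W))"
    by (simp add: sum.Sigma)
  finally show ?thesis .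
qed

instantiation grass :: ("{finite,linorder}") real_algebra_1
begin
lift_definition one_grass :: "'a grass" is "\<lambda>S. if S = {} then 1 else 0" .
lift_definition times_grass :: "'a grass \<Rightarrow> 'a grass \<Rightarrow> 'a grass"
  is "\<lambda>f g S. \<Sum>T\<in>Pow S. (-1) ^ ginv T (S - T) * f T * g (S - T)" .
instance
proof
  fix a b c :: "'a grass" and r :: real
  show "a * b * c = a * (b * c)"
  proof (transfer, rule ext)
    fix a b c :: "'a set \<Rightarrow> real" and S :: "'a set"
    have l: "(-1) ^ ginv T (S - T) * (\<Sum>U\<in>Pow T. (-1) ^ ginv U (T - U) * a U * b (T - U)) * c (S - T)
      = (\<Sum>U\<in>Pow T. (-1) ^ (ginv U (T - U) + ginv U (S - T) + ginv (T - U) (S - T))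
            * (a U * b (T - U) * c (S - T)))" (is "_ = (\<Sum>U\<in>_. ?F U (T - U) (S - T))")
      if "T \<in> Pow S" for T
      unfolding sum_distrib_left sum_distrib_right
    proof (intro sum.cong refl)
      fix U assume "U \<in> Pow T"
      then have "U \<union> (T - U) = T" "U \<inter> (T - U) = {}" by auto
      then have "ginv T (S - T) = ginv U (S - T) + ginv (T - U) (S - T)"
        using ginv_Un_left[of U "T - U" "S - T"] by simp
      then show "(-1) ^ ginv T (S - T) * ((-1) ^ ginv U (T - U) * a U * b (T - U)) * c (S - T)
        = ?F U (T - U) (S - T)" by (simp add: power_add mult_ac)
    qed
    have r: "(-1) ^ ginv U (S - U) * a U * (\<Sum>W\<in>Pow (S - U). (-1) ^ ginv W (S - U - W) * b W * c (S - U - W))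
      = (\<Sum>W\<in>Pow (S - U). ?F U W (S - U - W))"
      if "U \<in> Pow S" for U
      unfolding sum_distrib_left sum_distrib_right
    proof (intro sum.cong refl)
      fix W assume "W \<in> Pow (S - U)"
      then have "W \<union> (S - U - W) = S - U" "W \<inter> (S - U - W) = {}" by auto
      then have "ginv U (S - U) = ginv U W + ginv U (S - U - W)"
        using ginv_Un_right[of W "S - U - W" U] by simp
      then show "(-1) ^ ginv U (S - U) * a U * ((-1) ^ ginv W (S - U - W) * b W * c (S - U - W))
        = ?F U W (S - U - W)" by (simp add: power_add mult_ac)
    qed
    show "(\<Sum>T\<in>Pow S. (-1) ^ ginv T (S - T)
            * (\<Sum>U\<in>Pow T. (-1) ^ ginv U (T - U) * a U * b (T - U)) * c (S - T))
        = (\<Sum>U\<in>Pow S. (-1) ^ ginv U (S - U) * a U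
            * (\<Sum>W\<in>Pow (S - U). (-1) ^ ginv W (S - U - W) * b W * c (S - U - W)))"
      using grass_double_sum[of ?F S] by (simp only: l r cong: sum.cong)
  qed
  show "(a + b) * c = a * c + b * c"
    by transfer (auto simp: algebra_simps sum.distrib)
  show "a * (b + c) = a * b + a * c"
    by transfer (auto simp: algebra_simps sum.distrib)
  show "r *\<^sub>R a * b = r *\<^sub>R (a * b)"
    by transfer (auto simp: sum_distrib_left mult_ac)
  show "a * r *\<^sub>R b = r *\<^sub>R (a * b)"
    by transfer (auto simp: sum_distrib_left mult_ac)
  show "1 * a = a"
  proof (transfer, rule ext)
    fix a :: "'a set \<Rightarrow> real" and S :: "'a set"
    have "(\<Sum>T\<in>Pow S. (-1) ^ ginv T (S - T) * (if T = {} then 1 else 0) * a (S - T))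
        = (\<Sum>T\<in>Pow S. if T = {} then a S else 0)" by (intro sum.cong) auto
    then show "(\<Sum>T\<in>Pow S. (-1) ^ ginv T (S - T) * (if T = {} then 1 else 0) * a (S - T)) = a S"
      by simp
  qed
  show "a * 1 = a"
  proof (transfer, rule ext)
    fix a :: "'a set \<Rightarrow> real" and S :: "'a set"
    have "(\<Sum>T\<in>Pow S. (-1) ^ ginv T (S - T) * a T * (if S - T = {} then 1 else 0))
        = (\<Sum>T\<in>Pow S. if T = S then a S else 0)" by (intro sum.cong) auto
    then show "(\<Sum>T\<in>Pow S. (-1) ^ ginv T (S - T) * a T * (if S - T = {} then 1 else 0)) = a S"
      by simp
  qed
  show "(0::'a grass) \<noteq> 1"
    by transfer (auto simp: fun_eq_iff)
qed
end

definition ggen :: "'i \<Rightarrow> 'i grass" where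
  "ggen a = Grass (\<lambda>S. if S = {a} then 1 else 0)"

definition gpart :: "nat \<Rightarrow> 'i grass \<Rightarrow> 'i grass" where
  "gpart k f = Grass (\<lambda>S. if card S mod 2 = k mod 2 then gcoeff f S else 0)"

text \<open>Left derivative with respect to the generator \<open>\<xi>\<^sub>a\<close>.\<close>

definition gderiv :: "'i::linorder \<Rightarrow> 'i grass \<Rightarrow> 'i grass" where
  "gderiv a f = Grass (\<lambda>T. if a \<in> T then 0 else (-1) ^ card {t \<in> T. t < a} * gcoeff f (insert a T))"


section \<open>Superdomains\<close>

text \<open>
  Coordinates of a superdomain are indexed by two disjoint sets \<open>E\<close> (even coordinates) and \<open>N\<close> (odd
  coordinates) of a finite ordered index type \<open>'i\<close>; indices outside \<open>E \<union> N\<close> are not used.  The body is a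
  relatively open subset of \<open>evspace E\<close>, a copy of the Euclidean space with coordinates \<open>E\<close>.
  Either of the two sets may be empty.
\<close>

definition evspace :: "'i set \<Rightarrow> (real ^ 'i::finite) set" where
  "evspace E = {x. \<forall>a. a \<notin> E \<longrightarrow> x $ a = 0}"

abbreviation ev_open :: "'i set \<Rightarrow> (real ^ 'i::finite) set \<Rightarrow> bool" where
  "ev_open E U \<equiv> openin (top_of_set (evspace E)) U"

definition pd :: "'i \<Rightarrow> (real ^ 'i::finite \<Rightarrow> real) \<Rightarrow> real ^ 'i \<Rightarrow> real" where
  "pd a g x = deriv (\<lambda>t. g (x + t *\<^sub>R axis a 1)) 0"

definition Cinf :: "'i set \<Rightarrow> (real ^ 'i::finite) set \<Rightarrow> (real ^ 'i \<Rightarrow> real) \<Rightarrow> bool" where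
  "Cinf E U g \<longleftrightarrow> (\<forall>as. set as \<subseteq> E \<longrightarrow> foldr pd as g differentiable_on U)"

type_synonym 'i sfun = "real ^ 'i \<Rightarrow> 'i grass"

text \<open>Superfunctions on the superdomain with body \<open>U\<close>: elements of \<open>C\<^sup>\<infinity>(U) \<otimes> \<Lambda>[\<xi>\<^sub>a | a \<in> N]\<close>.\<close>

definition superfun :: "'i set \<Rightarrow> 'i set \<Rightarrow> (real ^ 'i::finite) set \<Rightarrow> 'i sfun \<Rightarrow> bool" where
  "superfun E N U f \<longleftrightarrow>
     (\<forall>x\<in>U. \<forall>S. \<not> S \<subseteq> N \<longrightarrow> gcoeff (f x) S = 0) \<and> (\<forall>S. Cinf E U (\<lambda>x. gcoeff (f x) S))"

definition parity_on :: "(real ^ 'i::finite) set \<Rightarrow> nat \<Rightarrow> 'i sfun \<Rightarrow> bool" where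
  "parity_on U k f \<longleftrightarrow> (\<forall>x\<in>U. gpart k (f x) = f x)"

definition coord :: "'i set \<Rightarrow> 'i \<Rightarrow> 'i::{finite,linorder} sfun" where
  "coord E a = (\<lambda>x. if a \<in> E then of_real (x $ a) else ggen a)"

text \<open>Partial derivatives; left derivatives for odd coordinates.\<close>

definition spd :: "'i set \<Rightarrow> 'i \<Rightarrow> 'i::{finite,linorder} sfun \<Rightarrow> 'i sfun" where
  "spd E a f = (\<lambda>x. if a \<in> E then Grass (\<lambda>S. pd a (\<lambda>y. gcoeff (f y) S) x) else gderiv a (f x))"

subsection \<open>Substitution\<close>

definition body :: "'i set \<Rightarrow> ('i \<Rightarrow> 'i sfun) \<Rightarrow> real ^ 'i::finite \<Rightarrow> real ^ 'i" where
  "body E \<phi> x = (\<chi> a. if a \<in> E then gcoeff (\<phi> a x) {} else 0)"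

definition mpd :: "('i \<Rightarrow> nat) \<Rightarrow> ((real, 'i) vec \<Rightarrow> real) \<Rightarrow> (real, 'i::{finite,linorder}) vec \<Rightarrow> real" where
  "mpd \<alpha> g = foldr (\<lambda>a. pd a ^^ \<alpha> a) (sorted_list_of_set UNIV) g"

text \<open>
  \<open>pullback E N \<phi> f\<close> is the superfunction obtained from \<open>f\<close> by substituting \<open>\<phi> a\<close> for the coordinate with
  index \<open>a\<close>.  Smooth functions of the even coordinates are evaluated by Taylor expansion at the body;
  the nilpotent part of an even element has vanishing powers beyond \<open>CARD('i)\<close>, so that the expansion is
  finite and exact.
\<close>

definition pullback :: "'i set \<Rightarrow> 'i set \<Rightarrow> ('i \<Rightarrow> 'i sfun) \<Rightarrow> 'i sfun \<Rightarrow> 'i::{finite,linorder} sfun" where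
  "pullback E N \<phi> f = (\<lambda>x. \<Sum>S\<in>Pow N. \<Sum>\<alpha>\<in>{\<alpha>. \<forall>a. \<alpha> a \<le> (if a \<in> E then CARD('i) else 0)}.
     (mpd \<alpha> (\<lambda>y. gcoeff (f y) S) (body E \<phi> x) / (\<Prod>a\<in>E. fact (\<alpha> a))) *\<^sub>R
       (prod_list (map (\<lambda>a. (\<phi> a x - of_real (gcoeff (\<phi> a x) {})) ^ \<alpha> a) (sorted_list_of_set E))
        * prod_list (map (\<lambda>s. \<phi> s x) (sorted_list_of_set S))))"

subsection \<open>Weights\<close>

text \<open>
  \<open>weights_in E w K U g\<close>: on \<open>U\<close> the function \<open>g\<close> is polynomial in the even coordinates of nonzero
  weight, with coefficients smooth in the even coordinates of weight zero, and all its monomials have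
  weights in \<open>K\<close>.
\<close>

definition weights_in ::
    "'i set \<Rightarrow> ('i \<Rightarrow> int) \<Rightarrow> int set \<Rightarrow> (real ^ 'i::finite) set \<Rightarrow> (real ^ 'i \<Rightarrow> real) \<Rightarrow> bool" where
  "weights_in E w K U g \<longleftrightarrow> (\<exists>F c. finite F \<and>
     (\<forall>\<alpha>\<in>F. {a. \<alpha> a \<noteq> 0} \<subseteq> {a \<in> E. w a \<noteq> 0} \<and> (\<Sum>a\<in>E. int (\<alpha> a) * w a) \<in> K \<and> Cinf E U (c \<alpha>) \<and>
        (\<forall>x\<in>U. \<forall>y\<in>U. (\<forall>a\<in>E. w a = 0 \<longrightarrow> x $ a = y $ a) \<longrightarrow> c \<alpha> x = c \<alpha> y)) \<and>
     (\<forall>x\<in>U. g x = (\<Sum>\<alpha>\<in>F. c \<alpha> x * (\<Prod>a\<in>E. (x $ a) ^ \<alpha> a))))"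

definition superfun_weights ::
    "'i set \<Rightarrow> 'i set \<Rightarrow> ('i \<Rightarrow> int) \<Rightarrow> int set \<Rightarrow> (real ^ 'i::finite) set \<Rightarrow> 'i sfun \<Rightarrow> bool" where
  "superfun_weights E N w K U f \<longleftrightarrow> superfun E N U f \<and>
     (\<forall>S\<subseteq>N. weights_in E w {k. k + (\<Sum>a\<in>S. w a) \<in> K} U (\<lambda>x. gcoeff (f x) S))"


section \<open>Graded manifolds\<close>

text \<open>
  A supermanifold is given by an atlas: for every chart \<open>i\<close> the body \<open>cdom i\<close> of a superdomain, for all charts
  \<open>i\<close>, \<open>j\<close> the part \<open>overlap i j\<close> of \<open>cdom i\<close> that lies in the chart \<open>j\<close> as well, and on it the coordinate
  changes: \<open>trans i j b\<close> is the coordinate \<open>b\<close> of the chart \<open>j\<close> as a function of the coordinates of the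
  chart \<open>i\<close>.  Finally \<open>weight i a\<close> is the weight of the coordinate \<open>a\<close> of the chart \<open>i\<close>.
  The points of the manifold are the points of the sets \<open>cdom i\<close>, glued along the bodies of the coordinate
  changes.
\<close>

record ('c, 'i) atlas =
  evens :: "'i set"
  odds :: "'i set"
  charts :: "'c set"
  cdom :: "'c \<Rightarrow> (real ^ 'i) set"
  overlap :: "'c \<Rightarrow> 'c \<Rightarrow> (real ^ 'i) set"
  trans :: "'c \<Rightarrow> 'c \<Rightarrow> 'i \<Rightarrow> 'i sfun"
  weight :: "'c \<Rightarrow> 'i \<Rightarrow> int"

abbreviation coords :: "('c, 'i::finite) atlas \<Rightarrow> 'i set" where
  "coords M \<equiv> evens M \<union> odds M"

definition cpar :: "('c, 'i::finite) atlas \<Rightarrow> 'i \<Rightarrow> nat" where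
  "cpar M a = (if a \<in> odds M then 1 else 0)"

abbreviation cbody :: "('c, 'i::finite) atlas \<Rightarrow> 'c \<Rightarrow> 'c \<Rightarrow> real ^ 'i \<Rightarrow> real ^ 'i" where
  "cbody M i j \<equiv> body (evens M) (trans M i j)"

abbreviation cpull :: "('c, 'i) atlas \<Rightarrow> 'c \<Rightarrow> 'c \<Rightarrow> 'i sfun \<Rightarrow> 'i::{finite,linorder} sfun" where
  "cpull M i j \<equiv> pullback (evens M) (odds M) (trans M i j)"

abbreviation partial :: "('c, 'i) atlas \<Rightarrow> 'i \<Rightarrow> 'i sfun \<Rightarrow> 'i::{finite,linorder} sfun" where
  "partial M \<equiv> spd (evens M)"

text \<open>Hausdorff property and second countability of the glued space, in terms of the charts.\<close>

definition hausdorff_atlas :: "('c, 'i::finite) atlas \<Rightarrow> bool" where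
  "hausdorff_atlas M \<longleftrightarrow> (\<forall>i\<in>charts M. \<forall>j\<in>charts M. \<forall>x\<in>cdom M i. \<forall>y\<in>cdom M j.
     \<not> (x \<in> overlap M i j \<and> cbody M i j x = y) \<longrightarrow>
     (\<exists>A B. ev_open (evens M) A \<and> ev_open (evens M) B \<and> x \<in> A \<and> y \<in> B \<and>
        (\<forall>u\<in>A \<inter> overlap M i j. cbody M i j u \<notin> B)))"

definition second_countable_atlas :: "('c, 'i::finite) atlas \<Rightarrow> bool" where
  "second_countable_atlas M \<longleftrightarrow> (\<exists>C\<subseteq>charts M. countable C \<and>
     (\<forall>i\<in>charts M. cdom M i \<subseteq> (\<Union>j\<in>C. overlap M i j)))"

definition supermanifold :: "('c, 'i::{finite,linorder}) atlas \<Rightarrow> bool" where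
  "supermanifold M \<longleftrightarrow> evens M \<inter> odds M = {} \<and>
     (\<forall>i\<in>charts M. ev_open (evens M) (cdom M i) \<and> overlap M i i = cdom M i \<and>
        (\<forall>a\<in>coords M. \<forall>x\<in>cdom M i. trans M i i a x = coord (evens M) a x)) \<and>
     (\<forall>i\<in>charts M. \<forall>j\<in>charts M.
        ev_open (evens M) (overlap M i j) \<and> overlap M i j \<subseteq> cdom M i \<and>
        cbody M i j ` overlap M i j \<subseteq> overlap M j i \<and>
        (\<forall>b\<in>coords M. superfun (evens M) (odds M) (overlap M i j) (trans M i j b) \<and>
           parity_on (overlap M i j) (cpar M b) (trans M i j b))) \<and>
     (\<forall>i\<in>charts M. \<forall>j\<in>charts M. \<forall>k\<in>charts M. \<forall>x\<in>overlap M i j. cbody M i j x \<in> overlap M j k \<longrightarrow>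
        x \<in> overlap M i k \<and>
        (\<forall>c\<in>coords M. trans M i k c x = cpull M i j (trans M j k c) x)) \<and>
     hausdorff_atlas M \<and> second_countable_atlas M"

text \<open>\<open>jac M i j a b\<close> is the derivative of the coordinate \<open>a\<close> of the chart \<open>i\<close> along the coordinate \<open>b\<close>
  of the chart \<open>j\<close>, as a function of the coordinates of the chart \<open>i\<close>.\<close>

definition jac :: "('c, 'i) atlas \<Rightarrow> 'c \<Rightarrow> 'c \<Rightarrow> 'i \<Rightarrow> 'i \<Rightarrow> 'i::{finite,linorder} sfun" where
  "jac M i j a b = cpull M i j (partial M b (trans M j i a))"

abbreviation weighted :: "('c, 'i) atlas \<Rightarrow> 'c \<Rightarrow> int set \<Rightarrow> (real ^ 'i) set \<Rightarrow> 'i::finite sfun \<Rightarrow> bool" where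
  "weighted M i \<equiv> superfun_weights (evens M) (odds M) (weight M i)"

text \<open>
  In a graded manifold the coordinate changes respect the weights: in every chart \<open>i\<close> the coordinates \<open>y\<^sup>b\<close>
  of another chart are polynomial in the coordinates of nonzero weight and homogeneous of weight
  \<open>weight j b\<close>, and the coordinate vector fields \<open>\<partial>/\<partial>y\<^sup>b = \<Sum>\<^sub>a (\<partial>x\<^sup>a/\<partial>y\<^sup>b) \<partial>/\<partial>x\<^sup>a\<close>, written
  in the chart \<open>i\<close>, have coefficients polynomial in the coordinates of nonzero weight and are homogeneous
  of weight \<open>- weight j b\<close>.  The polynomiality of the latter is not automatic: the coefficients are
  obtained by substituting the coordinate change \<open>y(x)\<close> into the derivatives of its inverse, and a weight
  zero coordinate \<open>y\<^sup>b\<close> may contain products of coordinates \<open>x\<^sup>a\<close> of opposite weights.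
\<close>

definition graded_manifold :: "('c, 'i::{finite,linorder}) atlas \<Rightarrow> bool" where
  "graded_manifold M \<longleftrightarrow> supermanifold M \<and>
     (\<forall>i\<in>charts M. \<forall>j\<in>charts M. \<forall>b\<in>coords M.
        weighted M i {weight M j b} (overlap M i j) (trans M i j b) \<and>
        (\<forall>a\<in>coords M. weighted M i {weight M i a - weight M j b} (overlap M i j) (jac M i j a b)))"

text \<open>Functions in a chart: smooth, and polynomial in the coordinates of nonzero weight.\<close>

definition chart_fun :: "('c, 'i) atlas \<Rightarrow> 'c \<Rightarrow> 'i::finite sfun \<Rightarrow> bool" where
  "chart_fun M i f \<longleftrightarrow> weighted M i UNIV (cdom M i) f"

definition function_on :: "('c, 'i) atlas \<Rightarrow> ('c \<Rightarrow> 'i::{finite,linorder} sfun) \<Rightarrow> bool" where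
  "function_on M f \<longleftrightarrow> (\<forall>i\<in>charts M. chart_fun M i (f i)) \<and>
     (\<forall>i\<in>charts M. \<forall>j\<in>charts M. \<forall>x\<in>overlap M i j. f i x = cpull M i j (f j) x)"

definition function_parity :: "('c, 'i) atlas \<Rightarrow> ('c \<Rightarrow> 'i::finite sfun) \<Rightarrow> nat \<Rightarrow> bool" where
  "function_parity M f k \<longleftrightarrow> (\<forall>i\<in>charts M. parity_on (cdom M i) k (f i))"

definition function_weight :: "('c, 'i) atlas \<Rightarrow> ('c \<Rightarrow> 'i::finite sfun) \<Rightarrow> int \<Rightarrow> bool" where
  "function_weight M f k \<longleftrightarrow> (\<forall>i\<in>charts M. weighted M i {k} (cdom M i) (f i))"


section \<open>Vector fields\<close>

text \<open>A vector field is given by its components \<open>X i a\<close> in the charts; \<open>vf_app\<close> is its action on functions.\<close>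

definition vf_app :: "('c, 'i) atlas \<Rightarrow> ('i \<Rightarrow> 'i sfun) \<Rightarrow> 'i sfun \<Rightarrow> 'i::{finite,linorder} sfun" where
  "vf_app M X f = (\<lambda>x. \<Sum>a\<in>coords M. X a x * partial M a f x)"

definition vector_field :: "('c, 'i) atlas \<Rightarrow> ('c \<Rightarrow> 'i \<Rightarrow> 'i::{finite,linorder} sfun) \<Rightarrow> bool" where
  "vector_field M X \<longleftrightarrow> (\<forall>i\<in>charts M. \<forall>a\<in>coords M. chart_fun M i (X i a)) \<and>
     (\<forall>i\<in>charts M. \<forall>j\<in>charts M. \<forall>b\<in>coords M. \<forall>x\<in>overlap M i j.
        cpull M i j (X j b) x = vf_app M (X i) (trans M i j b) x)"

definition vf_parity :: "('c, 'i) atlas \<Rightarrow> ('c \<Rightarrow> 'i \<Rightarrow> 'i::finite sfun) \<Rightarrow> nat \<Rightarrow> bool" where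
  "vf_parity M X k \<longleftrightarrow>
     (\<forall>i\<in>charts M. \<forall>a\<in>coords M. parity_on (cdom M i) (cpar M a + k) (X i a))"

definition vf_weight :: "('c, 'i) atlas \<Rightarrow> ('c \<Rightarrow> 'i \<Rightarrow> 'i::finite sfun) \<Rightarrow> int \<Rightarrow> bool" where
  "vf_weight M X k \<longleftrightarrow>
     (\<forall>i\<in>charts M. \<forall>a\<in>coords M. weighted M i {k + weight M i a} (cdom M i) (X i a))"

definition homological :: "('c, 'i) atlas \<Rightarrow> ('c \<Rightarrow> 'i \<Rightarrow> 'i::{finite,linorder} sfun) \<Rightarrow> bool" where
  "homological M X \<longleftrightarrow> vector_field M X \<and> vf_parity M X 1 \<and>
     (\<forall>i\<in>charts M. \<forall>f. chart_fun M i f \<longrightarrow>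
        (\<forall>x\<in>cdom M i. vf_app M (X i) (vf_app M (X i) f) x = 0))"

definition graded_Q_manifold :: "('c, 'i) atlas \<Rightarrow> ('c \<Rightarrow> 'i \<Rightarrow> 'i::{finite,linorder} sfun) \<Rightarrow> bool" where
  "graded_Q_manifold M X \<longleftrightarrow> graded_manifold M \<and> homological M X"


section \<open>The anticotangent bundle\<close>

text \<open>\<open>Base a\<close> is the index of the coordinate \<open>x\<^sup>a\<close>, \<open>Anti a\<close> the index of the momentum \<open>x\<^sup>*\<^sub>a\<close>.\<close>

datatype 'i tcoord = Base 'i | Anti 'i

instance tcoord :: (finite) finite
proof
  have "x \<in> range Base \<union> range Anti" for x :: "'a tcoord"
    by (cases x) auto
  then show "finite (UNIV :: 'a tcoord set)"
    by (intro finite_subset[of UNIV "range Base \<union> range Anti"]) auto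
qed

instantiation tcoord :: (linorder) linorder
begin
fun less_eq_tcoord :: "'a tcoord \<Rightarrow> 'a tcoord \<Rightarrow> bool" where
  "less_eq_tcoord (Base a) (Base b) = (a \<le> b)"
| "less_eq_tcoord (Base a) (Anti b) = True"
| "less_eq_tcoord (Anti a) (Base b) = False"
| "less_eq_tcoord (Anti a) (Anti b) = (a \<le> b)"
definition less_tcoord :: "'a tcoord \<Rightarrow> 'a tcoord \<Rightarrow> bool" where
  "less_tcoord x y \<longleftrightarrow> x \<le> y \<and> \<not> y \<le> x"
instance
proof
  fix x y z :: "'a tcoord"
  show "x < y \<longleftrightarrow> x \<le> y \<and> \<not> y \<le> x" by (simp add: less_tcoord_def)
  show "x \<le> x" by (cases x) auto
  show "x \<le> y \<Longrightarrow> y \<le> z \<Longrightarrow> x \<le> z" by (cases x; cases y; cases z) auto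
  show "x \<le> y \<Longrightarrow> y \<le> x \<Longrightarrow> x = y" by (cases x; cases y) auto
  show "x \<le> y \<or> y \<le> x" by (cases x; cases y) auto
qed
end

definition tproj :: "real ^ 'i tcoord \<Rightarrow> real ^ 'i::finite" where
  "tproj X = (\<chi> a. X $ Base a)"

definition tzero :: "real ^ 'i::finite \<Rightarrow> real ^ 'i tcoord" where
  "tzero x = (\<chi> z. case z of Base a \<Rightarrow> x $ a | Anti a \<Rightarrow> 0)"

text \<open>Pullback of functions along the bundle projection, and restriction to the zero section.\<close>

definition lift_fun :: "'i::finite sfun \<Rightarrow> 'i tcoord sfun" where
  "lift_fun f = (\<lambda>X. Grass (\<lambda>S. if S \<subseteq> range Base then gcoeff (f (tproj X)) (Base -` S) else 0))"

definition zero_sec :: "'i tcoord sfun \<Rightarrow> 'i::finite sfun" where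
  "zero_sec h = (\<lambda>x. Grass (\<lambda>S. gcoeff (h (tzero x)) (Base ` S)))"

text \<open>
  The anticotangent bundle with the induced weight.  The momenta transform like the coordinate vector fields:
  \<open>y\<^sup>*\<^sub>b = \<Sum>\<^sub>a (\<partial>x\<^sup>a/\<partial>y\<^sup>b) x\<^sup>*\<^sub>a\<close>.
\<close>

definition anticotangent :: "('c, 'i::{finite,linorder}) atlas \<Rightarrow> ('c, 'i tcoord) atlas" where
  "anticotangent M = (let E = Base ` evens M \<union> Anti ` odds M in \<lparr>
     evens = E,
     odds = Base ` odds M \<union> Anti ` evens M,
     charts = charts M,
     cdom = (\<lambda>i. {X \<in> evspace E. tproj X \<in> cdom M i}),
     overlap = (\<lambda>i j. {X \<in> evspace E. tproj X \<in> overlap M i j}),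
     trans = (\<lambda>i j z. case z of
         Base b \<Rightarrow> lift_fun (trans M i j b)
       | Anti b \<Rightarrow> (\<lambda>X. \<Sum>a\<in>coords M. lift_fun (jac M i j a b) X * coord E (Anti a) X)),
     weight = (\<lambda>i z. case z of Base a \<Rightarrow> weight M i a | Anti a \<Rightarrow> - weight M i a) \<rparr>)"

fun fibre_degree :: "'i tcoord \<Rightarrow> int" where
  "fibre_degree (Base a) = 0"
| "fibre_degree (Anti a) = 1"

text \<open>The anticotangent bundle with the weight \<open>w + r d\<close>.\<close>

definition anticotangent_wt :: "('c, 'i::{finite,linorder}) atlas \<Rightarrow> int \<Rightarrow> ('c, 'i tcoord) atlas" where
  "anticotangent_wt M r =
     (anticotangent M)\<lparr>weight := \<lambda>i z. weight (anticotangent M) i z + r * fibre_degree z\<rparr>"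

abbreviation tcoord_fun :: "('c, 'i) atlas \<Rightarrow> 'i tcoord \<Rightarrow> 'i::{finite,linorder} tcoord sfun" where
  "tcoord_fun M \<equiv> coord (evens (anticotangent M))"

text \<open>
  The canonical Schouten bracket in a chart.  The defining formula is for \<open>f\<close> of definite parity; it is applied
  to the components of \<open>f\<close> of parity \<open>k = 0, 1\<close>.
\<close>

definition schouten :: "('c, 'i) atlas \<Rightarrow> 'i tcoord sfun \<Rightarrow> 'i tcoord sfun \<Rightarrow> 'i::{finite,linorder} tcoord sfun" where
  "schouten M f g = (\<lambda>X. \<Sum>k\<in>{0, 1}. \<Sum>a\<in>coords M.
       (-1) ^ ((cpar M a + 1) * (k + 1)) * partial (anticotangent M) (Anti a) (\<lambda>Y. gpart k (f Y)) X
          * partial (anticotangent M) (Base a) g X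
     - (-1) ^ (cpar M a * (k + 1)) * partial (anticotangent M) (Base a) (\<lambda>Y. gpart k (f Y)) X
          * partial (anticotangent M) (Anti a) g X)"

text \<open>The vector field \<open>X\<^sub>f = {f, _}\<close> on the anticotangent bundle, by its components \<open>{f, z}\<close> at the coordinates \<open>z\<close>.\<close>

definition ham :: "('c, 'i) atlas \<Rightarrow> ('c \<Rightarrow> 'i tcoord sfun) \<Rightarrow> 'c \<Rightarrow> 'i tcoord \<Rightarrow> 'i::{finite,linorder} tcoord sfun" where
  "ham M f i z = schouten M (f i) (tcoord_fun M z)"

text \<open>The components determine the field: \<open>X\<^sub>f g = {f, g}\<close>.\<close>

lemma spd_coord:
  "spd E z (coord E z') X = (if z = z' then 1 else 0)"
proof (rule grass_eqI)
  fix S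
  have c: "gcoeff (of_real r :: 'a grass) S = (if S = {} then r else 0)" for r S
    unfolding of_real_def by transfer simp
  have g: "gcoeff (0::'a grass) S = 0" "gcoeff (1::'a grass) S = (if S = {} then 1 else 0)" for S
    by (transfer, simp)+
  show "gcoeff (spd E z (coord E z') X) S = gcoeff (if z = z' then 1 else 0) S"
  proof (cases "z \<in> E \<and> z' \<in> E")
    case True
    have "((\<lambda>t. (X + t *\<^sub>R axis z 1) $ z') has_real_derivative (if z = z' then 1 else 0)) (at 0)"
      by (auto simp: axis_def intro!: derivative_eq_intros)
    then have e: "deriv (\<lambda>t. (X + t *\<^sub>R axis z 1) $ z') 0 = (if z = z' then 1 else 0)"
      by (rule DERIV_imp_deriv)
    have "gcoeff (spd E z (coord E z') X) S
        = (if S = {} then deriv (\<lambda>t. (X + t *\<^sub>R axis z 1) $ z') 0 else 0)"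
      using True by (cases "S = {}")
        (simp_all add: spd_def coord_def pd_def c Grass_inverse del: of_real_add vector_add_component)
    then show ?thesis using e by (simp add: g)
  next
    case False
    then show ?thesis
      by (auto simp: spd_def coord_def pd_def c g Grass_inverse gderiv_def ggen_def
               split: if_splits)
  qed
qed

lemma schouten_eq_ham:
  "schouten M (f i) g = vf_app (anticotangent M) (ham M f i) g"
proof
  fix X
  let ?T = "anticotangent M"
  let ?A = "\<lambda>a k. (-1) ^ ((cpar M a + 1) * (k + 1)) * partial ?T (Anti a) (\<lambda>Y. gpart k (f i Y)) X"
  let ?B = "\<lambda>a k. (-1) ^ (cpar M a * (k + 1)) * partial ?T (Base a) (\<lambda>Y. gpart k (f i Y)) X"
  have co: "coords ?T = Base ` coords M \<union> Anti ` coords M"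
    by (auto simp: anticotangent_def Let_def)
  have d: "u * (if c then 1 else 0) = (if c then u else 0)" for u :: "'a tcoord grass" and c
    by simp
  have hB: "ham M f i (Base a) X = (\<Sum>k\<in>{0,1}. ?A a k)" if "a \<in> coords M" for a
  proof -
    have "ham M f i (Base a) X
        = (\<Sum>k\<in>{0,1}. \<Sum>b\<in>coords M. ?A b k * (if b = a then 1 else 0))"
      by (simp only: ham_def schouten_def spd_coord tcoord.inject tcoord.distinct if_False
          mult_zero_right diff_zero)
    also have "\<dots> = (\<Sum>k\<in>{0,1}. ?A a k)"
      using that by (simp only: d sum.delta finite if_True)
    finally show ?thesis .
  qed
  have hA: "ham M f i (Anti a) X = - (\<Sum>k\<in>{0,1}. ?B a k)" if "a \<in> coords M" for a
  proof -
    have "ham M f i (Anti a) X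
        = (\<Sum>k\<in>{0,1}. \<Sum>b\<in>coords M. - (?B b k * (if b = a then 1 else 0)))"
      by (simp only: ham_def schouten_def spd_coord tcoord.inject tcoord.distinct if_False
          mult_zero_right diff_0)
    also have "\<dots> = - (\<Sum>k\<in>{0,1}. ?B a k)"
      using that by (simp only: d sum_negf sum.delta finite if_True)
    finally show ?thesis .
  qed
  have "vf_app ?T (ham M f i) g X
      = (\<Sum>a\<in>coords M. ham M f i (Base a) X * partial ?T (Base a) g X)
      + (\<Sum>a\<in>coords M. ham M f i (Anti a) X * partial ?T (Anti a) g X)"
    unfolding vf_app_def co
    by (subst sum.union_disjoint) (auto simp: sum.reindex inj_on_def)
  also have "\<dots> = (\<Sum>a\<in>coords M. (\<Sum>k\<in>{0,1}. ?A a k) * partial ?T (Base a) g X)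
      + (\<Sum>a\<in>coords M. - (\<Sum>k\<in>{0,1}. ?B a k) * partial ?T (Anti a) g X)"
    by (simp only: hA hB cong: sum.cong)
  also have "\<dots> = schouten M (f i) g X"
    unfolding schouten_def by (simp add: sum.distrib sum_subtractf algebra_simps sum_negf)
  finally show "schouten M (f i) g X = vf_app ?T (ham M f i) g X" by simp
qed

text \<open>\<open>\<theta>(X) = (-1)^k X\<^sup>a x\<^sup>*\<^sub>a\<close> for a vector field \<open>X\<close> of parity \<open>k\<close>.\<close>

definition theta :: "('c, 'i) atlas \<Rightarrow> nat \<Rightarrow> ('c \<Rightarrow> 'i \<Rightarrow> 'i sfun) \<Rightarrow> 'c \<Rightarrow> 'i::{finite,linorder} tcoord sfun" where
  "theta M k X i = (\<lambda>Y. (-1) ^ k * (\<Sum>a\<in>coords M. lift_fun (X i a) Y * tcoord_fun M (Anti a) Y))"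


section \<open>Graded QP-manifolds\<close>

definition even_bivector :: "('c, 'i) atlas \<Rightarrow> ('c \<Rightarrow> 'i::{finite,linorder} tcoord sfun) \<Rightarrow> bool" where
  "even_bivector M P \<longleftrightarrow> function_on (anticotangent M) P \<and> function_parity (anticotangent M) P 0 \<and>
     (\<forall>i\<in>charts M. \<exists>c. (\<forall>a\<in>coords M. \<forall>b\<in>coords M. chart_fun M i (c a b)) \<and>
        (\<forall>Y\<in>cdom (anticotangent M) i. P i Y = (1/2) *\<^sub>R (\<Sum>a\<in>coords M. \<Sum>b\<in>coords M.
           lift_fun (c a b) Y * tcoord_fun M (Anti b) Y * tcoord_fun M (Anti a) Y)))"

definition poisson_bivector :: "('c, 'i) atlas \<Rightarrow> ('c \<Rightarrow> 'i::{finite,linorder} tcoord sfun) \<Rightarrow> bool" where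
  "poisson_bivector M P \<longleftrightarrow> even_bivector M P \<and>
     (\<forall>i\<in>charts M. \<forall>Y\<in>cdom (anticotangent M) i. schouten M (P i) (P i) Y = 0)"

text \<open>
  The derived bracket \<open>{f, {P, g}}\<close> of functions \<open>f\<close>, \<open>g\<close> on the base does not depend on the momenta when
  \<open>P\<close> is a bivector; restricting it to the zero section gives it as a function on the base.
\<close>

definition poisson_bracket :: "('c, 'i) atlas \<Rightarrow> 'i tcoord sfun \<Rightarrow> 'i sfun \<Rightarrow> 'i sfun \<Rightarrow> 'i::{finite,linorder} sfun" where
  "poisson_bracket M P f g = zero_sec (schouten M (lift_fun f) (schouten M P (lift_fun g)))"

text \<open>\<open>X\<close> is a derivation, of parity \<open>n\<close>, of the Poisson bracket.\<close>

definition bracket_derivation ::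
    "('c, 'i) atlas \<Rightarrow> nat \<Rightarrow> ('c \<Rightarrow> 'i \<Rightarrow> 'i sfun) \<Rightarrow> ('c \<Rightarrow> 'i::{finite,linorder} tcoord sfun) \<Rightarrow> bool" where
  "bracket_derivation M n X P \<longleftrightarrow>
     (\<forall>i\<in>charts M. \<forall>k f g. chart_fun M i f \<and> parity_on (cdom M i) k f \<and> chart_fun M i g \<longrightarrow>
        (\<forall>x\<in>cdom M i. vf_app M (X i) (poisson_bracket M (P i) f g) x
           = poisson_bracket M (P i) (vf_app M (X i) f) g x
             + (-1) ^ (n * k) * poisson_bracket M (P i) f (vf_app M (X i) g) x))"

definition graded_QP_manifold ::
    "('c, 'i) atlas \<Rightarrow> ('c \<Rightarrow> 'i \<Rightarrow> 'i sfun) \<Rightarrow> ('c \<Rightarrow> 'i::{finite,linorder} tcoord sfun) \<Rightarrow> bool" where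
  "graded_QP_manifold M Q P \<longleftrightarrow>
     graded_Q_manifold M Q \<and> poisson_bivector M P \<and> bracket_derivation M 1 Q P"

text \<open>The vector field \<open>X\<^bsub>Q'\<^esub> + \<lambda> X\<^sub>P\<close> with \<open>Q' = \<theta>(Q)\<close>.\<close>

definition QD ::
    "('c, 'i) atlas \<Rightarrow> ('c \<Rightarrow> 'i \<Rightarrow> 'i sfun) \<Rightarrow> ('c \<Rightarrow> 'i tcoord sfun) \<Rightarrow> real \<Rightarrow>
     'c \<Rightarrow> 'i tcoord \<Rightarrow> 'i::{finite,linorder} tcoord sfun" where
  "QD M Q P lam i z = (\<lambda>Y. ham M (theta M 1 Q) i z Y + lam *\<^sub>R ham M P i z Y)"

end

(* The pullback of a superfunction along a morphism only sees a finite jet of the function at the body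
   point. By Taylor's formula a superfunction is a polynomial in the coordinates plus a remainder that is
   flat to any prescribed order at a given point, so multiplicativity, the chain rule and functoriality of
   the pullback reduce to polynomials, where they can be checked by induction. The chain rule yields the
   cocycle and inverse identities for the Jacobians, hence the gluing of the anticotangent bundle.

   In a chart, Q_D is the Hamiltonian vector field X_H of the even function H = Q' + lam P. Differentiating
   {H, H} gives X_H (dH/dz) = (+-) 1/2 d{H, H}/dz, so {H, H} = 0 forces X_H to annihilate the components of X_H,
   i.e. X_H^2 = 0. The three parts of {H, H} vanish separately: {Q', Q'} because Q^2 = 0, {P, P} by the
   Poisson condition, and {Q', P} because, P being quadratic in the momenta, it is determined by
   its second momentum derivatives h_ab, for which the derivation property on pairs of coordinates is the
   required identity. H is globally defined and coordinate changes are canonical transformations, so X_H is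
   a vector field. Finally H has total weight 2q - p, and w(x^a) + w(x^*_a) = q - p, so X_H has weight q. *)

theory Submission
  imports Defs
begin

section \<open>Sign rules and parities in a Grassmann algebra\<close>

section \<open>Grassmann algebra\<close>

text \<open>The shift \<open>q - p\<close> is chosen so that both parts of the Hamiltonian get the
  same weight. A momentum then weighs q - p - w_a; hence Q' weighs (q + w_a) + (q - p - w_a), and P,
  whose coefficients weigh p + w_a + w_b, weighs p + 2(q - p).

  On the analytic side the obstacle is that \<open>pullback\<close> is an explicit truncated Taylor
  sum, so none of its algebraic properties holds by construction. The one product that can be
  evaluated directly in this sum is multiplication by a single coordinate; everything else is drawn
  from it.

  Statements about P therefore pass through its second momentum derivatives, which are determined by
  P, and the Euler field of the fibres rebuilds P from them.

  All derivatives are left derivatives, so the order of factors matters throughout. Sign identities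
  are closed by splitting on the parities involved.\<close>

lemma gcoeff_zero [simp]: "gcoeff 0 S = 0"
  by transfer simp

lemma gcoeff_one: "gcoeff (1 :: 'i::{finite,linorder} grass) S = (if S = {} then 1 else 0)"
  by transfer simp

lemma gcoeff_add [simp]: "gcoeff (f + g) S = gcoeff f S + gcoeff g S"
  by transfer simp

lemma gcoeff_diff [simp]: "gcoeff (f - g) S = gcoeff f S - gcoeff g S"
  by transfer simp

lemma gcoeff_uminus [simp]: "gcoeff (- f) S = - gcoeff f S"
  by transfer simp

lemma gcoeff_scaleR [simp]: "gcoeff (r *\<^sub>R f) S = r * gcoeff f S"
  by transfer simp

lemma gcoeff_mult:
  "gcoeff (f * g) S = (\<Sum>T\<in>Pow S. (-1) ^ ginv T (S - T) * gcoeff f T * gcoeff g (S - T))"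
  by transfer simp

lemma gcoeff_of_real:
  "gcoeff (of_real r :: 'i::{finite,linorder} grass) S = (if S = {} then r else 0)"
  by (simp add: of_real_def gcoeff_one)

lemma gcoeff_sum [simp]: "gcoeff (sum f A) S = (\<Sum>a\<in>A. gcoeff (f a) S)"
  by (induction A rule: infinite_finite_induct) auto

lemma gcoeff_Grass [simp]: "gcoeff (Grass f) = f"
  by (simp add: Grass_inverse)

lemma gcoeff_ggen: "gcoeff (ggen a) S = (if S = {a} then 1 else 0)"
  by (simp add: ggen_def)

lemma gcoeff_gpart: "gcoeff (gpart k f) S = (if card S mod 2 = k mod 2 then gcoeff f S else 0)"
  by (simp add: gpart_def)

lemma minus_one_power_sum_even: "even (m + n) \<Longrightarrow> (-1 :: 'a::ring_1) ^ m = (-1) ^ n"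
  by (simp add: minus_one_power_iff)

text \<open>Each pair in T \<times> U is inverted in exactly one of the two orders. This count is
  the source of the sign rules for commuting elements.\<close>

lemma ginv_swap:
  fixes T U :: "'i::{finite,linorder} set"
  assumes "T \<inter> U = {}"
  shows "ginv T U + ginv U T = card T * card U"
proof -
  have "ginv T U + ginv U T = (\<Sum>t\<in>T. \<Sum>u\<in>U. (if u < t then 1 else 0) + (if t < u then 1 else 0))"
    unfolding sum.distrib ginv_sum by (subst (3) sum.swap) simp
  also have "\<dots> = (\<Sum>t\<in>T. \<Sum>u\<in>U. 1)"
    using assms by (intro sum.cong refl) (auto simp: not_less_iff_gr_or_eq)
  finally show ?thesis by simp
qed

lemma ginv_single:
  fixes T :: "'i::{finite,linorder} set"
  shows "ginv {a} T = card {t \<in> T. t < a}" "ginv T {a} = card {t \<in> T. a < t}"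
proof -
  show "ginv {a} T = card {t \<in> T. t < a}" by (simp add: ginv_sum sum.If_cases Int_def)
  have "ginv T {a} = (\<Sum>t\<in>T. if a < t then 1 else 0)" unfolding ginv_sum by (intro sum.cong) auto
  then show "ginv T {a} = card {t \<in> T. a < t}" by (simp add: sum.If_cases Int_def)
qed

text \<open>Writes the sign of \<open>gderiv\<close> through \<open>ginv\<close>, so that
  \<open>ginv_Un_left\<close> and \<open>ginv_Un_right\<close> apply to it.\<close>

lemma gcoeff_gderiv:
  fixes f :: "'i::{finite,linorder} grass"
  shows "gcoeff (gderiv a f) T = (if a \<in> T then 0 else (-1) ^ ginv {a} T * gcoeff f (insert a T))"
  by (simp add: gderiv_def ginv_single)

text \<open>Phrased by nonvanishing coefficients, so that 0 has every parity and k matters modulo 2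
  only. Sums of homogeneous terms then need no special treatment of vanishing summands.\<close>

definition gpar :: "nat \<Rightarrow> 'i::finite grass \<Rightarrow> bool" where
  "gpar k f \<longleftrightarrow> (\<forall>S. gcoeff f S \<noteq> 0 \<longrightarrow> even (card S) = even k)"

lemma mod2_eq_iff: "m mod 2 = n mod (2::nat) \<longleftrightarrow> even m = even n"
  by presburger

lemma gpar_iff_gpart: "gpar k f \<longleftrightarrow> gpart k f = f"
proof
  assume "gpar k f" then show "gpart k f = f"
    by (intro grass_eqI) (auto simp: gpar_def gcoeff_gpart mod2_eq_iff)
next
  assume "gpart k f = f"
  then have "gcoeff f S = (if card S mod 2 = k mod 2 then gcoeff f S else 0)" for S
    by (metis gcoeff_gpart)
  then show "gpar k f" unfolding gpar_def mod2_eq_iff by metis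
qed

lemma gpar_cong: "even k = even l \<Longrightarrow> gpar k f \<longleftrightarrow> gpar l f"
  by (simp add: gpar_def)

lemma gpar_zero [simp]: "gpar k 0"
  by (simp add: gpar_def)

lemma gpar_add: "gpar k f \<Longrightarrow> gpar k g \<Longrightarrow> gpar k (f + g)"
  unfolding gpar_def by (metis gcoeff_add add_0)

lemma gpar_uminus: "gpar k f \<Longrightarrow> gpar k (- f)"
  by (simp add: gpar_def)

lemma gpar_diff: "gpar k f \<Longrightarrow> gpar k g \<Longrightarrow> gpar k (f - g)"
  using gpar_add[of k f "- g"] by (simp add: gpar_uminus)

lemma gpar_scaleR: "gpar k f \<Longrightarrow> gpar k (r *\<^sub>R f)"
  by (simp add: gpar_def)

lemma gpar_sum: "(\<And>a. a \<in> A \<Longrightarrow> gpar k (f a)) \<Longrightarrow> gpar k (sum f A)"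
  by (induction A rule: infinite_finite_induct) (auto intro: gpar_add)

lemma gpar_of_real: "gpar 0 (of_real r :: 'i::{finite,linorder} grass)"
  by (simp add: gpar_def gcoeff_of_real)

lemma gpar_one: "gpar 0 (1 :: 'i::{finite,linorder} grass)"
  by (simp add: gpar_def gcoeff_one)

lemma gpar_ggen: "gpar 1 (ggen a)"
  by (simp add: gpar_def gcoeff_ggen)

lemma gpar_mult:
  assumes "gpar k f" "gpar l g" shows "gpar (k + l) (f * g)"
  unfolding gpar_def
proof (intro allI impI)
  fix S assume "gcoeff (f * g) S \<noteq> 0"
  then obtain T where T: "T \<subseteq> S" "gcoeff f T \<noteq> 0" "gcoeff g (S - T) \<noteq> 0"
    unfolding gcoeff_mult by (elim sum.not_neutral_contains_not_neutral) auto
  have "card S = card T + card (S - T)"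
    using T(1) by (metis card_mono card_Diff_subset finite le_add_diff_inverse)
  with T assms show "even (card S) = even (k + l)"
    unfolding gpar_def by simp
qed

lemma gpar_mult_even: "gpar 0 f \<Longrightarrow> gpar k g \<Longrightarrow> gpar k (f * g)"
  using gpar_mult[of 0 f k g] by simp

lemma gpar_power: "gpar 0 f \<Longrightarrow> gpar 0 (f ^ n)"
  by (induction n) (auto intro: gpar_one gpar_mult_even)

lemma gpar_minus_one_power_mult: "gpar k f \<Longrightarrow> gpar k ((-1) ^ n * f)"
  by (simp add: minus_one_power_iff gpar_uminus)

lemma gpar_gderiv:
  fixes f :: "'i::{finite,linorder} grass"
  assumes "gpar k f" shows "gpar (k + 1) (gderiv a f)"
  unfolding gpar_def
proof (intro allI impI)
  fix S assume "gcoeff (gderiv a f) S \<noteq> 0"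
  then have "a \<notin> S" "gcoeff f (insert a S) \<noteq> 0" by (auto simp: gcoeff_gderiv split: if_splits)
  then have "even (Suc (card S)) = even k" using assms unfolding gpar_def by force
  then show "even (card S) = even (k + 1)" by auto
qed

text \<open>Complementing T in S exchanges the roles of the two factors. Where both coefficients are
  nonzero, the exponents for the two orders add up to \<open>card T * card (S - T)\<close> by
  \<open>ginv_swap\<close>, which has the parity of \<open>k * l\<close>.\<close>

lemma gpar_commute:
  fixes f g :: "'i::{finite,linorder} grass"
  assumes "gpar k f" "gpar l g" shows "f * g = (-1) ^ (k * l) * (g * f)"
proof (rule grass_eqI)
  fix S
  have "gcoeff (f * g) S = (\<Sum>T\<in>Pow S. (-1) ^ (k * l) * ((-1) ^ ginv (S - T) T * gcoeff g (S - T) * gcoeff f T))"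
    unfolding gcoeff_mult
  proof (intro sum.cong refl)
    fix T assume "T \<in> Pow S"
    show "(-1) ^ ginv T (S - T) * gcoeff f T * gcoeff g (S - T)
        = (-1) ^ (k * l) * ((-1) ^ ginv (S - T) T * gcoeff g (S - T) * gcoeff f T)"
    proof (cases "gcoeff f T = 0 \<or> gcoeff g (S - T) = 0")
      case False
      then have "even (card T) = even k" "even (card (S - T)) = even l"
        using assms by (auto simp: gpar_def)
      then have "even (ginv T (S - T) + ginv (S - T) T) = even (k * l)"
        using ginv_swap[of T "S - T"] by simp
      then have "even (ginv T (S - T) + (k * l + ginv (S - T) T))"
        by auto
      then have "(-1 :: real) ^ ginv T (S - T) = (-1) ^ (k * l) * (-1) ^ ginv (S - T) T"
        unfolding power_add[symmetric] by (rule minus_one_power_sum_even)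
      then show ?thesis by simp
    qed auto
  qed
  also have "\<dots> = (-1) ^ (k * l) * (\<Sum>T\<in>Pow S. (-1) ^ ginv (S - T) T * gcoeff g (S - T) * gcoeff f T)"
    by (simp add: sum_distrib_left)
  also have "(\<Sum>T\<in>Pow S. (-1) ^ ginv (S - T) T * gcoeff g (S - T) * gcoeff f T) = gcoeff (g * f) S"
    unfolding gcoeff_mult
    by (rule sum.reindex_bij_witness[where i="\<lambda>T. S - T" and j="\<lambda>T. S - T"]) (auto simp: double_diff)
  finally show "gcoeff (f * g) S = gcoeff ((-1) ^ (k * l) * (g * f)) S"
    by (simp add: minus_one_power_iff)
qed

text \<open>The sign produced by moving an odd element from one side of \<open>f\<close> to the other.\<close>

definition ginvol :: "'i grass \<Rightarrow> 'i grass" where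
  "ginvol f = Grass (\<lambda>S. (-1) ^ card S * gcoeff f S)"

lemma gcoeff_ginvol: "gcoeff (ginvol f) S = (-1) ^ card S * gcoeff f S"
  by (simp add: ginvol_def)

lemma ginvol_gpar: "gpar k f \<Longrightarrow> ginvol f = (-1) ^ k * (f :: 'i::{finite,linorder} grass)"
proof (rule grass_eqI)
  fix S assume "gpar k f"
  then have "gcoeff f S \<noteq> 0 \<Longrightarrow> even (card S) = even k"
    by (auto simp: gpar_def)
  then show "gcoeff (ginvol f) S = gcoeff ((-1) ^ k * f) S"
    by (cases "gcoeff f S = 0") (auto simp: gcoeff_ginvol minus_one_power_iff)
qed

section \<open>The odd left derivative\<close>

lemma gderiv_add: "gderiv a (f + g :: 'i::{finite,linorder} grass) = gderiv a f + gderiv a g"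
  by (rule grass_eqI) (simp add: gcoeff_gderiv algebra_simps)

lemma sum_Pow_insert:
  assumes "a \<notin> S" "finite S"
  shows "sum h (Pow (insert a S)) = (\<Sum>U\<in>Pow S. h U + h (insert a U))"
proof -
  have "inj_on (insert a) (Pow S)" using assms by (auto simp: inj_on_def)
  moreover have "Pow S \<inter> insert a ` Pow S = {}" using assms by auto
  ultimately show ?thesis
    using assms by (simp add: Pow_insert sum.union_disjoint sum.reindex sum.distrib)
qed

text \<open>\<open>ginvol f\<close> carries the sign of moving the derivative past f, so the rule
  covers f of mixed parity.\<close>

lemma gderiv_mult:
  fixes f g :: "'i::{finite,linorder} grass"
  shows "gderiv a (f * g) = gderiv a f * g + ginvol f * gderiv a g"
proof (rule grass_eqI)
  fix T
  have p: "ginv {a} U + ginv U {a} = card U" if "a \<notin> U" for U :: "'i set"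
    using ginv_swap[of "{a}" U] that by simp
  have l: "ginv (insert a U) V = ginv {a} V + ginv U V" if "a \<notin> U" for U V :: "'i set"
    using ginv_Un_left[of "{a}" U V] that by simp
  have r: "ginv U (insert a V) = ginv U {a} + ginv U V" if "a \<notin> V" for U V :: "'i set"
    using ginv_Un_right[of "{a}" V U] that by simp
  define d where "d = (\<lambda>f T. if a \<in> T then 0 else (-1) ^ ginv {a} T * gcoeff f (insert a T) :: real)"
  have d: "gcoeff (gderiv a f) T = d f T" for f T
    by (simp add: gcoeff_gderiv d_def)
  show "gcoeff (gderiv a (f * g)) T = gcoeff (gderiv a f * g + ginvol f * gderiv a g) T"
  proof (cases "a \<in> T")
    case True
    define S where "S = T - {a}"
    have S: "T = insert a S" "a \<notin> S" using True by (auto simp: S_def)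
    \<comment> \<open>The left side has no monomial containing a; on the right the contributions of
      U and \<open>insert a U\<close> cancel.\<close>
    have "gcoeff (gderiv a f * g + ginvol f * gderiv a g) T = (\<Sum>U\<in>Pow S. 0)"
      unfolding gcoeff_add gcoeff_mult d gcoeff_ginvol S(1) sum.distrib[symmetric]
        sum_Pow_insert[OF S(2) finite]
    proof (intro sum.cong refl)
      fix U assume "U \<in> Pow S"
      then have U: "a \<notin> U" "insert a S - U = insert a (S - U)" "insert a S - insert a U = S - U" "a \<notin> S - U"
        using S by auto
      show "(-1) ^ ginv U (insert a S - U) * d f U * gcoeff g (insert a S - U) +
          (-1) ^ ginv (insert a U) (insert a S - insert a U) * d f (insert a U) * gcoeff g (insert a S - insert a U) +
         ((-1) ^ ginv U (insert a S - U) * ((-1) ^ card U * gcoeff f U) * d g (insert a S - U) +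
          (-1) ^ ginv (insert a U) (insert a S - insert a U) * ((-1) ^ card (insert a U) * gcoeff f (insert a U)) *
            d g (insert a S - insert a U)) = 0"
        unfolding U(2,3) using U(1,4) p[OF U(1)]
        by (simp add: d_def l[OF U(1)] r[OF U(4)] power_add mult_ac flip: p[OF U(1)])
    qed
    then show ?thesis using True by (simp add: d d_def)
  next
    case False
    \<comment> \<open>The monomial \<open>insert a T\<close> is split according to whether a falls
      to the second factor (first summand) or to the first factor (second summand).\<close>
    have "gcoeff (gderiv a (f * g)) T = (\<Sum>U\<in>Pow T. (-1) ^ ginv {a} T * ((-1) ^ ginv U (insert a T - U) * gcoeff f U * gcoeff g (insert a T - U) +
         (-1) ^ ginv (insert a U) (insert a T - insert a U) * gcoeff f (insert a U) * gcoeff g (insert a T - insert a U)))"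
      using False unfolding d d_def gcoeff_mult sum_Pow_insert[OF False finite] by (simp add: sum_distrib_left)
    also have "\<dots> = gcoeff (gderiv a f * g + ginvol f * gderiv a g) T"
      unfolding gcoeff_add gcoeff_mult d gcoeff_ginvol sum.distrib[symmetric]
    proof (intro sum.cong refl)
      fix U assume "U \<in> Pow T"
      then have U: "a \<notin> U" "insert a T - U = insert a (T - U)" "insert a T - insert a U = T - U" "a \<notin> T - U"
          "U \<union> (T - U) = T"
        using False by auto
      have "ginv {a} T = ginv {a} U + ginv {a} (T - U)"
        using ginv_Un_right[of U "T - U" "{a}"] U by simp
      then show "(-1) ^ ginv {a} T * ((-1) ^ ginv U (insert a T - U) * gcoeff f U * gcoeff g (insert a T - U) +
         (-1) ^ ginv (insert a U) (insert a T - insert a U) * gcoeff f (insert a U) * gcoeff g (insert a T - insert a U))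
        = (-1) ^ ginv U (T - U) * d f U * gcoeff g (T - U) +
          (-1) ^ ginv U (T - U) * ((-1) ^ card U * gcoeff f U) * d g (T - U)"
        unfolding U(2,3) using U(1,4) p[OF U(1)]
        by (simp add: d_def l[OF U(1)] r[OF U(4)] power_add algebra_simps flip: p[OF U(1)])
    qed
    finally show ?thesis .
  qed
qed

text \<open>For a \<noteq> b the two iterated signs differ only in the comparison of a with b, where
  exactly one of \<open>ginv {a} {b}\<close> and \<open>ginv {b} {a}\<close> is 1.\<close>

lemma gderiv_anticommute:
  fixes f :: "'i::{finite,linorder} grass"
  shows "gderiv a (gderiv b f) = - gderiv b (gderiv a f)"
proof (rule grass_eqI)
  fix T
  have r: "ginv {c} (insert e T) = ginv {c} {e} + ginv {c} T" if "e \<notin> T" for c e :: 'i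
    using ginv_Un_right[of "{e}" T "{c}"] that by simp
  have "a \<noteq> b \<Longrightarrow> (-1 :: real) ^ ginv {a} {b} = - ((-1) ^ ginv {b} {a})"
    using ginv_swap[of "{a}" "{b}"] by (cases "ginv {a} {b}") auto
  then show "gcoeff (gderiv a (gderiv b f)) T = gcoeff (- gderiv b (gderiv a f)) T"
    by (auto simp: gcoeff_gderiv r insert_commute power_add algebra_simps)
qed

section \<open>Derivatives along coordinate lines, Schwarz's theorem and smoothness classes\<close>

section \<open>Smooth functions on the even coordinates\<close>

lemma evspace_add_axis: "x \<in> evspace E \<Longrightarrow> a \<in> E \<Longrightarrow> x + t *\<^sub>R axis a 1 \<in> evspace E"
  by (auto simp: evspace_def axis_def)

text \<open>Second differences need a whole small square inside U, hence two directions. The radius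
  is halved because two displacements are added.\<close>

lemma ev_open_plane:
  assumes "ev_open E U" "x \<in> U" "a \<in> E" "b \<in> E"
  obtains d where "d > 0" "\<And>s t. \<bar>s\<bar> < d \<Longrightarrow> \<bar>t\<bar> < d \<Longrightarrow> x + s *\<^sub>R axis a 1 + t *\<^sub>R axis b 1 \<in> U"
proof -
  obtain e where e: "e > 0" "ball x e \<inter> evspace E \<subseteq> U"
    using assms(1,2) unfolding openin_contains_ball by blast
  have "x \<in> evspace E" using assms(1,2) openin_imp_subset by blast
  have "x + s *\<^sub>R axis a 1 + t *\<^sub>R axis b 1 \<in> U" if "\<bar>s\<bar> < e/2" "\<bar>t\<bar> < e/2" for s t
  proof -
    have "norm (s *\<^sub>R axis a (1::real) + t *\<^sub>R axis b 1) \<le> \<bar>s\<bar> + \<bar>t\<bar>"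
      by (rule norm_triangle_le) simp
    moreover have "dist x (x + s *\<^sub>R axis a 1 + t *\<^sub>R axis b 1) = norm (s *\<^sub>R axis a (1::real) + t *\<^sub>R axis b 1)"
      by (metis add.assoc add_diff_cancel_left' dist_norm norm_minus_commute)
    ultimately have "x + s *\<^sub>R axis a 1 + t *\<^sub>R axis b 1 \<in> ball x e"
      using that by simp
    moreover have "x + s *\<^sub>R axis a 1 + t *\<^sub>R axis b 1 \<in> evspace E"
      using \<open>x \<in> evspace E\<close> assms(3,4) by (intro evspace_add_axis)
    ultimately show ?thesis
      using e(2) by blast
  qed
  with e(1) show ?thesis by (intro that[of "e/2"]) auto
qed

lemma ev_open_line:
  assumes "ev_open E U" "x \<in> U" "a \<in> E"
  obtains d where "d > 0" "\<And>t. \<bar>t\<bar> < d \<Longrightarrow> x + t *\<^sub>R axis a 1 \<in> U"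
  using ev_open_plane[OF assms(1-3) assms(3)] by (metis abs_0 add.right_neutral scaleR_zero_left)

text \<open>\<open>pd\<close> differentiates a total function along a line. Since functions are
  controlled on U only, its value must not depend on what happens outside of U.\<close>

lemma pd_cong:
  assumes "ev_open E U" "x \<in> U" "a \<in> E" "\<And>y. y \<in> U \<Longrightarrow> g y = h y"
  shows "pd a g x = pd a h x"
proof -
  obtain d where d: "d > 0" "\<And>t. \<bar>t\<bar> < d \<Longrightarrow> x + t *\<^sub>R axis a 1 \<in> U"
    using ev_open_line assms(1-3) by blast
  have "\<forall>\<^sub>F t in nhds 0. g (x + t *\<^sub>R axis a 1) = h (x + t *\<^sub>R axis a 1)"
    unfolding eventually_nhds_metric using d assms(4) by (auto simp: dist_norm)
  then show ?thesis unfolding pd_def by (intro deriv_cong_ev) auto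
qed

text \<open>Unless E contains all indices, U has empty interior in the ambient space, so
  differentiability is taken within U. Along a coordinate line of E this becomes an ordinary
  derivative at 0, because the line stays in U for small t.\<close>

lemma has_derivative_pd:
  assumes "ev_open E U" "x \<in> U" "a \<in> E" "(g has_derivative g') (at x within U)"
  shows "((\<lambda>t. g (x + t *\<^sub>R axis a 1)) has_real_derivative g' (axis a 1)) (at 0)"
    and "pd a g x = g' (axis a 1)"
proof -
  obtain d where d: "d > 0" "\<And>t. \<bar>t\<bar> < d \<Longrightarrow> x + t *\<^sub>R axis a 1 \<in> U"
    using ev_open_line assms(1-3) by blast
  have l: "((\<lambda>t. x + t *\<^sub>R axis a 1) has_derivative (\<lambda>t. t *\<^sub>R axis a 1)) (at 0 within ball 0 d)"
    by (auto intro!: derivative_eq_intros)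
  have "((\<lambda>t. g (x + t *\<^sub>R axis a 1)) has_derivative (\<lambda>t. g' (t *\<^sub>R axis a 1))) (at 0 within ball 0 d)"
    using has_derivative_in_compose[OF l, of g g'] assms(4) d(2)
    by (force intro: has_derivative_subset)
  then have "((\<lambda>t. g (x + t *\<^sub>R axis a 1)) has_derivative (\<lambda>t. g' (t *\<^sub>R axis a 1))) (at 0)"
    using d(1) by (simp add: at_within_open[of 0 "ball 0 d"])
  moreover have "g' (t *\<^sub>R axis a 1) = g' (axis a 1) * t" for t
    using has_derivative_bounded_linear[OF assms(4)] by (simp add: linear_simps(5))
  ultimately show *: "((\<lambda>t. g (x + t *\<^sub>R axis a 1)) has_real_derivative g' (axis a 1)) (at 0)"
    by (simp add: has_field_derivative_def)
  show "pd a g x = g' (axis a 1)" unfolding pd_def using * by (rule DERIV_imp_deriv)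
qed

lemma DERIV_line:
  assumes "ev_open E U" "a \<in> E" "g differentiable_on U" "x + t *\<^sub>R axis a 1 \<in> U"
  shows "((\<lambda>t. g (x + t *\<^sub>R axis a 1)) has_real_derivative pd a g (x + t *\<^sub>R axis a 1)) (at t)"
proof -
  obtain g' where g': "(g has_derivative g') (at (x + t *\<^sub>R axis a 1) within U)"
    using assms(3,4) unfolding differentiable_on_def differentiable_def by blast
  have "((\<lambda>s. g (x + t *\<^sub>R axis a 1 + s *\<^sub>R axis a 1)) has_real_derivative pd a g (x + t *\<^sub>R axis a 1)) (at 0)"
    using has_derivative_pd[OF assms(1,4,2) g'] by simp
  moreover have "x + t *\<^sub>R axis a 1 + s *\<^sub>R axis a 1 = x + (s + t) *\<^sub>R axis a 1" for s
    by (simp add: scaleR_left_distrib)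
  ultimately have "((\<lambda>s. g (x + (s + t) *\<^sub>R axis a 1)) has_real_derivative pd a g (x + t *\<^sub>R axis a 1)) (at 0)"
    by simp
  then show ?thesis using DERIV_shift[of "\<lambda>s. g (x + s *\<^sub>R axis a 1)" _ 0 t] by simp
qed

lemma pd_const [simp]: "pd a (\<lambda>x. c) = (\<lambda>x. 0)"
  by (rule ext) (simp add: pd_def)

lemma pd_add:
  assumes "ev_open E U" "x \<in> U" "a \<in> E" "g differentiable_on U" "h differentiable_on U"
  shows "pd a (\<lambda>y. g y + h y) x = pd a g x + pd a h x"
proof -
  obtain g' h' where g': "(g has_derivative g') (at x within U)" and h': "(h has_derivative h') (at x within U)"
    using assms unfolding differentiable_on_def differentiable_def by blast
  show ?thesis
    using has_derivative_pd(2)[OF assms(1-3) g'] has_derivative_pd(2)[OF assms(1-3) h']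
      has_derivative_pd(2)[OF assms(1-3) has_derivative_add[OF g' h']] by simp
qed

lemma pd_mult:
  fixes g h :: "real ^ 'i \<Rightarrow> real"
  assumes "ev_open E U" "x \<in> U" "a \<in> E" "g differentiable_on U" "h differentiable_on U"
  shows "pd a (\<lambda>y. g y * h y) x = pd a g x * h x + g x * pd a h x"
proof -
  obtain g' h' where g': "(g has_derivative g') (at x within U)" and h': "(h has_derivative h') (at x within U)"
    using assms unfolding differentiable_on_def differentiable_def by blast
  show ?thesis
    using has_derivative_pd(2)[OF assms(1-3) g'] has_derivative_pd(2)[OF assms(1-3) h']
      has_derivative_pd(2)[OF assms(1-3) has_derivative_mult[OF g' h']] by simp
qed

lemma pd_component: "pd a (\<lambda>x. x $ b) = (\<lambda>x. if a = b then 1 else 0)"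
proof
  fix x
  have "((\<lambda>t. (x + t *\<^sub>R axis a 1) $ b) has_real_derivative (if a = b then 1 else 0)) (at 0)"
    by (auto simp: axis_def intro!: derivative_eq_intros)
  then show "pd a (\<lambda>x. x $ b) x = (if a = b then 1 else 0)"
    unfolding pd_def by (rule DERIV_imp_deriv)
qed

text \<open>A function with values in \<open>evspace E\<close> is the finite sum of its components
  along the axes of E, so the derivatives of these components determine its derivative.\<close>

lemma has_derivative_components:
  fixes \<psi> :: "'a::real_normed_vector \<Rightarrow> real ^ 'i::finite"
  assumes "x \<in> U" "\<And>y. y \<in> U \<Longrightarrow> \<psi> y \<in> evspace E"
    and "\<And>b. b \<in> E \<Longrightarrow> ((\<lambda>y. \<psi> y $ b) has_derivative \<psi>' b) (at x within U)"
  shows "(\<psi> has_derivative (\<lambda>v. \<Sum>b\<in>E. \<psi>' b v *\<^sub>R axis b 1)) (at x within U)"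
proof -
  have "((\<lambda>y. \<Sum>b\<in>E. (\<psi> y $ b) *\<^sub>R axis b 1) has_derivative (\<lambda>v. \<Sum>b\<in>E. \<psi>' b v *\<^sub>R axis b 1)) (at x within U)"
    using assms(3) by (auto intro!: derivative_eq_intros)
  moreover have "(\<Sum>b\<in>E. (\<psi> y $ b) *\<^sub>R axis b 1) = \<psi> y" if "y \<in> U" for y
  proof (rule vec_eq_iff[THEN iffD2], rule allI)
    fix c
    have "(\<Sum>b\<in>E. (\<psi> y $ b) *\<^sub>R axis b 1) $ c = (\<Sum>b\<in>E. if c = b then \<psi> y $ b else 0)"
      by (simp add: axis_def if_distrib cong: if_cong)
    also have "\<dots> = \<psi> y $ c"
      using assms(2)[OF that] by (simp add: evspace_def)
    finally show "(\<Sum>b\<in>E. (\<psi> y $ b) *\<^sub>R axis b 1) $ c = \<psi> y $ c" .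
  qed
  ultimately show ?thesis
    by (intro has_derivative_transform[OF assms(1), of \<psi> "\<lambda>y. \<Sum>b\<in>E. (\<psi> y $ b) *\<^sub>R axis b 1"]) auto
qed

text \<open>The values of \<psi> lie in \<open>evspace E\<close>, so the sum runs over E alone.
  Source and target may have different index types, as the bundle projection requires.\<close>

lemma chain_rule:
  fixes \<psi> :: "real ^ 'j::finite \<Rightarrow> real ^ 'i::finite"
  assumes "ev_open E' U" "x \<in> U" "ev_open E V" "\<psi> ` U \<subseteq> V"
    and "\<And>b. b \<in> E \<Longrightarrow> (\<lambda>y. \<psi> y $ b) differentiable_on U" "g differentiable_on V"
  shows "(\<lambda>y. g (\<psi> y)) differentiable (at x within U)"
    and "a \<in> E' \<Longrightarrow> pd a (\<lambda>y. g (\<psi> y)) x = (\<Sum>b\<in>E. pd b g (\<psi> x) * pd a (\<lambda>y. \<psi> y $ b) x)"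
proof -
  have "\<forall>b\<in>E. \<exists>D. ((\<lambda>y. \<psi> y $ b) has_derivative D) (at x within U)"
    using assms(2,5) unfolding differentiable_on_def differentiable_def by blast
  then have "\<exists>D. \<forall>b\<in>E. ((\<lambda>y. \<psi> y $ b) has_derivative D b) (at x within U)"
    by (rule bchoice)
  then obtain D where D: "\<And>b. b \<in> E \<Longrightarrow> ((\<lambda>y. \<psi> y $ b) has_derivative D b) (at x within U)" by blast
  have ev: "\<psi> y \<in> evspace E" if "y \<in> U" for y
    using assms(3,4) that openin_imp_subset by blast
  have p: "(\<psi> has_derivative (\<lambda>v. \<Sum>b\<in>E. D b v *\<^sub>R axis b 1)) (at x within U)"
    by (rule has_derivative_components[OF assms(2) ev D])
  obtain g' where g': "(g has_derivative g') (at (\<psi> x) within V)"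
    using assms(2,4,6) unfolding differentiable_on_def differentiable_def by blast
  have c: "((\<lambda>y. g (\<psi> y)) has_derivative (\<lambda>v. g' (\<Sum>b\<in>E. D b v *\<^sub>R axis b 1))) (at x within U)"
    using has_derivative_in_compose[OF p] has_derivative_subset[OF g' assms(4)] by blast
  then show "(\<lambda>y. g (\<psi> y)) differentiable (at x within U)"
    unfolding differentiable_def by blast
  assume a: "a \<in> E'"
  interpret g': bounded_linear g' using g' by (rule has_derivative_bounded_linear)
  have "\<psi> x \<in> V" using assms(2,4) by blast
  have "pd a (\<lambda>y. g (\<psi> y)) x = g' (\<Sum>b\<in>E. D b (axis a 1) *\<^sub>R axis b 1)"
    using has_derivative_pd(2)[OF assms(1,2) a c] .
  also have "\<dots> = (\<Sum>b\<in>E. D b (axis a 1) * g' (axis b 1))"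
    by (simp add: g'.sum g'.scaleR)
  also have "\<dots> = (\<Sum>b\<in>E. pd b g (\<psi> x) * pd a (\<lambda>y. \<psi> y $ b) x)"
    using has_derivative_pd(2)[OF assms(3) \<open>\<psi> x \<in> V\<close> _ g'] has_derivative_pd(2)[OF assms(1,2) a D]
    by (intro sum.cong) auto
  finally show "pd a (\<lambda>y. g (\<psi> y)) x = (\<Sum>b\<in>E. pd b g (\<psi> x) * pd a (\<lambda>y. \<psi> y $ b) x)" .
qed

text \<open>The mean value theorem is applied first in direction a, to the difference of g along two
  parallel sides of the square, and then in direction b.\<close>

lemma second_difference:
  assumes "ev_open E U" "a \<in> E" "b \<in> E" "0 < h"
    and U: "\<And>s t. 0 \<le> s \<Longrightarrow> s \<le> h \<Longrightarrow> 0 \<le> t \<Longrightarrow> t \<le> h \<Longrightarrow> x + s *\<^sub>R axis a 1 + t *\<^sub>R axis b 1 \<in> U"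
    and g: "g differentiable_on U" "pd a g differentiable_on U"
  obtains s t where "0 < s" "s < h" "0 < t" "t < h"
    "g (x + h *\<^sub>R axis a 1 + h *\<^sub>R axis b 1) - g (x + h *\<^sub>R axis a 1) - g (x + h *\<^sub>R axis b 1) + g x
     = h * h * pd b (pd a g) (x + s *\<^sub>R axis a 1 + t *\<^sub>R axis b 1)"
proof -
  let ?\<phi> = "\<lambda>s. g (x + h *\<^sub>R axis b 1 + s *\<^sub>R axis a 1) - g (x + s *\<^sub>R axis a 1)"
  have c: "x + t *\<^sub>R axis b 1 + s *\<^sub>R axis a 1 = x + s *\<^sub>R axis a 1 + t *\<^sub>R axis b 1" for s t
    by simp
  have U0: "x + s *\<^sub>R axis a 1 \<in> U" if "0 \<le> s" "s \<le> h" for s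
    using U[of s 0] that assms(4) by simp
  have "\<exists>s. 0 < s \<and> s < h \<and> ?\<phi> h - ?\<phi> 0 = (h - 0) * (pd a g (x + h *\<^sub>R axis b 1 + s *\<^sub>R axis a 1) - pd a g (x + s *\<^sub>R axis a 1))"
  proof (rule MVT2[OF assms(4)])
    fix s assume s: "0 \<le> s" "s \<le> h"
    have "x + h *\<^sub>R axis b 1 + s *\<^sub>R axis a 1 \<in> U" using U[of s h] s assms(4) by (simp add: c)
    then show "(?\<phi> has_real_derivative pd a g (x + h *\<^sub>R axis b 1 + s *\<^sub>R axis a 1) - pd a g (x + s *\<^sub>R axis a 1)) (at s)"
      by (intro DERIV_diff DERIV_line[OF assms(1,2) g(1)] U0 s)
  qed
  then obtain s where s: "0 < s" "s < h" "?\<phi> h - ?\<phi> 0 = h * (pd a g (x + s *\<^sub>R axis a 1 + h *\<^sub>R axis b 1) - pd a g (x + s *\<^sub>R axis a 1))"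
    by (auto simp only: c diff_zero)
  have "\<exists>t. 0 < t \<and> t < h \<and> pd a g (x + s *\<^sub>R axis a 1 + h *\<^sub>R axis b 1) - pd a g (x + s *\<^sub>R axis a 1 + 0 *\<^sub>R axis b 1)
      = (h - 0) * pd b (pd a g) (x + s *\<^sub>R axis a 1 + t *\<^sub>R axis b 1)"
  proof (rule MVT2[OF assms(4)])
    fix t assume t: "0 \<le> t" "t \<le> h"
    show "((\<lambda>t. pd a g (x + s *\<^sub>R axis a 1 + t *\<^sub>R axis b 1)) has_real_derivative
        pd b (pd a g) (x + s *\<^sub>R axis a 1 + t *\<^sub>R axis b 1)) (at t)"
      using U[of s t] s t by (intro DERIV_line[OF assms(1,3) g(2)]) auto
  qed
  then obtain t where "0 < t" "t < h" "pd a g (x + s *\<^sub>R axis a 1 + h *\<^sub>R axis b 1) - pd a g (x + s *\<^sub>R axis a 1)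
      = h * pd b (pd a g) (x + s *\<^sub>R axis a 1 + t *\<^sub>R axis b 1)"
    by auto
  with s show ?thesis by (intro that[of s t]) (simp_all add: c)
qed

text \<open>Schwarz's theorem. The second difference over a small square does not depend on the
  order of the directions and equals \<open>h * h\<close> times either mixed derivative at some
  point of the square; continuity carries both values to x.\<close>

lemma pd_commute:
  assumes "ev_open E U" "x \<in> U" "a \<in> E" "b \<in> E"
    and g: "g differentiable_on U" "pd a g differentiable_on U" "pd b g differentiable_on U"
    and "continuous_on U (pd a (pd b g))" "continuous_on U (pd b (pd a g))"
  shows "pd a (pd b g) x = pd b (pd a g) x"
proof (rule ccontr)
  let ?A = "pd a (pd b g)" and ?B = "pd b (pd a g)"
  assume "?A x \<noteq> ?B x"
  define e where "e = \<bar>?A x - ?B x\<bar> / 2"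
  have "e > 0" using \<open>?A x \<noteq> ?B x\<close> by (simp add: e_def)
  obtain d1 where d1: "d1 > 0" "\<And>y. y \<in> U \<Longrightarrow> dist y x < d1 \<Longrightarrow> dist (?A y) (?A x) < e"
    using assms(2,8) \<open>e > 0\<close> unfolding continuous_on_iff by metis
  obtain d2 where d2: "d2 > 0" "\<And>y. y \<in> U \<Longrightarrow> dist y x < d2 \<Longrightarrow> dist (?B y) (?B x) < e"
    using assms(2,9) \<open>e > 0\<close> unfolding continuous_on_iff by metis
  obtain d3 where d3: "d3 > 0" "\<And>s t. \<bar>s\<bar> < d3 \<Longrightarrow> \<bar>t\<bar> < d3 \<Longrightarrow> x + s *\<^sub>R axis a 1 + t *\<^sub>R axis b 1 \<in> U"
    using ev_open_plane[OF assms(1-4)] by blast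
  \<comment> \<open>Points of the square have distance at most 2h from x. The divisor 3 keeps 2h
    below \<open>d1\<close> and \<open>d2\<close>, and h below \<open>d3\<close>.\<close>
  define h where "h = min (min d1 d2) d3 / 3"
  have h: "h > 0" "2 * h < d1" "2 * h < d2" "h < d3"
    using d1 d2 d3 by (auto simp: h_def min_def)
  have U: "x + s *\<^sub>R axis a 1 + t *\<^sub>R axis b 1 \<in> U" if "0 \<le> s" "s \<le> h" "0 \<le> t" "t \<le> h" for s t
    using that h by (intro d3(2)) auto
  have n: "dist (x + s *\<^sub>R axis a 1 + t *\<^sub>R axis b 1) x \<le> 2 * h" if "0 < s" "s < h" "0 < t" "t < h" for s t
  proof -
    have "norm (s *\<^sub>R axis a (1::real) + t *\<^sub>R axis b 1) \<le> s + t"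
      using that by (intro norm_triangle_le) simp
    then show ?thesis using that by (simp add: dist_norm add.assoc)
  qed
  obtain s t where st: "0 < s" "s < h" "0 < t" "t < h"
    "g (x + h *\<^sub>R axis a 1 + h *\<^sub>R axis b 1) - g (x + h *\<^sub>R axis a 1) - g (x + h *\<^sub>R axis b 1) + g x
     = h * h * ?B (x + s *\<^sub>R axis a 1 + t *\<^sub>R axis b 1)"
    using second_difference[OF assms(1,3,4) h(1) U g(1,2)] by blast
  have U': "x + s *\<^sub>R axis b 1 + t *\<^sub>R axis a 1 \<in> U" if "0 \<le> s" "s \<le> h" "0 \<le> t" "t \<le> h" for s t
    using U[of t s] that by (simp add: add_ac)
  obtain s' t' where st': "0 < s'" "s' < h" "0 < t'" "t' < h"
    "g (x + h *\<^sub>R axis b 1 + h *\<^sub>R axis a 1) - g (x + h *\<^sub>R axis b 1) - g (x + h *\<^sub>R axis a 1) + g x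
     = h * h * ?A (x + s' *\<^sub>R axis b 1 + t' *\<^sub>R axis a 1)"
    using second_difference[OF assms(1,4,3) h(1) U' g(1,3)] by blast
  have "h * h * ?A (x + s' *\<^sub>R axis b 1 + t' *\<^sub>R axis a 1) = h * h * ?B (x + s *\<^sub>R axis a 1 + t *\<^sub>R axis b 1)"
    unfolding st(5)[symmetric] st'(5)[symmetric] by (simp add: add_ac)
  then have eq: "?A (x + s' *\<^sub>R axis b 1 + t' *\<^sub>R axis a 1) = ?B (x + s *\<^sub>R axis a 1 + t *\<^sub>R axis b 1)"
    using h(1) by simp
  have "dist (?B (x + s *\<^sub>R axis a 1 + t *\<^sub>R axis b 1)) (?B x) < e"
    using U n[of s t] st h by (intro d2) auto
  moreover have "dist (?A (x + t' *\<^sub>R axis a 1 + s' *\<^sub>R axis b 1)) (?A x) < e"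
    using U n[of t' s'] st' h by (intro d1) auto
  then have "dist (?A (x + s' *\<^sub>R axis b 1 + t' *\<^sub>R axis a 1)) (?A x) < e"
    by (simp add: add_ac)
  ultimately show False
    unfolding eq dist_real_def e_def by (simp add: abs_if split: if_splits)
qed


text \<open>\<open>Cinf\<close> quantifies over derivative lists of all lengths and offers no
  induction. The finite orders do, since the product and chain rules lower the order by one.\<close>

definition Ck :: "nat \<Rightarrow> 'i set \<Rightarrow> (real ^ 'i::finite) set \<Rightarrow> (real ^ 'i \<Rightarrow> real) \<Rightarrow> bool" where
  "Ck k E U g \<longleftrightarrow> (\<forall>as. set as \<subseteq> E \<and> length as \<le> k \<longrightarrow> foldr pd as g differentiable_on U)"

lemma Cinf_iff_Ck: "Cinf E U g \<longleftrightarrow> (\<forall>k. Ck k E U g)"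
  unfolding Cinf_def Ck_def by blast

lemma Ck_0: "Ck 0 E U g \<longleftrightarrow> g differentiable_on U"
  by (auto simp: Ck_def)

text \<open>The last entry of the list is split off, because \<open>foldr\<close> applies it first,
  directly to g.\<close>

lemma Ck_Suc: "Ck (Suc k) E U g \<longleftrightarrow> g differentiable_on U \<and> (\<forall>a\<in>E. Ck k E U (pd a g))"
proof
  assume l: "Ck (Suc k) E U g"
  have "g differentiable_on U" using l[unfolded Ck_def, rule_format, of "[]"] by simp
  moreover have "Ck k E U (pd a g)" if "a \<in> E" for a
    unfolding Ck_def
  proof (intro allI impI)
    fix as assume "set as \<subseteq> E \<and> length as \<le> k"
    then show "foldr pd as (pd a g) differentiable_on U"
      using l[unfolded Ck_def, rule_format, of "as @ [a]"] that by simp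
  qed
  ultimately show "g differentiable_on U \<and> (\<forall>a\<in>E. Ck k E U (pd a g))" by blast
next
  assume r: "g differentiable_on U \<and> (\<forall>a\<in>E. Ck k E U (pd a g))"
  show "Ck (Suc k) E U g" unfolding Ck_def
  proof (intro allI impI)
    fix as assume "set as \<subseteq> E \<and> length as \<le> Suc k"
    with r show "foldr pd as g differentiable_on U"
      by (cases as rule: rev_cases) (auto simp: Ck_def)
  qed
qed

lemma Ck_SucD: "Ck (Suc k) E U g \<Longrightarrow> Ck k E U g"
  by (simp add: Ck_def)

lemma Ck_differentiable: "Ck k E U g \<Longrightarrow> g differentiable_on U"
  by (cases k) (auto simp: Ck_0 Ck_Suc)

lemma differentiable_on_cong:
  "(\<And>x. x \<in> U \<Longrightarrow> g x = h x) \<Longrightarrow> g differentiable_on U \<longleftrightarrow> h differentiable_on U"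
  unfolding differentiable_on_def differentiable_def by (metis has_derivative_transform)

lemma foldr_pd_cong:
  assumes "ev_open E U" "set as \<subseteq> E" "\<And>x. x \<in> U \<Longrightarrow> g x = h x" "x \<in> U"
  shows "foldr pd as g x = foldr pd as h x"
  using assms(2,4)
proof (induction as arbitrary: x)
  case (Cons a as)
  then show ?case by (auto intro!: pd_cong[OF assms(1)])
qed (simp add: assms(3))

lemma Ck_cong:
  assumes "ev_open E U" "\<And>x. x \<in> U \<Longrightarrow> g x = h x"
  shows "Ck k E U g \<longleftrightarrow> Ck k E U h"
proof -
  have "foldr pd as g differentiable_on U \<longleftrightarrow> foldr pd as h differentiable_on U" if "set as \<subseteq> E" for as
    using foldr_pd_cong[OF assms(1) that assms(2)] by (intro differentiable_on_cong) auto
  then show ?thesis unfolding Ck_def by blast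
qed

lemma Ck_const: "Ck k E U (\<lambda>x. c)"
  by (induction k arbitrary: c) (auto simp: Ck_0 Ck_Suc)

lemma Ck_component: "Ck k E U (\<lambda>x. x $ b)"
proof (cases k)
  case 0
  then show ?thesis
    by (simp add: Ck_0 differentiable_on_def bounded_linear_imp_differentiable bounded_linear_vec_nth)
next
  case (Suc l)
  then show ?thesis
    by (auto simp: Ck_Suc pd_component Ck_const differentiable_on_def bounded_linear_imp_differentiable
        bounded_linear_vec_nth)
qed

lemma Ck_add:
  assumes "ev_open E U"
  shows "Ck k E U g \<Longrightarrow> Ck k E U h \<Longrightarrow> Ck k E U (\<lambda>x. g x + h x)"
proof (induction k arbitrary: g h)
  case (Suc k)
  have "Ck k E U (pd a (\<lambda>x. g x + h x))" if a: "a \<in> E" for a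
  proof -
    have "Ck k E U (\<lambda>x. pd a g x + pd a h x)"
      using Suc that by (simp add: Ck_Suc)
    then show ?thesis
      using Ck_cong[OF assms pd_add[OF assms _ a]] Suc.prems by (simp add: Ck_Suc)
  qed
  with Suc.prems show ?case by (simp add: Ck_Suc)
qed (simp add: Ck_0)

lemma Ck_mult:
  assumes "ev_open E U"
  shows "Ck k E U g \<Longrightarrow> Ck k E U h \<Longrightarrow> Ck k E U (\<lambda>x. g x * h x)"
proof (induction k arbitrary: g h)
  case (Suc k)
  have "Ck k E U (pd a (\<lambda>x. g x * h x))" if a: "a \<in> E" for a
  proof -
    have "Ck k E U (\<lambda>x. pd a g x * h x + g x * pd a h x)"
      using Suc.prems[THEN Ck_SucD] Suc.prems that by (intro Ck_add[OF assms] Suc.IH) (auto simp: Ck_Suc)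
    then show ?thesis
      using Ck_cong[OF assms pd_mult[OF assms _ a]] Suc.prems by (simp add: Ck_Suc)
  qed
  with Suc.prems show ?case by (simp add: Ck_Suc)
qed (simp add: Ck_0)

lemma Ck_sum:
  assumes "ev_open E U" "\<And>i. i \<in> I \<Longrightarrow> Ck k E U (g i)"
  shows "Ck k E U (\<lambda>x. \<Sum>i\<in>I. g i x)"
  using assms(2)
  by (induction I rule: infinite_finite_induct) (auto simp: Ck_const intro: Ck_add[OF assms(1)])

text \<open>By the chain rule a derivative of the composite is a sum of products of order k, in
  which one factor is again a composite with \<psi>; the induction hypothesis applies to that
  factor.\<close>

lemma Ck_compose:
  fixes \<psi> :: "real ^ 'j::finite \<Rightarrow> real ^ 'i::finite"
  assumes "ev_open E' U" "ev_open E V" "\<psi> ` U \<subseteq> V"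
  shows "\<lbrakk>\<And>b. b \<in> E \<Longrightarrow> Ck k E' U (\<lambda>y. \<psi> y $ b); Ck k E V g\<rbrakk> \<Longrightarrow> Ck k E' U (\<lambda>y. g (\<psi> y))"
proof (induction k arbitrary: g)
  case 0
  then show ?case
    using chain_rule(1)[OF assms(1) _ assms(2,3)] by (auto simp: Ck_0 differentiable_on_def)
next
  case (Suc k)
  have d: "(\<lambda>y. \<psi> y $ b) differentiable_on U" if "b \<in> E" for b
    using Suc.prems(1)[OF that] by (rule Ck_differentiable)
  have g: "g differentiable_on V" using Suc.prems(2) by (rule Ck_differentiable)
  have "Ck k E' U (pd a (\<lambda>y. g (\<psi> y)))" if a: "a \<in> E'" for a
  proof -
    have "Ck k E' U (\<lambda>x. pd b g (\<psi> x))" if "b \<in> E" for b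
    proof (rule Suc.IH)
      show "Ck k E' U (\<lambda>y. \<psi> y $ c)" if "c \<in> E" for c
        using Suc.prems(1)[OF that] by (rule Ck_SucD)
      show "Ck k E V (pd b g)" using Suc.prems(2) that by (simp add: Ck_Suc)
    qed
    moreover have "Ck k E' U (pd a (\<lambda>y. \<psi> y $ b))" if "b \<in> E" for b
      using Suc.prems(1)[OF that] a by (simp add: Ck_Suc)
    ultimately have "Ck k E' U (\<lambda>x. \<Sum>b\<in>E. pd b g (\<psi> x) * pd a (\<lambda>y. \<psi> y $ b) x)"
      by (intro Ck_sum Ck_mult[OF assms(1)] assms(1))
    then show ?thesis
      using Ck_cong[OF assms(1) chain_rule(2)[OF assms(1) _ assms(2,3) d g a]] by simp
  qed
  moreover have "(\<lambda>y. g (\<psi> y)) differentiable_on U"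
    using chain_rule(1)[OF assms(1) _ assms(2,3) d g] by (auto simp: differentiable_on_def)
  ultimately show ?case by (simp add: Ck_Suc)
qed

lemma Cinf_differentiable: "Cinf E U g \<Longrightarrow> g differentiable_on U"
  unfolding Cinf_iff_Ck using Ck_differentiable by blast

lemma Cinf_pd: "Cinf E U g \<Longrightarrow> a \<in> E \<Longrightarrow> Cinf E U (pd a g)"
  unfolding Cinf_iff_Ck using Ck_Suc by blast

lemma Cinf_foldr_pd: "Cinf E U g \<Longrightarrow> set as \<subseteq> E \<Longrightarrow> Cinf E U (foldr pd as g)"
  by (induction as) (auto intro: Cinf_pd)

lemma Cinf_const [simp]: "Cinf E U (\<lambda>x. c)"
  by (simp add: Cinf_iff_Ck Ck_const)

lemma Cinf_component: "Cinf E U (\<lambda>x. x $ b)"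
  by (simp add: Cinf_iff_Ck Ck_component)

lemma Cinf_cong: "ev_open E U \<Longrightarrow> (\<And>x. x \<in> U \<Longrightarrow> g x = h x) \<Longrightarrow> Cinf E U g \<longleftrightarrow> Cinf E U h"
  unfolding Cinf_iff_Ck using Ck_cong by blast

lemma Cinf_add: "ev_open E U \<Longrightarrow> Cinf E U g \<Longrightarrow> Cinf E U h \<Longrightarrow> Cinf E U (\<lambda>x. g x + h x)"
  by (simp add: Cinf_iff_Ck Ck_add)

lemma Cinf_mult: "ev_open E U \<Longrightarrow> Cinf E U g \<Longrightarrow> Cinf E U h \<Longrightarrow> Cinf E U (\<lambda>x. g x * h x)"
  by (simp add: Cinf_iff_Ck Ck_mult)

lemma Cinf_sum: "ev_open E U \<Longrightarrow> (\<And>i. i \<in> I \<Longrightarrow> Cinf E U (g i)) \<Longrightarrow> Cinf E U (\<lambda>x. \<Sum>i\<in>I. g i x)"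
  by (simp add: Cinf_iff_Ck Ck_sum)

lemma Cinf_power: "ev_open E U \<Longrightarrow> Cinf E U g \<Longrightarrow> Cinf E U (\<lambda>x. g x ^ n)"
  by (induction n) (auto intro: Cinf_mult)

lemma Cinf_prod: "ev_open E U \<Longrightarrow> (\<And>i. i \<in> I \<Longrightarrow> Cinf E U (g i)) \<Longrightarrow> Cinf E U (\<lambda>x. \<Prod>i\<in>I. g i x)"
  by (induction I rule: infinite_finite_induct) (auto intro: Cinf_mult)

lemma Cinf_compose:
  fixes \<psi> :: "real ^ 'j::finite \<Rightarrow> real ^ 'i::finite"
  assumes "ev_open E' U" "ev_open E V" "\<psi> ` U \<subseteq> V"
    and "\<And>b. b \<in> E \<Longrightarrow> Cinf E' U (\<lambda>y. \<psi> y $ b)" "Cinf E V g"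
  shows "Cinf E' U (\<lambda>y. g (\<psi> y))"
  using assms(4,5) unfolding Cinf_iff_Ck by (auto intro: Ck_compose[OF assms(1-3)])

lemma Cinf_subset: "Cinf E U g \<Longrightarrow> V \<subseteq> U \<Longrightarrow> Cinf E V g"
  unfolding Cinf_def using differentiable_on_subset by blast

lemma Cinf_pd_commute:
  assumes "ev_open E U" "x \<in> U" "a \<in> E" "b \<in> E" "Cinf E U g"
  shows "pd a (pd b g) x = pd b (pd a g) x"
  using assms by (intro pd_commute[OF assms(1-4)])
    (auto intro!: differentiable_imp_continuous_on Cinf_differentiable intro: Cinf_pd)

text \<open>Frees iterated derivatives from the fixed order in which \<open>mpd\<close> takes
  them.\<close>

lemma foldr_pd_mset:
  assumes "ev_open E U" "Cinf E U g"
  shows "\<lbrakk>set as \<subseteq> E; mset as = mset bs; x \<in> U\<rbrakk> \<Longrightarrow> foldr pd as g x = foldr pd bs g x"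
proof (induction as arbitrary: bs x)
  case (Cons a as)
  \<comment> \<open>By Schwarz's theorem \<open>pd a\<close> moves outwards past the derivatives in
    cs. Each exchange is an equality on U only, hence the appeal to \<open>pd_cong\<close>.\<close>
  have move: "foldr pd cs (pd a h) y = pd a (foldr pd cs h) y"
    if "set cs \<subseteq> E" "Cinf E U h" "y \<in> U" for cs h y
    using that
  proof (induction cs arbitrary: y)
    case (Cons c cs)
    have "foldr pd (c # cs) (pd a h) y = pd c (pd a (foldr pd cs h)) y"
      using Cons by (auto intro!: pd_cong[OF assms(1)])
    also have "\<dots> = pd a (pd c (foldr pd cs h)) y"
      using Cons \<open>set (a # as) \<subseteq> E\<close> by (intro Cinf_pd_commute[OF assms(1)] Cinf_foldr_pd) auto
    finally show ?case by simp
  qed simp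
  have "a \<in> set bs" using Cons.prems(2) by (metis list.set_intros(1) set_mset_mset)
  then obtain b1 b2 where bs: "bs = b1 @ a # b2" by (meson split_list)
  have m: "mset as = mset (b1 @ b2)" using Cons.prems(2) bs by simp
  have sub: "set (b1 @ b2) \<subseteq> E"
    using Cons.prems(1) m by (metis set_mset_mset set_subset_Cons subset_trans)
  have "foldr pd (a # as) g x = pd a (foldr pd (b1 @ b2) g) x"
    using Cons m by (auto intro!: pd_cong[OF assms(1)] simp del: foldr_append)
  also have "\<dots> = foldr pd b1 (pd a (foldr pd b2 g)) x"
    using move[of b1 "foldr pd b2 g" x] sub Cons.prems(3) assms(2) by (simp add: Cinf_foldr_pd)
  finally show ?case by (simp add: bs)
qed simp

section \<open>Graded Leibniz rule and graded commutation of partial derivatives\<close>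

section \<open>Superfunctions and their partial derivatives\<close>

text \<open>The parity is read off from E alone: an index outside E counts as odd, exactly as
  \<open>spd\<close> treats it.\<close>

definition sdeg :: "'i set \<Rightarrow> 'i \<Rightarrow> nat" where
  "sdeg E a = (if a \<in> E then 0 else 1)"

lemma superfunI:
  "(\<And>x S. x \<in> U \<Longrightarrow> \<not> S \<subseteq> N \<Longrightarrow> gcoeff (f x) S = 0) \<Longrightarrow> (\<And>S. Cinf E U (\<lambda>x. gcoeff (f x) S)) \<Longrightarrow> superfun E N U f"
  by (simp add: superfun_def)

lemma superfun_Cinf: "superfun E N U f \<Longrightarrow> Cinf E U (\<lambda>x. gcoeff (f x) S)"
  by (simp add: superfun_def)

lemma superfun_diff: "superfun E N U f \<Longrightarrow> (\<lambda>x. gcoeff (f x) S) differentiable_on U"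
  by (rule Cinf_differentiable[OF superfun_Cinf])

lemma superfun_subset: "superfun E N U f \<Longrightarrow> V \<subseteq> U \<Longrightarrow> superfun E N V f"
  unfolding superfun_def using Cinf_subset by blast

lemma superfun_cong:
  assumes "ev_open E U" "\<And>x. x \<in> U \<Longrightarrow> f x = g x"
  shows "superfun E N U f \<longleftrightarrow> superfun E N U g"
proof -
  have "Cinf E U (\<lambda>x. gcoeff (f x) S) \<longleftrightarrow> Cinf E U (\<lambda>x. gcoeff (g x) S)" for S
    using assms by (intro Cinf_cong) auto
  then show ?thesis using assms(2) by (simp add: superfun_def)
qed

lemma superfun_of_real: "superfun E N U (\<lambda>x. of_real r :: 'i::{finite,linorder} grass)"
  by (rule superfunI) (auto simp: gcoeff_of_real)

lemma superfun_zero: "superfun E N U (\<lambda>x. 0)"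
  by (rule superfunI) auto

lemma superfun_one: "superfun E N U (\<lambda>x. 1 :: 'i::{finite,linorder} grass)"
  by (rule superfunI) (auto simp: gcoeff_one)

lemma superfun_coord:
  assumes "a \<in> E \<union> N" shows "superfun E N U (coord E a)"
proof (rule superfunI)
  fix S show "Cinf E U (\<lambda>x. gcoeff (coord E a x) S)"
    by (cases "a \<in> E"; cases "S = {}") (simp_all add: coord_def gcoeff_of_real gcoeff_ggen Cinf_component)
qed (use assms in \<open>auto simp: coord_def gcoeff_of_real gcoeff_ggen split: if_splits\<close>)

context
  fixes E N :: "'i::{finite,linorder} set" and U
  assumes U: "ev_open E U"
begin

lemma superfun_add: "superfun E N U f \<Longrightarrow> superfun E N U g \<Longrightarrow> superfun E N U (\<lambda>x. f x + g x)"
  by (intro superfunI) (auto simp: superfun_def intro!: Cinf_add[OF U])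

lemma superfun_scaleR:
  assumes "Cinf E U r" "superfun E N U f" shows "superfun E N U (\<lambda>x. r x *\<^sub>R f x)"
  using assms by (intro superfunI) (auto simp: superfun_def intro!: Cinf_mult[OF U])

lemma superfun_uminus: "superfun E N U f \<Longrightarrow> superfun E N U (\<lambda>x. - f x)"
  using superfun_scaleR[of "\<lambda>x. -1" f] by simp

lemma superfun_minus: "superfun E N U f \<Longrightarrow> superfun E N U g \<Longrightarrow> superfun E N U (\<lambda>x. f x - g x)"
  using superfun_add[of f "\<lambda>x. - g x"] superfun_uminus[of g] by simp

lemma superfun_sum: "(\<And>i. i \<in> I \<Longrightarrow> superfun E N U (f i)) \<Longrightarrow> superfun E N U (\<lambda>x. \<Sum>i\<in>I. f i x)"
  by (induction I rule: infinite_finite_induct) (auto intro: superfun_zero superfun_add)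

lemma superfun_mult:
  assumes "superfun E N U f" "superfun E N U g" shows "superfun E N U (\<lambda>x. f x * g x)"
proof (rule superfunI)
  fix x S assume "x \<in> U" "\<not> S \<subseteq> N"
  then have "\<not> T \<subseteq> N \<or> \<not> S - T \<subseteq> N" for T by blast
  then show "gcoeff (f x * g x) S = 0"
    using assms \<open>x \<in> U\<close> unfolding gcoeff_mult superfun_def by (intro sum.neutral ballI) (metis mult_zero_left mult_zero_right)
next
  fix S show "Cinf E U (\<lambda>x. gcoeff (f x * g x) S)"
    unfolding gcoeff_mult using assms by (intro Cinf_sum Cinf_mult U Cinf_const superfun_Cinf)
qed

lemma superfun_power: "superfun E N U f \<Longrightarrow> superfun E N U (\<lambda>x. f x ^ n)"
  by (induction n) (auto intro: superfun_one superfun_mult)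

lemma superfun_prod_list:
  "(\<And>a. a \<in> set as \<Longrightarrow> superfun E N U (f a)) \<Longrightarrow> superfun E N U (\<lambda>x. prod_list (map (\<lambda>a. f a x) as))"
proof (induction as)
  case (Cons a as)
  then show ?case using superfun_mult[of "f a" "\<lambda>x. prod_list (map (\<lambda>a. f a x) as)"] by simp
qed (simp add: superfun_one)

lemma superfun_sign: "superfun E N U f \<Longrightarrow> superfun E N U (\<lambda>x. (-1) ^ n * f x)"
  by (simp add: minus_one_power_iff superfun_uminus)

lemma superfun_spd:
  assumes "superfun E N U f" shows "superfun E N U (spd E a f)"
proof (cases "a \<in> E")
  case True
  show ?thesis
  proof (rule superfunI)
    fix x S assume x: "x \<in> U" "\<not> S \<subseteq> N"
    then have "gcoeff (f y) S = 0" if "y \<in> U" for y using assms that by (simp add: superfun_def)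
    then show "gcoeff (spd E a f x) S = 0"
      using True pd_cong[OF U x(1) True, of "\<lambda>y. gcoeff (f y) S" "\<lambda>y. 0"] by (simp add: spd_def)
  qed (use True assms in \<open>auto simp: spd_def intro!: Cinf_pd superfun_Cinf\<close>)
next
  case False
  show ?thesis
  proof (rule superfunI)
    fix S show "Cinf E U (\<lambda>x. gcoeff (spd E a f x) S)"
      using False assms by (cases "a \<in> S")
        (auto simp: spd_def gcoeff_gderiv superfun_def intro!: Cinf_mult[OF U])
  qed (use False assms in \<open>auto simp: spd_def gcoeff_gderiv superfun_def\<close>)
qed

lemma spd_cong:
  assumes "x \<in> U" "\<And>y. y \<in> U \<Longrightarrow> f y = g y" shows "spd E a f x = spd E a g x"
proof (cases "a \<in> E")
  case True
  then have "pd a (\<lambda>y. gcoeff (f y) S) x = pd a (\<lambda>y. gcoeff (g y) S) x" for S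
    using assms by (intro pd_cong[OF U]) auto
  then show ?thesis using True by (simp add: spd_def)
qed (use assms in \<open>simp add: spd_def\<close>)

lemma spd_add:
  assumes "x \<in> U" "superfun E N U f" "superfun E N U g"
  shows "spd E a (\<lambda>y. f y + g y) x = spd E a f x + spd E a g x"
proof (cases "a \<in> E")
  case True
  then show ?thesis
    using assms by (intro grass_eqI) (simp add: spd_def pd_add[OF U] superfun_diff)
qed (simp add: spd_def gderiv_add)

text \<open>Stated for f of mixed parity; for an odd coordinate \<open>ginvol\<close> supplies the
  sign on each homogeneous part.\<close>

lemma spd_mult:
  assumes "x \<in> U" "superfun E N U f" "superfun E N U g"
  shows "spd E a (\<lambda>y. f y * g y) x = spd E a f x * g x + (if a \<in> E then f x else ginvol (f x)) * spd E a g x"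
proof (cases "a \<in> E")
  case True
  show ?thesis
  proof (rule grass_eqI)
    fix S
    have d: "(\<lambda>y. (-1) ^ ginv T (S - T) * gcoeff (f y) T * gcoeff (g y) (S - T)) differentiable_on U" for T
      using assms by (intro differentiable_on_mult superfun_diff differentiable_on_const)
    have s: "pd a (\<lambda>y. \<Sum>T\<in>I. h T y) x = (\<Sum>T\<in>I. pd a (h T) x)"
      if "finite I" "\<And>T. h T differentiable_on U" for I :: "'i set set" and h
      using that(1) by (induction I rule: finite_induct)
        (simp_all add: pd_add[OF U assms(1) True] that(2) Ck_sum[OF U, where k = 0, unfolded Ck_0])
    have "gcoeff (spd E a (\<lambda>y. f y * g y) x) S
        = (\<Sum>T\<in>Pow S. pd a (\<lambda>y. (-1) ^ ginv T (S - T) * gcoeff (f y) T * gcoeff (g y) (S - T)) x)"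
      using True by (simp add: spd_def gcoeff_mult s d)
    also have "\<dots> = (\<Sum>T\<in>Pow S. (-1) ^ ginv T (S - T) * pd a (\<lambda>y. gcoeff (f y) T) x * gcoeff (g x) (S - T)
        + (-1) ^ ginv T (S - T) * gcoeff (f x) T * pd a (\<lambda>y. gcoeff (g y) (S - T)) x)"
    proof (intro sum.cong refl)
      fix T
      have c: "(\<lambda>y. (-1) ^ ginv T (S - T) * gcoeff (f y) T) differentiable_on U"
        using assms by (intro differentiable_on_mult superfun_diff differentiable_on_const)
      show "pd a (\<lambda>y. (-1) ^ ginv T (S - T) * gcoeff (f y) T * gcoeff (g y) (S - T)) x
        = (-1) ^ ginv T (S - T) * pd a (\<lambda>y. gcoeff (f y) T) x * gcoeff (g x) (S - T)
          + (-1) ^ ginv T (S - T) * gcoeff (f x) T * pd a (\<lambda>y. gcoeff (g y) (S - T)) x"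
        using pd_mult[OF U assms(1) True c superfun_diff[OF assms(3)]]
          pd_mult[OF U assms(1) True differentiable_on_const superfun_diff[OF assms(2)]] by simp
    qed
    also have "\<dots> = gcoeff (spd E a f x * g x + f x * spd E a g x) S"
      using True by (simp add: spd_def gcoeff_mult sum.distrib)
    finally show "gcoeff (spd E a (\<lambda>y. f y * g y) x) S
        = gcoeff (spd E a f x * g x + (if a \<in> E then f x else ginvol (f x)) * spd E a g x) S"
      using True by simp
  qed
qed (simp add: spd_def gderiv_mult)

lemma spd_mult_gpar:
  assumes "x \<in> U" "superfun E N U f" "superfun E N U g" "gpar k (f x)"
  shows "spd E a (\<lambda>y. f y * g y) x = spd E a f x * g x + (-1) ^ (sdeg E a * k) * (f x * spd E a g x)"
  using spd_mult[OF assms(1-3)] ginvol_gpar[OF assms(4)] by (simp add: sdeg_def mult.assoc)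

lemma spd_const: "spd E a (\<lambda>x. of_real r) x = 0"
  by (rule grass_eqI) (auto simp: spd_def gcoeff_of_real gcoeff_gderiv)

lemma spd_zero: "spd E a (\<lambda>x. 0) x = 0"
  using spd_const[of a 0] by simp

lemma spd_scaleR:
  assumes "x \<in> U" "superfun E N U f"
  shows "spd E a (\<lambda>y. r *\<^sub>R f y) x = r *\<^sub>R spd E a f x"
  using spd_mult[OF assms(1) superfun_of_real[of E N U r] assms(2), of a] spd_const[of a r]
    ginvol_gpar[OF gpar_of_real[of r, where ?'i = 'i]]
  by (cases "a \<in> E") (simp_all add: scaleR_conv_of_real)

lemma spd_uminus:
  assumes "x \<in> U" "superfun E N U f"
  shows "spd E a (\<lambda>y. - f y) x = - spd E a f x"
  using spd_scaleR[OF assms, of a "-1"] by simp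

lemma spd_sign:
  assumes "x \<in> U" "superfun E N U f"
  shows "spd E a (\<lambda>y. (-1) ^ n * f y) x = (-1) ^ n * spd E a f x"
  using spd_uminus[OF assms] by (simp add: minus_one_power_iff)

lemma spd_sum:
  assumes "x \<in> U" "finite I" "\<And>i. i \<in> I \<Longrightarrow> superfun E N U (f i)"
  shows "spd E a (\<lambda>y. \<Sum>i\<in>I. f i y) x = (\<Sum>i\<in>I. spd E a (f i) x)"
  using assms(2,3)
proof (induction I rule: finite_induct)
  case (insert i I)
  then show ?case
    using spd_add[OF assms(1), of "f i" "\<lambda>y. \<Sum>i\<in>I. f i y" a] by (simp add: superfun_sum)
qed (simp add: spd_zero)

lemma gpar_spd:
  assumes "x \<in> U" "\<And>y. y \<in> U \<Longrightarrow> gpar k (f y)"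
  shows "gpar (k + sdeg E a) (spd E a f x)"
proof (cases "a \<in> E")
  case True
  have "pd a (\<lambda>y. gcoeff (f y) S) x = 0" if "even (card S) \<noteq> even k" for S
  proof -
    have "gcoeff (f y) S = 0" if "y \<in> U" for y
      using assms(2)[OF that] \<open>even (card S) \<noteq> even k\<close> unfolding gpar_def by blast
    then show ?thesis
      using pd_cong[OF U assms(1) True, of "\<lambda>y. gcoeff (f y) S" "\<lambda>y. 0"] by simp
  qed
  then show ?thesis using True by (auto simp: gpar_def spd_def sdeg_def)
next
  case False
  then show ?thesis using gpar_gderiv[OF assms(2)[OF assms(1)], of a] by (simp add: spd_def sdeg_def)
qed

text \<open>The even-even case is Schwarz's theorem, the odd-odd case is
  \<open>gderiv_anticommute\<close>. In the mixed case \<open>gderiv\<close> selects coefficients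
  and multiplies them by constant signs, which \<open>pd\<close> respects.\<close>

lemma spd_commute:
  assumes "x \<in> U" "superfun E N U f"
  shows "spd E a (spd E b f) x = (-1) ^ (sdeg E a * sdeg E b) * spd E b (spd E a f) x"
proof -
  have mixed: "pd c (\<lambda>y. gcoeff (gderiv d (f y)) S) x = gcoeff (gderiv d (Grass (\<lambda>S. pd c (\<lambda>y. gcoeff (f y) S) x))) S"
    if "c \<in> E" for c d S
    using pd_mult[OF U assms(1) that differentiable_on_const superfun_diff[OF assms(2)], of "(-1) ^ ginv {d} S" "insert d S"]
    by (cases "d \<in> S") (simp_all add: gcoeff_gderiv)
  show ?thesis
  proof (rule grass_eqI)
    fix S
    show "gcoeff (spd E a (spd E b f) x) S = gcoeff ((-1) ^ (sdeg E a * sdeg E b) * spd E b (spd E a f) x) S"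
      using Cinf_pd_commute[OF U assms(1) _ _ superfun_Cinf[OF assms(2)], of a b S]
      by (cases "a \<in> E"; cases "b \<in> E")
        (auto simp: spd_def sdeg_def mixed gderiv_anticommute[of a b] cong: if_cong)
  qed
qed

end

lemma spd_coord_self: "spd E a (coord E b) = (\<lambda>x. if a = b then 1 else 0)"
  by (rule ext) (rule spd_coord)

lemma gpar_coord: "gpar (sdeg E a) (coord E a x)"
  using gpar_ggen[of a] by (auto simp: coord_def sdeg_def gpar_of_real)

section \<open>Multi-indices and functions with vanishing jets\<close>

section \<open>Jets\<close>

text \<open>A multi-index written out as the list of its directions in the order of
  \<open>mpd\<close>, so that facts about \<open>foldr pd\<close> apply.\<close>

definition mlist :: "('i \<Rightarrow> nat) \<Rightarrow> 'i::{finite,linorder} list" where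
  "mlist \<alpha> = concat (map (\<lambda>a. replicate (\<alpha> a) a) (sorted_list_of_set UNIV))"

lemma mpd_mlist: "mpd \<alpha> g = foldr pd (mlist \<alpha>) g"
proof -
  have "foldr pd (concat (map (\<lambda>a. replicate (\<alpha> a) a) as)) g = foldr (\<lambda>a. pd a ^^ \<alpha> a) as g" for as
    by (induction as) (simp_all add: foldr_replicate)
  then show ?thesis by (simp add: mpd_def mlist_def)
qed

lemma count_mlist: "count (mset (mlist \<alpha>)) a = \<alpha> a"
proof -
  have "count (mset (concat (map (\<lambda>a. replicate (\<alpha> a) a) as))) a = (if a \<in> set as then \<alpha> a else 0)"
    if "distinct as" for as
    using that by (induction as) (auto simp: count_mset)
  then show ?thesis by (simp add: mlist_def)
qed

lemma set_mlist: "set (mlist \<alpha>) = {a. \<alpha> a \<noteq> 0}"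
proof -
  have "a \<in> set (mlist \<alpha>) \<longleftrightarrow> count (mset (mlist \<alpha>)) a \<noteq> 0" for a
    by (metis count_mset_0_iff)
  then show ?thesis by (auto simp: count_mlist)
qed

lemma length_mlist: "length (mlist \<alpha>) = (\<Sum>a\<in>UNIV. \<alpha> a)"
  by (simp add: mlist_def length_concat comp_def sum_list_distinct_conv_sum_set)

lemma mlist_zero: "mlist (\<lambda>a. 0) = []"
  using set_mlist[of "\<lambda>a. 0"] by auto

text \<open>The index set of \<open>pullback\<close> is the case m = \<open>CARD('i)\<close>; Taylor
  polynomials use other bounds.\<close>

definition mindices :: "'i::finite set \<Rightarrow> nat \<Rightarrow> ('i \<Rightarrow> nat) set" where
  "mindices E m = {\<alpha>. \<forall>a. \<alpha> a \<le> (if a \<in> E then m else 0)}"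

lemma mindices_le:
  assumes "\<alpha> \<in> mindices E m" shows "\<alpha> a \<le> m"
proof -
  have "\<alpha> a \<le> (if a \<in> E then m else 0)" using assms by (simp add: mindices_def)
  then show ?thesis by (cases "a \<in> E") auto
qed

lemma finite_mindices: "finite (mindices E m)"
proof -
  have "mindices E m \<subseteq> (\<Pi>\<^sub>E a\<in>UNIV. {..m})"
    by (auto simp: PiE_def mindices_le)
  then show ?thesis by (rule finite_subset) (simp add: finite_PiE)
qed

lemma mindices_set: "\<alpha> \<in> mindices E m \<Longrightarrow> set (mlist \<alpha>) \<subseteq> E"
  by (force simp: mindices_def set_mlist split: if_splits)

lemma mindices_length:
  fixes \<alpha> :: "'i::{finite,linorder} \<Rightarrow> nat"
  assumes "\<alpha> \<in> mindices E m" shows "length (mlist \<alpha>) \<le> CARD('i) * m"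
proof -
  have "(\<Sum>a\<in>UNIV. \<alpha> a) \<le> CARD('i) * m"
    using sum_bounded_above[of UNIV \<alpha> m] mindices_le[OF assms] by simp
  then show ?thesis by (simp add: length_mlist)
qed

text \<open>The m-jet of g at y in the directions E vanishes.\<close>

definition flat_at :: "'i set \<Rightarrow> nat \<Rightarrow> real ^ 'i::finite \<Rightarrow> (real ^ 'i \<Rightarrow> real) \<Rightarrow> bool" where
  "flat_at E m y g \<longleftrightarrow> (\<forall>as. set as \<subseteq> E \<and> length as \<le> m \<longrightarrow> foldr pd as g y = 0)"

lemma flat_at_0: "flat_at E 0 y g \<longleftrightarrow> g y = 0"
  by (simp add: flat_at_def)

lemma flat_at_Suc: "flat_at E (Suc m) y g \<longleftrightarrow> g y = 0 \<and> (\<forall>a\<in>E. flat_at E m y (pd a g))"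
proof
  assume l: "flat_at E (Suc m) y g"
  have "g y = 0" using l[unfolded flat_at_def, rule_format, of "[]"] by simp
  moreover have "flat_at E m y (pd a g)" if "a \<in> E" for a
    unfolding flat_at_def
  proof (intro allI impI)
    fix as assume "set as \<subseteq> E \<and> length as \<le> m"
    then show "foldr pd as (pd a g) y = 0"
      using l[unfolded flat_at_def, rule_format, of "as @ [a]"] that by simp
  qed
  ultimately show "g y = 0 \<and> (\<forall>a\<in>E. flat_at E m y (pd a g))" by blast
next
  assume r: "g y = 0 \<and> (\<forall>a\<in>E. flat_at E m y (pd a g))"
  show "flat_at E (Suc m) y g" unfolding flat_at_def
  proof (intro allI impI)
    fix as assume "set as \<subseteq> E \<and> length as \<le> Suc m"
    with r show "foldr pd as g y = 0"
      by (cases as rule: rev_cases) (auto simp: flat_at_def)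
  qed
qed

lemma flat_at_mono: "flat_at E m y g \<Longrightarrow> l \<le> m \<Longrightarrow> flat_at E l y g"
  by (auto simp: flat_at_def)

lemma flat_at_foldr_pd: "flat_at E (m + length as) y g \<Longrightarrow> set as \<subseteq> E \<Longrightarrow> flat_at E m y (foldr pd as g)"
  unfolding flat_at_def by (auto simp: foldr_append[symmetric] simp del: foldr_append)

context
  fixes E :: "'i::finite set" and U and y
  assumes U: "ev_open E U" "y \<in> U"
begin

lemma flat_at_cong: "(\<And>x. x \<in> U \<Longrightarrow> g x = h x) \<Longrightarrow> flat_at E m y g \<longleftrightarrow> flat_at E m y h"
  unfolding flat_at_def using foldr_pd_cong[OF U(1) _ _ U(2)] by metis

lemma flat_at_add:
  "Cinf E U g \<Longrightarrow> Cinf E U h \<Longrightarrow> flat_at E m y g \<Longrightarrow> flat_at E m y h \<Longrightarrow> flat_at E m y (\<lambda>x. g x + h x)"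
proof (induction m arbitrary: g h)
  case (Suc m)
  have "flat_at E m y (pd a (\<lambda>x. g x + h x))" if a: "a \<in> E" for a
  proof -
    have "flat_at E m y (\<lambda>x. pd a g x + pd a h x)"
      using Suc a by (simp add: flat_at_Suc Cinf_pd)
    then show ?thesis
      using flat_at_cong[OF pd_add[OF U(1) _ a]] Suc.prems by (simp add: Cinf_differentiable)
  qed
  with Suc.prems show ?case by (simp add: flat_at_Suc)
qed (simp add: flat_at_0)

text \<open>Flat functions form an ideal: every term of the Leibniz rule contains g or a derivative
  of g of order at most m.\<close>

lemma flat_at_mult:
  "Cinf E U g \<Longrightarrow> Cinf E U h \<Longrightarrow> flat_at E m y g \<Longrightarrow> flat_at E m y (\<lambda>x. g x * h x)"
proof (induction m arbitrary: g h)
  case (Suc m)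
  have "flat_at E m y (pd a (\<lambda>x. g x * h x))" if a: "a \<in> E" for a
  proof -
    have "flat_at E m y (\<lambda>x. pd a g x * h x + g x * pd a h x)"
      using Suc.prems a flat_at_mono[OF Suc.prems(3), of m]
      by (intro flat_at_add Suc.IH Cinf_mult U(1) Cinf_pd) (auto simp: flat_at_Suc)
    then show ?thesis
      using flat_at_cong[OF pd_mult[OF U(1) _ a]] Suc.prems by (simp add: Cinf_differentiable)
  qed
  with Suc.prems show ?case by (simp add: flat_at_Suc)
qed (simp add: flat_at_0)

lemma flat_at_zero: "flat_at E m y (\<lambda>x. 0)"
  by (induction m) (simp_all add: flat_at_0 flat_at_Suc)

lemma flat_at_sum:
  "(\<And>i. i \<in> I \<Longrightarrow> Cinf E U (g i)) \<Longrightarrow> (\<And>i. i \<in> I \<Longrightarrow> flat_at E m y (g i)) \<Longrightarrow> flat_at E m y (\<lambda>x. \<Sum>i\<in>I. g i x)"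
proof (induction I rule: infinite_finite_induct)
  case (insert i I)
  then show ?case by (simp add: flat_at_add Cinf_sum[OF U(1)])
qed (simp_all add: flat_at_zero)

text \<open>The chain rule expresses each derivative of the composite through derivatives of g of no
  higher order, taken at the image point.\<close>

lemma flat_at_compose:
  fixes \<psi> :: "real ^ 'i \<Rightarrow> real ^ 'j::finite"
  assumes "ev_open F V" "\<psi> ` U \<subseteq> V" "\<And>b. b \<in> F \<Longrightarrow> Cinf E U (\<lambda>y. \<psi> y $ b)"
  shows "Cinf F V g \<Longrightarrow> flat_at F m (\<psi> y) g \<Longrightarrow> flat_at E m y (\<lambda>y. g (\<psi> y))"
proof (induction m arbitrary: g)
  case (Suc m)
  have "flat_at E m y (pd a (\<lambda>y. g (\<psi> y)))" if a: "a \<in> E" for a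
  proof -
    have 1: "flat_at E m y (\<lambda>x. pd b g (\<psi> x))" "Cinf E U (\<lambda>x. pd b g (\<psi> x))" if "b \<in> F" for b
      using Suc.IH[of "pd b g"] Suc.prems Cinf_compose[OF U(1) assms(1,2,3), of "pd b g"] that
      by (auto simp: flat_at_Suc Cinf_pd)
    then have "flat_at E m y (\<lambda>x. \<Sum>b\<in>F. pd b g (\<psi> x) * pd a (\<lambda>y. \<psi> y $ b) x)"
      using assms(3) a by (intro flat_at_sum flat_at_mult Cinf_mult U(1)) (auto intro: Cinf_pd)
    then show ?thesis
      using flat_at_cong[OF chain_rule(2)[OF U(1) _ assms(1,2) Cinf_differentiable[OF assms(3)]
            Cinf_differentiable[OF Suc.prems(1)] a]] by simp
  qed
  with Suc.prems show ?case by (simp add: flat_at_Suc)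
qed (simp add: flat_at_0)

lemma foldr_pd_sum:
  assumes "set as \<subseteq> E" "finite I" "\<And>i. i \<in> I \<Longrightarrow> Cinf E U (g i)" "x \<in> U"
  shows "foldr pd as (\<lambda>y. \<Sum>i\<in>I. c i * g i y) x = (\<Sum>i\<in>I. c i * foldr pd as (g i) x)"
  using assms(1,4)
proof (induction as arbitrary: x)
  case (Cons a as)
  have a: "a \<in> E" "set as \<subseteq> E" using Cons.prems by auto
  have 0: "Cinf E U (foldr pd as (g i))" if "i \<in> I" for i
    using assms(3)[OF that] a by (intro Cinf_foldr_pd)
  have "foldr pd (a # as) (\<lambda>y. \<Sum>i\<in>I. c i * g i y) x = pd a (\<lambda>y. \<Sum>i\<in>I. c i * foldr pd as (g i) y) x"
    using Cons a by (auto intro!: pd_cong[OF U(1)])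
  also have "\<dots> = (\<Sum>i\<in>I. pd a (\<lambda>y. c i * foldr pd as (g i) y) x)"
    using assms(2) 0
  proof (induction I rule: finite_induct)
    case (insert i I)
    have "Cinf E U (\<lambda>y. c i * foldr pd as (g i) y)" "Cinf E U (\<lambda>y. \<Sum>i\<in>I. c i * foldr pd as (g i) y)"
      using insert by (auto intro!: Cinf_mult Cinf_sum U(1))
    with insert show ?case
      using pd_add[OF U(1) Cons.prems(2) a(1) Cinf_differentiable Cinf_differentiable] by simp
  qed simp
  also have "\<dots> = (\<Sum>i\<in>I. c i * foldr pd (a # as) (g i) x)"
    using Cinf_differentiable[OF 0] pd_mult[OF U(1) Cons.prems(2) a(1) differentiable_on_const]
    by (intro sum.cong refl) simp
  finally show ?case .
qed simp

lemma foldr_pd_add: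
  assumes "set as \<subseteq> E" "Cinf E U g" "Cinf E U h"
  shows "foldr pd as (\<lambda>x. g x + h x) y = foldr pd as g y + foldr pd as h y"
  using foldr_pd_sum[of as "{True, False}" "\<lambda>i. if i then g else h" y "\<lambda>_. 1"] assms U(2) by simp

lemma foldr_pd_cmult:
  assumes "set as \<subseteq> E" "Cinf E U g"
  shows "foldr pd as (\<lambda>x. c * g x) y = c * foldr pd as g y"
  using foldr_pd_sum[of as "{()}" "\<lambda>_. g" y "\<lambda>_. c"] assms U(2) by simp

end

section \<open>Evaluating the Taylor sum on products with a coordinate\<close>

section \<open>Pullback along morphisms\<close>

text \<open>Only one of the derivatives can hit the linear factor, and \<open>count\<close> tells in
  how many ways.\<close>

lemma foldr_pd_component_mult:
  assumes "ev_open E U" "a \<in> E" "Cinf E U g"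
  shows "set as \<subseteq> E \<Longrightarrow> x \<in> U \<Longrightarrow> foldr pd as (\<lambda>y. y $ a * g y) x
    = x $ a * foldr pd as g x + of_nat (count (mset as) a) * foldr pd (remove1 a as) g x"
proof (induction as arbitrary: x)
  case (Cons c as)
  have c: "c \<in> E" "set as \<subseteq> E" using Cons.prems by auto
  have r: "set (remove1 a as) \<subseteq> E" using c(2) set_remove1_subset[of a as] by blast
  define G H where "G = foldr pd as g" and "H = foldr pd (remove1 a as) g"
  have GH: "G differentiable_on U" "H differentiable_on U"
    using c r assms(3) by (auto simp: G_def H_def intro!: Cinf_differentiable Cinf_foldr_pd)
  have v: "(\<lambda>x. x $ a) differentiable_on U" by (rule Cinf_differentiable[OF Cinf_component])
  have "foldr pd (c # as) (\<lambda>y. y $ a * g y) x = pd c (\<lambda>x. x $ a * G x + of_nat (count (mset as) a) * H x) x"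
    using Cons c by (auto intro!: pd_cong[OF assms(1)] simp: G_def H_def)
  also have "\<dots> = x $ a * pd c G x + (if c = a then G x else 0) + of_nat (count (mset as) a) * pd c H x"
    using pd_add[OF assms(1) Cons.prems(2) c(1), of "\<lambda>x. x $ a * G x" "\<lambda>x. of_nat (count (mset as) a) * H x"]
      pd_mult[OF assms(1) Cons.prems(2) c(1) v GH(1)]
      pd_mult[OF assms(1) Cons.prems(2) c(1) differentiable_on_const GH(2)] GH v
    by (simp add: pd_component)
  also have "\<dots> = x $ a * foldr pd (c # as) g x + of_nat (count (mset (c # as)) a) * foldr pd (remove1 a (c # as)) g x"
  proof (cases "c = a")
    case True
    \<comment> \<open>The missing a is restored in front instead of at its old place in the list, a
      difference which \<open>foldr_pd_mset\<close> ignores.\<close>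
    have "pd c H x = G x" if "a \<in> set as"
    proof -
      have "foldr pd (a # remove1 a as) g x = foldr pd as g x"
        using that r c(2) assms(2) Cons.prems(2) by (intro foldr_pd_mset[OF assms(1,3)]) auto
      then show ?thesis using True by (simp add: G_def H_def)
    qed
    moreover have "count (mset as) a = 0" if "a \<notin> set as" using that by (simp add: count_mset_0_iff)
    ultimately show ?thesis using True by (cases "a \<in> set as") (simp_all add: G_def H_def algebra_simps)
  qed (simp add: G_def H_def)
  finally show ?case .
qed simp

lemma gcoeff_ggen_mult:
  fixes h :: "'i::{finite,linorder} grass"
  shows "gcoeff (ggen a * h) S = (if a \<in> S then (-1) ^ ginv {a} (S - {a}) * gcoeff h (S - {a}) else 0)"
proof -
  have "gcoeff (ggen a * h) S = (\<Sum>T\<in>Pow S. if T = {a} then (-1) ^ ginv {a} (S - {a}) * gcoeff h (S - {a}) else 0)"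
    unfolding gcoeff_mult by (intro sum.cong) (auto simp: gcoeff_ggen)
  then show ?thesis by simp
qed

text \<open>Membership in the k-th power of the ideal generated by the odd generators.\<close>

definition glow :: "nat \<Rightarrow> 'i::finite grass \<Rightarrow> bool" where
  "glow k f \<longleftrightarrow> (\<forall>S. card S < k \<longrightarrow> gcoeff f S = 0)"

lemma glow_mult:
  fixes f g :: "'i::{finite,linorder} grass"
  assumes "glow k f" "glow l g" shows "glow (k + l) (f * g)"
  unfolding glow_def
proof (intro allI impI)
  fix S :: "'i set" assume S: "card S < k + l"
  have "gcoeff f T = 0 \<or> gcoeff g (S - T) = 0" if "T \<in> Pow S" for T
  proof -
    have "card S = card T + card (S - T)"
      using that by (metis PowD card_mono card_Diff_subset finite le_add_diff_inverse)
    with S have "card T < k \<or> card (S - T) < l" by linarith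
    with assms show ?thesis by (auto simp: glow_def)
  qed
  then show "gcoeff (f * g) S = 0"
    unfolding gcoeff_mult by (intro sum.neutral) auto
qed

text \<open>All monomials of the power would have degree at least \<open>Suc (CARD('i))\<close>, and
  there are none. This is why \<open>pullback\<close> may cut its exponents off at
  \<open>CARD('i)\<close>.\<close>

lemma nilpotent_power:
  fixes f :: "'i::{finite,linorder} grass"
  assumes "gcoeff f {} = 0" shows "f ^ Suc (CARD('i)) = 0"
proof -
  have "glow 1 f" using assms by (auto simp: glow_def)
  then have "glow k (f ^ k)" for k
  proof (induction k)
    case (Suc k)
    then show ?case using glow_mult[of 1 f k "f ^ k"] by simp
  qed (simp add: glow_def)
  from this[of "Suc (CARD('i))"] show ?thesis
    by (intro grass_eqI) (simp add: glow_def card_mono le_imp_less_Suc del: power_Suc)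
qed

lemma odd_square: "gpar 1 f \<Longrightarrow> f * f = (0 :: 'i::{finite,linorder} grass)"
  using gpar_commute[of 1 f 1 f] by (simp add: eq_neg_iff_add_eq_0 flip: scaleR_2)

lemma gcoeff_empty_mult: "gcoeff (f * g) {} = gcoeff f {} * gcoeff (g :: 'i::{finite,linorder} grass) {}"
  by (simp add: gcoeff_mult)

lemma gpar_odd_empty: "gpar 1 f \<Longrightarrow> gcoeff f {} = 0"
  by (force simp: gpar_def)

lemma even_commute: "gpar 0 f \<Longrightarrow> f * g = g * (f :: 'i::{finite,linorder} grass)"
proof (rule grass_eqI)
  fix S assume f: "gpar 0 f"
  have g: "g = gpart 0 g + gpart 1 g" 
    by (rule grass_eqI) (auto simp: gcoeff_gpart mod2_eq_iff)
  have "gpar k (gpart k g)" for k by (auto simp: gpar_def gcoeff_gpart mod2_eq_iff)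
  then have "f * gpart k g = gpart k g * f" for k
    using gpar_commute[OF f, of k "gpart k g"] by simp
  then show "gcoeff (f * g) S = gcoeff (g * f) S"
    by (subst (1 2) g) (simp only: distrib_left distrib_right)
qed

text \<open>Each factor with index below a that \<open>x a\<close> passes costs one sign, and
  \<open>insort\<close> places it exactly behind these.\<close>

lemma prod_list_odd_insort:
  fixes x :: "'a::linorder \<Rightarrow> 'i::{finite,linorder} grass"
  assumes "sorted L" "distinct L" "a \<notin> set L" "\<And>b. b \<in> insert a (set L) \<Longrightarrow> gpar 1 (x b)"
  shows "x a * prod_list (map x L) = (-1) ^ card {b \<in> set L. b < a} * prod_list (map x (insort a L))"
  using assms
proof (induction L)
  case (Cons b L)
  show ?case
  proof (cases "a \<le> b")
    case True
    with Cons.prems have "{c \<in> set (b # L). c < a} = {}" by auto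
    then have c: "card {c \<in> set (b # L). c < a} = 0" by (simp only: card.empty)
    show ?thesis unfolding c using True by simp
  next
    case False
    with Cons.prems have "{c \<in> set (b # L). c < a} = insert b {c \<in> set L. c < a}" by auto
    then have c: "card {c \<in> set (b # L). c < a} = Suc (card {c \<in> set L. c < a})"
      using Cons.prems by simp
    have "x a * x b = - (x b * x a)" using gpar_commute[of 1 "x a" 1 "x b"] Cons.prems by simp
    then have "x a * prod_list (map x (b # L)) = - (x b * (x a * prod_list (map x L)))"
      by (simp add: mult.assoc[symmetric])
    also have "x a * prod_list (map x L) = (-1) ^ card {c \<in> set L. c < a} * prod_list (map x (insort a L))"
      using Cons.prems by (intro Cons.IH) auto
    finally show ?thesis
      unfolding c using False by (simp add: minus_one_power_iff)
  qed
qed simp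

lemma prod_list_odd_dup:
  fixes x :: "'a \<Rightarrow> 'i::{finite,linorder} grass"
  assumes "a \<in> set L" "\<And>b. b \<in> set L \<Longrightarrow> gpar 1 (x b)"
  shows "x a * prod_list (map x L) = 0"
  using assms
proof (induction L)
  case (Cons b L)
  show ?case
  proof (cases "a = b")
    case True
    then show ?thesis using odd_square[of "x b"] Cons.prems by (simp add: mult.assoc[symmetric])
  next
    case False
    have "x a * x b = - (x b * x a)" using gpar_commute[of 1 "x a" 1 "x b"] Cons.prems by simp
    then have "x a * prod_list (map x (b # L)) = - (x b * (x a * prod_list (map x L)))"
      by (simp add: mult.assoc[symmetric])
    then show ?thesis using False Cons by simp
  qed
qed simp

text \<open>Even factors commute with everything, so the additional factor can be moved from its
  place in the list to the front.\<close>

lemma prod_list_power_upd: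
  fixes x :: "'a \<Rightarrow> 'i::{finite,linorder} grass"
  assumes "distinct L" "a \<in> set L" "\<And>b. gpar 0 (x b)"
  shows "prod_list (map (\<lambda>b. x b ^ (\<beta>(a := Suc (\<beta> a))) b) L) = x a * prod_list (map (\<lambda>b. x b ^ \<beta> b) L)"
  using assms
proof (induction L)
  case (Cons b L)
  have s: "prod_list (map (\<lambda>b. x b ^ (\<beta>(a := Suc (\<beta> a))) b) L) = prod_list (map (\<lambda>b. x b ^ \<beta> b) L)"
    if "a \<notin> set L" using that by (intro arg_cong[where f=prod_list] map_cong) auto
  show ?case
  proof (cases "a = b")
    case True
    with Cons.prems s show ?thesis by (simp add: mult.assoc)
  next
    case False
    have "x b ^ \<beta> b * (x a * y) = x a * (x b ^ \<beta> b * y)" for y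
      using even_commute[OF gpar_power[OF Cons.prems(3)], of b "\<beta> b" "x a"] by (metis mult.assoc)
    with False Cons show ?thesis by simp
  qed
qed simp

lemma gpar_prod_list_even: "(\<And>b. b \<in> set L \<Longrightarrow> gpar 0 (x b)) \<Longrightarrow> gpar 0 (prod_list (map x L) :: 'i::{finite,linorder} grass)"
  by (induction L) (auto intro: gpar_one gpar_mult_even)

lemma gpar_prod_list_odd: "(\<And>b. b \<in> set L \<Longrightarrow> gpar 1 (x b)) \<Longrightarrow> gpar (length L) (prod_list (map x L) :: 'i::{finite,linorder} grass)"
proof (induction L)
  case (Cons a L)
  then show ?case using gpar_mult[of 1 "x a" "length L" "prod_list (map x L)"] by simp
qed (simp add: gpar_one)

lemma prod_fact_upd:
  fixes \<alpha> :: "'i::finite \<Rightarrow> nat"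
  assumes "\<alpha> a \<noteq> 0" "a \<in> E"
  shows "(\<Prod>b\<in>E. fact (\<alpha> b) :: real) = of_nat (\<alpha> a) * (\<Prod>b\<in>E. fact ((\<alpha>(a := \<alpha> a - 1)) b))"
proof -
  have "fact (\<alpha> b) = (if b = a then of_nat (\<alpha> a) else 1) * (fact ((\<alpha>(a := \<alpha> a - 1)) b) :: real)" for b
    using assms(1) by (auto simp: fact_reduce)
  then have "(\<Prod>b\<in>E. fact (\<alpha> b) :: real) = (\<Prod>b\<in>E. if b = a then of_nat (\<alpha> a) else 1) * (\<Prod>b\<in>E. fact ((\<alpha>(a := \<alpha> a - 1)) b))"
    by (simp only: prod.distrib)
  then show ?thesis using assms(2) by simp
qed

text \<open>\<open>nilmono\<close>, \<open>oddmono\<close> and \<open>pcoef\<close> are the three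
  factors of a summand of \<open>pullback\<close>: powers of nilpotent parts, the product of odd
  images, and the Taylor coefficient at the body. Their parities and smoothness are handled
  separately.\<close>

definition nilmono :: "'i set \<Rightarrow> ('i \<Rightarrow> 'i sfun) \<Rightarrow> ('i \<Rightarrow> nat) \<Rightarrow> 'i::{finite,linorder} sfun" where
  "nilmono E \<phi> \<alpha> x = prod_list (map (\<lambda>a. (\<phi> a x - of_real (gcoeff (\<phi> a x) {})) ^ \<alpha> a) (sorted_list_of_set E))"

definition oddmono :: "('i \<Rightarrow> 'i sfun) \<Rightarrow> 'i set \<Rightarrow> 'i::{finite,linorder} sfun" where
  "oddmono \<phi> S x = prod_list (map (\<lambda>s. \<phi> s x) (sorted_list_of_set S))"

definition pcoef :: "'i set \<Rightarrow> ('i \<Rightarrow> 'i sfun) \<Rightarrow> 'i sfun \<Rightarrow> 'i set \<Rightarrow> ('i \<Rightarrow> nat) \<Rightarrow> real ^ 'i::{finite,linorder} \<Rightarrow> real" where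
  "pcoef E \<phi> f S \<alpha> x = mpd \<alpha> (\<lambda>y. gcoeff (f y) S) (body E \<phi> x) / (\<Prod>a\<in>E. fact (\<alpha> a))"

lemma pullback_eq:
  fixes \<phi> :: "'i \<Rightarrow> 'i::{finite,linorder} sfun"
  shows "pullback E N \<phi> f x = (\<Sum>S\<in>Pow N. \<Sum>\<alpha>\<in>mindices E CARD('i). pcoef E \<phi> f S \<alpha> x *\<^sub>R (nilmono E \<phi> \<alpha> x * oddmono \<phi> S x))"
  by (simp add: pullback_def nilmono_def oddmono_def pcoef_def mindices_def)

text \<open>An upper bound for the order of the derivatives that \<open>pullback\<close> evaluates: it is a sum over multi-indices
  with at most \<open>CARD('i)\<close> entries, each at most \<open>CARD('i)\<close>, since higher powers of nilpotents vanish.\<close>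

definition jetorder :: "'i::finite itself \<Rightarrow> nat" where
  "jetorder _ = CARD('i) * CARD('i)"

text \<open>Generated by left multiplication with one coordinate at a time, the product that can be
  evaluated directly in the sum defining \<open>pullback\<close>. General products follow in
  \<open>polysf_mult\<close>.\<close>

inductive polysf :: "'i set \<Rightarrow> 'i set \<Rightarrow> 'i::{finite,linorder} sfun \<Rightarrow> bool" for E N where
  const: "polysf E N (\<lambda>x. of_real r)"
| add: "polysf E N p \<Longrightarrow> polysf E N p' \<Longrightarrow> polysf E N (\<lambda>x. p x + p' x)"
| mult: "a \<in> E \<union> N \<Longrightarrow> polysf E N p \<Longrightarrow> polysf E N (\<lambda>x. coord E a x * p x)"

text \<open>A map between superdomains with the same index sets. The parity condition sends even
  coordinates to even elements, so that the factors of \<open>nilmono\<close> commute.\<close>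

definition morphism :: "'i set \<Rightarrow> 'i set \<Rightarrow> (real, 'i) vec set \<Rightarrow> (real, 'i) vec set \<Rightarrow> ('i \<Rightarrow> 'i::{finite,linorder} sfun) \<Rightarrow> bool" where
  "morphism E N U V \<phi> \<longleftrightarrow> E \<inter> N = {} \<and> ev_open E U \<and> ev_open E V \<and>
     (\<forall>a\<in>E \<union> N. superfun E N U (\<phi> a) \<and> (\<forall>x\<in>U. gpar (sdeg E a) (\<phi> a x))) \<and> body E \<phi> ` U \<subseteq> V"

lemma polysf_superfun:
  assumes "ev_open E U" shows "polysf E N p \<Longrightarrow> superfun E N U p"
  by (induction rule: polysf.induct)
    (auto intro: superfun_of_real superfun_add[OF assms] superfun_mult[OF assms] superfun_coord)

context
  fixes E N :: "'i::{finite,linorder} set" and U V and \<phi> :: "'i \<Rightarrow> 'i sfun"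
  assumes m: "morphism E N U V \<phi>"
begin

lemma morphism_facts:
  "E \<inter> N = {}" "ev_open E U" "ev_open E V"
  "a \<in> E \<union> N \<Longrightarrow> superfun E N U (\<phi> a)" "x \<in> U \<Longrightarrow> a \<in> E \<union> N \<Longrightarrow> gpar (sdeg E a) (\<phi> a x)"
  "x \<in> U \<Longrightarrow> body E \<phi> x \<in> V" "body E \<phi> ` U \<subseteq> V"
  using m by (auto simp: morphism_def)

lemma Cinf_body: "b \<in> E \<Longrightarrow> Cinf E U (\<lambda>x. body E \<phi> x $ b)"
  using superfun_Cinf[OF morphism_facts(4)] by (simp add: body_def)

lemma mpd_add:
  "superfun E N V f \<Longrightarrow> superfun E N V g \<Longrightarrow> x \<in> U \<Longrightarrow> \<alpha> \<in> mindices E m \<Longrightarrow>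
    pcoef E \<phi> (\<lambda>y. f y + g y) S \<alpha> x = pcoef E \<phi> f S \<alpha> x + pcoef E \<phi> g S \<alpha> x"
  using foldr_pd_add[OF morphism_facts(3,6) mindices_set superfun_Cinf superfun_Cinf]
  by (simp add: pcoef_def mpd_mlist add_divide_distrib)

lemma pullback_add:
  "superfun E N V f \<Longrightarrow> superfun E N V g \<Longrightarrow> x \<in> U \<Longrightarrow>
    pullback E N \<phi> (\<lambda>y. f y + g y) x = pullback E N \<phi> f x + pullback E N \<phi> g x"
  by (simp add: pullback_eq mpd_add scaleR_left_distrib sum.distrib)

lemma pullback_scaleR:
  "superfun E N V f \<Longrightarrow> x \<in> U \<Longrightarrow> pullback E N \<phi> (\<lambda>y. r *\<^sub>R f y) x = r *\<^sub>R pullback E N \<phi> f x"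
  using foldr_pd_cmult[OF morphism_facts(3,6) mindices_set superfun_Cinf]
  by (simp add: pullback_eq pcoef_def mpd_mlist scaleR_sum_right)

lemma pullback_cong:
  assumes "x \<in> U" "\<And>y. y \<in> V \<Longrightarrow> f y = g y"
  shows "pullback E N \<phi> f x = pullback E N \<phi> g x"
proof -
  have "pcoef E \<phi> f S \<alpha> x = pcoef E \<phi> g S \<alpha> x" if "\<alpha> \<in> mindices E m" for S \<alpha> m
    using foldr_pd_cong[OF morphism_facts(3) mindices_set[OF that] _ morphism_facts(6)[OF assms(1)],
        of "\<lambda>y. gcoeff (f y) S" "\<lambda>y. gcoeff (g y) S"] assms(2)
    by (simp add: pcoef_def mpd_mlist)
  then show ?thesis by (simp add: pullback_eq)
qed

lemma pullback_flat:
  assumes "x \<in> U" "\<And>S. flat_at E (jetorder TYPE('i)) (body E \<phi> x) (\<lambda>y. gcoeff (f y) S)"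
  shows "pullback E N \<phi> f x = 0"
proof -
  have "pcoef E \<phi> f S \<alpha> x = 0" if "\<alpha> \<in> mindices E CARD('i)" for S \<alpha>
    using mindices_set[OF that] mindices_length[OF that] assms(2)[of S]
    by (simp add: pcoef_def mpd_mlist flat_at_def jetorder_def)
  then show ?thesis by (simp add: pullback_eq)
qed

lemma pullback_zero: "x \<in> U \<Longrightarrow> pullback E N \<phi> (\<lambda>y. 0) x = 0"
  using pullback_scaleR[OF superfun_zero, of x 0] by simp

lemma gpar_nilfactor: "x \<in> U \<Longrightarrow> a \<in> E \<Longrightarrow> gpar 0 (\<phi> a x - of_real (gcoeff (\<phi> a x) {}))"
  using morphism_facts(5)[of x a] by (intro gpar_diff gpar_of_real) (simp add: sdeg_def)

lemma gpar_odd: "x \<in> U \<Longrightarrow> a \<in> N \<Longrightarrow> gpar 1 (\<phi> a x)"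
  using morphism_facts(5)[of x a] morphism_facts(1) by (auto simp: sdeg_def split: if_splits)

lemma gpar_nilmono: "x \<in> U \<Longrightarrow> gpar 0 (nilmono E \<phi> \<alpha> x)"
  unfolding nilmono_def by (intro gpar_prod_list_even gpar_power gpar_nilfactor) auto

lemma gpar_oddmono: "x \<in> U \<Longrightarrow> S \<subseteq> N \<Longrightarrow> gpar (card S) (oddmono \<phi> S x)"
  using gpar_prod_list_odd[of "sorted_list_of_set S" "\<lambda>s. \<phi> s x"] gpar_odd[of x]
  by (auto simp: oddmono_def)

lemma nilmono_upd:
  assumes "x \<in> U" "a \<in> E"
  shows "nilmono E \<phi> (\<beta>(a := Suc (\<beta> a))) x = (\<phi> a x - of_real (gcoeff (\<phi> a x) {})) * nilmono E \<phi> \<beta> x"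
proof -
  let ?x = "\<lambda>b. if b \<in> E then \<phi> b x - of_real (gcoeff (\<phi> b x) {}) else 0"
  have e: "nilmono E \<phi> \<gamma> x = prod_list (map (\<lambda>b. ?x b ^ \<gamma> b) (sorted_list_of_set E))" for \<gamma>
    unfolding nilmono_def by (intro arg_cong[where f=prod_list] map_cong) auto
  have "gpar 0 (?x b)" for b using gpar_nilfactor[OF assms(1)] by auto
  then show ?thesis
    unfolding e using prod_list_power_upd[of "sorted_list_of_set E" a ?x \<beta>] assms by simp
qed

lemma nilmono_high:
  assumes "x \<in> U" "a \<in> E" "\<beta> a = CARD('i)"
  shows "(\<phi> a x - of_real (gcoeff (\<phi> a x) {})) * nilmono E \<phi> \<beta> x = 0"
proof -
  have z: "(\<phi> a x - of_real (gcoeff (\<phi> a x) {})) ^ Suc (CARD('i)) = 0"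
    by (rule nilpotent_power) (simp add: gcoeff_of_real)
  have "prod_list (map f L) = 0" if "a \<in> set L" "f a = (0::'i grass)" for f L
    using that by (induction L) auto
  then show ?thesis
    unfolding nilmono_upd[OF assms(1,2), symmetric] unfolding nilmono_def
    using z assms(2,3) by (simp del: power_Suc)
qed

lemma oddmono_insert:
  assumes "x \<in> U" "a \<in> N" "S \<subseteq> N"
  shows "\<phi> a x * oddmono \<phi> S x = (if a \<in> S then 0 else (-1) ^ ginv {a} S * oddmono \<phi> (insert a S) x)"
proof (cases "a \<in> S")
  case True
  then show ?thesis
    unfolding oddmono_def using prod_list_odd_dup[of a "sorted_list_of_set S" "\<lambda>s. \<phi> s x"] gpar_odd assms by auto
next
  case False
  have "sorted_list_of_set (insert a S) = insort a (sorted_list_of_set S)"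
    using False by (simp add: sorted_list_of_set_insert)
  then show ?thesis
    unfolding oddmono_def ginv_single
    using False prod_list_odd_insort[of "sorted_list_of_set S" a "\<lambda>s. \<phi> s x"] gpar_odd assms by auto
qed

text \<open>Write \<open>\<phi> a x\<close> as r + n with r its body. The Leibniz rule for a
  coordinate gives r times the Taylor coefficient plus the coefficient with the exponent of a
  lowered by one; re-indexing turns the latter into multiplication by n.\<close>

lemma pullback_coord_mult_even:
  assumes "superfun E N V f" "x \<in> U" "a \<in> E"
  shows "pullback E N \<phi> (\<lambda>y. coord E a y * f y) x = \<phi> a x * pullback E N \<phi> f x"
proof -
  define n where "n = \<phi> a x - of_real (gcoeff (\<phi> a x) {})"
  define r where "r = gcoeff (\<phi> a x) {}"
  let ?I = "mindices E CARD('i)" and ?y = "body E \<phi> x"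
  have y: "?y \<in> V" using assms(2) by (rule morphism_facts)
  define G where "G = (\<lambda>S \<alpha>. pcoef E \<phi> f S \<alpha> x)"
  have c: "pcoef E \<phi> (\<lambda>y. coord E a y * f y) S \<alpha> x
      = r * G S \<alpha> + (if \<alpha> a = 0 then 0 else G S (\<alpha>(a := \<alpha> a - 1)))" if \<alpha>: "\<alpha> \<in> ?I" for S \<alpha>
  proof -
    let ?g = "\<lambda>y. gcoeff (f y) S"
    have "mpd \<alpha> (\<lambda>y. gcoeff (coord E a y * f y) S) ?y = mpd \<alpha> (\<lambda>y. y $ a * ?g y) ?y"
      using assms(3) by (simp add: coord_def flip: scaleR_conv_of_real)
    also have "\<dots> = ?y $ a * mpd \<alpha> ?g ?y + of_nat (\<alpha> a) * foldr pd (remove1 a (mlist \<alpha>)) ?g ?y"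
      unfolding mpd_mlist
      using foldr_pd_component_mult[OF morphism_facts(3) assms(3) superfun_Cinf[OF assms(1)] mindices_set[OF \<alpha>] y]
      by (simp add: count_mlist)
    finally have e: "mpd \<alpha> (\<lambda>y. gcoeff (coord E a y * f y) S) ?y
      = r * mpd \<alpha> ?g ?y + of_nat (\<alpha> a) * foldr pd (remove1 a (mlist \<alpha>)) ?g ?y"
      using assms(3) by (simp add: r_def body_def)
    show ?thesis
    proof (cases "\<alpha> a = 0")
      case True
      then show ?thesis using e by (simp add: pcoef_def G_def)
    next
      case False
      have "mset (remove1 a (mlist \<alpha>)) = mset (mlist (\<alpha>(a := \<alpha> a - 1)))"
        by (rule multiset_eqI) (simp add: count_mlist)
      moreover have "set (remove1 a (mlist \<alpha>)) \<subseteq> E"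
        using mindices_set[OF \<alpha>] set_remove1_subset[of a "mlist \<alpha>"] by blast
      ultimately have 1: "foldr pd (remove1 a (mlist \<alpha>)) ?g ?y = mpd (\<alpha>(a := \<alpha> a - 1)) ?g ?y"
        unfolding mpd_mlist by (intro foldr_pd_mset[OF morphism_facts(3) superfun_Cinf[OF assms(1)]] y)
      have 2: "(\<Prod>b\<in>E. fact (\<alpha> b) :: real) = of_nat (\<alpha> a) * (\<Prod>b\<in>E. fact ((\<alpha>(a := \<alpha> a - 1)) b))"
        using False assms(3) by (rule prod_fact_upd)
      show ?thesis using False e 1 2 by (simp add: pcoef_def G_def add_divide_distrib)
    qed
  qed
  have "(\<Sum>\<alpha>\<in>?I. (if \<alpha> a = 0 then 0 else G S (\<alpha>(a := \<alpha> a - 1))) *\<^sub>R nilmono E \<phi> \<alpha> x)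
      = n * (\<Sum>\<alpha>\<in>?I. G S \<alpha> *\<^sub>R nilmono E \<phi> \<alpha> x)" for S
  proof -
    have "(\<Sum>\<alpha>\<in>?I. (if \<alpha> a = 0 then 0 else G S (\<alpha>(a := \<alpha> a - 1))) *\<^sub>R nilmono E \<phi> \<alpha> x)
        = (\<Sum>\<alpha>\<in>{\<alpha>\<in>?I. \<alpha> a \<noteq> 0}. G S (\<alpha>(a := \<alpha> a - 1)) *\<^sub>R nilmono E \<phi> \<alpha> x)"
      by (intro sum.mono_neutral_cong_right finite_mindices) auto
    also have "\<dots> = (\<Sum>\<beta>\<in>{\<beta>\<in>?I. \<beta> a < CARD('i)}. G S \<beta> *\<^sub>R nilmono E \<phi> (\<beta>(a := Suc (\<beta> a))) x)"
    proof (rule sum.reindex_bij_witness[where i="\<lambda>\<beta>. \<beta>(a := Suc (\<beta> a))" and j="\<lambda>\<alpha>. \<alpha>(a := \<alpha> a - 1)"])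
      fix \<alpha> assume \<alpha>: "\<alpha> \<in> {\<alpha>\<in>?I. \<alpha> a \<noteq> 0}"
      have 0: "(\<alpha>(a := \<alpha> a - 1)) b \<le> \<alpha> b" for b by simp
      have 1: "\<alpha> b \<le> (if b \<in> E then CARD('i) else 0)" for b using \<alpha> by (simp add: mindices_def)
      have "\<alpha>(a := \<alpha> a - 1) \<in> ?I"
        unfolding mindices_def mem_Collect_eq by (intro allI le_trans[OF 0 1])
      with \<alpha> mindices_le[of \<alpha> E "CARD('i)" a] show "\<alpha>(a := \<alpha> a - 1) \<in> {\<beta>\<in>?I. \<beta> a < CARD('i)}" by auto
    next
      fix \<beta> assume \<beta>: "\<beta> \<in> {\<beta>\<in>?I. \<beta> a < CARD('i)}"
      have 1: "\<beta> b \<le> (if b \<in> E then CARD('i) else 0)" for b using \<beta> by (simp add: mindices_def)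
      have 2: "(\<beta>(a := Suc (\<beta> a))) b \<le> (if b \<in> E then CARD('i) else 0)" for b
        using 1[of b] \<beta> assms(3) by (cases "b = a") auto
      have "\<beta>(a := Suc (\<beta> a)) \<in> ?I"
        unfolding mindices_def mem_Collect_eq by (intro allI 2)
      then show "\<beta>(a := Suc (\<beta> a)) \<in> {\<alpha>\<in>?I. \<alpha> a \<noteq> 0}"
        by simp
    qed auto
    also have "\<dots> = (\<Sum>\<beta>\<in>{\<beta>\<in>?I. \<beta> a < CARD('i)}. n * G S \<beta> *\<^sub>R nilmono E \<phi> \<beta> x)"
      by (intro sum.cong refl) (simp add: nilmono_upd[OF assms(2,3)] n_def)
    \<comment> \<open>For \<open>\<beta> a = CARD('i)\<close> the summand is killed by n, so the
      range of summation closes up again.\<close>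
    also have "\<dots> = (\<Sum>\<beta>\<in>?I. n * G S \<beta> *\<^sub>R nilmono E \<phi> \<beta> x)"
    proof (intro sum.mono_neutral_cong_left finite_mindices ballI refl)
      fix \<beta> assume \<beta>: "\<beta> \<in> ?I - {\<beta>\<in>?I. \<beta> a < CARD('i)}"
      then have "\<beta> a = CARD('i)" using mindices_le[of \<beta> E "CARD('i)" a] by auto
      then show "n * G S \<beta> *\<^sub>R nilmono E \<phi> \<beta> x = 0"
        using nilmono_high[OF assms(2,3)] by (simp add: n_def)
    qed auto
    finally show ?thesis by (simp add: sum_distrib_left)
  qed
  moreover have "pullback E N \<phi> h x = (\<Sum>S\<in>Pow N. (\<Sum>\<alpha>\<in>?I. pcoef E \<phi> h S \<alpha> x *\<^sub>R nilmono E \<phi> \<alpha> x) * oddmono \<phi> S x)" for h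
    by (simp add: pullback_eq sum_distrib_right)
  ultimately have "pullback E N \<phi> (\<lambda>y. coord E a y * f y) x
      = (\<Sum>S\<in>Pow N. (r *\<^sub>R (\<Sum>\<alpha>\<in>?I. G S \<alpha> *\<^sub>R nilmono E \<phi> \<alpha> x) + n * (\<Sum>\<alpha>\<in>?I. G S \<alpha> *\<^sub>R nilmono E \<phi> \<alpha> x)) * oddmono \<phi> S x)"
    by (simp add: c scaleR_left_distrib sum.distrib scaleR_sum_right)
  also have "\<dots> = (of_real r + n) * pullback E N \<phi> f x"
    unfolding pullback_eq G_def
    by (simp add: sum_distrib_left sum_distrib_right scaleR_conv_of_real distrib_right mult.assoc sum.distrib)
  finally show ?thesis by (simp add: n_def r_def)
qed

text \<open>Sets S containing a are matched with the sets without a. The products with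
  \<open>\<phi> a x\<close> that this matching misses belong to sets that contain a already, and
  they vanish since an odd element squares to 0.\<close>

lemma pullback_coord_mult_odd:
  assumes "superfun E N V f" "x \<in> U" "a \<in> N"
  shows "pullback E N \<phi> (\<lambda>y. coord E a y * f y) x = \<phi> a x * pullback E N \<phi> f x"
proof -
  let ?I = "mindices E CARD('i)"
  have a: "a \<notin> E" using assms(3) morphism_facts(1) by blast
  have c: "pcoef E \<phi> (\<lambda>y. coord E a y * f y) S \<alpha> x
      = (if a \<in> S then (-1) ^ ginv {a} (S - {a}) * pcoef E \<phi> f (S - {a}) \<alpha> x else 0)" if "\<alpha> \<in> ?I" for S \<alpha>
  proof (cases "a \<in> S")
    case True
    then show ?thesis
      using a foldr_pd_cmult[OF morphism_facts(3) morphism_facts(6)[OF assms(2)] mindices_set[OF that]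
          superfun_Cinf[OF assms(1), of "S - {a}"], where c = "(-1) ^ ginv {a} (S - {a})"]
      by (simp add: pcoef_def coord_def gcoeff_ggen_mult mpd_mlist)
  next
    case False
    then show ?thesis
      using a foldr_pd_cmult[OF morphism_facts(3) morphism_facts(6)[OF assms(2)] mindices_set[OF that] Cinf_const, where c = 0]
      by (simp add: pcoef_def coord_def gcoeff_ggen_mult mpd_mlist)
  qed
  have comm: "\<phi> a x * (nilmono E \<phi> \<alpha> x * y) = nilmono E \<phi> \<alpha> x * (\<phi> a x * y)" for \<alpha> y
    using even_commute[OF gpar_nilmono[OF assms(2)], of \<alpha> "\<phi> a x"] by (metis mult.assoc)
  have "pullback E N \<phi> (\<lambda>y. coord E a y * f y) x
      = (\<Sum>S\<in>{S\<in>Pow N. a \<in> S}. \<Sum>\<alpha>\<in>?I. ((-1) ^ ginv {a} (S - {a}) * pcoef E \<phi> f (S - {a}) \<alpha> x) *\<^sub>R (nilmono E \<phi> \<alpha> x * oddmono \<phi> S x))"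
    unfolding pullback_eq by (intro sum.mono_neutral_cong_right ballI sum.neutral sum.cong refl) (auto simp: c)
  also have "\<dots> = (\<Sum>S\<in>{S\<in>Pow N. a \<notin> S}. \<Sum>\<alpha>\<in>?I. ((-1) ^ ginv {a} S * pcoef E \<phi> f S \<alpha> x) *\<^sub>R (nilmono E \<phi> \<alpha> x * oddmono \<phi> (insert a S) x))"
    using assms(3)
    by (intro sum.reindex_bij_witness[where i="insert a" and j="\<lambda>S. S - {a}"]) (auto simp: insert_absorb)
  also have "\<dots> = (\<Sum>S\<in>{S\<in>Pow N. a \<notin> S}. \<phi> a x * (\<Sum>\<alpha>\<in>?I. pcoef E \<phi> f S \<alpha> x *\<^sub>R (nilmono E \<phi> \<alpha> x * oddmono \<phi> S x)))"
    unfolding sum_distrib_left using oddmono_insert[OF assms(2,3)]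
    by (intro sum.cong refl) (auto simp: comm minus_one_power_iff)
  also have "\<dots> = (\<Sum>S\<in>Pow N. \<phi> a x * (\<Sum>\<alpha>\<in>?I. pcoef E \<phi> f S \<alpha> x *\<^sub>R (nilmono E \<phi> \<alpha> x * oddmono \<phi> S x)))"
    unfolding sum_distrib_left using oddmono_insert[OF assms(2,3)]
    by (intro sum.mono_neutral_cong_left ballI sum.neutral sum.cong refl) (auto simp: comm)
  finally show ?thesis by (simp add: pullback_eq sum_distrib_left)
qed

lemma pullback_coord_mult:
  "superfun E N V f \<Longrightarrow> x \<in> U \<Longrightarrow> a \<in> E \<union> N \<Longrightarrow>
    pullback E N \<phi> (\<lambda>y. coord E a y * f y) x = \<phi> a x * pullback E N \<phi> f x"
  using pullback_coord_mult_even pullback_coord_mult_odd by blast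

lemma pullback_one: 
  assumes "x \<in> U" shows "pullback E N \<phi> (\<lambda>y. 1) x = 1"
proof -
  have one: "prod_list (map (\<lambda>a. 1 :: 'i grass) L) = 1" for L :: "'i list"
    by (induction L) auto
  have "pcoef E \<phi> (\<lambda>y. 1) S \<alpha> x = (if S = {} \<and> \<alpha> = (\<lambda>a. 0) then 1 else 0)" if "\<alpha> \<in> mindices E CARD('i)" for S \<alpha>
  proof -
    have "foldr pd as (\<lambda>y. c) = (if as = [] then (\<lambda>y. c) else (\<lambda>y. 0))" for as :: "'i list" and c :: real
      by (induction as) auto
    moreover have "mlist \<alpha> = [] \<longleftrightarrow> \<alpha> = (\<lambda>a. 0)"
      using set_mlist[of \<alpha>] mlist_zero by (auto simp: fun_eq_iff)
    ultimately show ?thesis by (auto simp: pcoef_def mpd_mlist gcoeff_one)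
  qed
  then have "pullback E N \<phi> (\<lambda>y. 1) x = (\<Sum>S\<in>Pow N. \<Sum>\<alpha>\<in>mindices E CARD('i). if \<alpha> = (\<lambda>a. 0) then
      (if S = {} then nilmono E \<phi> \<alpha> x * oddmono \<phi> S x else 0) else 0)"
    unfolding pullback_eq by (intro sum.cong refl) auto
  also have "\<dots> = (\<Sum>S\<in>Pow N. if S = {} then nilmono E \<phi> (\<lambda>a. 0) x * oddmono \<phi> S x else 0)"
    by (intro sum.cong refl, subst sum.delta[OF finite_mindices]) (simp add: mindices_def)
  also have "\<dots> = nilmono E \<phi> (\<lambda>a. 0) x * oddmono \<phi> {} x" by (subst sum.delta) auto
  also have "\<dots> = 1"
    by (simp add: nilmono_def oddmono_def one)
  finally show ?thesis .
qed

lemma pullback_of_real: "x \<in> U \<Longrightarrow> pullback E N \<phi> (\<lambda>y. of_real r) x = of_real r"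
  using pullback_scaleR[OF superfun_one, of x r] pullback_one by (simp add: of_real_def)

lemma pullback_coord: "x \<in> U \<Longrightarrow> a \<in> E \<union> N \<Longrightarrow> pullback E N \<phi> (coord E a) x = \<phi> a x"
  using pullback_coord_mult[OF superfun_one, of x a] pullback_one by simp

end

section \<open>Flat superfunctions and Taylor polynomials\<close>

definition sflat :: "'i set \<Rightarrow> nat \<Rightarrow> real ^ 'i::finite \<Rightarrow> 'i sfun \<Rightarrow> bool" where
  "sflat E m y f \<longleftrightarrow> (\<forall>S. flat_at E m y (\<lambda>x. gcoeff (f x) S))"

lemma sflat_mono: "sflat E m y f \<Longrightarrow> l \<le> m \<Longrightarrow> sflat E l y f"
  unfolding sflat_def using flat_at_mono by blast

lemma sflat_value: "sflat E m y f \<Longrightarrow> f y = 0"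
  unfolding sflat_def flat_at_def by (intro grass_eqI) (force dest: spec[of _ "[]"])

lemma sflat_mult:
  assumes "ev_open E U" "y \<in> U" "superfun E N U f" "superfun E N U g" "sflat E m y f"
  shows "sflat E m y (\<lambda>x. f x * g x)"
  unfolding sflat_def gcoeff_mult
proof (intro allI flat_at_sum[OF assms(1,2)])
  fix S T
  have *: "(-1) ^ ginv T (S - T) * gcoeff (f x) T * gcoeff (g x) (S - T)
      = gcoeff (f x) T * ((-1) ^ ginv T (S - T) * gcoeff (g x) (S - T))" for x
    by simp
  have C: "Cinf E U (\<lambda>x. (-1) ^ ginv T (S - T) * gcoeff (g x) (S - T))"
    using assms(1) superfun_Cinf[OF assms(4)] by (intro Cinf_mult Cinf_const)
  show "Cinf E U (\<lambda>x. (-1) ^ ginv T (S - T) * gcoeff (f x) T * gcoeff (g x) (S - T))"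
    unfolding * using assms(1) superfun_Cinf[OF assms(3)] C by (rule Cinf_mult)
  show "flat_at E m y (\<lambda>x. (-1) ^ ginv T (S - T) * gcoeff (f x) T * gcoeff (g x) (S - T))"
    unfolding * using assms(5) superfun_Cinf[OF assms(3)] C
    by (intro flat_at_mult[OF assms(1,2)]) (auto simp: sflat_def)
qed

lemma sflat_spd:
  assumes "ev_open E U" "y \<in> U" "superfun E N U f" "sflat E (Suc m) y f"
  shows "sflat E m y (spd E a f)"
proof (cases "a \<in> E")
  case True
  then show ?thesis using assms(4) by (simp add: sflat_def spd_def flat_at_Suc)
next
  case False
  have "flat_at E m y (\<lambda>x. gcoeff (f x) (insert a S) * (-1) ^ ginv {a} S)" for S
    using assms(3,4) flat_at_mono[of E "Suc m" y _ m]
    by (intro flat_at_mult[OF assms(1,2)] superfun_Cinf Cinf_const) (auto simp: sflat_def)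
  then show ?thesis
    using False flat_at_zero[OF assms(1,2)] unfolding sflat_def
    by (intro allI) (case_tac "a \<in> S", simp_all add: spd_def gcoeff_gderiv mult.commute)
qed

lemma polysf_cmult: "polysf E N p \<Longrightarrow> polysf E N (\<lambda>y. of_real r * p y)"
proof (induction rule: polysf.induct)
  case (const s)
  then show ?case using polysf.const[of E N "r * s"] by simp
next
  case (add p p')
  then show ?case using polysf.add by (simp add: distrib_left)
next
  case (mult a p)
  have "of_real r * (coord E a y * p y) = coord E a y * (of_real r * p y)" for y
    by (simp flip: scaleR_conv_of_real)
  with mult show ?case using polysf.mult by simp
qed

lemma polysf_mult: "polysf E N p \<Longrightarrow> polysf E N p' \<Longrightarrow> polysf E N (\<lambda>y. p y * p' y)"
proof (induction rule: polysf.induct)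
  case (add p1 p2)
  then show ?case using polysf.add by (simp add: distrib_right)
next
  case (mult a p)
  then show ?case using polysf.mult by (simp add: mult.assoc)
qed (rule polysf_cmult)

lemma polysf_coord: "a \<in> E \<union> N \<Longrightarrow> polysf E N (coord E a)"
  using polysf.mult[OF _ polysf.const[of E N 1], of a] by simp

lemma polysf_sum: "(\<And>i. i \<in> I \<Longrightarrow> polysf E N (p i)) \<Longrightarrow> polysf E N (\<lambda>y. \<Sum>i\<in>I. p i y)"
  by (induction I rule: infinite_finite_induct) (use polysf.const[of E N 0] in \<open>auto intro: polysf.add\<close>)

lemma polysf_power: "polysf E N p \<Longrightarrow> polysf E N (\<lambda>y. p y ^ n)"
  by (induction n) (use polysf.const[of E N 1] in \<open>auto intro: polysf_mult\<close>)

lemma polysf_prod_list: "(\<And>a. a \<in> set L \<Longrightarrow> polysf E N (p a)) \<Longrightarrow> polysf E N (\<lambda>y. prod_list (map (\<lambda>a. p a y) L))"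
proof (induction L)
  case (Cons a L)
  then show ?case using polysf_mult[of E N "p a" "\<lambda>y. prod_list (map (\<lambda>a. p a y) L)"] by simp
qed (use polysf.const[of E N 1] in simp)

definition cmono :: "'i set \<Rightarrow> real ^ 'i \<Rightarrow> ('i \<Rightarrow> nat) \<Rightarrow> real ^ 'i::finite \<Rightarrow> real" where
  "cmono E y0 \<alpha> y = (\<Prod>a\<in>E. (y $ a - y0 $ a) ^ \<alpha> a)"

lemma polysf_cmono:
  fixes E N :: "'i::{finite,linorder} set"
  shows "polysf E N (\<lambda>y. of_real (cmono E y0 \<alpha> y))"
proof -
  have "polysf E N (\<lambda>y. of_real (y $ a - y0 $ a))" if "a \<in> E" for a
    using polysf.add[OF polysf_coord polysf.const, of a E N "- (y0 $ a)"] that by (simp add: coord_def)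
  moreover have "of_real (\<Prod>a\<in>A. f a) = prod_list (map (\<lambda>a. of_real (f a) :: 'i grass) (sorted_list_of_set A))" if "finite A"
    for A and f :: "'i \<Rightarrow> real"
  proof -
    have "of_real (prod_list (map f L)) = prod_list (map (\<lambda>a. of_real (f a) :: 'i grass) L)" for L
      by (induction L) auto
    then show ?thesis using that
      by (metis prod.distinct_set_conv_list distinct_sorted_list_of_set set_sorted_list_of_set)
  qed
  ultimately show ?thesis
    unfolding cmono_def by (auto simp del: of_real_diff intro!: polysf_prod_list polysf_power)
qed

text \<open>For \<open>\<alpha> a = 0\<close> the factor \<open>of_nat (\<alpha> a)\<close>
  vanishes, so the truncated subtraction in the exponent does no harm.\<close>

lemma pd_cmono:
  assumes "a \<in> E"
  shows "pd a (\<lambda>y. c * cmono E y0 \<alpha> y) = (\<lambda>y. c * of_nat (\<alpha> a) * cmono E y0 (\<alpha>(a := \<alpha> a - 1)) y)"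
proof
  fix y :: "real ^ 'a"
  define R where "R = (\<Prod>b\<in>E - {a}. (y $ b - y0 $ b) ^ \<alpha> b)"
  have s: "cmono E y0 \<beta> z = (z $ a - y0 $ a) ^ \<beta> a * (\<Prod>b\<in>E - {a}. (z $ b - y0 $ b) ^ \<beta> b)" for \<beta> z
    unfolding cmono_def using assms by (simp add: prod.remove)
  have R: "(\<Prod>b\<in>E - {a}. (y $ b - y0 $ b) ^ (\<alpha>(a := \<alpha> a - 1)) b) = R"
    unfolding R_def by (intro prod.cong) auto
  have "(\<lambda>t. c * cmono E y0 \<alpha> (y + t *\<^sub>R axis a 1)) = (\<lambda>t. c * ((y $ a + t - y0 $ a) ^ \<alpha> a * R))"
    unfolding s R_def by (intro ext arg_cong2[where f="(*)"] refl prod.cong) (auto simp: axis_def)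
  moreover have "((\<lambda>t. c * ((y $ a + t - y0 $ a) ^ \<alpha> a * R)) has_real_derivative
      c * (of_nat (\<alpha> a) * (y $ a - y0 $ a) ^ (\<alpha> a - 1) * R)) (at 0)"
    by (auto intro!: derivative_eq_intros)
  moreover have "cmono E y0 (\<alpha>(a := \<alpha> a - 1)) y = (y $ a - y0 $ a) ^ (\<alpha> a - 1) * R"
    unfolding s R by simp
  ultimately show "pd a (\<lambda>y. c * cmono E y0 \<alpha> y) y = c * of_nat (\<alpha> a) * cmono E y0 (\<alpha>(a := \<alpha> a - 1)) y"
    unfolding pd_def by (simp add: DERIV_imp_deriv)
qed

text \<open>Up to factorials, the monomials centred at y0 are dual to the derivatives at y0. The
  constant c is general because it absorbs the exponents that come down during the
  induction.\<close>

lemma foldr_pd_cmono: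
  "\<lbrakk>set as \<subseteq> E; \<And>a. \<alpha> a \<noteq> 0 \<Longrightarrow> a \<in> E\<rbrakk> \<Longrightarrow> foldr pd as (\<lambda>y. c * cmono E y0 \<alpha> y) y0
    = (if count (mset as) = \<alpha> then c * (\<Prod>a\<in>E. fact (\<alpha> a)) else 0)"
proof (induction as arbitrary: c \<alpha> rule: rev_induct)
  case Nil
  show ?case
  proof (cases "\<alpha> = (\<lambda>_. 0)")
    case True
    then show ?thesis by (simp add: cmono_def)
  next
    case False
    then obtain a where "\<alpha> a \<noteq> 0" by auto
    then have "cmono E y0 \<alpha> y0 = 0" using Nil(2)[of a] unfolding cmono_def by (intro prod_zero) auto
    with False show ?thesis by auto
  qed
next
  case (snoc a as)
  have a: "a \<in> E" "set as \<subseteq> E" using snoc.prems by auto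
  have "foldr pd (as @ [a]) (\<lambda>y. c * cmono E y0 \<alpha> y) y0
      = foldr pd as (\<lambda>y. c * of_nat (\<alpha> a) * cmono E y0 (\<alpha>(a := \<alpha> a - 1)) y) y0"
    by (simp add: pd_cmono[OF a(1)])
  also have "\<dots> = (if count (mset as) = \<alpha>(a := \<alpha> a - 1) then c * of_nat (\<alpha> a) * (\<Prod>b\<in>E. fact ((\<alpha>(a := \<alpha> a - 1)) b)) else 0)"
    using snoc.prems(2) a by (intro snoc.IH) (auto split: if_splits)
  also have "\<dots> = (if count (mset (as @ [a])) = \<alpha> then c * (\<Prod>a\<in>E. fact (\<alpha> a)) else 0)"
  proof (cases "\<alpha> a = 0")
    case True
    then have "count (mset (as @ [a])) \<noteq> \<alpha>" by (auto simp: fun_eq_iff intro!: exI[of _ a])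
    with True show ?thesis by simp
  next
    case False
    then have "count (mset as) = \<alpha>(a := \<alpha> a - 1) \<longleftrightarrow> count (mset (as @ [a])) = \<alpha>"
      by (auto simp: fun_eq_iff split: if_splits)
    with prod_fact_upd[of \<alpha> a E, OF False a(1)] show ?thesis by simp
  qed
  finally show ?case .
qed

lemma prod_list_ggen:
  "sorted L \<Longrightarrow> distinct L \<Longrightarrow> gcoeff (prod_list (map ggen L)) S = (if S = set (L :: 'i::{finite,linorder} list) then 1 else 0)"
proof (induction L arbitrary: S)
  case (Cons a L)
  have "{t \<in> set L. t < a} = {}" using Cons.prems by auto
  then have "ginv {a} (set L) = 0" by (simp add: ginv_single)
  moreover have "S - {a} = set L \<longleftrightarrow> S = set (a # L)" if "a \<in> S" using that Cons.prems by auto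
  ultimately show ?case using Cons by (auto simp: gcoeff_ggen_mult)
qed (simp add: gcoeff_one)

text \<open>No estimate of a remainder is involved: h is defined as the difference, and its flatness
  says that f and the polynomial have the same derivatives at y0 up to order m. The exponents fill a
  box, which contains all multi-indices of total order at most m.\<close>

lemma taylor:
  fixes f :: "'i::{finite,linorder} sfun"
  assumes V: "ev_open E V" "E \<inter> N = {}" "y0 \<in> V" and f: "superfun E N V f"
  obtains p h where "polysf E N p" "superfun E N V p" "superfun E N V h" "sflat E m y0 h" "f = (\<lambda>y. p y + h y)"
proof -
  define c where "c = (\<lambda>S \<alpha>. mpd \<alpha> (\<lambda>y. gcoeff (f y) S) y0 / (\<Prod>a\<in>E. fact (\<alpha> a)))"
  define p where "p = (\<lambda>y. \<Sum>S\<in>Pow N. \<Sum>\<alpha>\<in>mindices E m.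
      of_real (c S \<alpha>) * (of_real (cmono E y0 \<alpha> y) * prod_list (map (\<lambda>a. coord E a y) (sorted_list_of_set S))))"
  define h where "h = (\<lambda>y. f y - p y)"
  have p: "polysf E N p"
    unfolding p_def by (intro polysf_sum polysf_cmult polysf_mult polysf_cmono polysf_prod_list polysf_coord) auto
  note sp = polysf_superfun[OF V(1) p]
  have sh: "superfun E N V h" unfolding h_def by (rule superfun_minus[OF V(1) f sp])
  have gp: "gcoeff (p y) T = (if T \<subseteq> N then \<Sum>\<alpha>\<in>mindices E m. c T \<alpha> * cmono E y0 \<alpha> y else 0)" for y T
  proof -
    have "gcoeff (prod_list (map (\<lambda>a. coord E a y) (sorted_list_of_set S))) T = (if T = S then 1 else 0)"
      if "S \<subseteq> N" for S
    proof -
      have *: "map (\<lambda>a. coord E a y) (sorted_list_of_set S) = map ggen (sorted_list_of_set S)"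
        using that V(2) by (auto simp: coord_def)
      show ?thesis unfolding * using prod_list_ggen[of "sorted_list_of_set S" T] by simp
    qed
    then have "gcoeff (p y) T = (\<Sum>S\<in>Pow N. if T = S then \<Sum>\<alpha>\<in>mindices E m. c S \<alpha> * cmono E y0 \<alpha> y else 0)"
      unfolding p_def gcoeff_sum
      by (intro sum.cong refl) (auto simp: mult.commute simp flip: scaleR_conv_of_real)
    then show ?thesis by simp
  qed
  have "sflat E m y0 h"
    unfolding sflat_def flat_at_def
  proof (intro allI impI, elim conjE)
    fix T as assume as: "set as \<subseteq> E" "length as \<le> m"
    let ?\<beta> = "count (mset as)"
    have "?\<beta> a \<le> (if a \<in> E then m else 0)" for a
    proof (cases "a \<in> E")
      case True then show ?thesis using count_le_length[of as a] as(2) by (simp add: count_mset)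
    next
      case False then show ?thesis using as(1) by (auto simp: count_mset_0_iff)
    qed
    then have \<beta>: "?\<beta> \<in> mindices E m" by (simp add: mindices_def)
    have "foldr pd as (\<lambda>y. gcoeff (f y + (-1) *\<^sub>R p y) T) y0 = foldr pd as (\<lambda>y. gcoeff (f y) T) y0 - foldr pd as (\<lambda>y. gcoeff (p y) T) y0"
      using foldr_pd_add[OF V(1,3) as(1) superfun_Cinf[OF f] superfun_Cinf[OF superfun_scaleR[OF V(1) Cinf_const sp]], of T "-1"]
        foldr_pd_cmult[OF V(1,3) as(1) superfun_Cinf[OF sp], of "-1" T] by simp
    moreover have "foldr pd as (\<lambda>y. gcoeff (f y) T) y0 = foldr pd as (\<lambda>y. gcoeff (p y) T) y0"
    proof (cases "T \<subseteq> N")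
      case False
      have "foldr pd as (\<lambda>y. gcoeff (f y) T) y0 = foldr pd as (\<lambda>y. gcoeff (p y) T) y0"
        using False f gp by (intro foldr_pd_cong[OF V(1) as(1) _ V(3)]) (simp add: superfun_def)
      then show ?thesis .
    next
      case True
      have mono: "Cinf E V (cmono E y0 \<alpha>)" for \<alpha>
        using superfun_Cinf[OF polysf_superfun[OF V(1) polysf_cmono[of E N y0 \<alpha>]], of "{}"]
        by (simp add: gcoeff_of_real)
      have z: "\<alpha> \<in> mindices E m \<Longrightarrow> \<alpha> a \<noteq> 0 \<Longrightarrow> a \<in> E" for \<alpha> a
        by (force simp: mindices_def split: if_splits)
      have "foldr pd as (\<lambda>y. gcoeff (p y) T) y0 = (\<Sum>\<alpha>\<in>mindices E m. c T \<alpha> * foldr pd as (cmono E y0 \<alpha>) y0)"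
        using True foldr_pd_sum[OF V(1,3) as(1) finite_mindices mono V(3)] by (simp add: gp)
      also have "\<dots> = (\<Sum>\<alpha>\<in>mindices E m. if ?\<beta> = \<alpha> then c T \<alpha> * (\<Prod>a\<in>E. fact (\<alpha> a)) else 0)"
      proof (intro sum.cong refl)
        fix \<alpha> assume "\<alpha> \<in> mindices E m"
        then show "c T \<alpha> * foldr pd as (cmono E y0 \<alpha>) y0 = (if ?\<beta> = \<alpha> then c T \<alpha> * (\<Prod>a\<in>E. fact (\<alpha> a)) else 0)"
          using foldr_pd_cmono[OF as(1), of \<alpha> 1 y0] z[of \<alpha>] by simp
      qed
      also have "\<dots> = c T ?\<beta> * (\<Prod>a\<in>E. fact (?\<beta> a))"
        using \<beta> by (simp add: finite_mindices)
      also have "\<dots> = foldr pd (mlist ?\<beta>) (\<lambda>y. gcoeff (f y) T) y0"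
        by (simp add: c_def mpd_mlist)
      also have "\<dots> = foldr pd as (\<lambda>y. gcoeff (f y) T) y0"
      proof (rule foldr_pd_mset[OF V(1) superfun_Cinf[OF f] mindices_set[OF \<beta>] _ V(3)])
        show "mset (mlist ?\<beta>) = mset as" by (rule multiset_eqI) (simp add: count_mlist)
      qed
      finally show ?thesis by simp
    qed
    ultimately show "foldr pd as (\<lambda>x. gcoeff (h x) T) y0 = 0"
      by (simp add: h_def)
  qed
  then show ?thesis by (rule that[OF p sp sh]) (simp add: h_def fun_eq_iff)
qed

section \<open>The pullback as a homomorphism of algebras, the chain rule and functoriality\<close>

context
  fixes E N :: "'i::{finite,linorder} set" and U V and \<phi> :: "'i \<Rightarrow> 'i sfun"
  assumes m: "morphism E N U V \<phi>"
begin

private lemmas mf = morphism_facts[OF m]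

lemma pullback_sflat: "x \<in> U \<Longrightarrow> sflat E (jetorder TYPE('i)) (body E \<phi> x) f \<Longrightarrow> pullback E N \<phi> f x = 0"
  using pullback_flat[OF m] by (simp add: sflat_def)

lemma pullback_poly_mult:
  assumes "superfun E N V f" "x \<in> U"
  shows "polysf E N p \<Longrightarrow> pullback E N \<phi> (\<lambda>y. p y * f y) x = pullback E N \<phi> p x * pullback E N \<phi> f x"
proof (induction rule: polysf.induct)
  case (const r)
  then show ?case
    using pullback_scaleR[OF m assms] pullback_of_real[OF m assms(2)] by (simp add: scaleR_conv_of_real)
next
  case (add p p')
  note s = polysf_superfun[OF mf(3) add(1)] polysf_superfun[OF mf(3) add(2)]
  show ?case
    using pullback_add[OF m superfun_mult[OF mf(3) s(1) assms(1)] superfun_mult[OF mf(3) s(2) assms(1)] assms(2)]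
      pullback_add[OF m s assms(2)] add.IH by (simp add: distrib_right)
next
  case (mult a p)
  note s = polysf_superfun[OF mf(3) mult(2)]
  show ?case
    using pullback_coord_mult[OF m superfun_mult[OF mf(3) s assms(1)] assms(2) mult(1)]
      pullback_coord_mult[OF m s assms(2) mult(1)] mult.IH by (simp add: mult.assoc)
qed

text \<open>It suffices to expand f, because the product of its flat remainder with g is flat
  again.\<close>

lemma pullback_mult:
  assumes f: "superfun E N V f" and g: "superfun E N V g" and x: "x \<in> U"
  shows "pullback E N \<phi> (\<lambda>y. f y * g y) x = pullback E N \<phi> f x * pullback E N \<phi> g x"
proof -
  obtain p h where ph: "polysf E N p" "superfun E N V p" "superfun E N V h"
      "sflat E (jetorder TYPE('i)) (body E \<phi> x) h" "f = (\<lambda>y. p y + h y)"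
    using taylor[OF mf(3,1) mf(6)[OF x] f] by blast
  have "pullback E N \<phi> (\<lambda>y. h y * g y) x = 0" "pullback E N \<phi> h x = 0"
    using sflat_mult[OF mf(3) mf(6)[OF x] ph(3) g ph(4)] ph(4) by (auto intro: pullback_sflat x)
  then show ?thesis
    using pullback_add[OF m superfun_mult[OF mf(3) ph(2) g] superfun_mult[OF mf(3) ph(3) g] x]
      pullback_add[OF m ph(2,3) x] pullback_poly_mult[OF g x ph(1)]
    by (simp add: ph(5) distrib_right)
qed

lemma pullback_sum:
  assumes "finite I" "\<And>i. i \<in> I \<Longrightarrow> superfun E N V (f i)" "x \<in> U"
  shows "pullback E N \<phi> (\<lambda>y. \<Sum>i\<in>I. f i y) x = (\<Sum>i\<in>I. pullback E N \<phi> (f i) x)"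
  using assms(1,2)
proof (induction I rule: finite_induct)
  case (insert i I)
  then show ?case
    using pullback_add[OF m, of "f i" "\<lambda>y. \<Sum>i\<in>I. f i y" x] assms(3) by (simp add: superfun_sum[OF mf(3)])
qed (simp add: pullback_zero[OF m assms(3)])

lemma pullback_uminus:
  "superfun E N V f \<Longrightarrow> x \<in> U \<Longrightarrow> pullback E N \<phi> (\<lambda>y. - f y) x = - pullback E N \<phi> f x"
  using pullback_scaleR[OF m, of f x "-1"] by simp

lemma pullback_sign:
  "superfun E N V f \<Longrightarrow> x \<in> U \<Longrightarrow> pullback E N \<phi> (\<lambda>y. (-1) ^ n * f y) x = (-1) ^ n * pullback E N \<phi> f x"
  using pullback_uminus by (simp add: minus_one_power_iff)

text \<open>Taking the body is multiplicative and kills odd elements, so on polynomials the claim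
  reduces to single coordinates.\<close>

lemma gcoeff_empty_pullback:
  assumes f: "superfun E N V f" and x: "x \<in> U"
  shows "gcoeff (pullback E N \<phi> f x) {} = gcoeff (f (body E \<phi> x)) {}"
proof -
  let ?y = "body E \<phi> x"
  have poly: "gcoeff (pullback E N \<phi> p x) {} = gcoeff (p ?y) {}" if "polysf E N p" for p
    using that
  proof (induction rule: polysf.induct)
    case (const r)
    then show ?case using pullback_of_real[OF m x] by simp
  next
    case (add p p')
    then show ?case
      using pullback_add[OF m polysf_superfun[OF mf(3) add(1)] polysf_superfun[OF mf(3) add(2)] x] by simp
  next
    case (mult a p)
    have "gcoeff (\<phi> a x) {} = gcoeff (coord E a ?y) {}"
    proof (cases "a \<in> E")
      case False
      then show ?thesis
        using mult(1) gpar_odd_empty[OF gpar_odd[OF m x, of a]] by (simp add: coord_def gcoeff_ggen)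
    qed (simp add: coord_def gcoeff_of_real body_def)
    with mult.IH show ?case
      using pullback_coord_mult[OF m polysf_superfun[OF mf(3) mult(2)] x mult(1)] by (simp add: gcoeff_empty_mult)
  qed
  obtain p h where ph: "polysf E N p" "superfun E N V p" "superfun E N V h"
      "sflat E (jetorder TYPE('i)) ?y h" "f = (\<lambda>y. p y + h y)"
    using taylor[OF mf(3,1) mf(6)[OF x] f] by blast
  show ?thesis
    using pullback_add[OF m ph(2,3) x] poly[OF ph(1)] pullback_sflat[OF x ph(4)] sflat_value[OF ph(4)]
    by (simp add: ph(5))
qed

lemma superfun_nilmono: "superfun E N U (nilmono E \<phi> \<alpha>)"
proof -
  have "superfun E N U (\<lambda>x. \<phi> a x - of_real (gcoeff (\<phi> a x) {}))" if "a \<in> E" for a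
  proof -
    have s: "superfun E N U (\<phi> a)" using mf(4) that by blast
    have "superfun E N U (\<lambda>x. gcoeff (\<phi> a x) {} *\<^sub>R 1)"
      by (intro superfun_scaleR mf(2) superfun_Cinf[OF s] superfun_one)
    then show ?thesis using superfun_minus[OF mf(2) s] by (simp add: of_real_def)
  qed
  then show ?thesis
    unfolding nilmono_def by (intro superfun_prod_list superfun_power mf(2)) auto
qed

lemma superfun_oddmono: "S \<subseteq> N \<Longrightarrow> superfun E N U (oddmono \<phi> S)"
  unfolding oddmono_def using mf(4) by (intro superfun_prod_list mf(2)) auto

lemma Cinf_jet:
  assumes "superfun E N V f" "\<alpha> \<in> mindices E k"
  shows "Cinf E U (\<lambda>x. foldr pd (mlist \<alpha>) (\<lambda>y. gcoeff (f y) S) (body E \<phi> x))"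
proof -
  have "Cinf E V (foldr pd (mlist \<alpha>) (\<lambda>y. gcoeff (f y) S))"
    by (intro Cinf_foldr_pd superfun_Cinf[OF assms(1)] mindices_set[OF assms(2)])
  from Cinf_compose[OF mf(2,3,7) Cinf_body[OF m] this] show ?thesis .
qed

lemma Cinf_pcoef:
  assumes "superfun E N V f" "\<alpha> \<in> mindices E k" shows "Cinf E U (pcoef E \<phi> f S \<alpha>)"
proof -
  have "Cinf E U (\<lambda>x. foldr pd (mlist \<alpha>) (\<lambda>y. gcoeff (f y) S) (body E \<phi> x) * (1 / (\<Prod>a\<in>E. fact (\<alpha> a))))"
    by (rule Cinf_mult[OF mf(2) Cinf_jet[OF assms] Cinf_const])
  then show ?thesis by (simp add: pcoef_def[abs_def] mpd_mlist)
qed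

lemma superfun_pullback:
  assumes "superfun E N V f" shows "superfun E N U (pullback E N \<phi> f)"
  unfolding pullback_eq[abs_def]
  by (intro superfun_sum superfun_scaleR superfun_mult mf(2) superfun_nilmono superfun_oddmono Cinf_pcoef[OF assms]) auto

text \<open>A summand whose S has the wrong parity vanishes, since its Taylor coefficient is a
  derivative of a function that is zero on V.\<close>

lemma gpar_pullback:
  assumes "superfun E N V f" "\<And>y. y \<in> V \<Longrightarrow> gpar k (f y)" "x \<in> U"
  shows "gpar k (pullback E N \<phi> f x)"
  unfolding pullback_eq
proof (intro gpar_sum)
  fix S \<alpha> assume S: "S \<in> Pow N" and \<alpha>: "\<alpha> \<in> mindices E CARD('i)"
  show "gpar k (pcoef E \<phi> f S \<alpha> x *\<^sub>R (nilmono E \<phi> \<alpha> x * oddmono \<phi> S x))"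
  proof (cases "even (card S) = even k")
    case True
    have "gpar (card S) (nilmono E \<phi> \<alpha> x * oddmono \<phi> S x)"
      using S by (intro gpar_mult_even gpar_nilmono[OF m] gpar_oddmono[OF m] assms(3)) auto
    then show ?thesis using gpar_cong[OF True] by (intro gpar_scaleR) blast
  next
    case False
    then have "gcoeff (f y) S = 0" if "y \<in> V" for y using assms(2)[OF that] by (auto simp: gpar_def)
    then have "foldr pd (mlist \<alpha>) (\<lambda>y. gcoeff (f y) S) (body E \<phi> x) = foldr pd (mlist \<alpha>) (\<lambda>y. 0) (body E \<phi> x)"
      by (intro foldr_pd_cong[OF mf(3) mindices_set[OF \<alpha>] _ mf(6)[OF assms(3)]])
    also have "\<dots> = 0"
      using flat_at_zero[OF mf(3) mf(6)[OF assms(3)], of "length (mlist \<alpha>)"] mindices_set[OF \<alpha>]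
      by (auto simp: flat_at_def)
    finally show ?thesis by (simp add: pcoef_def mpd_mlist)
  qed
qed

text \<open>The coefficients of a pullback already contain derivatives of f up to
  \<open>jetorder\<close>; hence the loss of that many orders.\<close>

lemma sflat_pullback:
  assumes f: "superfun E N V f" and x: "x \<in> U" and flat: "sflat E (k + jetorder TYPE('i)) (body E \<phi> x) f"
  shows "sflat E k x (pullback E N \<phi> f)"
  unfolding sflat_def
proof
  fix T
  let ?t = "\<lambda>S \<alpha> x. pcoef E \<phi> f S \<alpha> x * gcoeff (nilmono E \<phi> \<alpha> x * oddmono \<phi> S x) T"
  have e: "gcoeff (pullback E N \<phi> f x) T = (\<Sum>S\<in>Pow N. \<Sum>\<alpha>\<in>mindices E CARD('i). ?t S \<alpha> x)" for x
    by (simp add: pullback_eq)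
  have C: "Cinf E U (\<lambda>x. gcoeff (nilmono E \<phi> \<alpha> x * oddmono \<phi> S x) T)" if "S \<in> Pow N" for S \<alpha>
    using that by (intro superfun_Cinf[OF superfun_mult[OF mf(2) superfun_nilmono superfun_oddmono]]) auto
  have F: "flat_at E k x (pcoef E \<phi> f S \<alpha>)" if \<alpha>: "\<alpha> \<in> mindices E CARD('i)" for S \<alpha>
  proof -
    have "length (mlist \<alpha>) \<le> jetorder TYPE('i)" using mindices_length[OF \<alpha>] by (simp add: jetorder_def)
    then have "flat_at E (k + length (mlist \<alpha>)) (body E \<phi> x) (\<lambda>y. gcoeff (f y) S)"
      using flat by (auto simp: sflat_def intro: flat_at_mono)
    then have "flat_at E k (body E \<phi> x) (foldr pd (mlist \<alpha>) (\<lambda>y. gcoeff (f y) S))"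
      by (intro flat_at_foldr_pd mindices_set[OF \<alpha>])
    moreover have "Cinf E V (foldr pd (mlist \<alpha>) (\<lambda>y. gcoeff (f y) S))"
      by (intro Cinf_foldr_pd superfun_Cinf[OF f] mindices_set[OF \<alpha>])
    ultimately have "flat_at E k x (\<lambda>x. foldr pd (mlist \<alpha>) (\<lambda>y. gcoeff (f y) S) (body E \<phi> x))"
      using flat_at_compose[OF mf(2) x mf(3,7) Cinf_body[OF m]] by blast
    from flat_at_mult[OF mf(2) x Cinf_jet[OF f \<alpha>] Cinf_const this]
    have "flat_at E k x (\<lambda>x. foldr pd (mlist \<alpha>) (\<lambda>y. gcoeff (f y) S) (body E \<phi> x) * (1 / (\<Prod>a\<in>E. fact (\<alpha> a))))"
      .
    then show ?thesis by (simp add: pcoef_def[abs_def] mpd_mlist)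
  qed
  show "flat_at E k x (\<lambda>x. gcoeff (pullback E N \<phi> f x) T)"
    unfolding e
    by (intro flat_at_sum[OF mf(2) x] flat_at_mult[OF mf(2) x] Cinf_sum Cinf_mult mf(2) Cinf_pcoef[OF f] C F)
qed

text \<open>Left derivatives put the derivative of the substituted coordinate on the left. On
  polynomials the rule follows from the Leibniz rules on both sides.\<close>

lemma pullback_chain_rule:
  assumes f: "superfun E N V f" and x: "x \<in> U"
  shows "spd E c (pullback E N \<phi> f) x = (\<Sum>b\<in>E \<union> N. spd E c (\<phi> b) x * pullback E N \<phi> (spd E b f) x)"
proof -
  have poly: "spd E c (pullback E N \<phi> p) x = (\<Sum>b\<in>E \<union> N. spd E c (\<phi> b) x * pullback E N \<phi> (spd E b p) x)"
    if "polysf E N p" for p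
    using that
  proof (induction rule: polysf.induct)
    case (const r)
    have "spd E c (pullback E N \<phi> (\<lambda>y. of_real r)) x = spd E c (\<lambda>y. of_real r) x"
      using pullback_of_real[OF m] by (intro spd_cong[OF mf(2) x]) auto
    moreover have "spd E b (\<lambda>y. of_real r) = (\<lambda>y. 0 :: 'i grass)" for b
      using spd_const[OF mf(2)] by blast
    ultimately show ?case using pullback_zero[OF m x] by simp
  next
    case (add p p')
    note s = polysf_superfun[OF mf(3) add(1)] polysf_superfun[OF mf(3) add(2)]
    have "spd E c (pullback E N \<phi> (\<lambda>y. p y + p' y)) x = spd E c (\<lambda>x. pullback E N \<phi> p x + pullback E N \<phi> p' x) x"
      using pullback_add[OF m s] by (intro spd_cong[OF mf(2) x]) auto
    also have "\<dots> = spd E c (pullback E N \<phi> p) x + spd E c (pullback E N \<phi> p') x"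
      by (rule spd_add[OF mf(2) x superfun_pullback[OF s(1)] superfun_pullback[OF s(2)]])
    finally have 1: "spd E c (pullback E N \<phi> (\<lambda>y. p y + p' y)) x = spd E c (pullback E N \<phi> p) x + spd E c (pullback E N \<phi> p') x" .
    have 2: "pullback E N \<phi> (spd E b (\<lambda>y. p y + p' y)) x = pullback E N \<phi> (spd E b p) x + pullback E N \<phi> (spd E b p') x" for b
    proof -
      have "pullback E N \<phi> (spd E b (\<lambda>y. p y + p' y)) x = pullback E N \<phi> (\<lambda>y. spd E b p y + spd E b p' y) x"
        using spd_add[OF mf(3) _ s] by (intro pullback_cong[OF m x])
      then show ?thesis using pullback_add[OF m superfun_spd[OF mf(3) s(1)] superfun_spd[OF mf(3) s(2)] x] by simp
    qed
    show ?case unfolding 1 2 by (simp add: add.IH distrib_left sum.distrib)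
  next
    case (mult a p)
    note s = polysf_superfun[OF mf(3) mult(2)]
    let ?P = "pullback E N \<phi>"
    have "spd E c (?P (\<lambda>y. coord E a y * p y)) x = spd E c (\<lambda>x. \<phi> a x * ?P p x) x"
      using pullback_coord_mult[OF m s _ mult(1)] by (intro spd_cong[OF mf(2) x])
    also have "\<dots> = spd E c (\<phi> a) x * ?P p x + (-1) ^ (sdeg E c * sdeg E a) * (\<phi> a x * spd E c (?P p) x)"
      by (rule spd_mult_gpar[OF mf(2) x mf(4)[OF mult(1)] superfun_pullback[OF s] mf(5)[OF x mult(1)]])
    finally have L: "spd E c (?P (\<lambda>y. coord E a y * p y)) x
      = spd E c (\<phi> a) x * ?P p x + (-1) ^ (sdeg E c * sdeg E a) * (\<phi> a x * spd E c (?P p) x)" .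
    have R: "spd E c (\<phi> b) x * ?P (spd E b (\<lambda>y. coord E a y * p y)) x
      = (if b = a then spd E c (\<phi> a) x * ?P p x else 0)
        + (-1) ^ (sdeg E c * sdeg E a) * (\<phi> a x * (spd E c (\<phi> b) x * ?P (spd E b p) x))" if b: "b \<in> E \<union> N" for b
    proof -
      have d: "superfun E N V (\<lambda>y. (if b = a then 1 else 0) * p y)"
        using s superfun_zero by (cases "b = a") simp_all
      have sp: "superfun E N V (spd E b p)" by (rule superfun_spd[OF mf(3) s])
      have "?P (spd E b (\<lambda>y. coord E a y * p y)) x
          = ?P (\<lambda>y. (if b = a then 1 else 0) * p y + (-1) ^ (sdeg E b * sdeg E a) * (coord E a y * spd E b p y)) x"
        using spd_mult_gpar[OF mf(3) _ superfun_coord[OF mult(1)] s gpar_coord, of _ b]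
        by (intro pullback_cong[OF m x]) (simp add: spd_coord)
      also have "\<dots> = ?P (\<lambda>y. (if b = a then 1 else 0) * p y) x
          + ?P (\<lambda>y. (-1) ^ (sdeg E b * sdeg E a) * (coord E a y * spd E b p y)) x"
        by (intro pullback_add[OF m d _ x] superfun_sign superfun_mult mf(3) superfun_coord mult(1) sp)
      also have "?P (\<lambda>y. (-1) ^ (sdeg E b * sdeg E a) * (coord E a y * spd E b p y)) x
          = (-1) ^ (sdeg E b * sdeg E a) * (\<phi> a x * ?P (spd E b p) x)"
        using pullback_sign[OF superfun_mult[OF mf(3) superfun_coord[OF mult(1)] sp] x]
          pullback_coord_mult[OF m sp x mult(1)] by simp
      also have "?P (\<lambda>y. (if b = a then 1 else 0) * p y) x = (if b = a then ?P p x else 0)"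
        using pullback_zero[OF m x] by (cases "b = a") simp_all
      finally have e: "?P (spd E b (\<lambda>y. coord E a y * p y)) x
        = (if b = a then ?P p x else 0) + (-1) ^ (sdeg E b * sdeg E a) * (\<phi> a x * ?P (spd E b p) x)" .
      \<comment> \<open>Moving \<open>\<phi> a x\<close> to the front, past the derivative of
        \<open>\<phi> b\<close>, replaces the sign depending on b by one that depends on c, which
        can then leave the sum.\<close>
      have "gpar (sdeg E b + sdeg E c) (spd E c (\<phi> b) x)"
        using b by (intro gpar_spd[OF mf(2) x] mf(5))
      from gpar_commute[OF this mf(5)[OF x mult(1)]]
      have "spd E c (\<phi> b) x * \<phi> a x = (-1) ^ ((sdeg E b + sdeg E c) * sdeg E a) * (\<phi> a x * spd E c (\<phi> b) x)" .
      then have "(-1) ^ (sdeg E b * sdeg E a) * (spd E c (\<phi> b) x * \<phi> a x)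
          = (-1) ^ (sdeg E c * sdeg E a) * (\<phi> a x * spd E c (\<phi> b) x)"
        by (cases "even (sdeg E b)"; cases "even (sdeg E a)"; cases "even (sdeg E c)")
          (simp_all add: minus_one_power_iff)
      from arg_cong[OF this, of "\<lambda>z. z * ?P (spd E b p) x"]
      have "spd E c (\<phi> b) x * ((-1) ^ (sdeg E b * sdeg E a) * (\<phi> a x * ?P (spd E b p) x))
          = (-1) ^ (sdeg E c * sdeg E a) * (\<phi> a x * (spd E c (\<phi> b) x * ?P (spd E b p) x))"
        by (auto simp: minus_one_power_iff mult.assoc split: if_splits)
      then show ?thesis unfolding e by (simp add: distrib_left)
    qed
    have "(\<Sum>b\<in>E \<union> N. spd E c (\<phi> b) x * ?P (spd E b (\<lambda>y. coord E a y * p y)) x)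
      = (\<Sum>b\<in>E \<union> N. if b = a then spd E c (\<phi> a) x * ?P p x else 0)
        + (\<Sum>b\<in>E \<union> N. (-1) ^ (sdeg E c * sdeg E a) * (\<phi> a x * (spd E c (\<phi> b) x * ?P (spd E b p) x)))"
      unfolding sum.distrib[symmetric] by (intro sum.cong refl R)
    also have "\<dots> = spd E c (?P (\<lambda>y. coord E a y * p y)) x"
      using mult(1) by (simp add: L mult.IH sum_distrib_left)
    finally show ?case ..
  qed
  \<comment> \<open>One order beyond \<open>jetorder\<close>, since the remainder is differentiated
    once as well as pulled back.\<close>
  obtain p h where ph: "polysf E N p" "superfun E N V p" "superfun E N V h"
      "sflat E (Suc (jetorder TYPE('i))) (body E \<phi> x) h" "f = (\<lambda>y. p y + h y)"
    using taylor[OF mf(3,1) mf(6)[OF x] f] by blast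
  have "spd E c (pullback E N \<phi> f) x = spd E c (\<lambda>x. pullback E N \<phi> p x + pullback E N \<phi> h x) x"
    unfolding ph(5) using pullback_add[OF m ph(2,3)] by (intro spd_cong[OF mf(2) x]) auto
  also have "\<dots> = spd E c (pullback E N \<phi> p) x + spd E c (pullback E N \<phi> h) x"
    by (rule spd_add[OF mf(2) x superfun_pullback[OF ph(2)] superfun_pullback[OF ph(3)]])
  also have "spd E c (pullback E N \<phi> h) x = 0"
    using sflat_pullback[OF ph(3) x, of 1] ph(4)
    by (intro sflat_value[OF sflat_spd[OF mf(2) x superfun_pullback[OF ph(3)]]]) simp
  finally have 1: "spd E c (pullback E N \<phi> f) x = spd E c (pullback E N \<phi> p) x" by simp
  have 2: "pullback E N \<phi> (spd E b f) x = pullback E N \<phi> (spd E b p) x" for b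
  proof -
    have "pullback E N \<phi> (spd E b f) x = pullback E N \<phi> (\<lambda>y. spd E b p y + spd E b h y) x"
      unfolding ph(5) using spd_add[OF mf(3) _ ph(2,3)] by (intro pullback_cong[OF m x])
    also have "\<dots> = pullback E N \<phi> (spd E b p) x + pullback E N \<phi> (spd E b h) x"
      using pullback_add[OF m superfun_spd[OF mf(3) ph(2)] superfun_spd[OF mf(3) ph(3)] x] .
    also have "pullback E N \<phi> (spd E b h) x = 0"
      by (intro pullback_sflat x sflat_spd[OF mf(3) mf(6)[OF x] ph(3,4)])
    finally show ?thesis by simp
  qed
  show ?thesis unfolding 1 2 by (rule poly[OF ph(1)])
qed

text \<open>The map has to be the identity at the point x only, since \<open>pullback\<close> takes
  no derivatives of the map.\<close>

lemma pullback_id: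
  assumes f: "superfun E N V f" and x: "x \<in> U" and id: "\<And>a. a \<in> E \<union> N \<Longrightarrow> \<phi> a x = coord E a x"
  shows "pullback E N \<phi> f x = f x"
proof -
  have poly: "pullback E N \<phi> p x = p x" if "polysf E N p" for p
    using that
  proof (induction rule: polysf.induct)
    case (const r)
    then show ?case using pullback_of_real[OF m x] by simp
  next
    case (add p p')
    then show ?case
      using pullback_add[OF m polysf_superfun[OF mf(3) add(1)] polysf_superfun[OF mf(3) add(2)] x] by simp
  next
    case (mult a p)
    then show ?case
      using pullback_coord_mult[OF m polysf_superfun[OF mf(3) mult(2)] x mult(1)] id by simp
  qed
  have "x \<in> evspace E" using mf(2) x openin_imp_subset by blast
  then have "body E \<phi> x = x"
    using id by (auto simp: body_def vec_eq_iff evspace_def coord_def gcoeff_of_real)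
  moreover obtain p h where ph: "polysf E N p" "superfun E N V p" "superfun E N V h"
      "sflat E (jetorder TYPE('i)) (body E \<phi> x) h" "f = (\<lambda>y. p y + h y)"
    using taylor[OF mf(3,1) mf(6)[OF x] f] by blast
  ultimately show ?thesis
    using pullback_add[OF m ph(2,3) x] poly[OF ph(1)] pullback_sflat[OF x ph(4)] sflat_value[OF ph(4)]
    by (simp add: ph(5))
qed

end

text \<open>For the same reason \<eta> has to agree with the composite at the single point x only,
  and its domain may differ from that of the composite.\<close>

lemma pullback_compose:
  fixes \<phi> \<psi> \<eta> :: "'i \<Rightarrow> 'i::{finite,linorder} sfun"
  assumes m1: "morphism E N U V \<phi>" and m2: "morphism E N V W \<psi>" and m3: "morphism E N U1 W \<eta>"
    and x: "x \<in> U" "x \<in> U1"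
    and \<eta>: "\<And>a. a \<in> E \<union> N \<Longrightarrow> \<eta> a x = pullback E N \<phi> (\<psi> a) x" and f: "superfun E N W f"
  shows "pullback E N \<phi> (pullback E N \<psi> f) x = pullback E N \<eta> f x"
proof -
  note mf1 = morphism_facts[OF m1] and mf2 = morphism_facts[OF m2]
  let ?P = "pullback E N \<phi>" and ?Q = "pullback E N \<psi>" and ?R = "pullback E N \<eta>"
  have b: "body E \<eta> x = body E \<psi> (body E \<phi> x)"
    using \<eta> gcoeff_empty_pullback[OF m1 mf2(4) x(1)] by (auto simp: body_def vec_eq_iff)
  have poly: "?P (?Q p) x = ?R p x" if "polysf E N p" for p
    using that
  proof (induction rule: polysf.induct)
    case (const r)
    have "?P (?Q (\<lambda>y. of_real r)) x = ?P (\<lambda>y. of_real r) x"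
      using pullback_of_real[OF m2] by (intro pullback_cong[OF m1 x(1)])
    then show ?case using pullback_of_real[OF m1 x(1)] pullback_of_real[OF m3 x(2)] by simp
  next
    case (add p p')
    note s = polysf_superfun[OF mf2(3) add(1)] polysf_superfun[OF mf2(3) add(2)]
    have "?P (?Q (\<lambda>y. p y + p' y)) x = ?P (\<lambda>y. ?Q p y + ?Q p' y) x"
      using pullback_add[OF m2 s] by (intro pullback_cong[OF m1 x(1)])
    also have "\<dots> = ?P (?Q p) x + ?P (?Q p') x"
      by (intro pullback_add[OF m1 _ _ x(1)] superfun_pullback[OF m2] s)
    finally show ?case using pullback_add[OF m3 s x(2)] add.IH by simp
  next
    case (mult a p)
    note s = polysf_superfun[OF mf2(3) mult(2)]
    have "?P (?Q (\<lambda>y. coord E a y * p y)) x = ?P (\<lambda>y. \<psi> a y * ?Q p y) x"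
      using pullback_coord_mult[OF m2 s _ mult(1)] by (intro pullback_cong[OF m1 x(1)])
    also have "\<dots> = ?P (\<psi> a) x * ?P (?Q p) x"
      by (intro pullback_mult[OF m1 _ _ x(1)] superfun_pullback[OF m2] s mf2(4) mult(1))
    finally show ?case using pullback_coord_mult[OF m3 s x(2) mult(1)] mult.IH \<eta>[OF mult(1)] by simp
  qed
  have y: "body E \<phi> x \<in> V" using mf1(6) x by blast
  have z: "body E \<psi> (body E \<phi> x) \<in> W" using mf2(6) y by blast
  \<comment> \<open>Each of the two pullbacks consumes \<open>jetorder\<close> orders of
    flatness.\<close>
  let ?k = "jetorder TYPE('i) + jetorder TYPE('i)"
  obtain p h where ph: "polysf E N p" "superfun E N W p" "superfun E N W h"
      "sflat E ?k (body E \<psi> (body E \<phi> x)) h" "f = (\<lambda>y. p y + h y)"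
    using taylor[OF mf2(3,1) z f] by blast
  have "?P (?Q f) x = ?P (\<lambda>y. ?Q p y + ?Q h y) x"
    unfolding ph(5) using pullback_add[OF m2 ph(2,3)] by (intro pullback_cong[OF m1 x(1)])
  also have "\<dots> = ?P (?Q p) x + ?P (?Q h) x"
    by (intro pullback_add[OF m1 _ _ x(1)] superfun_pullback[OF m2] ph)
  also have "?P (?Q h) x = 0"
    by (intro pullback_sflat[OF m1 x(1)] sflat_pullback[OF m2 ph(3) y ph(4)])
  also have "?P (?Q p) x = ?R p x" by (rule poly[OF ph(1)])
  also have "?R p x + 0 = ?R p x + ?R h x"
    using pullback_sflat[OF m3 x(2), of h] sflat_mono[OF ph(4), of "jetorder TYPE('i)"] by (simp add: b)
  also have "\<dots> = ?R f x"
    unfolding ph(5) by (rule pullback_add[OF m3 ph(2,3) x(2), symmetric])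
  finally show ?thesis .
qed

section \<open>Functions lifted along the bundle projection\<close>

section \<open>Lifting functions to the anticotangent bundle\<close>

text \<open>\<open>lift_fun\<close> at one point. It becomes a homomorphism of algebras because
  \<open>Base\<close> preserves the order of indices, and with it the signs
  \<open>ginv\<close>.\<close>

definition glift :: "'i grass \<Rightarrow> 'i tcoord grass" where
  "glift g = Grass (\<lambda>S. if S \<subseteq> range Base then gcoeff g (Base -` S) else 0)"

lemma lift_fun_glift: "lift_fun f X = glift (f (tproj X))"
  by (simp add: lift_fun_def glift_def)

lemma gcoeff_glift: "gcoeff (glift g) S = (if S \<subseteq> range Base then gcoeff g (Base -` S) else 0)"
  by (simp add: glift_def)

lemma gcoeff_glift_image: "gcoeff (glift g) (Base ` S) = gcoeff g S"
proof -
  have "Base -` Base ` S = S" "Base ` S \<subseteq> range Base" by auto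
  then show ?thesis by (simp add: gcoeff_glift)
qed

lemma Base_subset_cases:
  obtains (base) T where "S = Base ` T" | (other) "\<not> S \<subseteq> range Base"
  by (metis subset_imageE)

lemma Base_less_iff [simp]: "Base a < Base b \<longleftrightarrow> a < b" "Anti a < Anti b \<longleftrightarrow> a < b"
  by (auto simp: less_tcoord_def)

lemma ginv_Base: "ginv (Base ` T) (Base ` U) = ginv T U"
proof -
  have "{(t, u). t \<in> Base ` T \<and> u \<in> Base ` U \<and> u < t} = map_prod Base Base ` {(t, u). t \<in> T \<and> u \<in> U \<and> u < t}"
    by force
  moreover have "inj_on (map_prod Base Base) A" for A :: "('a \<times> 'a) set"
    by (auto simp: inj_on_def)
  ultimately show ?thesis unfolding ginv_def by (simp only: card_image)
qed

lemma glift_zero [simp]: "glift 0 = 0"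
  by (rule grass_eqI) (simp add: gcoeff_glift)

lemma glift_add: "glift (f + g) = glift f + glift g"
  by (rule grass_eqI) (simp add: gcoeff_glift)

lemma glift_uminus: "glift (- f) = - glift f"
  by (rule grass_eqI) (simp add: gcoeff_glift)

lemma glift_scaleR: "glift (r *\<^sub>R f) = r *\<^sub>R glift f"
  by (rule grass_eqI) (simp add: gcoeff_glift)

lemma glift_sum: "glift (\<Sum>i\<in>I. f i) = (\<Sum>i\<in>I. glift (f i))"
  by (induction I rule: infinite_finite_induct) (simp_all add: glift_add)

lemma glift_one: "glift (1 :: 'i::{finite,linorder} grass) = 1"
proof (rule grass_eqI)
  fix S show "gcoeff (glift (1 :: 'i grass)) S = gcoeff 1 S"
    by (cases S rule: Base_subset_cases) (simp add: gcoeff_glift_image gcoeff_one, auto simp: gcoeff_glift gcoeff_one split: if_splits)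
qed

lemma glift_of_real: "glift (of_real r :: 'i::{finite,linorder} grass) = of_real r"
  by (simp add: of_real_def glift_scaleR glift_one)

lemma glift_ggen: "glift (ggen a) = ggen (Base a)"
proof (rule grass_eqI)
  fix S
  have "Base ` T = {Base a} \<longleftrightarrow> T = {a}" for T by auto
  then show "gcoeff (glift (ggen a)) S = gcoeff (ggen (Base a)) S"
    by (cases S rule: Base_subset_cases) (simp add: gcoeff_glift_image gcoeff_ggen, auto simp: gcoeff_glift gcoeff_ggen split: if_splits)
qed

lemma glift_mult:
  fixes f g :: "'i::{finite,linorder} grass"
  shows "glift (f * g) = glift f * glift g"
proof (rule grass_eqI)
  fix S :: "'i tcoord set"
  show "gcoeff (glift (f * g)) S = gcoeff (glift f * glift g) S"
  proof (cases S rule: Base_subset_cases)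
    case (base T)
    have "Pow S = (`) Base ` Pow T" by (simp add: base image_Pow_surj)
    moreover have "inj_on ((`) Base) (Pow T)" by (meson inj_on_image_Pow inj_def inj_on_subset subset_UNIV tcoord.inject(1))
    moreover have "Base ` T - Base ` U = Base ` (T - U)" for U :: "'i set" by auto
    ultimately have "gcoeff (glift f * glift g) S = (\<Sum>U\<in>Pow T. (-1) ^ ginv U (T - U) * gcoeff f U * gcoeff g (T - U))"
      unfolding gcoeff_mult base by (simp add: sum.reindex gcoeff_glift_image ginv_Base)
    then show ?thesis by (simp add: base gcoeff_glift_image gcoeff_mult)
  next
    case other
    \<comment> \<open>However such an S is split, one of the two parts contains a momentum index,
      where the lifted factor has coefficient 0.\<close>
    then have "\<not> T \<subseteq> range Base \<or> \<not> S - T \<subseteq> range Base" if "T \<subseteq> S" for T using that by blast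
    then have "gcoeff (glift f * glift g) S = 0"
      unfolding gcoeff_mult by (intro sum.neutral) (force simp: gcoeff_glift)
    then show ?thesis using other by (simp add: gcoeff_glift)
  qed
qed

lemma gpar_glift: "gpar k g \<Longrightarrow> gpar k (glift g)"
  unfolding gpar_def
proof (intro allI impI)
  fix S assume g: "\<forall>S. gcoeff g S \<noteq> 0 \<longrightarrow> even (card S) = even k" "gcoeff (glift g) S \<noteq> 0"
  then obtain T where "S = Base ` T" by (cases S rule: Base_subset_cases) (auto simp: gcoeff_glift)
  with g show "even (card S) = even k"
    by (metis gcoeff_glift_image card_image inj_on_def tcoord.inject(1))
qed

lemma gderiv_glift: "gderiv (Base a) (glift g) = glift (gderiv a (g :: 'i::{finite,linorder} grass))"
proof (rule grass_eqI)
  fix S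
  show "gcoeff (gderiv (Base a) (glift g)) S = gcoeff (glift (gderiv a g)) S"
  proof (cases S rule: Base_subset_cases)
    case (base T)
    have "gcoeff (glift g) (insert (Base a) (Base ` T)) = gcoeff g (insert a T)"
      using gcoeff_glift_image[of g "insert a T"] by simp
    moreover have "ginv {Base a} (Base ` T) = ginv {a} T" using ginv_Base[of "{a}" T] by simp
    ultimately show ?thesis unfolding base by (auto simp: gcoeff_gderiv gcoeff_glift_image)
  qed (auto simp: gcoeff_gderiv gcoeff_glift)
qed

lemma gderiv_Anti_glift: "gderiv (Anti a) (glift g) = (0 :: 'i::{finite,linorder} tcoord grass)"
  by (rule grass_eqI) (auto simp: gcoeff_gderiv gcoeff_glift)

text \<open>\<open>tE\<close>, \<open>tN\<close> and \<open>tU\<close> describe a chart of the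
  anticotangent bundle in terms of E, N and U, so that local computations do not refer to an atlas.
  Momenta have the opposite parity, hence those of N are even coordinates.\<close>

definition tE :: "'i set \<Rightarrow> 'i set \<Rightarrow> 'i tcoord set" where
  "tE E N = Base ` E \<union> Anti ` N"

definition tN :: "'i set \<Rightarrow> 'i set \<Rightarrow> 'i tcoord set" where
  "tN E N = Base ` N \<union> Anti ` E"

definition tU :: "'i set \<Rightarrow> 'i set \<Rightarrow> (real ^ 'i::finite) set \<Rightarrow> (real ^ 'i tcoord) set" where
  "tU E N U = {X \<in> evspace (tE E N). tproj X \<in> U}"

lemma tE_simps [simp]: "Base a \<in> tE E N \<longleftrightarrow> a \<in> E" "Anti a \<in> tE E N \<longleftrightarrow> a \<in> N"
  "Base a \<in> tN E N \<longleftrightarrow> a \<in> N" "Anti a \<in> tN E N \<longleftrightarrow> a \<in> E"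
  by (auto simp: tE_def tN_def)

lemma tE_tN: "tE E N \<union> tN E N = Base ` (E \<union> N) \<union> Anti ` (E \<union> N)"
  by (auto simp: tE_def tN_def)

lemma tE_disjoint: "E \<inter> N = {} \<Longrightarrow> tE E N \<inter> tN E N = {}"
  by (auto simp: tE_def tN_def)

lemma sdeg_Base: "sdeg (tE E N) (Base a) = sdeg E a"
  by (simp add: sdeg_def)

lemma sdeg_Anti: "E \<inter> N = {} \<Longrightarrow> a \<in> E \<union> N \<Longrightarrow> sdeg (tE E N) (Anti a) = 1 - sdeg E a"
  by (auto simp: sdeg_def)

lemma tproj_component: "tproj X $ a = X $ Base a"
  by (simp add: tproj_def)

lemma tproj_evspace: "X \<in> evspace (tE E N) \<Longrightarrow> tproj X \<in> evspace E"
  by (simp add: evspace_def tproj_component)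

lemma continuous_tproj: "continuous_on S tproj"
  unfolding tproj_def[abs_def] by (intro continuous_on_vec_lambda continuous_intros)

lemma ev_open_tU:
  assumes "ev_open E U" shows "ev_open (tE E N) (tU E N U)"
proof -
  have "tU E N U = evspace (tE E N) \<inter> tproj -` U" by (auto simp: tU_def)
  moreover have "ev_open (tE E N) (evspace (tE E N) \<inter> tproj -` U)"
    using assms tproj_evspace by (intro continuous_openin_preimage[OF continuous_tproj]) auto
  ultimately show ?thesis by simp
qed

lemma tU_proj: "X \<in> tU E N U \<Longrightarrow> tproj X \<in> U" "tproj ` tU E N U \<subseteq> U"
  by (auto simp: tU_def)

lemma Cinf_tproj:
  assumes "ev_open E U" "Cinf E U g" shows "Cinf (tE E N) (tU E N U) (\<lambda>X. g (tproj X))"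
  by (rule Cinf_compose[OF ev_open_tU[OF assms(1)] assms(1) tU_proj(2) _ assms(2)])
    (simp add: tproj_component Cinf_component)

lemma lift_fun_coeff:
  "(\<lambda>X. gcoeff (lift_fun f X) S) = (if S \<subseteq> range Base then (\<lambda>X. gcoeff (f (tproj X)) (Base -` S)) else (\<lambda>X. 0))"
  by (auto simp: lift_fun_glift gcoeff_glift)

lemma superfun_lift:
  assumes "ev_open E U" "superfun E N U f"
  shows "superfun (tE E N) (tN E N) (tU E N U) (lift_fun f)"
proof (rule superfunI)
  fix S show "Cinf (tE E N) (tU E N U) (\<lambda>X. gcoeff (lift_fun f X) S)"
    unfolding lift_fun_coeff using Cinf_tproj[OF assms(1) superfun_Cinf[OF assms(2)]] by simp
next
  fix X S assume X: "X \<in> tU E N U" and S: "\<not> S \<subseteq> tN E N"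
  show "gcoeff (lift_fun f X) S = 0"
  proof (cases S rule: Base_subset_cases)
    case (base T)
    then have "\<not> T \<subseteq> N" using S by auto
    then show ?thesis
      using assms(2) tU_proj(1)[OF X] by (simp add: base lift_fun_glift gcoeff_glift_image superfun_def)
  qed (simp add: lift_fun_glift gcoeff_glift)
qed

lemma tproj_axis: "tproj (X + t *\<^sub>R axis (Base a) 1) = tproj X + t *\<^sub>R axis a 1"
  "tproj (X + t *\<^sub>R axis (Anti a) 1) = tproj X"
  by (auto simp: vec_eq_iff tproj_component axis_def)

lemma spd_lift_Base: "spd (tE E N) (Base a) (lift_fun f) X = lift_fun (spd E a f) X"
proof (cases "a \<in> E")
  case True
  show ?thesis
  proof (rule grass_eqI)
    fix S
    show "gcoeff (spd (tE E N) (Base a) (lift_fun f) X) S = gcoeff (lift_fun (spd E a f) X) S"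
      using True by (simp add: spd_def lift_fun_glift gcoeff_glift pd_def tproj_axis)
  qed
qed (simp add: spd_def lift_fun_glift gderiv_glift)

lemma spd_lift_Anti: "spd (tE E N) (Anti a) (lift_fun f) X = 0"
proof (cases "a \<in> N")
  case True
  then show ?thesis
    by (intro grass_eqI) (simp add: spd_def lift_fun_glift pd_def tproj_axis)
qed (simp add: spd_def lift_fun_glift gderiv_Anti_glift)

lemma lift_coord: "lift_fun (coord E a) X = coord (tE E N) (Base a) X"
  by (simp add: lift_fun_glift coord_def glift_of_real glift_ggen tproj_component)

lemma sflat_lift:
  assumes U: "ev_open E U" "superfun E N U f" and X: "X \<in> tU E N U" and f: "sflat E m (tproj X) f"
  shows "sflat (tE E N) m X (lift_fun f)"
  unfolding sflat_def
proof
  fix S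
  have "flat_at (tE E N) m X (\<lambda>X. gcoeff (f (tproj X)) T)" for T
  proof (rule flat_at_compose[OF ev_open_tU[OF U(1)] X U(1) tU_proj(2)])
    show "Cinf (tE E N) (tU E N U) (\<lambda>Y. tproj Y $ b)" for b
      by (simp add: tproj_component Cinf_component)
    show "Cinf E U (\<lambda>y. gcoeff (f y) T)" by (rule superfun_Cinf[OF U(2)])
    show "flat_at E m (tproj X) (\<lambda>y. gcoeff (f y) T)" using f by (simp add: sflat_def)
  qed
  then show "flat_at (tE E N) m X (\<lambda>X. gcoeff (lift_fun f X) S)"
    unfolding lift_fun_coeff using flat_at_zero[OF ev_open_tU[OF U(1)] X] by simp
qed

text \<open>The projection intertwines a coordinate change with its lift, whatever the lift does to
  the momenta.\<close>

lemma pullback_lift: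
  fixes \<phi> :: "'i \<Rightarrow> 'i::{finite,linorder} sfun"
  assumes m: "morphism E N U V \<phi>" and mT: "morphism (tE E N) (tN E N) (tU E N U) (tU E N V) \<Phi>"
    and base: "\<And>a X. a \<in> E \<union> N \<Longrightarrow> X \<in> tU E N U \<Longrightarrow> \<Phi> (Base a) X = lift_fun (\<phi> a) X"
    and f: "superfun E N V f" and X: "X \<in> tU E N U"
  shows "pullback (tE E N) (tN E N) \<Phi> (lift_fun f) X = lift_fun (pullback E N \<phi> f) X"
proof -
  let ?P = "pullback (tE E N) (tN E N) \<Phi>" and ?x = "tproj X"
  note mf = morphism_facts[OF m] and mfT = morphism_facts[OF mT]
  note x = tU_proj(1)[OF X]
  have poly: "?P (lift_fun p) X = glift (pullback E N \<phi> p ?x)" if "polysf E N p" for p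
    using that
  proof (induction rule: polysf.induct)
    case (const r)
    have "lift_fun (\<lambda>y. of_real r :: 'i grass) = (\<lambda>y. of_real r)" by (simp add: fun_eq_iff lift_fun_glift glift_of_real)
    then show ?case using pullback_of_real[OF mT X] pullback_of_real[OF m x] by (simp add: glift_of_real)
  next
    case (add p p')
    note s = polysf_superfun[OF mf(3) add(1)] polysf_superfun[OF mf(3) add(2)]
    have "lift_fun (\<lambda>y. p y + p' y) = (\<lambda>Y. lift_fun p Y + lift_fun p' Y)" by (simp add: fun_eq_iff lift_fun_glift glift_add)
    then show ?case
      using pullback_add[OF mT superfun_lift[OF mf(3) s(1)] superfun_lift[OF mf(3) s(2)] X]
        pullback_add[OF m s x] add.IH by (simp add: glift_add)
  next
    case (mult a p)
    note s = polysf_superfun[OF mf(3) mult(2)]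
    have "lift_fun (\<lambda>y. coord E a y * p y) = (\<lambda>Y. coord (tE E N) (Base a) Y * lift_fun p Y)"
      by (simp add: fun_eq_iff lift_coord[symmetric]) (simp add: lift_fun_glift glift_mult)
    moreover have "Base a \<in> tE E N \<union> tN E N" using mult(1) by auto
    ultimately show ?case
      using pullback_coord_mult[OF mT superfun_lift[OF mf(3) s] X] pullback_coord_mult[OF m s x mult(1)]
        mult.IH base[OF mult(1) X] by (simp add: glift_mult lift_fun_glift)
  qed
  \<comment> \<open>The two index types have their own jet orders, and one expansion of f has to
    serve both pullbacks.\<close>
  obtain k where k: "jetorder TYPE('i) \<le> k" "jetorder TYPE('i tcoord) \<le> k"
    by (meson max.cobounded1 max.cobounded2)
  obtain p h where ph: "polysf E N p" "superfun E N V p" "superfun E N V h"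
      "sflat E k (body E \<phi> ?x) h" "f = (\<lambda>y. p y + h y)"
    using taylor[OF mf(3,1) mf(6)[OF x] f] by blast
  have b: "tproj (body (tE E N) \<Phi> X) = body E \<phi> ?x"
    using base[OF _ X] gcoeff_glift_image[of _ "{}"] by (auto simp: vec_eq_iff tproj_component body_def lift_fun_glift)
  have "?P (lift_fun h) X = 0"
    using sflat_lift[OF mf(3) ph(3) mfT(6)[OF X], unfolded b, OF ph(4)]
    by (intro pullback_sflat[OF mT X]) (rule sflat_mono[OF _ k(2)])
  moreover have "pullback E N \<phi> h ?x = 0"
    by (intro pullback_sflat[OF m x] sflat_mono[OF ph(4) k(1)])
  moreover have "lift_fun f = (\<lambda>Y. lift_fun p Y + lift_fun h Y)" by (simp add: ph(5) fun_eq_iff lift_fun_glift glift_add)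
  ultimately show ?thesis
    using pullback_add[OF mT superfun_lift[OF mf(3) ph(2)] superfun_lift[OF mf(3) ph(3)] X]
      pullback_add[OF m ph(2,3) x] poly[OF ph(1)] by (simp add: ph(5) lift_fun_glift)
qed

section \<open>Homogeneity of sums, products and derivatives\<close>

section \<open>Weights\<close>

definition wcoef :: "'i set \<Rightarrow> ('i \<Rightarrow> int) \<Rightarrow> (real ^ 'i::finite) set \<Rightarrow> (real ^ 'i \<Rightarrow> real) \<Rightarrow> bool" where
  "wcoef E w U c \<longleftrightarrow> Cinf E U c \<and>
     (\<forall>x\<in>U. \<forall>y\<in>U. (\<forall>a\<in>E. w a = 0 \<longrightarrow> x $ a = y $ a) \<longrightarrow> c x = c y)"

definition windex :: "'i set \<Rightarrow> ('i \<Rightarrow> int) \<Rightarrow> int set \<Rightarrow> ('i \<Rightarrow> nat) \<Rightarrow> bool" where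
  "windex E w K \<alpha> \<longleftrightarrow> {a. \<alpha> a \<noteq> 0} \<subseteq> {a \<in> E. w a \<noteq> 0} \<and> (\<Sum>a\<in>E. int (\<alpha> a) * w a) \<in> K"

definition monom_at :: "'i set \<Rightarrow> ('i \<Rightarrow> nat) \<Rightarrow> real ^ 'i::finite \<Rightarrow> real" where
  "monom_at E \<alpha> x = (\<Prod>a\<in>E. (x $ a) ^ \<alpha> a)"

lemma wcoef_eq:
  "wcoef E w U c \<Longrightarrow> x \<in> U \<Longrightarrow> y \<in> U \<Longrightarrow> \<forall>a\<in>E. w a = 0 \<longrightarrow> x $ a = y $ a \<Longrightarrow> c x = c y"
  unfolding wcoef_def by blast

lemma wcoef_Cinf: "wcoef E w U c \<Longrightarrow> Cinf E U c"
  unfolding wcoef_def by blast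

lemma weights_in_iff:
  "weights_in E w K U g \<longleftrightarrow> (\<exists>F c. finite F \<and> (\<forall>\<alpha>\<in>F. windex E w K \<alpha> \<and> wcoef E w U (c \<alpha>)) \<and>
     (\<forall>x\<in>U. g x = (\<Sum>\<alpha>\<in>F. c \<alpha> x * monom_at E \<alpha> x)))"
  unfolding weights_in_def windex_def wcoef_def monom_at_def by (simp add: conj_assoc)

lemma weights_inE:
  assumes "weights_in E w K U g"
  obtains F c where "finite F" "\<forall>\<alpha>\<in>F. windex E w K \<alpha>" "\<forall>\<alpha>\<in>F. wcoef E w U (c \<alpha>)"
    "\<forall>x\<in>U. g x = (\<Sum>\<alpha>\<in>F. c \<alpha> x * monom_at E \<alpha> x)"
  using assms unfolding weights_in_iff by blast

lemma weights_in_mono: "weights_in E w K U g \<Longrightarrow> K \<subseteq> L \<Longrightarrow> weights_in E w L U g"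
  unfolding weights_in_iff windex_def by blast

lemma weights_in_cong: "weights_in E w K U g \<Longrightarrow> (\<And>x. x \<in> U \<Longrightarrow> g x = h x) \<Longrightarrow> weights_in E w K U h"
  unfolding weights_in_iff by simp

lemma monom_at_add: "monom_at E (\<lambda>a. \<alpha> a + \<beta> a) x = monom_at E \<alpha> x * monom_at E \<beta> x"
  by (simp add: monom_at_def power_add prod.distrib)

lemma windex_add:
  assumes "windex E w K \<alpha>" "windex E w L \<beta>" "\<And>k l. k \<in> K \<Longrightarrow> l \<in> L \<Longrightarrow> k + l \<in> M"
  shows "windex E w M (\<lambda>a. \<alpha> a + \<beta> a)"
  using assms by (auto simp: windex_def distrib_right sum.distrib)

context
  fixes E :: "'i::finite set" and U and w :: "'i \<Rightarrow> int"
  assumes U: "ev_open E U"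
begin

lemma wcoef_const: "wcoef E w U (\<lambda>x. r)"
  by (simp add: wcoef_def)

lemma wcoef_comb:
  assumes c: "wcoef E w U c" and d: "wcoef E w U d" and C: "Cinf E U (\<lambda>x. h (c x) (d x))"
  shows "wcoef E w U (\<lambda>x. h (c x) (d x))"
  unfolding wcoef_def
proof (intro conjI ballI impI C)
  fix x y assume xy: "x \<in> U" "y \<in> U" "\<forall>a\<in>E. w a = 0 \<longrightarrow> x $ a = y $ a"
  show "h (c x) (d x) = h (c y) (d y)" using wcoef_eq[OF c xy] wcoef_eq[OF d xy] by simp
qed

lemma wcoef_add: "wcoef E w U c \<Longrightarrow> wcoef E w U d \<Longrightarrow> wcoef E w U (\<lambda>x. c x + d x)"
  using wcoef_comb[of c d "(+)"] Cinf_add[OF U wcoef_Cinf wcoef_Cinf, of w c w d] by blast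

lemma wcoef_mult: "wcoef E w U c \<Longrightarrow> wcoef E w U d \<Longrightarrow> wcoef E w U (\<lambda>x. c x * d x)"
  using wcoef_comb[of c d "(*)"] Cinf_mult[OF U wcoef_Cinf wcoef_Cinf, of w c w d] by blast

lemma wcoef_sum: "(\<And>i. i \<in> I \<Longrightarrow> wcoef E w U (c i)) \<Longrightarrow> wcoef E w U (\<lambda>x. \<Sum>i\<in>I. c i x)"
  by (induction I rule: infinite_finite_induct) (auto intro: wcoef_const wcoef_add)

text \<open>Allows a family with repeated exponents, as sums and products produce it; terms with
  equal exponent are collected.\<close>

lemma weights_inI:
  assumes "finite I" "\<And>i. i \<in> I \<Longrightarrow> windex E w K (\<alpha> i)" "\<And>i. i \<in> I \<Longrightarrow> wcoef E w U (c i)"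
    "\<And>x. x \<in> U \<Longrightarrow> g x = (\<Sum>i\<in>I. c i x * monom_at E (\<alpha> i) x)"
  shows "weights_in E w K U g"
  unfolding weights_in_iff
proof (intro exI conjI ballI)
  let ?c = "\<lambda>\<beta> x. \<Sum>i\<in>{i\<in>I. \<alpha> i = \<beta>}. c i x"
  show "finite (\<alpha> ` I)" using assms(1) by simp
  show "windex E w K \<beta>" if "\<beta> \<in> \<alpha> ` I" for \<beta> using assms(2) that by blast
  show "wcoef E w U (?c \<beta>)" if "\<beta> \<in> \<alpha> ` I" for \<beta> using assms(3) by (intro wcoef_sum) auto
  fix x assume "x \<in> U"
  then have "g x = (\<Sum>\<beta>\<in>\<alpha> ` I. \<Sum>i\<in>{i\<in>I. \<alpha> i = \<beta>}. c i x * monom_at E (\<alpha> i) x)"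
    using assms(4) sum.image_gen[OF assms(1), of "\<lambda>i. c i x * monom_at E (\<alpha> i) x" \<alpha>] by simp
  also have "\<dots> = (\<Sum>\<beta>\<in>\<alpha> ` I. ?c \<beta> x * monom_at E \<beta> x)"
    by (intro sum.cong refl) (simp add: sum_distrib_right)
  finally show "g x = (\<Sum>\<beta>\<in>\<alpha> ` I. ?c \<beta> x * monom_at E \<beta> x)" .
qed

lemma weights_in_zero: "weights_in E w K U (\<lambda>x. 0)"
  by (rule weights_inI[of "{}"]) auto

lemma weights_in_add:
  assumes "weights_in E w K U g" "weights_in E w K U h" shows "weights_in E w K U (\<lambda>x. g x + h x)"
proof -
  obtain F c where F0: "finite F" "\<forall>\<alpha>\<in>F. windex E w K \<alpha>" "\<forall>\<alpha>\<in>F. wcoef E w U (c \<alpha>)"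
    "\<forall>x\<in>U. g x = (\<Sum>\<alpha>\<in>F. c \<alpha> x * monom_at E \<alpha> x)"
    using assms(1) by (rule weights_inE)
  note F = F0[rule_format]
  obtain G d where G0: "finite G" "\<forall>\<alpha>\<in>G. windex E w K \<alpha>" "\<forall>\<alpha>\<in>G. wcoef E w U (d \<alpha>)"
    "\<forall>x\<in>U. h x = (\<Sum>\<alpha>\<in>G. d \<alpha> x * monom_at E \<alpha> x)"
    using assms(2) by (rule weights_inE)
  note G = G0[rule_format]
  show ?thesis
    by (rule weights_inI[of "F <+> G" K "case_sum id id" "case_sum c d"])
      (use F G in \<open>auto simp: sum.Plus\<close>)
qed

lemma weights_in_sum:
  "(\<And>i. i \<in> I \<Longrightarrow> weights_in E w K U (g i)) \<Longrightarrow> weights_in E w K U (\<lambda>x. \<Sum>i\<in>I. g i x)"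
  by (induction I rule: infinite_finite_induct) (auto intro: weights_in_zero weights_in_add)

lemma weights_in_mult:
  assumes "weights_in E w K U g" "weights_in E w L U h" "\<And>k l. k \<in> K \<Longrightarrow> l \<in> L \<Longrightarrow> k + l \<in> M"
  shows "weights_in E w M U (\<lambda>x. g x * h x)"
proof -
  obtain F c where F0: "finite F" "\<forall>\<alpha>\<in>F. windex E w K \<alpha>" "\<forall>\<alpha>\<in>F. wcoef E w U (c \<alpha>)"
    "\<forall>x\<in>U. g x = (\<Sum>\<alpha>\<in>F. c \<alpha> x * monom_at E \<alpha> x)"
    using assms(1) by (rule weights_inE)
  note F = F0[rule_format]
  obtain G d where G0: "finite G" "\<forall>\<alpha>\<in>G. windex E w L \<alpha>" "\<forall>\<alpha>\<in>G. wcoef E w U (d \<alpha>)"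
    "\<forall>x\<in>U. h x = (\<Sum>\<alpha>\<in>G. d \<alpha> x * monom_at E \<alpha> x)"
    using assms(2) by (rule weights_inE)
  note G = G0[rule_format]
  show ?thesis
  proof (rule weights_inI[of "F \<times> G" M "\<lambda>(\<alpha>, \<beta>) a. \<alpha> a + \<beta> a" "\<lambda>(\<alpha>, \<beta>) x. c \<alpha> x * d \<beta> x"])
    fix x assume "x \<in> U"
    then show "g x * h x = (\<Sum>i\<in>F \<times> G. (case i of (\<alpha>, \<beta>) \<Rightarrow> \<lambda>x. c \<alpha> x * d \<beta> x) x * monom_at E (case i of (\<alpha>, \<beta>) \<Rightarrow> \<lambda>a. \<alpha> a + \<beta> a) x)"
      by (simp add: F(4) G(4) sum_product sum.cartesian_product monom_at_add case_prod_beta mult_ac)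
  qed (use F G assms(3) in \<open>auto intro!: wcoef_mult windex_add[OF F(2) G(2) assms(3)]\<close>)
qed

lemma weights_in_const:
  assumes "0 \<in> K" shows "weights_in E w K U (\<lambda>x. r)"
  by (rule weights_inI[of "{()}" K "\<lambda>_ _. 0" "\<lambda>_ _. r"])
    (use assms in \<open>auto simp: windex_def monom_at_def wcoef_const\<close>)

lemma weights_in_cmult: "weights_in E w K U g \<Longrightarrow> weights_in E w K U (\<lambda>x. r * g x)"
  by (rule weights_in_mult[OF weights_in_const[of "{0}"]]) auto

lemma weights_in_component:
  assumes "a \<in> E" "w a \<in> K" shows "weights_in E w K U (\<lambda>x. x $ a)"
proof (cases "w a = 0")
  case True
  then show ?thesis
    by (intro weights_inI[of "{()}" K "\<lambda>_ _. 0" "\<lambda>_ x. x $ a"])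
      (use assms in \<open>auto simp: windex_def monom_at_def wcoef_def Cinf_component\<close>)
next
  case False
  have "(\<Sum>b\<in>E. int (if b = a then 1 else 0) * w b) = (\<Sum>b\<in>E. if b = a then w a else 0)"
    by (intro sum.cong) auto
  moreover have "(\<Prod>b\<in>E. (x $ b) ^ (if b = a then 1 else 0)) = (\<Prod>b\<in>E. if b = a then x $ a else 1)" for x :: "real ^ 'i"
    by (intro prod.cong) auto
  ultimately show ?thesis
    using False assms
    by (intro weights_inI[of "{()}" K "\<lambda>_ b. if b = a then 1 else 0" "\<lambda>_ x. 1"])
      (auto simp: windex_def monom_at_def wcoef_const)
qed

lemma monom_at_cmono: "monom_at E \<alpha> = cmono E 0 \<alpha>"
  by (simp add: fun_eq_iff monom_at_def cmono_def)

lemma pd_monom_at: "a \<in> E \<Longrightarrow> pd a (monom_at E \<alpha>) = (\<lambda>x. of_nat (\<alpha> a) * monom_at E (\<alpha>(a := \<alpha> a - 1)) x)"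
  using pd_cmono[of a E 1 0 \<alpha>] by (simp add: monom_at_cmono)

lemma Cinf_monom_at: "Cinf E U (monom_at E \<alpha>)"
  unfolding monom_at_def[abs_def] by (intro Cinf_prod Cinf_power U Cinf_component)

text \<open>A coordinate of weight zero occurs in the coefficients only, one of nonzero weight in
  the monomials only. Either way a single term of the Leibniz rule survives.\<close>

lemma weights_in_pd:
  assumes g: "weights_in E w K U g" and a: "a \<in> E" and L: "\<And>k. k \<in> K \<Longrightarrow> k - w a \<in> L"
  shows "weights_in E w L U (pd a g)"
proof -
  obtain F c where F0: "finite F" "\<forall>\<alpha>\<in>F. windex E w K \<alpha>" "\<forall>\<alpha>\<in>F. wcoef E w U (c \<alpha>)"
    "\<forall>x\<in>U. g x = (\<Sum>\<alpha>\<in>F. c \<alpha> x * monom_at E \<alpha> x)"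
    using g by (rule weights_inE)
  note F = F0[rule_format]
  have c: "Cinf E U (c \<alpha>)" if "\<alpha> \<in> F" for \<alpha> using F(3)[OF that] by (simp add: wcoef_def)
  have e: "pd a g x = (\<Sum>\<alpha>\<in>F. pd a (c \<alpha>) x * monom_at E \<alpha> x + of_nat (\<alpha> a) * c \<alpha> x * monom_at E (\<alpha>(a := \<alpha> a - 1)) x)"
    if x: "x \<in> U" for x
  proof -
    have "pd a g x = pd a (\<lambda>x. \<Sum>\<alpha>\<in>F. 1 * (c \<alpha> x * monom_at E \<alpha> x)) x"
      using F(4) by (intro pd_cong[OF U x a]) simp
    also have "\<dots> = (\<Sum>\<alpha>\<in>F. 1 * pd a (\<lambda>x. c \<alpha> x * monom_at E \<alpha> x) x)"
      using foldr_pd_sum[OF U x, of "[a]" F "\<lambda>\<alpha> x. c \<alpha> x * monom_at E \<alpha> x" x "\<lambda>_. 1"] a F(1) x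
        Cinf_mult[OF U c Cinf_monom_at] by simp
    also have "\<dots> = (\<Sum>\<alpha>\<in>F. pd a (c \<alpha>) x * monom_at E \<alpha> x + of_nat (\<alpha> a) * c \<alpha> x * monom_at E (\<alpha>(a := \<alpha> a - 1)) x)"
      using pd_mult[OF U x a Cinf_differentiable[OF c] Cinf_differentiable[OF Cinf_monom_at]]
      by (intro sum.cong refl) (simp add: pd_monom_at[OF a])
    finally show ?thesis .
  qed
  show ?thesis
  proof (cases "w a = 0")
    case True
    have "wcoef E w U (pd a (c \<alpha>))" if \<alpha>: "\<alpha> \<in> F" for \<alpha>
      unfolding wcoef_def
    proof (intro conjI ballI impI Cinf_pd c \<alpha> a)
      fix x y assume xy: "x \<in> U" "y \<in> U" "\<forall>b\<in>E. w b = 0 \<longrightarrow> x $ b = y $ b"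
      obtain d1 where d1: "d1 > 0" "\<And>t. \<bar>t\<bar> < d1 \<Longrightarrow> x + t *\<^sub>R axis a 1 \<in> U" using ev_open_line[OF U xy(1) a] by blast
      obtain d2 where d2: "d2 > 0" "\<And>t. \<bar>t\<bar> < d2 \<Longrightarrow> y + t *\<^sub>R axis a 1 \<in> U" using ev_open_line[OF U xy(2) a] by blast
      \<comment> \<open>Shifting x and y by the same amount along a keeps their weight zero
        coordinates equal, so the coefficient agrees along both lines.\<close>
      have "c \<alpha> (x + t *\<^sub>R axis a 1) = c \<alpha> (y + t *\<^sub>R axis a 1)" if "\<bar>t\<bar> < min d1 d2" for t
        using that xy(3) by (intro wcoef_eq[OF F(3)[OF \<alpha>] d1(2) d2(2)]) auto
      then have "\<forall>\<^sub>F t in nhds 0. c \<alpha> (x + t *\<^sub>R axis a 1) = c \<alpha> (y + t *\<^sub>R axis a 1)"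
        unfolding eventually_nhds_metric using d1(1) d2(1) by (intro exI[of _ "min d1 d2"]) (auto simp: dist_norm)
      then show "pd a (c \<alpha>) x = pd a (c \<alpha>) y" unfolding pd_def by (intro deriv_cong_ev) auto
    qed
    moreover have "\<alpha> a = 0" if "\<alpha> \<in> F" for \<alpha> using F(2)[OF that] True by (auto simp: windex_def)
    moreover have "windex E w L \<alpha>" if "\<alpha> \<in> F" for \<alpha> using F(2)[OF that] L True by (auto simp: windex_def)
    ultimately show ?thesis
      using F(1) e by (intro weights_inI[of F L "\<lambda>\<alpha>. \<alpha>" "\<lambda>\<alpha>. pd a (c \<alpha>)"]) (auto intro!: sum.cong)
  next
    case False
    have z: "pd a (c \<alpha>) x = 0" if \<alpha>: "\<alpha> \<in> F" and x: "x \<in> U" for \<alpha> x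
    proof -
      obtain d1 where d1: "d1 > 0" "\<And>t. \<bar>t\<bar> < d1 \<Longrightarrow> x + t *\<^sub>R axis a 1 \<in> U" using ev_open_line[OF U x a] by blast
      have "c \<alpha> (x + t *\<^sub>R axis a 1) = c \<alpha> x" if "\<bar>t\<bar> < d1" for t
        using False by (intro wcoef_eq[OF F(3)[OF \<alpha>] d1(2)[OF that] x]) (auto simp: axis_def)
      then have "\<forall>\<^sub>F t in nhds 0. c \<alpha> (x + t *\<^sub>R axis a 1) = c \<alpha> x"
        unfolding eventually_nhds_metric using d1(1) by (intro exI[of _ d1]) (auto simp: dist_norm)
      then have "pd a (c \<alpha>) x = deriv (\<lambda>t. c \<alpha> x) 0" unfolding pd_def by (intro deriv_cong_ev) auto
      then show ?thesis by simp
    qed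
    have "windex E w L (\<alpha>(a := \<alpha> a - 1))" if "\<alpha> \<in> F" "\<alpha> a \<noteq> 0" for \<alpha>
    proof -
      have "(\<Sum>b\<in>E. int ((\<alpha>(a := \<alpha> a - 1)) b) * w b) = (\<Sum>b\<in>E. int (\<alpha> b) * w b - (if b = a then w a else 0))"
        using that(2) by (intro sum.cong) (auto simp: of_nat_diff left_diff_distrib)
      also have "\<dots> = (\<Sum>b\<in>E. int (\<alpha> b) * w b) - w a" using a by (simp add: sum_subtractf)
      finally show ?thesis using F(2)[OF that(1)] L a False by (auto simp: windex_def split: if_splits)
    qed
    moreover have "pd a g x = (\<Sum>\<alpha>\<in>{\<alpha>\<in>F. \<alpha> a \<noteq> 0}. of_nat (\<alpha> a) * c \<alpha> x * monom_at E (\<alpha>(a := \<alpha> a - 1)) x)" if "x \<in> U" for x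
      unfolding e[OF that] using z[OF _ that] F(1) by (intro sum.mono_neutral_cong_right) auto
    moreover have "wcoef E w U (\<lambda>x. of_nat (\<alpha> a) * c \<alpha> x)" if "\<alpha> \<in> F" for \<alpha>
      by (rule wcoef_mult[OF wcoef_const F(3)[OF that]])
    ultimately show ?thesis
      using F(1) by (intro weights_inI[of "{\<alpha>\<in>F. \<alpha> a \<noteq> 0}" L "\<lambda>\<alpha>. \<alpha>(a := \<alpha> a - 1)" "\<lambda>\<alpha> x. of_nat (\<alpha> a) * c \<alpha> x"]) auto
  qed
qed

end

section \<open>Weights under the bundle projection and on the zero section\<close>

lemma sum_tE: "E \<inter> N = {} \<Longrightarrow> (\<Sum>z\<in>tE E N. f z) = (\<Sum>a\<in>E. f (Base a)) + (\<Sum>a\<in>N. f (Anti a))"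
  for E :: "'i::finite set"
  unfolding tE_def by (subst sum.union_disjoint) (auto simp: sum.reindex inj_on_def)

lemma prod_tE: "E \<inter> N = {} \<Longrightarrow> (\<Prod>z\<in>tE E N. f z) = (\<Prod>a\<in>E. f (Base a)) * (\<Prod>a\<in>N. f (Anti a))"
  for E :: "'i::finite set"
  unfolding tE_def by (subst prod.union_disjoint) (auto simp: prod.reindex inj_on_def)

lemma weights_in_tproj:
  assumes U: "ev_open E U" "E \<inter> N = {}" and w: "\<And>a. wT (Base a) = w a" and g: "weights_in E w K U g"
  shows "weights_in (tE E N) wT K (tU E N U) (\<lambda>X. g (tproj X))"
proof -
  obtain F c where F0: "finite F" "\<forall>\<alpha>\<in>F. windex E w K \<alpha>" "\<forall>\<alpha>\<in>F. wcoef E w U (c \<alpha>)"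
    "\<forall>x\<in>U. g x = (\<Sum>\<alpha>\<in>F. c \<alpha> x * monom_at E \<alpha> x)"
    using g by (rule weights_inE)
  note F = F0[rule_format]
  let ?\<alpha> = "\<lambda>\<alpha> z. case z of Base a \<Rightarrow> \<alpha> a | Anti a \<Rightarrow> 0"
  show ?thesis
  proof (rule weights_inI[OF ev_open_tU[OF U(1)] F(1), where \<alpha> = ?\<alpha> and c = "\<lambda>\<alpha> X. c \<alpha> (tproj X)"])
    fix \<alpha> assume \<alpha>: "\<alpha> \<in> F"
    have "z \<in> {z \<in> tE E N. wT z \<noteq> 0}" if "?\<alpha> \<alpha> z \<noteq> 0" for z
      using that F(2)[OF \<alpha>] by (cases z) (auto simp: windex_def w)
    then show "windex (tE E N) wT K (?\<alpha> \<alpha>)"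
      using F(2)[OF \<alpha>] by (auto simp: windex_def sum_tE[OF U(2)] w)
    show "wcoef (tE E N) wT (tU E N U) (\<lambda>X. c \<alpha> (tproj X))"
      unfolding wcoef_def
    proof (intro conjI ballI impI)
      show "Cinf (tE E N) (tU E N U) (\<lambda>X. c \<alpha> (tproj X))"
        using F(3)[OF \<alpha>] by (intro Cinf_tproj[OF U(1)]) (simp add: wcoef_def)
      fix X Y assume XY: "X \<in> tU E N U" "Y \<in> tU E N U" "\<forall>z\<in>tE E N. wT z = 0 \<longrightarrow> X $ z = Y $ z"
      then have "\<forall>a\<in>E. w a = 0 \<longrightarrow> tproj X $ a = tproj Y $ a" using w by (simp add: tproj_component)
      then show "c \<alpha> (tproj X) = c \<alpha> (tproj Y)"
        using F(3)[OF \<alpha>] XY(1,2)[THEN tU_proj(1)] unfolding wcoef_def by blast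
    qed
  next
    fix X assume X: "X \<in> tU E N U"
    have "monom_at (tE E N) (?\<alpha> \<alpha>) X = monom_at E \<alpha> (tproj X)" for \<alpha>
      by (simp add: monom_at_def prod_tE[OF U(2)] tproj_component)
    then show "g (tproj X) = (\<Sum>\<alpha>\<in>F. c \<alpha> (tproj X) * monom_at (tE E N) (?\<alpha> \<alpha>) X)"
      using F(4)[OF tU_proj(1)[OF X]] by simp
  qed
qed

lemma tzero_component: "tzero x $ Base a = x $ a" "tzero x $ Anti a = 0"
  by (simp_all add: tzero_def)

lemma tproj_tzero: "tproj (tzero x) = x"
  by (simp add: vec_eq_iff tproj_component tzero_component)

lemma tzero_tU: "ev_open E U \<Longrightarrow> x \<in> U \<Longrightarrow> tzero x \<in> tU E N U"
proof -
  assume "ev_open E U" "x \<in> U"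
  then have "x \<in> evspace E" using openin_imp_subset by blast
  then have "tzero x \<in> evspace (tE E N)"
    unfolding evspace_def by (auto simp: tzero_def split: tcoord.splits)
  then show "tzero x \<in> tU E N U" using \<open>x \<in> U\<close> by (simp add: tU_def tproj_tzero)
qed

lemma Cinf_tzero:
  assumes U: "ev_open E U" and g: "Cinf (tE E N) (tU E N U) g" shows "Cinf E U (\<lambda>x. g (tzero x))"
proof (rule Cinf_compose[OF U ev_open_tU[OF U] _ _ g])
  show "tzero ` U \<subseteq> tU E N U" using tzero_tU[OF U] by blast
  show "Cinf E U (\<lambda>y. tzero y $ z)" for z
    by (cases z) (simp_all add: tzero_component Cinf_component)
qed

text \<open>On the zero section every monomial containing an even momentum vanishes; the remaining
  ones are monomials of the base with the same weight.\<close>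

lemma weights_in_tzero:
  assumes U: "ev_open E U" "E \<inter> N = {}" and w: "\<And>a. wT (Base a) = w a" and g: "weights_in (tE E N) wT K (tU E N U) g"
  shows "weights_in E w K U (\<lambda>x. g (tzero x))"
proof -
  obtain F c where F0: "finite F" "\<forall>\<alpha>\<in>F. windex (tE E N) wT K \<alpha>" "\<forall>\<alpha>\<in>F. wcoef (tE E N) wT (tU E N U) (c \<alpha>)"
    "\<forall>X\<in>tU E N U. g X = (\<Sum>\<alpha>\<in>F. c \<alpha> X * monom_at (tE E N) \<alpha> X)"
    using g by (rule weights_inE)
  note F = F0[rule_format]
  let ?F = "{\<alpha>\<in>F. \<forall>a\<in>N. \<alpha> (Anti a) = 0}"
  show ?thesis
  proof (rule weights_inI[OF U(1), where I = ?F and \<alpha> = "\<lambda>\<alpha> a. \<alpha> (Base a)" and c = "\<lambda>\<alpha> x. c \<alpha> (tzero x)"])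
    show "finite ?F" using F(1) by simp
    fix \<alpha> assume "\<alpha> \<in> ?F"
    then have \<alpha>: "\<alpha> \<in> F" "\<forall>a\<in>N. \<alpha> (Anti a) = 0" by auto
    show "windex E w K (\<lambda>a. \<alpha> (Base a))"
      using F(2)[OF \<alpha>(1)] \<alpha>(2) by (auto simp: windex_def sum_tE[OF U(2)] w)
    show "wcoef E w U (\<lambda>x. c \<alpha> (tzero x))"
      unfolding wcoef_def
    proof (intro conjI ballI impI)
      show "Cinf E U (\<lambda>x. c \<alpha> (tzero x))"
        using F(3)[OF \<alpha>(1)] by (intro Cinf_tzero[OF U(1), where N = N]) (simp add: wcoef_def)
      fix x y assume xy: "x \<in> U" "y \<in> U" "\<forall>a\<in>E. w a = 0 \<longrightarrow> x $ a = y $ a"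
      then have "\<forall>z\<in>tE E N. wT z = 0 \<longrightarrow> tzero x $ z = tzero y $ z"
        using w by (auto simp: tE_def tzero_component)
      then show "c \<alpha> (tzero x) = c \<alpha> (tzero y)"
        using F(3)[OF \<alpha>(1)] xy(1,2)[THEN tzero_tU[OF U(1)]] unfolding wcoef_def by blast
    qed
  next
    fix x assume x: "x \<in> U"
    have m: "monom_at (tE E N) \<alpha> (tzero x) = monom_at E (\<lambda>a. \<alpha> (Base a)) x * (\<Prod>a\<in>N. 0 ^ \<alpha> (Anti a))" for \<alpha>
      by (simp add: monom_at_def prod_tE[OF U(2)] tzero_component)
    have z: "(\<Prod>a\<in>N. 0 ^ \<alpha> (Anti a)) = (if \<forall>a\<in>N. \<alpha> (Anti a) = 0 then 1 else (0::real))" for \<alpha>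
    proof (cases "\<forall>a\<in>N. \<alpha> (Anti a) = 0")
      case False
      then obtain a where "a \<in> N" "\<alpha> (Anti a) \<noteq> 0" by blast
      then have "(\<Prod>a\<in>N. 0 ^ \<alpha> (Anti a)) = (0::real)" by (intro prod_zero) auto
      with False show ?thesis by simp
    qed simp
    show "g (tzero x) = (\<Sum>\<alpha>\<in>?F. c \<alpha> (tzero x) * monom_at E (\<lambda>a. \<alpha> (Base a)) x)"
      unfolding F(4)[OF tzero_tU[OF U(1) x]] m z
      using F(1) by (intro sum.mono_neutral_cong_right) auto
  qed
qed

lemma superfun_weights_single:
  "superfun_weights E N w {k} U f \<longleftrightarrow> superfun E N U f \<and>
     (\<forall>S\<subseteq>N. weights_in E w {k - (\<Sum>a\<in>S. w a)} U (\<lambda>x. gcoeff (f x) S))"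
proof -
  have "{l. l + (\<Sum>a\<in>S. w a) \<in> {k}} = {k - (\<Sum>a\<in>S. w a)}" for S by auto
  then show ?thesis by (simp add: superfun_weights_def)
qed

lemma sw_superfun: "superfun_weights E N w K U f \<Longrightarrow> superfun E N U f"
  by (simp add: superfun_weights_def)

lemma sw_UNIV: "superfun_weights E N w K U f \<Longrightarrow> superfun_weights E N w UNIV U f"
  unfolding superfun_weights_def by (blast intro: weights_in_mono)

context
  fixes E N :: "'i::{finite,linorder} set" and U and w :: "'i \<Rightarrow> int"
  assumes U: "ev_open E U"
begin

lemma sw_cong:
  assumes "superfun_weights E N w K U f" "\<And>x. x \<in> U \<Longrightarrow> f x = g x" shows "superfun_weights E N w K U g"
  unfolding superfun_weights_def
proof (intro conjI allI impI)
  show "superfun E N U g" using superfun_cong[OF U, of f g N] assms(2) sw_superfun[OF assms(1)] by blast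
  fix S assume "S \<subseteq> N"
  then show "weights_in E w {k. k + sum w S \<in> K} U (\<lambda>x. gcoeff (g x) S)"
    using assms weights_in_cong[of E w "{k. k + sum w S \<in> K}" U "\<lambda>x. gcoeff (f x) S"] by (simp add: superfun_weights_def)
qed

lemma sw_zero: "superfun_weights E N w K U (\<lambda>x. 0)"
  by (simp add: superfun_weights_def superfun_zero weights_in_zero[OF U])

lemma sw_add: "superfun_weights E N w K U f \<Longrightarrow> superfun_weights E N w K U g \<Longrightarrow> superfun_weights E N w K U (\<lambda>x. f x + g x)"
  by (simp add: superfun_weights_def superfun_add[OF U] weights_in_add[OF U])

lemma sw_sum: "(\<And>i. i \<in> I \<Longrightarrow> superfun_weights E N w K U (f i)) \<Longrightarrow> superfun_weights E N w K U (\<lambda>x. \<Sum>i\<in>I. f i x)"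
  by (induction I rule: infinite_finite_induct) (auto intro: sw_zero sw_add)

lemma sw_scaleR: "superfun_weights E N w K U f \<Longrightarrow> superfun_weights E N w K U (\<lambda>x. r *\<^sub>R f x)"
  by (simp add: superfun_weights_def superfun_scaleR[OF U] weights_in_cmult[OF U])

lemma sw_uminus: "superfun_weights E N w K U f \<Longrightarrow> superfun_weights E N w K U (\<lambda>x. - f x)"
  using sw_scaleR[of K f "-1"] by simp

lemma sw_sign: "superfun_weights E N w K U f \<Longrightarrow> superfun_weights E N w K U (\<lambda>x. (-1) ^ n * f x)"
  by (simp add: minus_one_power_iff sw_uminus)

lemma sw_mult:
  assumes "superfun_weights E N w {k} U f" "superfun_weights E N w {l} U g"
  shows "superfun_weights E N w {k + l} U (\<lambda>x. f x * g x)"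
  unfolding superfun_weights_single
proof (intro conjI allI impI)
  show "superfun E N U (\<lambda>x. f x * g x)" using assms by (intro superfun_mult[OF U] sw_superfun)
  fix S assume S: "S \<subseteq> N"
  show "weights_in E w {k + l - sum w S} U (\<lambda>x. gcoeff (f x * g x) S)"
    unfolding gcoeff_mult
  proof (intro weights_in_sum[OF U])
    fix T assume "T \<in> Pow S"
    then have T: "T \<subseteq> N" "S - T \<subseteq> N" "sum w S = sum w (S - T) + sum w T"
      using S by (auto simp: sum.subset_diff)
    have f: "weights_in E w {k - sum w T} U (\<lambda>x. (-1) ^ ginv T (S - T) * gcoeff (f x) T)"
      using assms(1) T(1) by (intro weights_in_cmult[OF U]) (simp add: superfun_weights_single)
    have g: "weights_in E w {l - sum w (S - T)} U (\<lambda>x. gcoeff (g x) (S - T))"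
      using assms(2) T(2) by (simp add: superfun_weights_single)
    show "weights_in E w {k + l - sum w S} U (\<lambda>x. (-1) ^ ginv T (S - T) * gcoeff (f x) T * gcoeff (g x) (S - T))"
      by (rule weights_in_mult[OF U f g]) (simp add: T(3))
  qed
qed

lemma sw_coord:
  assumes "E \<inter> N = {}" "a \<in> E \<union> N" shows "superfun_weights E N w {w a} U (coord E a)"
  unfolding superfun_weights_single
proof (intro conjI allI impI superfun_coord assms(2))
  fix S assume S: "S \<subseteq> N"
  show "weights_in E w {w a - sum w S} U (\<lambda>x. gcoeff (coord E a x) S)"
    using assms S by (cases "a \<in> E"; cases "S = {}"; cases "S = {a}")
      (auto simp: coord_def gcoeff_of_real gcoeff_ggen intro: weights_in_zero[OF U] weights_in_const[OF U] weights_in_component[OF U])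
qed

lemma sw_spd:
  assumes f: "superfun_weights E N w {k} U f" and a: "a \<in> E \<union> N" shows "superfun_weights E N w {k - w a} U (spd E a f)"
  unfolding superfun_weights_single
proof (intro conjI allI impI superfun_spd[OF U sw_superfun[OF f]])
  fix S assume S: "S \<subseteq> N"
  show "weights_in E w {k - w a - sum w S} U (\<lambda>x. gcoeff (spd E a f x) S)"
  proof (cases "a \<in> E")
    case True
    have "weights_in E w {k - w a - sum w S} U (pd a (\<lambda>x. gcoeff (f x) S))"
      using f S by (intro weights_in_pd[OF U _ True, where K = "{k - sum w S}"]) (auto simp: superfun_weights_single)
    then show ?thesis using True by (simp add: spd_def)
  next
    case False
    show ?thesis
    proof (cases "a \<in> S")
      case True
      then show ?thesis using False weights_in_zero[OF U] by (simp add: spd_def gcoeff_gderiv)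
    next
      case aS: False
      have "weights_in E w {k - sum w (insert a S)} U (\<lambda>x. (-1) ^ ginv {a} S * gcoeff (f x) (insert a S))"
        using f S a False by (intro weights_in_cmult[OF U]) (auto simp: superfun_weights_single)
      then show ?thesis using False aS by (simp add: spd_def gcoeff_gderiv algebra_simps)
    qed
  qed
qed

end

lemma sw_lift:
  assumes U: "ev_open E U" "E \<inter> N = {}" and w: "\<And>a. wT (Base a) = w a" and f: "superfun_weights E N w {k} U f"
  shows "superfun_weights (tE E N) (tN E N) wT {k} (tU E N U) (lift_fun f)"
  unfolding superfun_weights_single
proof (intro conjI allI impI superfun_lift[OF U(1) sw_superfun[OF f]])
  fix S assume S: "S \<subseteq> tN E N"
  show "weights_in (tE E N) wT {k - sum wT S} (tU E N U) (\<lambda>X. gcoeff (lift_fun f X) S)"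
  proof (cases S rule: Base_subset_cases)
    case (base T)
    then have "T \<subseteq> N" using S by auto
    moreover have "sum wT S = sum w T" by (simp add: base sum.reindex inj_on_def w)
    ultimately show ?thesis
      using f weights_in_tproj[where wT = wT and w = w, OF U w, where K = "{k - sum w T}" and g = "\<lambda>x. gcoeff (f x) T"]
      by (simp add: base lift_fun_glift gcoeff_glift_image superfun_weights_single)
  next
    case other
    then show ?thesis
      using weights_in_zero[OF ev_open_tU[OF U(1)]] by (simp add: lift_fun_glift gcoeff_glift)
  qed
qed

text \<open>Reads off weights on the base. The two weights are compared on \<open>Base\<close>
  coordinates only, so any weight of the momenta may be used upstairs.\<close>

lemma sw_zero_sec:
  assumes U: "ev_open E U" "E \<inter> N = {}" and w: "\<And>a. wT (Base a) = w a"
    and f: "superfun_weights (tE E N) (tN E N) wT {k} (tU E N U) f"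
  shows "superfun_weights E N w {k} U (zero_sec f)"
  unfolding superfun_weights_single
proof (intro conjI allI impI)
  show "superfun E N U (zero_sec f)"
  proof (rule superfunI)
    fix S show "Cinf E U (\<lambda>x. gcoeff (zero_sec f x) S)"
      using Cinf_tzero[OF U(1) superfun_Cinf[OF sw_superfun[OF f]]] by (simp add: zero_sec_def)
  next
    fix x S assume "x \<in> U" "\<not> S \<subseteq> N"
    moreover then have "\<not> Base ` S \<subseteq> tN E N" by auto
    ultimately show "gcoeff (zero_sec f x) S = 0"
      using sw_superfun[OF f] tzero_tU[OF U(1)] unfolding superfun_def zero_sec_def by simp
  qed
  fix S assume S: "S \<subseteq> N"
  have "sum wT (Base ` S) = sum w S" by (simp add: sum.reindex inj_on_def w)
  moreover have "Base ` S \<subseteq> tN E N" using S by auto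
  ultimately have "weights_in (tE E N) wT {k - sum w S} (tU E N U) (\<lambda>X. gcoeff (f X) (Base ` S))"
    using f by (metis superfun_weights_single)
  then show "weights_in E w {k - sum w S} U (\<lambda>x. gcoeff (zero_sec f x) S)"
    using weights_in_tzero[where wT = wT and w = w, OF U w, where K = "{k - sum w S}"] by (simp add: zero_sec_def)
qed

section \<open>Transformation of coordinate vector fields\<close>

section \<open>Coordinate changes and their Jacobians\<close>

lemma parity_on_iff: "parity_on U k f \<longleftrightarrow> (\<forall>x\<in>U. gpar k (f x))"
  by (simp add: parity_on_def gpar_iff_gpart)

lemma continuous_on_body:
  assumes "morphism E N U V \<phi>" shows "continuous_on U (body E \<phi>)"
proof -
  have "continuous_on U (\<lambda>x. body E \<phi> x $ a)" for a
  proof (cases "a \<in> E")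
    case True
    then show ?thesis
      using differentiable_imp_continuous_on[OF Cinf_differentiable[OF Cinf_body[OF assms]]] by blast
  qed (simp add: body_def)
  then show ?thesis
    unfolding continuous_on_def by (intro ballI vec_tendstoI) auto
qed

text \<open>A function may live on an open part W of the target only; the preimage of W under the
  body map is open by continuity.\<close>

lemma morphism_restrict:
  assumes m: "morphism E N U V \<phi>" and W: "ev_open E W"
  shows "morphism E N {x \<in> U. body E \<phi> x \<in> W} W \<phi>"
proof -
  have "body E \<phi> x \<in> evspace E" for x by (simp add: body_def evspace_def)
  then have "openin (top_of_set U) (U \<inter> body E \<phi> -` W)"
    by (intro continuous_openin_preimage[OF continuous_on_body[OF m] _ W]) auto
  then have "ev_open E (U \<inter> body E \<phi> -` W)"
    using m openin_trans by (auto simp: morphism_def)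
  moreover have "U \<inter> body E \<phi> -` W = {x \<in> U. body E \<phi> x \<in> W}" by auto
  ultimately show ?thesis
    using m W unfolding morphism_def by (auto intro: superfun_subset)
qed

context
  fixes M :: "('c, 'i::{finite,linorder}) atlas"
  assumes M: "supermanifold M"
begin

lemma cpar_sdeg: "a \<in> coords M \<Longrightarrow> cpar M a = sdeg (evens M) a"
  using M by (auto simp: supermanifold_def cpar_def sdeg_def)

lemma coords_disjoint: "evens M \<inter> odds M = {}"
  using M by (simp add: supermanifold_def)

lemma ev_open_cdom: "i \<in> charts M \<Longrightarrow> ev_open (evens M) (cdom M i)"
  using M by (simp add: supermanifold_def)

lemma ev_open_overlap: "i \<in> charts M \<Longrightarrow> j \<in> charts M \<Longrightarrow> ev_open (evens M) (overlap M i j)"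
  using M by (simp add: supermanifold_def)

lemma overlap_cdom: "i \<in> charts M \<Longrightarrow> j \<in> charts M \<Longrightarrow> overlap M i j \<subseteq> cdom M i"
  using M by (simp add: supermanifold_def)

lemma morphism_trans:
  assumes "i \<in> charts M" "j \<in> charts M"
  shows "morphism (evens M) (odds M) (overlap M i j) (overlap M j i) (trans M i j)"
  using M assms unfolding morphism_def supermanifold_def parity_on_iff
  by (auto simp: cpar_sdeg image_subset_iff)

lemma cbody_overlap: "i \<in> charts M \<Longrightarrow> j \<in> charts M \<Longrightarrow> x \<in> overlap M i j \<Longrightarrow> cbody M i j x \<in> overlap M j i"
  using morphism_facts(6)[OF morphism_trans] by blast

lemma cocycle:
  assumes "i \<in> charts M" "j \<in> charts M" "k \<in> charts M" "x \<in> overlap M i j" "cbody M i j x \<in> overlap M j k"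
  shows "x \<in> overlap M i k" "c \<in> coords M \<Longrightarrow> trans M i k c x = cpull M i j (trans M j k c) x"
  using M assms unfolding supermanifold_def by blast+

lemma morphism_trans_restrict:
  assumes "i \<in> charts M" "j \<in> charts M" "ev_open (evens M) W"
  shows "morphism (evens M) (odds M) {x \<in> overlap M i j. cbody M i j x \<in> W} W (trans M i j)"
  using morphism_restrict[OF morphism_trans[OF assms(1,2)] assms(3)] .

lemma cbody_compose:
  assumes "i \<in> charts M" "j \<in> charts M" "k \<in> charts M" "x \<in> overlap M i j" "cbody M i j x \<in> overlap M j k"
  shows "cbody M i k x = cbody M j k (cbody M i j x)"
proof -
  have "gcoeff (trans M i k a x) {} = gcoeff (trans M j k a (cbody M i j x)) {}" if "a \<in> evens M" for a
    using that cocycle(2)[OF assms, of a] assms(4,5)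
      gcoeff_empty_pullback[OF morphism_trans_restrict[OF assms(1,2) ev_open_overlap[OF assms(2,3)]]
        morphism_facts(4)[OF morphism_trans[OF assms(2,3)], of a], of x] by simp
  then show ?thesis by (auto simp: body_def vec_eq_iff)
qed

lemma trans_self: "i \<in> charts M \<Longrightarrow> x \<in> cdom M i \<Longrightarrow> a \<in> coords M \<Longrightarrow> trans M i i a x = coord (evens M) a x"
  using M by (simp add: supermanifold_def)

lemma overlap_self: "i \<in> charts M \<Longrightarrow> overlap M i i = cdom M i"
  using M by (simp add: supermanifold_def)

lemma cbody_self: 
  assumes "i \<in> charts M" "x \<in> cdom M i" shows "cbody M i i x = x"
proof -
  have "x \<in> evspace (evens M)" using assms ev_open_cdom openin_imp_subset by blast
  then show ?thesis
    using trans_self[OF assms] by (auto simp: body_def vec_eq_iff evspace_def coord_def gcoeff_of_real)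
qed

lemma cbody_inverse:
  assumes "i \<in> charts M" "j \<in> charts M" "x \<in> overlap M i j" shows "cbody M j i (cbody M i j x) = x"
proof -
  have "x \<in> cdom M i" using assms overlap_cdom by blast
  then show ?thesis
    using cbody_compose[OF assms(1,2,1,3) cbody_overlap[OF assms]] cbody_self[OF assms(1)] by simp
qed

lemma cpull_id:
  assumes i: "i \<in> charts M" and x: "x \<in> cdom M i" "x \<in> W" and f: "ev_open (evens M) W" "superfun (evens M) (odds M) W f"
  shows "cpull M i i f x = f x"
  using assms by (intro pullback_id[OF morphism_trans_restrict[OF i i f(1)]])
    (auto simp: overlap_self cbody_self trans_self)

text \<open>The function lives on W only, so each coordinate change is first restricted to the
  preimage of its target; then \<open>pullback_compose\<close> applies.\<close>

lemma cpull_compose: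
  assumes ijk: "i \<in> charts M" "j \<in> charts M" "k \<in> charts M" and x: "x \<in> overlap M i j" "cbody M i j x \<in> overlap M j k"
    and f: "ev_open (evens M) W" "superfun (evens M) (odds M) W f" "cbody M i k x \<in> W"
  shows "cpull M i j (cpull M j k f) x = cpull M i k f x"
proof -
  note m = morphism_trans_restrict[OF ijk(2,3) f(1)]
  show ?thesis
  proof (rule pullback_compose[OF morphism_trans_restrict[OF ijk(1,2) morphism_facts(2)[OF m]] m
        morphism_trans_restrict[OF ijk(1,3) f(1)]])
    show "x \<in> {x \<in> overlap M i j. cbody M i j x \<in> {y \<in> overlap M j k. cbody M j k y \<in> W}}"
      using x f(3) cbody_compose[OF ijk x] by simp
    show "x \<in> {x \<in> overlap M i k. cbody M i k x \<in> W}" using cocycle(1)[OF ijk x] f(3) by simp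
    show "superfun (evens M) (odds M) W f" by (rule f)
    show "trans M i k a x = cpull M i j (trans M j k a) x" if "a \<in> coords M" for a
      using cocycle(2)[OF ijk x that] .
  qed
qed

lemma cpull_inverse:
  assumes ij: "i \<in> charts M" "j \<in> charts M" and x: "x \<in> overlap M i j" "x \<in> W"
    and f: "ev_open (evens M) W" "superfun (evens M) (odds M) W f"
  shows "cpull M i j (cpull M j i f) x = f x"
proof -
  have "x \<in> cdom M i" using x ij overlap_cdom by blast
  then show ?thesis
    using cpull_compose[OF ij ij(1) x(1) cbody_overlap[OF ij x(1)] f] cpull_id[OF ij(1) _ x(2) f] x(2)
    by (simp add: cbody_self[OF ij(1)])
qed

lemma superfun_cpull:
  assumes "i \<in> charts M" "j \<in> charts M" "ev_open (evens M) W" "superfun (evens M) (odds M) W f"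
  shows "superfun (evens M) (odds M) {x \<in> overlap M i j. cbody M i j x \<in> W} (cpull M i j f)"
  by (rule superfun_pullback[OF morphism_trans_restrict[OF assms(1-3)] assms(4)])

lemma superfun_trans: "i \<in> charts M \<Longrightarrow> j \<in> charts M \<Longrightarrow> a \<in> coords M \<Longrightarrow> superfun (evens M) (odds M) (overlap M i j) (trans M i j a)"
  using morphism_facts(4)[OF morphism_trans] by blast

lemma gpar_trans: "i \<in> charts M \<Longrightarrow> j \<in> charts M \<Longrightarrow> a \<in> coords M \<Longrightarrow> x \<in> overlap M i j \<Longrightarrow> gpar (sdeg (evens M) a) (trans M i j a x)"
  using morphism_facts(5)[OF morphism_trans] by blast

lemma superfun_partial_trans: "i \<in> charts M \<Longrightarrow> j \<in> charts M \<Longrightarrow> a \<in> coords M \<Longrightarrow> superfun (evens M) (odds M) (overlap M i j) (partial M b (trans M i j a))"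
  by (intro superfun_spd ev_open_overlap superfun_trans)

lemma gpar_partial_trans:
  "i \<in> charts M \<Longrightarrow> j \<in> charts M \<Longrightarrow> a \<in> coords M \<Longrightarrow> x \<in> overlap M i j \<Longrightarrow>
    gpar (sdeg (evens M) a + sdeg (evens M) b) (partial M b (trans M i j a) x)"
  using gpar_spd[OF ev_open_overlap, of i j x "sdeg (evens M) a" "trans M i j a" b] gpar_trans by blast

lemma superfun_jac: "i \<in> charts M \<Longrightarrow> j \<in> charts M \<Longrightarrow> a \<in> coords M \<Longrightarrow> superfun (evens M) (odds M) (overlap M i j) (jac M i j a b)"
  unfolding jac_def by (intro superfun_pullback[OF morphism_trans] superfun_partial_trans)

lemma gpar_jac: "i \<in> charts M \<Longrightarrow> j \<in> charts M \<Longrightarrow> a \<in> coords M \<Longrightarrow> x \<in> overlap M i j \<Longrightarrow>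
    gpar (sdeg (evens M) a + sdeg (evens M) b) (jac M i j a b x)"
  unfolding jac_def by (rule gpar_pullback[OF morphism_trans superfun_partial_trans gpar_partial_trans]) auto

lemma partial_cpull:
  assumes "i \<in> charts M" "j \<in> charts M" "x \<in> overlap M i j"
    and f: "ev_open (evens M) W" "superfun (evens M) (odds M) W f" "cbody M i j x \<in> W"
  shows "partial M c (cpull M i j f) x = (\<Sum>b\<in>coords M. partial M c (trans M i j b) x * cpull M i j (partial M b f) x)"
  using assms by (intro pullback_chain_rule[OF morphism_trans_restrict[OF assms(1,2) f(1)] f(2)]) auto

text \<open>The transformation law of coordinate vector fields. In the chart j, f is the pullback of
  its own pullback; the chain rule is applied there and the result is carried to the chart i, where
  the derivatives of \<open>trans M j i\<close> become \<open>jac\<close>.\<close>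

lemma cpull_partial:
  assumes ij: "i \<in> charts M" "j \<in> charts M" and x: "x \<in> overlap M i j"
    and f: "ev_open (evens M) W" "superfun (evens M) (odds M) W f" "cbody M i j x \<in> W"
  shows "cpull M i j (partial M b f) x = (\<Sum>a\<in>coords M. jac M i j a b x * partial M a (cpull M i j f) x)"
proof -
  let ?E = "evens M" and ?N = "odds M"
  \<comment> \<open>V is where both f and the change to the chart i are defined, and U is the domain
    of the pulled back f.\<close>
  define V where "V = overlap M j i \<inter> W"
  define U where "U = {x \<in> overlap M i j. cbody M i j x \<in> W}"
  have V: "ev_open ?E V" unfolding V_def using ev_open_overlap[OF ij(2,1)] f(1) by (rule openin_Int)
  have U: "ev_open ?E U" unfolding U_def by (rule morphism_facts(2)[OF morphism_trans_restrict[OF ij f(1)]])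
  have h: "superfun ?E ?N U (cpull M i j f)" unfolding U_def by (rule superfun_cpull[OF ij f(1,2)])
  have m: "morphism ?E ?N {x \<in> overlap M i j. cbody M i j x \<in> V} V (trans M i j)"
    by (rule morphism_trans_restrict[OF ij V])
  have xm: "x \<in> {x \<in> overlap M i j. cbody M i j x \<in> V}" using x f(3) cbody_overlap[OF ij x] by (simp add: V_def)
  have UV: "cbody M j i y \<in> U" if "y \<in> V" for y
    using that cbody_overlap[OF ij(2,1)] cbody_inverse[OF ij(2,1)] by (simp add: U_def V_def)
  have sub: "V \<subseteq> {y \<in> overlap M j i. cbody M j i y \<in> U}" using UV by (auto simp: V_def)
  have s: "superfun ?E ?N V (\<lambda>y. partial M b (trans M j i a) y * cpull M j i (partial M a (cpull M i j f)) y)" if "a \<in> coords M" for a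
  proof (rule superfun_mult[OF V])
    show "superfun ?E ?N V (partial M b (trans M j i a))"
      by (rule superfun_subset[OF superfun_partial_trans[OF ij(2,1) that]]) (simp add: V_def)
    show "superfun ?E ?N V (cpull M j i (partial M a (cpull M i j f)))"
      by (rule superfun_subset[OF superfun_cpull[OF ij(2,1) U superfun_spd[OF U h]] sub])
  qed
  have "partial M b f y = (\<Sum>a\<in>coords M. partial M b (trans M j i a) y * cpull M j i (partial M a (cpull M i j f)) y)"
    if y: "y \<in> V" for y
  proof -
    have "partial M b f y = partial M b (cpull M j i (cpull M i j f)) y"
      using cpull_inverse[OF ij(2,1) _ _ f(1,2)] by (intro spd_cong[OF V y]) (auto simp: V_def)
    then show ?thesis
      using partial_cpull[OF ij(2,1) _ U h UV[OF y]] y by (simp add: V_def)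
  qed
  then have "cpull M i j (partial M b f) x
    = cpull M i j (\<lambda>y. \<Sum>a\<in>coords M. partial M b (trans M j i a) y * cpull M j i (partial M a (cpull M i j f)) y) x"
    by (intro pullback_cong[OF m xm])
  also have "\<dots> = (\<Sum>a\<in>coords M. cpull M i j (\<lambda>y. partial M b (trans M j i a) y * cpull M j i (partial M a (cpull M i j f)) y) x)"
    using s by (intro pullback_sum[OF m _ _ xm]) auto
  also have "\<dots> = (\<Sum>a\<in>coords M. jac M i j a b x * partial M a (cpull M i j f) x)"
  proof (intro sum.cong refl)
    fix a assume a: "a \<in> coords M"
    have 1: "superfun ?E ?N V (partial M b (trans M j i a))"
      by (rule superfun_subset[OF superfun_partial_trans[OF ij(2,1) a]]) (simp add: V_def)
    have 2: "superfun ?E ?N V (cpull M j i (partial M a (cpull M i j f)))"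
      by (rule superfun_subset[OF superfun_cpull[OF ij(2,1) U superfun_spd[OF U h]] sub])
    have "cpull M i j (cpull M j i (partial M a (cpull M i j f))) x = partial M a (cpull M i j f) x"
      using x f(3) by (intro cpull_inverse[OF ij x _ U superfun_spd[OF U h]]) (simp add: U_def)
    then show "cpull M i j (\<lambda>y. partial M b (trans M j i a) y * cpull M j i (partial M a (cpull M i j f)) y) x
      = jac M i j a b x * partial M a (cpull M i j f) x"
      using pullback_mult[OF m 1 2 xm] by (simp add: jac_def)
  qed
  finally show ?thesis .
qed

text \<open>The transformation law applied to the coordinate functions of the chart j.\<close>

lemma jac_inverse:
  assumes ij: "i \<in> charts M" "j \<in> charts M" and x: "x \<in> overlap M i j" and c: "c \<in> coords M"
  shows "(\<Sum>a\<in>coords M. jac M i j a b x * partial M a (trans M i j c) x) = (if b = c then 1 else 0)"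
proof -
  let ?E = "evens M"
  note m = morphism_trans[OF ij]
  have "cpull M i j (partial M b (coord ?E c)) x = (if b = c then 1 else 0)"
    using pullback_of_real[OF m x, of "if b = c then 1 else 0"] by (cases "b = c") (simp_all add: spd_coord_self)
  moreover have "partial M a (cpull M i j (coord ?E c)) x = partial M a (trans M i j c) x" for a
    using pullback_coord[OF m _ c] by (intro spd_cong[OF ev_open_overlap[OF ij] x])
  ultimately show ?thesis
    using cpull_partial[OF ij x ev_open_overlap[OF ij(2,1)] superfun_coord[OF c] cbody_overlap[OF ij x], of b] by simp
qed

text \<open>From \<partial>/\<partial>z^c = (\<partial>y^b/\<partial>z^c) \<partial>/\<partial>y^b
  and \<partial>/\<partial>y^b = (\<partial>x^a/\<partial>y^b) \<partial>/\<partial>x^a, with the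
  factors in the order in which left derivatives compose. It becomes the cocycle condition for the
  momenta.\<close>

lemma jac_cocycle:
  assumes ijk: "i \<in> charts M" "j \<in> charts M" "k \<in> charts M" and x: "x \<in> overlap M i j" "cbody M i j x \<in> overlap M j k"
    and a: "a \<in> coords M"
  shows "jac M i k a c x = (\<Sum>b\<in>coords M. cpull M i j (jac M j k b c) x * jac M i j a b x)"
proof -
  let ?E = "evens M" and ?N = "odds M"
  define V where "V = {y \<in> overlap M j k. cbody M j k y \<in> overlap M k i}"
  note mV = morphism_trans_restrict[OF ijk(2,3) ev_open_overlap[OF ijk(3,1)]]
  have V: "ev_open ?E V" unfolding V_def by (rule morphism_facts(2)[OF mV])
  have xk: "x \<in> overlap M i k" by (rule cocycle(1)[OF ijk x])
  have y: "cbody M i j x \<in> V"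
    using x cbody_compose[OF ijk x] cbody_overlap[OF ijk(1,3) xk] by (simp add: V_def)
  have m: "morphism ?E ?N {x \<in> overlap M i j. cbody M i j x \<in> V} V (trans M i j)"
    by (rule morphism_trans_restrict[OF ijk(1,2) V])
  have xm: "x \<in> {x \<in> overlap M i j. cbody M i j x \<in> V}" using x y by simp
  have ji: "y \<in> overlap M j i" if "y \<in> V" for y using cocycle(1)[OF ijk(2,3,1)] that by (simp add: V_def)
  have e: "cpull M j k (partial M c (trans M k i a)) y = (\<Sum>b\<in>coords M. jac M j k b c y * partial M b (trans M j i a) y)" if y: "y \<in> V" for y
  proof -
    have "partial M b (cpull M j k (trans M k i a)) y = partial M b (trans M j i a) y" for b
      using cocycle(2)[OF ijk(2,3,1) _ _ a] by (intro spd_cong[OF V y]) (simp add: V_def)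
    then show ?thesis
      using cpull_partial[OF ijk(2,3) _ ev_open_overlap[OF ijk(3,1)] superfun_trans[OF ijk(3,1) a], of y c] y
      by (simp add: V_def)
  qed
  have 1: "superfun ?E ?N V (jac M j k b c)" if "b \<in> coords M" for b
    by (rule superfun_subset[OF superfun_jac[OF ijk(2,3) that]]) (auto simp: V_def)
  have 2: "superfun ?E ?N V (partial M b (trans M j i a))" for b
    by (rule superfun_subset[OF superfun_partial_trans[OF ijk(2,1) a]]) (use ji in blast)
  have "jac M i k a c x = cpull M i j (cpull M j k (partial M c (trans M k i a))) x"
    unfolding jac_def
    by (rule cpull_compose[OF ijk x ev_open_overlap[OF ijk(3,1)] superfun_partial_trans[OF ijk(3,1) a] cbody_overlap[OF ijk(1,3) xk], symmetric])
  also have "\<dots> = cpull M i j (\<lambda>y. \<Sum>b\<in>coords M. jac M j k b c y * partial M b (trans M j i a) y) x"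
    by (intro pullback_cong[OF m xm] e)
  also have "\<dots> = (\<Sum>b\<in>coords M. cpull M i j (\<lambda>y. jac M j k b c y * partial M b (trans M j i a) y) x)"
    by (intro pullback_sum[OF m _ _ xm] superfun_mult[OF V] 1 2) auto
  also have "\<dots> = (\<Sum>b\<in>coords M. cpull M i j (jac M j k b c) x * jac M i j a b x)"
    using pullback_mult[OF m 1 2 xm] by (intro sum.cong refl) (simp add: jac_def)
  finally show ?thesis .
qed

lemma cpull_jac:
  assumes "i \<in> charts M" "j \<in> charts M" "x \<in> overlap M i j" "b \<in> coords M"
  shows "cpull M i j (jac M j i b a) x = partial M a (trans M i j b) x"
  unfolding jac_def
  by (rule cpull_inverse[OF assms(1-3,3) ev_open_overlap[OF assms(1,2)] superfun_partial_trans[OF assms(1,2,4)]])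

text \<open>Brings in second derivatives of the coordinate change, which \<open>partial_jac\<close>
  trades for derivatives of \<open>jac\<close>.\<close>

lemma cpull_partial_jac:
  assumes ij: "i \<in> charts M" "j \<in> charts M" and x: "x \<in> overlap M i j" and c: "c \<in> coords M"
  shows "cpull M i j (partial M b (jac M j i c a)) x
    = (\<Sum>e\<in>coords M. jac M i j e b x * partial M e (partial M a (trans M i j c)) x)"
proof -
  have "partial M e (cpull M i j (jac M j i c a)) x = partial M e (partial M a (trans M i j c)) x" for e
    using cpull_jac[OF ij _ c] by (intro spd_cong[OF ev_open_overlap[OF ij] x])
  then show ?thesis
    using cpull_partial[OF ij x ev_open_overlap[OF ij(2,1)] superfun_jac[OF ij(2,1) c] cbody_overlap[OF ij x], of b a] by simp
qed

lemma jac_self: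
  assumes i: "i \<in> charts M" and x: "x \<in> cdom M i" and a: "a \<in> coords M"
  shows "jac M i i a b x = (if a = b then 1 else 0)"
proof -
  have "jac M i i a b x = partial M b (trans M i i a) x"
    unfolding jac_def
    using x superfun_partial_trans[OF i i a] by (intro cpull_id[OF i x x ev_open_cdom[OF i]]) (simp add: overlap_self[OF i])
  also have "\<dots> = partial M b (coord (evens M) a) x"
    using trans_self[OF i] a by (intro spd_cong[OF ev_open_cdom[OF i] x])
  finally show ?thesis by (simp add: spd_coord_self eq_commute)
qed

end

section \<open>Gluing, Hausdorff property and countability of the anticotangent bundle\<close>

section \<open>The atlas of the anticotangent bundle\<close>

lemma anticotangent_simps [simp]:
  "evens (anticotangent M) = tE (evens M) (odds M)"
  "odds (anticotangent M) = tN (evens M) (odds M)"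
  "charts (anticotangent M) = charts M"
  "cdom (anticotangent M) i = tU (evens M) (odds M) (cdom M i)"
  "overlap (anticotangent M) i j = tU (evens M) (odds M) (overlap M i j)"
  "trans (anticotangent M) i j (Base b) = lift_fun (trans M i j b)"
  "trans (anticotangent M) i j (Anti b) = (\<lambda>X. \<Sum>a\<in>coords M. lift_fun (jac M i j a b) X * coord (tE (evens M) (odds M)) (Anti a) X)"
  "weight (anticotangent M) i (Base a) = weight M i a"
  "weight (anticotangent M) i (Anti a) = - weight M i a"
  by (simp_all add: anticotangent_def Let_def tE_def tN_def tU_def)

lemma anticotangent_wt_simps [simp]:
  "evens (anticotangent_wt M r) = tE (evens M) (odds M)"
  "odds (anticotangent_wt M r) = tN (evens M) (odds M)"
  "charts (anticotangent_wt M r) = charts M"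
  "cdom (anticotangent_wt M r) = cdom (anticotangent M)"
  "overlap (anticotangent_wt M r) = overlap (anticotangent M)"
  "trans (anticotangent_wt M r) = trans (anticotangent M)"
  "weight (anticotangent_wt M r) i z = weight (anticotangent M) i z + r * fibre_degree z"
  by (simp_all add: anticotangent_wt_def)

lemma superfun_coord_Anti: "a \<in> E \<union> N \<Longrightarrow> superfun (tE E N) (tN E N) W (coord (tE E N) (Anti a))"
  by (rule superfun_coord) auto

lemma gpar_coord_Anti: "E \<inter> N = {} \<Longrightarrow> a \<in> E \<union> N \<Longrightarrow> gpar (Suc (sdeg E a)) (coord (tE E N) (Anti a) X)"
  using gpar_coord[of "tE E N" "Anti a" X] sdeg_Anti[of E N a]
  by (subst gpar_cong) (auto simp: sdeg_def)

lemma cpar_anticotangent_wt: "cpar (anticotangent_wt M r) = cpar (anticotangent M)"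
  by (simp add: cpar_def fun_eq_iff)

lemma jac_anticotangent_wt: "jac (anticotangent_wt M r) = jac (anticotangent M)"
  by (simp add: jac_def fun_eq_iff)

lemma supermanifold_anticotangent_wt: "supermanifold (anticotangent_wt M r) \<longleftrightarrow> supermanifold (anticotangent M)"
  by (simp add: supermanifold_def hausdorff_atlas_def second_countable_atlas_def cpar_anticotangent_wt)

context
  fixes M :: "('c, 'i::{finite,linorder}) atlas"
  assumes M: "supermanifold M"
begin

lemma tproj_cbody:
  "tproj (body (tE (evens M) (odds M)) (trans (anticotangent M) i j) X) = cbody M i j (tproj X)"
  using gcoeff_glift_image[of _ "{}"] by (auto simp: vec_eq_iff tproj_component body_def lift_fun_glift)

lemma superfun_trans_T:
  assumes ij: "i \<in> charts M" "j \<in> charts M" and z: "z \<in> coords (anticotangent M)"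
  shows "superfun (tE (evens M) (odds M)) (tN (evens M) (odds M)) (tU (evens M) (odds M) (overlap M i j)) (trans (anticotangent M) i j z)"
    and "X \<in> tU (evens M) (odds M) (overlap M i j) \<Longrightarrow> gpar (sdeg (tE (evens M) (odds M)) z) (trans (anticotangent M) i j z X)"
proof -
  note o = ev_open_overlap[OF M ij]
  have "superfun (tE (evens M) (odds M)) (tN (evens M) (odds M)) (tU (evens M) (odds M) (overlap M i j)) (trans (anticotangent M) i j z) \<and>
    (X \<in> tU (evens M) (odds M) (overlap M i j) \<longrightarrow> gpar (sdeg (tE (evens M) (odds M)) z) (trans (anticotangent M) i j z X))"
  proof (cases z)
    case (Base b)
    then have b: "b \<in> coords M" using z by auto
    show ?thesis
      using superfun_lift[OF o superfun_trans[OF M ij b]] gpar_glift[OF gpar_trans[OF M ij b]] tU_proj(1)[of X "evens M" "odds M"]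
      by (simp add: Base sdeg_Base lift_fun_glift)
  next
    case (Anti b)
    then have b: "b \<in> coords M" using z by auto
    have "superfun (tE (evens M) (odds M)) (tN (evens M) (odds M)) (tU (evens M) (odds M) (overlap M i j)) (trans (anticotangent M) i j z)"
      unfolding Anti anticotangent_simps
      by (intro superfun_sum superfun_mult superfun_lift superfun_jac[OF M ij] superfun_coord_Anti ev_open_tU o)
    moreover have "gpar (sdeg (tE (evens M) (odds M)) z) (trans (anticotangent M) i j z X)" if X: "X \<in> tU (evens M) (odds M) (overlap M i j)"
      unfolding Anti anticotangent_simps
    proof (rule gpar_sum)
      fix a assume a: "a \<in> coords M"
      have "gpar (sdeg (evens M) a + sdeg (evens M) b + Suc (sdeg (evens M) a)) (lift_fun (jac M i j a b) X * coord (tE (evens M) (odds M)) (Anti a) X)"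
        unfolding lift_fun_glift by (intro gpar_mult gpar_glift gpar_jac[OF M ij] a gpar_coord_Anti coords_disjoint[OF M] tU_proj(1)[OF X])
      moreover have "even (sdeg (evens M) a + sdeg (evens M) b + Suc (sdeg (evens M) a)) = even (sdeg (tE (evens M) (odds M)) (Anti b))"
        using sdeg_Anti[OF coords_disjoint[OF M] b] by (auto simp: sdeg_def)
      ultimately show "gpar (sdeg (tE (evens M) (odds M)) (Anti b)) (lift_fun (jac M i j a b) X * coord (tE (evens M) (odds M)) (Anti a) X)"
        using gpar_cong by blast
    qed
    ultimately show ?thesis by blast
  qed
  then show "superfun (tE (evens M) (odds M)) (tN (evens M) (odds M)) (tU (evens M) (odds M) (overlap M i j)) (trans (anticotangent M) i j z)"
    "X \<in> tU (evens M) (odds M) (overlap M i j) \<Longrightarrow> gpar (sdeg (tE (evens M) (odds M)) z) (trans (anticotangent M) i j z X)" by blast+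
qed

lemma cbody_T_evspace: "body (tE (evens M) (odds M)) (trans (anticotangent M) i j) X \<in> evspace (tE (evens M) (odds M))"
  by (simp add: body_def evspace_def)

lemma morphism_trans_T:
  assumes ij: "i \<in> charts M" "j \<in> charts M"
  shows "morphism (tE (evens M) (odds M)) (tN (evens M) (odds M)) (tU (evens M) (odds M) (overlap M i j)) (tU (evens M) (odds M) (overlap M j i)) (trans (anticotangent M) i j)"
  unfolding morphism_def
proof (intro conjI ballI ev_open_tU ev_open_overlap[OF M] ij)
  show "tE (evens M) (odds M) \<inter> tN (evens M) (odds M) = {}" by (rule tE_disjoint[OF coords_disjoint[OF M]])
  show "body (tE (evens M) (odds M)) (trans (anticotangent M) i j) ` tU (evens M) (odds M) (overlap M i j) \<subseteq> tU (evens M) (odds M) (overlap M j i)"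
    using tproj_cbody[of i j] cbody_T_evspace[of i j] cbody_overlap[OF M ij] by (auto simp: tU_def)
qed (use superfun_trans_T[OF ij] in auto)

lemma tU_restrict: "{X \<in> tU (evens M) (odds M) (overlap M i j). body (tE (evens M) (odds M)) (trans (anticotangent M) i j) X \<in> tU (evens M) (odds M) W} = tU (evens M) (odds M) {x \<in> overlap M i j. cbody M i j x \<in> W}"
  using tproj_cbody[of i j] cbody_T_evspace[of i j] by (auto simp: tU_def)

lemma morphism_trans_T_restrict:
  assumes ij: "i \<in> charts M" "j \<in> charts M" and W: "ev_open (evens M) W"
  shows "morphism (tE (evens M) (odds M)) (tN (evens M) (odds M)) (tU (evens M) (odds M) {x \<in> overlap M i j. cbody M i j x \<in> W}) (tU (evens M) (odds M) W) (trans (anticotangent M) i j)"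
  using morphism_restrict[OF morphism_trans_T[OF ij] ev_open_tU[OF W]] tU_restrict[of i j W] by simp

lemma cpull_T_lift:
  assumes ij: "i \<in> charts M" "j \<in> charts M" and W: "ev_open (evens M) W" "superfun (evens M) (odds M) W f"
    and X: "tproj X \<in> overlap M i j" "X \<in> evspace (tE (evens M) (odds M))" "cbody M i j (tproj X) \<in> W"
  shows "cpull (anticotangent M) i j (lift_fun f) X = lift_fun (cpull M i j f) X"
  using pullback_lift[OF morphism_trans_restrict[OF M ij W(1)] morphism_trans_T_restrict[OF ij W(1)] _ W(2)] X
  by (simp add: tU_def)

lemma trans_T_self:
  assumes i: "i \<in> charts M" and X: "X \<in> tU (evens M) (odds M) (cdom M i)" and z: "z \<in> coords (anticotangent M)"
  shows "trans (anticotangent M) i i z X = coord (tE (evens M) (odds M)) z X"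
proof (cases z)
  case (Base a)
  then show ?thesis
    using z trans_self[OF M i tU_proj(1)[OF X], of a] lift_coord[of "evens M" a X "odds M"] by (auto simp: lift_fun_glift)
next
  case (Anti b)
  then have b: "b \<in> coords M" using z by auto
  have "trans (anticotangent M) i i z X = (\<Sum>a\<in>coords M. glift (jac M i i a b (tproj X)) * coord (tE (evens M) (odds M)) (Anti a) X)"
    by (simp add: Anti lift_fun_glift)
  also have "\<dots> = (\<Sum>a\<in>coords M. if a = b then coord (tE (evens M) (odds M)) (Anti b) X else 0)"
    using jac_self[OF M i tU_proj(1)[OF X]] by (intro sum.cong refl) (simp add: glift_one)
  also have "\<dots> = coord (tE (evens M) (odds M)) (Anti b) X" using b by (subst sum.delta) auto
  finally show ?thesis by (simp add: Anti)
qed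

text \<open>Base coordinates inherit the condition through \<open>cpull_T_lift\<close>. For the
  momenta it is \<open>jac_cocycle\<close>, after the coefficients have been collected in front of
  each momentum.\<close>

lemma trans_T_cocycle:
  assumes ijk: "i \<in> charts M" "j \<in> charts M" "k \<in> charts M"
    and X: "X \<in> tU (evens M) (odds M) (overlap M i j)" "body (tE (evens M) (odds M)) (trans (anticotangent M) i j) X \<in> tU (evens M) (odds M) (overlap M j k)" and z: "z \<in> coords (anticotangent M)"
  shows "trans (anticotangent M) i k z X = cpull (anticotangent M) i j (trans (anticotangent M) j k z) X"
proof -
  let ?x = "tproj X"
  have x: "?x \<in> overlap M i j" "cbody M i j ?x \<in> overlap M j k"
    using X tproj_cbody[of i j X] by (auto simp: tU_def)
  have ev: "X \<in> evspace (tE (evens M) (odds M))" using X by (simp add: tU_def)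
  note W = ev_open_overlap[OF M ijk(2,3)]
  show ?thesis
  proof (cases z)
    case (Base c)
    then have c: "c \<in> coords M" using z by auto
    show ?thesis
      using cpull_T_lift[OF ijk(1,2) W superfun_trans[OF M ijk(2,3) c] x(1) ev x(2)] cocycle(2)[OF M ijk x c]
      by (simp add: Base lift_fun_glift)
  next
    case (Anti c)
    then have c: "c \<in> coords M" using z by auto
    note m = morphism_trans_T_restrict[OF ijk(1,2) W]
    have Xm: "X \<in> tU (evens M) (odds M) {x \<in> overlap M i j. cbody M i j x \<in> overlap M j k}" using x ev by (simp add: tU_def)
    have s: "superfun (tE (evens M) (odds M)) (tN (evens M) (odds M)) (tU (evens M) (odds M) (overlap M j k)) (lift_fun (jac M j k b c))" if "b \<in> coords M" for b
      by (rule superfun_lift[OF W superfun_jac[OF M ijk(2,3) that]])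
    have "cpull (anticotangent M) i j (trans (anticotangent M) j k z) X
      = (\<Sum>b\<in>coords M. cpull (anticotangent M) i j (\<lambda>Y. lift_fun (jac M j k b c) Y * coord (tE (evens M) (odds M)) (Anti b) Y) X)"
      unfolding Anti anticotangent_simps
      using superfun_mult[OF ev_open_tU[OF W] s superfun_coord_Anti] by (intro pullback_sum[OF m finite _ Xm])
    also have "\<dots> = (\<Sum>b\<in>coords M. glift (cpull M i j (jac M j k b c) ?x) * (\<Sum>a\<in>coords M. glift (jac M i j a b ?x) * coord (tE (evens M) (odds M)) (Anti a) X))"
    proof (intro sum.cong refl)
      fix b assume b: "b \<in> coords M"
      then have "Anti b \<in> tE (evens M) (odds M) \<union> tN (evens M) (odds M)" by auto
      then show "cpull (anticotangent M) i j (\<lambda>Y. lift_fun (jac M j k b c) Y * coord (tE (evens M) (odds M)) (Anti b) Y) X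
        = glift (cpull M i j (jac M j k b c) ?x) * (\<Sum>a\<in>coords M. glift (jac M i j a b ?x) * coord (tE (evens M) (odds M)) (Anti a) X)"
        using pullback_mult[OF m s[OF b] superfun_coord_Anti[OF b] Xm] pullback_coord[OF m Xm]
          cpull_T_lift[OF ijk(1,2) W superfun_jac[OF M ijk(2,3) b] x(1) ev x(2)]
        by (simp add: lift_fun_glift)
    qed
    also have "\<dots> = (\<Sum>a\<in>coords M. glift (\<Sum>b\<in>coords M. cpull M i j (jac M j k b c) ?x * jac M i j a b ?x) * coord (tE (evens M) (odds M)) (Anti a) X)"
      unfolding sum_distrib_left glift_sum sum_distrib_right
      by (subst sum.swap) (simp add: glift_mult mult.assoc)
    also have "\<dots> = trans (anticotangent M) i k z X"
      unfolding Anti anticotangent_simps lift_fun_glift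
      by (intro sum.cong refl) (simp only: jac_cocycle[OF M ijk x])
    finally show ?thesis ..
  qed
qed

text \<open>Points over separated base points are separated by preimages of base neighbourhoods;
  over the same base point the separation takes place in the fibre.\<close>

lemma hausdorff_T: "hausdorff_atlas (anticotangent M)"
  unfolding hausdorff_atlas_def anticotangent_simps
proof (intro ballI impI)
  have H: "hausdorff_atlas M" using M by (simp add: supermanifold_def)
  fix i j X Y
  assume ij: "i \<in> charts M" "j \<in> charts M" and X: "X \<in> tU (evens M) (odds M) (cdom M i)" and Y: "Y \<in> tU (evens M) (odds M) (cdom M j)"
    and n: "\<not> (X \<in> tU (evens M) (odds M) (overlap M i j) \<and> body (tE (evens M) (odds M)) (trans (anticotangent M) i j) X = Y)"
  show "\<exists>A B. ev_open (tE (evens M) (odds M)) A \<and> ev_open (tE (evens M) (odds M)) B \<and> X \<in> A \<and> Y \<in> B \<and>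
      (\<forall>u\<in>A \<inter> tU (evens M) (odds M) (overlap M i j). body (tE (evens M) (odds M)) (trans (anticotangent M) i j) u \<notin> B)"
  proof (cases "tproj X \<in> overlap M i j \<and> cbody M i j (tproj X) = tproj Y")
    case False
    then obtain A B where AB: "ev_open (evens M) A" "ev_open (evens M) B" "tproj X \<in> A" "tproj Y \<in> B"
        "\<forall>u\<in>A \<inter> overlap M i j. cbody M i j u \<notin> B"
      using H[unfolded hausdorff_atlas_def, rule_format, OF ij tU_proj(1)[OF X] tU_proj(1)[OF Y] False] by blast
    show ?thesis
    proof (rule exI[of _ "tU (evens M) (odds M) A"], rule exI[of _ "tU (evens M) (odds M) B"], intro conjI ev_open_tU AB ballI)
      show "X \<in> tU (evens M) (odds M) A" "Y \<in> tU (evens M) (odds M) B" using X Y AB by (auto simp: tU_def)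
      fix Z assume "Z \<in> tU (evens M) (odds M) A \<inter> tU (evens M) (odds M) (overlap M i j)"
      then show "body (tE (evens M) (odds M)) (trans (anticotangent M) i j) Z \<notin> tU (evens M) (odds M) B" using AB(5) tproj_cbody[of i j Z] by (auto simp: tU_def)
    qed
  next
    case True
    \<comment> \<open>The image of X in the chart j and the point Y are distinct points of one
      Euclidean space; the neighbourhood of the image is pulled back to the chart i.\<close>
    then have Xo: "X \<in> tU (evens M) (odds M) (overlap M i j)" using X by (auto simp: tU_def)
    then have "body (tE (evens M) (odds M)) (trans (anticotangent M) i j) X \<noteq> Y" using n by blast
    then obtain A B where AB: "open A" "open B" "body (tE (evens M) (odds M)) (trans (anticotangent M) i j) X \<in> A" "Y \<in> B" "A \<inter> B = {}"
      using hausdorff[of "body (tE (evens M) (odds M)) (trans (anticotangent M) i j) X" Y] by auto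
    have A: "ev_open (tE (evens M) (odds M)) (evspace (tE (evens M) (odds M)) \<inter> A)" "ev_open (tE (evens M) (odds M)) (evspace (tE (evens M) (odds M)) \<inter> B)"
      by (intro openin_open_Int AB)+
    note m = morphism_restrict[OF morphism_trans_T[OF ij] A(1)]
    show ?thesis
      using morphism_facts(2)[OF m] A(2) AB Xo Y cbody_T_evspace[of i j]
      by - (rule exI[of _ "{X \<in> tU (evens M) (odds M) (overlap M i j). body (tE (evens M) (odds M)) (trans (anticotangent M) i j) X \<in> evspace (tE (evens M) (odds M)) \<inter> A}"],
          rule exI[of _ "evspace (tE (evens M) (odds M)) \<inter> B"], auto simp: tU_def)
  qed
qed

lemma supermanifold_T: "supermanifold (anticotangent M)"
  unfolding supermanifold_def
proof (intro conjI ballI impI, goal_cases)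
  case 1
  show ?case using tE_disjoint[OF coords_disjoint[OF M]] by simp
next
  case (2 i) then show ?case using ev_open_tU[OF ev_open_cdom[OF M]] by simp
next
  case (3 i) then show ?case by (simp add: overlap_self[OF M])
next
  case (4 i z X) then show ?case using trans_T_self[of i X z] by simp
next
  case (5 i j) then show ?case using ev_open_tU[OF ev_open_overlap[OF M]] by simp
next
  case (6 i j) then show ?case using overlap_cdom[OF M] by (auto simp: tU_def)
next
  case (7 i j) then show ?case using morphism_facts(7)[OF morphism_trans_T[of i j]] by simp
next
  case (8 i j z) then show ?case using superfun_trans_T(1)[of i j z] by simp
next
  case (9 i j z)
  have "cpar (anticotangent M) z = sdeg (tE (evens M) (odds M)) z"
    using 9(3) tE_disjoint[OF coords_disjoint[OF M]] by (auto simp: cpar_def sdeg_def)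
  then show ?case using 9 superfun_trans_T(2)[of i j z] by (simp add: parity_on_iff)
next
  case (10 i j k X)
  then show ?case using cocycle(1)[OF M, of i j k "tproj X"] tproj_cbody[of i j X] by (auto simp: tU_def)
next
  case (11 i j k X z)
  then show ?case using trans_T_cocycle[of i j k X z] by simp
next
  case 12 show ?case by (rule hausdorff_T)
next
  case 13
  have "second_countable_atlas M" using M by (simp add: supermanifold_def)
  then obtain C where C: "C \<subseteq> charts M" "countable C" "\<forall>i\<in>charts M. cdom M i \<subseteq> (\<Union>j\<in>C. overlap M i j)"
    unfolding second_countable_atlas_def by blast
  \<comment> \<open>Domains and overlaps upstairs are full preimages, so the same countable family
    of charts works.\<close>
  then show ?case
    unfolding second_countable_atlas_def anticotangent_simps
  proof (intro exI[of _ C] conjI ballI C(1,2))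
    fix i assume i: "i \<in> charts M"
    have "X \<in> (\<Union>j\<in>C. tU (evens M) (odds M) (overlap M i j))" if X: "X \<in> tU (evens M) (odds M) (cdom M i)" for X
    proof -
      obtain j where "j \<in> C" "tproj X \<in> overlap M i j" using C(3) i tU_proj(1)[OF X] by blast
      then show ?thesis using X by (auto simp: tU_def)
    qed
    then show "tU (evens M) (odds M) (cdom M i) \<subseteq> (\<Union>j\<in>C. tU (evens M) (odds M) (overlap M i j))" by blast
  qed
qed

end

section \<open>Momentum-linear functions and the Jacobian of the lifted coordinate changes\<close>

lemma spd_lift_mult_Base:
  assumes "E \<inter> N = {}" "ev_open E U" "X \<in> tU E N U" "superfun E N U f" "superfun (tE E N) (tN E N) (tU E N U) g"
  shows "spd (tE E N) (Base b) (\<lambda>Y. lift_fun f Y * g Y) X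
    = lift_fun (spd E b f) X * g X + (if b \<in> E then lift_fun f X else ginvol (lift_fun f X)) * spd (tE E N) (Base b) g X"
  using spd_mult[OF ev_open_tU[OF assms(2)] assms(3) superfun_lift[OF assms(2,4)] assms(5), of "Base b"]
  by (simp add: spd_lift_Base)

lemma spd_lift_mult_Anti:
  assumes "E \<inter> N = {}" "ev_open E U" "X \<in> tU E N U" "superfun E N U f" "superfun (tE E N) (tN E N) (tU E N U) g"
  shows "spd (tE E N) (Anti b) (\<lambda>Y. lift_fun f Y * g Y) X
    = (if b \<in> N then lift_fun f X else ginvol (lift_fun f X)) * spd (tE E N) (Anti b) g X"
  using spd_mult[OF ev_open_tU[OF assms(2)] assms(3) superfun_lift[OF assms(2,4)] assms(5), of "Anti b"]
  by (simp add: spd_lift_Anti)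

text \<open>Both the transformed momenta and, up to sign, the Hamiltonian of a vector field have the
  form L. The sign in the last claim comes from moving the derivative, of parity
  \<open>Suc (sdeg E b)\<close>, past a coefficient of parity k.\<close>

lemma
  fixes E N :: "'i::{finite,linorder} set"
  assumes EN: "E \<inter> N = {}" and U: "ev_open E U" and X: "X \<in> tU E N U"
    and g: "\<And>a. a \<in> E \<union> N \<Longrightarrow> superfun E N U (g a)"
  defines "L \<equiv> \<lambda>Y. \<Sum>a\<in>E \<union> N. lift_fun (g a) Y * coord (tE E N) (Anti a) Y"
  shows superfun_momentum_linear: "superfun (tE E N) (tN E N) (tU E N U) L"
    and spd_Base_momentum_linear: "spd (tE E N) (Base b) L X = (\<Sum>a\<in>E \<union> N. lift_fun (spd E b (g a)) X * coord (tE E N) (Anti a) X)"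
    and spd_Anti_momentum_linear: "b \<in> E \<union> N \<Longrightarrow> gpar k (g b (tproj X)) \<Longrightarrow>
      spd (tE E N) (Anti b) L X = (-1) ^ (Suc (sdeg E b) * k) * lift_fun (g b) X"
proof -
  have s: "superfun (tE E N) (tN E N) (tU E N U) (\<lambda>Y. lift_fun (g a) Y * coord (tE E N) (Anti a) Y)" if "a \<in> E \<union> N" for a
    using that by (intro superfun_mult ev_open_tU U superfun_lift g superfun_coord_Anti)
  then show "superfun (tE E N) (tN E N) (tU E N U) L"
    unfolding L_def by (intro superfun_sum ev_open_tU U)
  have e: "spd (tE E N) z L X = (\<Sum>a\<in>E \<union> N. spd (tE E N) z (\<lambda>Y. lift_fun (g a) Y * coord (tE E N) (Anti a) Y) X)" for z
    unfolding L_def by (rule spd_sum[OF ev_open_tU[OF U] X finite s])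
  show "spd (tE E N) (Base b) L X = (\<Sum>a\<in>E \<union> N. lift_fun (spd E b (g a)) X * coord (tE E N) (Anti a) X)"
    unfolding e
    by (intro sum.cong refl, subst spd_lift_mult_Base[OF EN U X g superfun_coord_Anti]) (auto simp: spd_coord)
  assume b: "b \<in> E \<union> N" and k: "gpar k (g b (tproj X))"
  have "ginvol (lift_fun (g b) X) = (-1) ^ k * lift_fun (g b) X"
    unfolding lift_fun_glift by (intro ginvol_gpar gpar_glift k)
  then have l: "(if b \<in> N then lift_fun (g b) X else ginvol (lift_fun (g b) X)) = (-1) ^ (Suc (sdeg E b) * k) * lift_fun (g b) X"
    using b EN by (auto simp: sdeg_def)
  have "spd (tE E N) (Anti b) L X = (\<Sum>a\<in>E \<union> N. if a = b then (-1) ^ (Suc (sdeg E b) * k) * lift_fun (g b) X else 0)"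
    unfolding e
    by (intro sum.cong refl, subst spd_lift_mult_Anti[OF EN U X g superfun_coord_Anti]) (use l in \<open>auto simp: spd_coord\<close>)
  then show "spd (tE E N) (Anti b) L X = (-1) ^ (Suc (sdeg E b) * k) * lift_fun (g b) X"
    using b by (simp add: sum.delta)
qed

context
  fixes M :: "('c, 'i::{finite,linorder}) atlas"
  assumes M: "supermanifold M"
begin

lemma cpull_trans_inverse:
  assumes ij: "i \<in> charts M" "j \<in> charts M" and x: "x \<in> overlap M i j" and d: "d \<in> coords M"
  shows "cpull M i j (trans M j i d) x = coord (evens M) d x"
proof -
  have "x \<in> cdom M i" using overlap_cdom[OF M ij] x by blast
  then show ?thesis
    using cocycle(2)[OF M ij ij(1) x cbody_overlap[OF M ij x] d] trans_self[OF M ij(1) _ d] by simp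
qed

text \<open>The inverse identity on the other side, from the chain rule for the identity change of
  the chart i.\<close>

lemma jac_inverse_right:
  assumes ij: "i \<in> charts M" "j \<in> charts M" and x: "x \<in> overlap M i j" and d: "d \<in> coords M"
  shows "(\<Sum>c\<in>coords M. partial M e (trans M i j c) x * jac M i j d c x) = (if e = d then 1 else 0)"
proof -
  have "partial M e (cpull M i j (trans M j i d)) x = partial M e (coord (evens M) d) x"
    using cpull_trans_inverse[OF ij _ d] by (intro spd_cong[OF ev_open_overlap[OF M ij] x])
  then show ?thesis
    using partial_cpull[OF M ij x ev_open_overlap[OF M ij(2,1)] superfun_trans[OF M ij(2,1) d] cbody_overlap[OF M ij x], of e]
    by (simp add: spd_coord jac_def)
qed

text \<open>Differentiate \<open>jac_inverse\<close>, whose right side is constant, and let the two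
  derivatives of the coordinate change commute.\<close>

lemma partial_jac:
  assumes ij: "i \<in> charts M" "j \<in> charts M" and x: "x \<in> overlap M i j" and ab: "a \<in> coords M" "b \<in> coords M" and c: "c \<in> coords M"
  shows "(\<Sum>e\<in>coords M. jac M i j e b x * partial M e (partial M a (trans M i j c)) x)
    = - ((-1) ^ (sdeg (evens M) a * sdeg (evens M) b) * (\<Sum>e\<in>coords M. partial M a (jac M i j e b) x * partial M e (trans M i j c) x))"
proof -
  let ?p = "sdeg (evens M)" and ?E = "evens M"
  note U = ev_open_overlap[OF M ij]
  have "partial M a (\<lambda>y. \<Sum>e\<in>coords M. jac M i j e b y * partial M e (trans M i j c) y) x = partial M a (\<lambda>y. of_real (if b = c then 1 else 0)) x"
    using jac_inverse[OF M ij _ c, of _ b] by (intro spd_cong[OF U x]) simp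
  also have "\<dots> = 0" by (rule spd_const[OF U])
  also have "partial M a (\<lambda>y. \<Sum>e\<in>coords M. jac M i j e b y * partial M e (trans M i j c) y) x
      = (\<Sum>e\<in>coords M. partial M a (\<lambda>y. jac M i j e b y * partial M e (trans M i j c) y) x)"
    by (rule spd_sum[OF U x finite superfun_mult[OF U superfun_jac[OF M ij] superfun_partial_trans[OF M ij c]]])
  also have "\<dots> = (\<Sum>e\<in>coords M. partial M a (jac M i j e b) x * partial M e (trans M i j c) x
      + (-1) ^ (?p a * ?p b) * (jac M i j e b x * partial M e (partial M a (trans M i j c)) x))"
  proof (intro sum.cong refl)
    fix e assume e: "e \<in> coords M"
    have "partial M a (partial M e (trans M i j c)) x = (-1) ^ (?p a * ?p e) * partial M e (partial M a (trans M i j c)) x"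
      by (rule spd_commute[OF U x superfun_trans[OF M ij c]])
    then show "partial M a (\<lambda>y. jac M i j e b y * partial M e (trans M i j c) y) x
      = partial M a (jac M i j e b) x * partial M e (trans M i j c) x
        + (-1) ^ (?p a * ?p b) * (jac M i j e b x * partial M e (partial M a (trans M i j c)) x)"
      using spd_mult_gpar[OF U x superfun_jac[OF M ij e] superfun_partial_trans[OF M ij c] gpar_jac[OF M ij e x], of a]
      by (cases "even (?p a)"; cases "even (?p b)"; cases "even (?p e)") simp_all
  qed
  finally have "(\<Sum>e\<in>coords M. partial M a (jac M i j e b) x * partial M e (trans M i j c) x)
      + (-1) ^ (?p a * ?p b) * (\<Sum>e\<in>coords M. jac M i j e b x * partial M e (partial M a (trans M i j c)) x) = 0"
    by (simp add: sum.distrib sum_distrib_left)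
  then have "(\<Sum>e\<in>coords M. partial M a (jac M i j e b) x * partial M e (trans M i j c) x)
      = - ((-1) ^ (?p a * ?p b) * (\<Sum>e\<in>coords M. jac M i j e b x * partial M e (partial M a (trans M i j c)) x))"
    by (simp add: eq_neg_iff_add_eq_0)
  then show ?thesis by (cases "even (?p a * ?p b)") simp_all
qed

text \<open>Up to the lift, this is the coefficient of the momentum d in the mixed entry of
  \<open>jac_T\<close>. After \<open>partial_jac\<close> the sum over c collapses by
  \<open>jac_inverse_right\<close>.\<close>

lemma cpull_partial_jac_jac:
  assumes ij: "i \<in> charts M" "j \<in> charts M" and x: "x \<in> overlap M i j" and a: "a \<in> coords M" and b: "b \<in> coords M" and d: "d \<in> coords M"
  shows "(\<Sum>c\<in>coords M. cpull M i j (partial M b (jac M j i c a)) x * jac M i j d c x)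
    = - ((-1) ^ (sdeg (evens M) a * sdeg (evens M) b) * partial M a (jac M i j d b) x)"
proof -
  let ?s = "(-1) ^ (sdeg (evens M) a * sdeg (evens M) b) :: 'i grass"
  have "(\<Sum>c\<in>coords M. cpull M i j (partial M b (jac M j i c a)) x * jac M i j d c x)
     = (\<Sum>c\<in>coords M. \<Sum>e\<in>coords M. - (?s * (partial M a (jac M i j e b) x * (partial M e (trans M i j c) x * jac M i j d c x))))"
    by (intro sum.cong refl, subst cpull_partial_jac[OF M ij x], assumption, subst partial_jac[OF ij x a b])
      (simp_all add: sum_distrib_left sum_distrib_right sum_negf mult.assoc)
  also have "\<dots> = - (?s * (\<Sum>e\<in>coords M. partial M a (jac M i j e b) x * (\<Sum>c\<in>coords M. partial M e (trans M i j c) x * jac M i j d c x)))"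
    by (subst sum.swap) (simp add: sum_distrib_left sum_negf)
  also have "(\<Sum>e\<in>coords M. partial M a (jac M i j e b) x * (\<Sum>c\<in>coords M. partial M e (trans M i j c) x * jac M i j d c x))
      = (\<Sum>e\<in>coords M. if e = d then partial M a (jac M i j d b) x else 0)"
    using jac_inverse_right[OF ij x d] by (intro sum.cong refl) simp
  also have "\<dots> = partial M a (jac M i j d b) x" using d by (subst sum.delta) auto
  finally show ?thesis .
qed

text \<open>The block form shows that the lifted change is canonical: the momentum block is, up to
  sign, the derivative of the base change with exchanged indices, and the mixed block is linear in
  the momenta. Both the grading of the bundle and the invariance of Hamiltonian fields rest on these
  entries.\<close>

lemma jac_T:
  assumes ij: "i \<in> charts M" "j \<in> charts M" and X: "X \<in> tU (evens M) (odds M) (overlap M i j)"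
    and a: "a \<in> coords M" and b: "b \<in> coords M"
  shows "jac (anticotangent M) i j (Base a) (Base b) X = lift_fun (jac M i j a b) X"
    and "jac (anticotangent M) i j (Base a) (Anti b) X = 0"
    and "jac (anticotangent M) i j (Anti a) (Anti b) X
      = (-1) ^ (Suc (sdeg (evens M) b) * (sdeg (evens M) a + sdeg (evens M) b)) * lift_fun (partial M a (trans M i j b)) X"
    and "jac (anticotangent M) i j (Anti a) (Base b) X
      = - ((-1) ^ (sdeg (evens M) a * sdeg (evens M) b) *
          (\<Sum>d\<in>coords M. lift_fun (partial M a (jac M i j d b)) X * coord (tE (evens M) (odds M)) (Anti d) X))"
proof -
  let ?T = "anticotangent M" and ?E = "evens M" and ?N = "odds M" and ?p = "sdeg (evens M)"
  let ?x = "tproj X"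
  note dis = coords_disjoint[OF M]
  note x = tU_proj(1)[OF X]
  have ev: "X \<in> evspace (tE ?E ?N)" using X by (simp add: tU_def)
  note bx = cbody_overlap[OF M ij x]
  note W = ev_open_overlap[OF M ij(2,1)]
  note m = morphism_trans_T[OF M ij]
  note lft = cpull_T_lift[OF M ij W _ x ev bx]
  have "partial ?T (Base b) (trans ?T j i (Base a)) = lift_fun (partial M b (trans M j i a))"
    by (simp add: fun_eq_iff spd_lift_Base)
  then show "jac ?T i j (Base a) (Base b) X = lift_fun (jac M i j a b) X"
    using lft[OF superfun_partial_trans[OF M ij(2,1) a], of b] by (simp add: jac_def lift_fun_glift)
  have "partial ?T (Anti b) (trans ?T j i (Base a)) = (\<lambda>Y. 0)"
    by (simp add: fun_eq_iff spd_lift_Anti)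
  then show "jac ?T i j (Base a) (Anti b) X = 0"
    using pullback_zero[OF m X] by (simp add: jac_def)
  let ?L = "\<lambda>Y. \<Sum>c\<in>coords M. lift_fun (jac M j i c a) Y * coord (tE ?E ?N) (Anti c) Y"
  note J = superfun_jac[OF M ij(2,1)]
  have "jac ?T i j (Anti a) (Anti b) X = cpull ?T i j (spd (tE ?E ?N) (Anti b) ?L) X"
    by (simp add: jac_def)
  also have "\<dots> = cpull ?T i j (\<lambda>Y. (-1) ^ (Suc (?p b) * (?p b + ?p a)) * lift_fun (jac M j i b a) Y) X"
    unfolding anticotangent_simps
    by (intro pullback_cong[OF m X] spd_Anti_momentum_linear[OF dis W _ J b] gpar_jac[OF M ij(2,1) b] tU_proj(1))
  also have "\<dots> = (-1) ^ (Suc (?p b) * (?p b + ?p a)) * lift_fun (cpull M i j (jac M j i b a)) X"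
    using pullback_sign[OF m superfun_lift[OF W J[OF b]] X] lft[OF J[OF b]] by simp
  finally show "jac ?T i j (Anti a) (Anti b) X = (-1) ^ (Suc (?p b) * (?p a + ?p b)) * lift_fun (partial M a (trans M i j b)) X"
    using cpull_jac[OF M ij x b] by (simp add: lift_fun_glift add.commute)
  have dJ: "superfun ?E ?N (overlap M j i) (partial M b (jac M j i c a))" if "c \<in> coords M" for c
    by (rule superfun_spd[OF W J[OF that]])
  have "jac ?T i j (Anti a) (Base b) X = cpull ?T i j (spd (tE ?E ?N) (Base b) ?L) X"
    by (simp add: jac_def)
  also have "\<dots> = cpull ?T i j (\<lambda>Y. \<Sum>c\<in>coords M. lift_fun (partial M b (jac M j i c a)) Y * coord (tE ?E ?N) (Anti c) Y) X"
    unfolding anticotangent_simps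
    by (intro pullback_cong[OF m X] spd_Base_momentum_linear[OF dis W _ J])
  also have "\<dots> = (\<Sum>c\<in>coords M. cpull ?T i j (\<lambda>Y. lift_fun (partial M b (jac M j i c a)) Y * coord (tE ?E ?N) (Anti c) Y) X)"
    unfolding anticotangent_simps
    by (intro pullback_sum[OF m finite _ X] superfun_mult ev_open_tU W superfun_lift dJ superfun_coord_Anti)
  also have "\<dots> = (\<Sum>c\<in>coords M. glift (cpull M i j (partial M b (jac M j i c a)) ?x) * (\<Sum>d\<in>coords M. glift (jac M i j d c ?x) * coord (tE ?E ?N) (Anti d) X))"
  proof (intro sum.cong refl)
    fix c assume c: "c \<in> coords M"
    then have "Anti c \<in> tE ?E ?N \<union> tN ?E ?N" by auto
    then show "cpull ?T i j (\<lambda>Y. lift_fun (partial M b (jac M j i c a)) Y * coord (tE ?E ?N) (Anti c) Y) X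
      = glift (cpull M i j (partial M b (jac M j i c a)) ?x) * (\<Sum>d\<in>coords M. glift (jac M i j d c ?x) * coord (tE ?E ?N) (Anti d) X)"
      using pullback_mult[OF m superfun_lift[OF W dJ[OF c]] superfun_coord_Anti[OF c] X] pullback_coord[OF m X]
        lft[OF dJ[OF c]] by (simp add: lift_fun_glift)
  qed
  also have "\<dots> = (\<Sum>d\<in>coords M. glift (\<Sum>c\<in>coords M. cpull M i j (partial M b (jac M j i c a)) ?x * jac M i j d c ?x) * coord (tE ?E ?N) (Anti d) X)"
    unfolding sum_distrib_left glift_sum sum_distrib_right
    by (subst sum.swap) (simp add: glift_mult mult.assoc)
  also have "\<dots> = (\<Sum>d\<in>coords M. - ((-1) ^ (?p a * ?p b) * (lift_fun (partial M a (jac M i j d b)) X * coord (tE ?E ?N) (Anti d) X)))"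
  proof (intro sum.cong refl)
    fix d assume d: "d \<in> coords M"
    show "glift (\<Sum>c\<in>coords M. cpull M i j (partial M b (jac M j i c a)) ?x * jac M i j d c ?x) * coord (tE ?E ?N) (Anti d) X
      = - ((-1) ^ (?p a * ?p b) * (lift_fun (partial M a (jac M i j d b)) X * coord (tE ?E ?N) (Anti d) X))"
      unfolding cpull_partial_jac_jac[OF ij x a b d] lift_fun_glift
      by (cases "even (?p a * ?p b)") (simp_all add: glift_uminus)
  qed
  finally show "jac ?T i j (Anti a) (Base b) X
      = - ((-1) ^ (?p a * ?p b) * (\<Sum>d\<in>coords M. lift_fun (partial M a (jac M i j d b)) X * coord (tE ?E ?N) (Anti d) X))"
    by (simp add: sum_negf sum_distrib_left)
qed

end

text \<open>Every shift r is admissible, because new momenta are linear in the old ones: coordinate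
  changes preserve the fibre degree, so both sides of each transformation law carry the same
  multiple of r.\<close>

lemma graded_manifold_anticotangent_wt:
  assumes gm: "graded_manifold M" shows "graded_manifold (anticotangent_wt M r)"
proof -
  let ?T = "anticotangent M" and ?E = "evens M" and ?N = "odds M"
  let ?W = "anticotangent_wt M r"
  have M: "supermanifold M" using gm by (simp add: graded_manifold_def)
  note dis = coords_disjoint[OF M]
  show ?thesis
    unfolding graded_manifold_def
  proof (intro conjI ballI)
    show "supermanifold ?W" by (simp add: supermanifold_anticotangent_wt supermanifold_T[OF M])
    fix i j assume "i \<in> charts ?W" "j \<in> charts ?W"
    then have ij: "i \<in> charts M" "j \<in> charts M" by auto
    let ?U = "overlap M i j" and ?w = "weight ?W i"
    have U: "ev_open ?E ?U" by (rule ev_open_overlap[OF M ij])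
    note UT = ev_open_tU[OF U, of ?N]
    have wB: "?w (Base a) = weight M i a" and wA: "?w (Anti a) = r - weight M i a" for a by simp_all
    have tr: "weighted M i {weight M j b} ?U (trans M i j b)" if "b \<in> coords M" for b
      using gm ij that by (simp add: graded_manifold_def)
    have jc: "weighted M i {weight M i a - weight M j b} ?U (jac M i j a b)" if "a \<in> coords M" "b \<in> coords M" for a b
      using gm ij that by (simp add: graded_manifold_def)
    note lft = sw_lift[where wT = ?w and w = "weight M i", OF U dis wB]
    have y: "superfun_weights (tE ?E ?N) (tN ?E ?N) ?w {r - weight M i a} (tU ?E ?N ?U) (coord (tE ?E ?N) (Anti a))" if "a \<in> coords M" for a
      using sw_coord[OF UT tE_disjoint[OF dis], of "Anti a" ?w] that by auto
    have eq: "superfun_weights A B w {k} V f" if "superfun_weights A B w {l} V f" "l = k" for A B V f k l and w :: "'b tcoord \<Rightarrow> int"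
      using that by simp
    fix z assume z: "z \<in> coords ?W"
    show "weighted ?W i {weight ?W j z} (overlap ?W i j) (trans ?W i j z)"
    proof (cases z)
      case (Base b)
      then show ?thesis using z lft[OF tr[of b]] by auto
    next
      case (Anti b)
      then have b: "b \<in> coords M" using z by auto
      have "superfun_weights (tE ?E ?N) (tN ?E ?N) ?w {r - weight M j b} (tU ?E ?N ?U)
          (\<lambda>X. \<Sum>a\<in>coords M. lift_fun (jac M i j a b) X * coord (tE ?E ?N) (Anti a) X)"
        by (intro sw_sum[OF UT] eq[OF sw_mult[OF UT lft[OF jc] y]] b) auto
      then show ?thesis by (simp add: Anti)
    qed
    fix z' assume z': "z' \<in> coords ?W"
    have "superfun_weights (tE ?E ?N) (tN ?E ?N) ?w {?w z' - weight ?W j z} (tU ?E ?N ?U) (jac ?T i j z' z)"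
    proof (cases z'; cases z)
      fix a b assume s: "z' = Base a" "z = Base b"
      then have ab: "a \<in> coords M" "b \<in> coords M" using z z' by auto
      show ?thesis unfolding s
        by (rule sw_cong[OF UT eq[OF lft[OF jc[OF ab]]] jac_T(1)[OF M ij _ ab, symmetric]]) auto
    next
      fix a b assume s: "z' = Base a" "z = Anti b"
      then have ab: "a \<in> coords M" "b \<in> coords M" using z z' by auto
      show ?thesis unfolding s
        by (rule sw_cong[OF UT sw_zero[OF UT] jac_T(2)[OF M ij _ ab, symmetric]])
    next
      fix a b assume s: "z' = Anti a" "z = Anti b"
      then have ab: "a \<in> coords M" "b \<in> coords M" using z z' by auto
      show ?thesis unfolding s
        by (rule sw_cong[OF UT sw_sign[OF UT eq[OF lft[OF sw_spd[OF U tr[OF ab(2)] ab(1)]]]] jac_T(3)[OF M ij _ ab, symmetric]]) auto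
    next
      fix a b assume s: "z' = Anti a" "z = Base b"
      then have ab: "a \<in> coords M" "b \<in> coords M" using z z' by auto
      show ?thesis unfolding s
      proof (rule sw_cong[OF UT _ jac_T(4)[OF M ij _ ab, symmetric]])
        show "superfun_weights (tE ?E ?N) (tN ?E ?N) ?w {?w (Anti a) - weight ?W j (Base b)} (tU ?E ?N ?U)
          (\<lambda>X. - ((-1) ^ (sdeg ?E a * sdeg ?E b) * (\<Sum>d\<in>coords M. lift_fun (partial M a (jac M i j d b)) X * coord (tE ?E ?N) (Anti d) X)))"
          by (intro sw_uminus[OF UT] sw_sign[OF UT] sw_sum[OF UT] eq[OF sw_mult[OF UT lft[OF sw_spd[OF U jc]] y]] ab) auto
      qed
    qed
    then show "weighted ?W i {weight ?W i z' - weight ?W j z} (overlap ?W i j) (jac ?W i j z' z)"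
      by (simp add: jac_anticotangent_wt)
  qed
qed

section \<open>Odd vector fields and the square of a Hamiltonian field\<close>

section \<open>Hamiltonian vector fields\<close>

definition dapp :: "'i set \<Rightarrow> 'i set \<Rightarrow> ('i \<Rightarrow> 'i sfun) \<Rightarrow> 'i sfun \<Rightarrow> 'i::{finite,linorder} sfun" where
  "dapp E N V f x = (\<Sum>z\<in>E \<union> N. V z x * spd E z f x)"

lemma vf_app_dapp: "vf_app M V f = dapp (evens M) (odds M) V f"
  by (simp add: vf_app_def dapp_def fun_eq_iff)

lemma dapp_coord: "a \<in> E \<union> N \<Longrightarrow> dapp E N V (coord E a) x = V a x"
  by (simp add: dapp_def spd_coord mult_if_delta if_distrib sum.delta cong: if_cong)

lemma eq_uminus_self_iff: "(u :: 'a::real_vector) = - u \<longleftrightarrow> u = 0"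
  by (metis add.inverse_neutral add_eq_0_iff scaleR_2 scaleR_eq_0_iff zero_neq_numeral)

context
  fixes E N :: "'i::{finite,linorder} set" and U and V :: "'i \<Rightarrow> 'i sfun"
  assumes U: "ev_open E U"
    and V: "\<And>z. z \<in> E \<union> N \<Longrightarrow> superfun E N U (V z)"
    and V_odd: "\<And>z x. z \<in> E \<union> N \<Longrightarrow> x \<in> U \<Longrightarrow> gpar (Suc (sdeg E z)) (V z x)"
begin

lemma dapp_cong: "x \<in> U \<Longrightarrow> (\<And>y. y \<in> U \<Longrightarrow> f y = g y) \<Longrightarrow> dapp E N V f x = dapp E N V g x"
  unfolding dapp_def using spd_cong[OF U, of x f g] by simp

lemma dapp_zero: "dapp E N V (\<lambda>x. 0) x = 0"
  by (simp add: dapp_def spd_zero[OF U])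

lemma dapp_scaleR: "x \<in> U \<Longrightarrow> superfun E N U f \<Longrightarrow> dapp E N V (\<lambda>y. r *\<^sub>R f y) x = r *\<^sub>R dapp E N V f x"
  by (simp add: dapp_def spd_scaleR[OF U] scaleR_sum_right)

lemma dapp_uminus: "x \<in> U \<Longrightarrow> superfun E N U f \<Longrightarrow> dapp E N V (\<lambda>y. - f y) x = - dapp E N V f x"
  using dapp_scaleR[of x f "-1"] by simp

lemma dapp_sign: "x \<in> U \<Longrightarrow> superfun E N U f \<Longrightarrow> dapp E N V (\<lambda>y. (-1) ^ n * f y) x = (-1) ^ n * dapp E N V f x"
  using dapp_uminus by (simp add: minus_one_power_iff)

lemma dapp_add: "x \<in> U \<Longrightarrow> superfun E N U f \<Longrightarrow> superfun E N U g \<Longrightarrow>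
    dapp E N V (\<lambda>y. f y + g y) x = dapp E N V f x + dapp E N V g x"
  by (simp add: dapp_def spd_add[OF U, of x N] distrib_left sum.distrib)

lemma dapp_sum:
  assumes "x \<in> U" "finite I" "\<And>i. i \<in> I \<Longrightarrow> superfun E N U (f i)"
  shows "dapp E N V (\<lambda>y. \<Sum>i\<in>I. f i y) x = (\<Sum>i\<in>I. dapp E N V (f i) x)"
  using assms(2,3)
proof (induction I rule: finite_induct)
  case (insert i I)
  then show ?case
    using dapp_add[OF assms(1), of "f i" "\<lambda>y. \<Sum>i\<in>I. f i y"] by (simp add: superfun_sum[OF U])
qed (simp add: dapp_zero)

lemma dapp_mult:
  assumes x: "x \<in> U" and f: "superfun E N U f" and g: "superfun E N U g" and k: "gpar k (f x)"
  shows "dapp E N V (\<lambda>y. f y * g y) x = dapp E N V f x * g x + (-1) ^ k * (f x * dapp E N V g x)"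
proof -
  have "dapp E N V (\<lambda>y. f y * g y) x = (\<Sum>z\<in>E \<union> N. V z x * spd E z f x * g x + (-1) ^ k * (f x * (V z x * spd E z g x)))"
    unfolding dapp_def
  proof (intro sum.cong refl)
    fix z assume z: "z \<in> E \<union> N"
    from gpar_commute[OF V_odd[OF z x] k, THEN arg_cong, of "\<lambda>u. u * spd E z g x"]
    show "V z x * spd E z (\<lambda>y. f y * g y) x = V z x * spd E z f x * g x + (-1) ^ k * (f x * (V z x * spd E z g x))"
      unfolding spd_mult_gpar[OF U x f g k]
      by (cases "even k"; cases "even (sdeg E z)") (simp_all add: distrib_left mult.assoc right_diff_distrib)
  qed
  then show ?thesis by (simp add: dapp_def sum.distrib sum_distrib_left sum_distrib_right)
qed

text \<open>The graded commutator of a coordinate derivative with the odd field V is the field whose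
  components are the derivatives of those of V.\<close>

lemma spd_dapp:
  assumes x: "x \<in> U" and f: "superfun E N U f"
  shows "spd E w (dapp E N V f) x = (\<Sum>z\<in>E \<union> N. spd E w (V z) x * spd E z f x) + (-1) ^ sdeg E w * dapp E N V (spd E w f) x"
proof -
  have "spd E w (dapp E N V f) x = (\<Sum>z\<in>E \<union> N. spd E w (\<lambda>x. V z x * spd E z f x) x)"
    unfolding dapp_def[abs_def]
    by (rule spd_sum[OF U x finite superfun_mult[OF U V superfun_spd[OF U f]]])
  also have "\<dots> = (\<Sum>z\<in>E \<union> N. spd E w (V z) x * spd E z f x + (-1) ^ sdeg E w * (V z x * spd E z (spd E w f) x))"
  proof (intro sum.cong refl)
    fix z assume z: "z \<in> E \<union> N"
    show "spd E w (\<lambda>x. V z x * spd E z f x) x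
      = spd E w (V z) x * spd E z f x + (-1) ^ sdeg E w * (V z x * spd E z (spd E w f) x)"
      unfolding spd_mult_gpar[OF U x V[OF z] superfun_spd[OF U f] V_odd[OF z x]] spd_commute[OF U x f, of w z]
      by (cases "even (sdeg E w)"; cases "even (sdeg E z)") simp_all
  qed
  finally show ?thesis by (simp add: dapp_def sum.distrib sum_distrib_left)
qed

text \<open>The square of an odd vector field is again a derivation, since its second order part is
  antisymmetric in the two indices and cancels. So it vanishes once V annihilates its own
  components.\<close>

lemma dapp_dapp:
  assumes x: "x \<in> U" and f: "superfun E N U f" and z: "\<And>w. w \<in> E \<union> N \<Longrightarrow> dapp E N V (V w) x = 0"
  shows "dapp E N V (dapp E N V f) x = 0"
proof -
  \<comment> \<open>The second order part. Components of V have the parity opposite to that of their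
    coordinates, so exchanging components and derivatives together changes the sign.\<close>
  define t where "t = (\<lambda>w z. - ((-1) ^ sdeg E w * (V w x * (V z x * spd E z (spd E w f) x))))"
  have t: "t w z = - t z w" if wz: "w \<in> E \<union> N" "z \<in> E \<union> N" for w z
  proof -
    let ?d = "spd E z (spd E w f) x"
    have c: "V z x * V w x = (-1) ^ (Suc (sdeg E z) * Suc (sdeg E w)) * (V w x * V z x)"
      by (rule gpar_commute[OF V_odd[OF wz(2) x] V_odd[OF wz(1) x]])
    have "V z x * (V w x * spd E w (spd E z f) x) = (-1) ^ (sdeg E w * sdeg E z) * (V z x * V w x * ?d)"
      by (subst spd_commute[OF U x f, of w z], cases "even (sdeg E w * sdeg E z)") (simp_all add: mult.assoc)
    then show ?thesis
      unfolding t_def c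
      by (cases "even (sdeg E w)"; cases "even (sdeg E z)") (simp_all add: mult.assoc)
  qed
  have "dapp E N V (dapp E N V f) x = (\<Sum>w\<in>E \<union> N. dapp E N V (\<lambda>y. V w y * spd E w f y) x)"
    unfolding dapp_def[of E N V f, abs_def]
    by (rule dapp_sum[OF x finite superfun_mult[OF U V superfun_spd[OF U f]]])
  also have "\<dots> = (\<Sum>w\<in>E \<union> N. \<Sum>z\<in>E \<union> N. t w z)"
  proof (intro sum.cong refl)
    fix w assume w: "w \<in> E \<union> N"
    show "dapp E N V (\<lambda>y. V w y * spd E w f y) x = (\<Sum>z\<in>E \<union> N. t w z)"
      using dapp_mult[OF x V[OF w] superfun_spd[OF U f] V_odd[OF w x], of w] z[OF w]
      by (simp add: t_def dapp_def sum_distrib_left sum_negf)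
  qed
  finally have e: "dapp E N V (dapp E N V f) x = (\<Sum>w\<in>E \<union> N. \<Sum>z\<in>E \<union> N. t w z)" .
  also have "\<dots> = (\<Sum>w\<in>E \<union> N. \<Sum>z\<in>E \<union> N. - t z w)"
    by (intro sum.cong refl t)
  also have "\<dots> = - (\<Sum>w\<in>E \<union> N. \<Sum>z\<in>E \<union> N. t w z)"
    by (subst sum.swap) (simp add: sum_negf)
  finally show ?thesis unfolding e[symmetric] by (simp add: eq_uminus_self_iff)
qed

end

text \<open>The Hamiltonian vector field of an even \<open>H\<close>: for \<open>H\<close> even the signs of the Schouten bracket \<open>{H, z}\<close>
  collapse to a single factor depending on the parity of the base coordinate.\<close>

definition hv :: "'i set \<Rightarrow> 'i set \<Rightarrow> 'i tcoord sfun \<Rightarrow> 'i tcoord \<Rightarrow> 'i::{finite,linorder} tcoord sfun" where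
  "hv E N H z X = (case z of
      Base a \<Rightarrow> - ((-1) ^ sdeg E a * spd (tE E N) (Anti a) H X)
    | Anti a \<Rightarrow> - ((-1) ^ sdeg E a * spd (tE E N) (Base a) H X))"

lemma sum_tcoords:
  fixes E N :: "'i::finite set"
  shows "(\<Sum>z\<in>tE E N \<union> tN E N. F z) = (\<Sum>a\<in>E \<union> N. F (Base a) + F (Anti a))"
proof -
  have "(\<Sum>z\<in>tE E N \<union> tN E N. F z) = (\<Sum>z\<in>Base ` (E \<union> N). F z) + (\<Sum>z\<in>Anti ` (E \<union> N). F z)"
    unfolding tE_tN by (rule sum.union_disjoint) auto
  then show ?thesis by (simp add: sum.reindex inj_on_def sum.distrib)
qed

context
  fixes E N :: "'i::{finite,linorder} set" and U
  assumes EN: "E \<inter> N = {}" and U: "ev_open E U"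
begin

lemma gpar_spd_Anti:
  assumes "X \<in> tU E N U" "\<And>Y. Y \<in> tU E N U \<Longrightarrow> gpar k (f Y)" "a \<in> E \<union> N"
  shows "gpar (Suc (k + sdeg E a)) (spd (tE E N) (Anti a) f X)"
proof -
  have "gpar (k + sdeg (tE E N) (Anti a)) (spd (tE E N) (Anti a) f X)"
    by (rule gpar_spd[OF ev_open_tU[OF U] assms(1)]) (rule assms(2))
  moreover have "even (k + sdeg (tE E N) (Anti a)) = even (Suc (k + sdeg E a))"
    using sdeg_Anti[OF EN assms(3)] by (auto simp: sdeg_def)
  ultimately show ?thesis using gpar_cong by blast
qed

lemma gpar_spd_Base:
  assumes "X \<in> tU E N U" "\<And>Y. Y \<in> tU E N U \<Longrightarrow> gpar k (f Y)"
  shows "gpar (k + sdeg E a) (spd (tE E N) (Base a) f X)"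
  using gpar_spd[OF ev_open_tU[OF U] assms, where a = "Base a"] by (simp add: sdeg_Base)

end

context
  fixes E N :: "'i::{finite,linorder} set" and U and H :: "'i tcoord sfun"
  assumes EN: "E \<inter> N = {}" and U: "ev_open E U"
    and H: "superfun (tE E N) (tN E N) (tU E N U) H"
    and H_even: "\<And>X. X \<in> tU E N U \<Longrightarrow> gpar 0 (H X)"
begin

private lemmas UT = ev_open_tU[OF U, of N]

lemma superfun_hv: "superfun (tE E N) (tN E N) (tU E N U) (hv E N H z)"
  unfolding hv_def[abs_def]
  by (cases z) (auto intro!: superfun_uminus superfun_sign superfun_spd UT H)

lemma gpar_hv:
  assumes "z \<in> tE E N \<union> tN E N" "X \<in> tU E N U"
  shows "gpar (Suc (sdeg (tE E N) z)) (hv E N H z X)"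
proof (cases z)
  case (Base a)
  then have "a \<in> E \<union> N" using assms(1) by auto
  then show ?thesis
    using gpar_spd_Anti[OF EN U assms(2) H_even]
    by (simp add: Base hv_def sdeg_Base gpar_uminus gpar_minus_one_power_mult)
next
  case (Anti a)
  then have a: "a \<in> E \<union> N" using assms(1) by auto
  have "gpar (sdeg E a) (hv E N H z X)"
    using gpar_spd_Base[OF EN U assms(2) H_even]
    by (simp add: Anti hv_def gpar_uminus gpar_minus_one_power_mult)
  then show ?thesis
    using sdeg_Anti[OF EN a] by (subst gpar_cong) (auto simp: Anti sdeg_def)
qed

lemmas hv_facts = UT superfun_hv gpar_hv

text \<open>The facts \<open>t\<close> show that differentiating the component at
  \<open>Base a\<close> contributes the same as the \<open>Anti a\<close> term of the field acting
  on the derivative of H, and conversely. The terms with differentiated components thus repeat the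
  other ones, which gives the factor 2.\<close>

lemma spd_ham_self:
  assumes X: "X \<in> tU E N U" and w: "w \<in> tE E N \<union> tN E N"
  shows "spd (tE E N) w (dapp (tE E N) (tN E N) (hv E N H) H) X
    = 2 *\<^sub>R ((-1) ^ sdeg (tE E N) w * dapp (tE E N) (tN E N) (hv E N H) (spd (tE E N) w H) X)"
proof -
  let ?E = "tE E N" and ?s = "sdeg (tE E N) w"
  let ?A = "\<lambda>a. spd ?E (Anti a)" and ?B = "\<lambda>a. spd ?E (Base a)"
  have t: "spd ?E w (hv E N H (Base a)) X * ?B a H X = (-1) ^ ?s * (hv E N H (Anti a) X * ?A a (spd ?E w H) X)"
    "spd ?E w (hv E N H (Anti a)) X * ?A a H X = (-1) ^ ?s * (hv E N H (Base a) X * ?B a (spd ?E w H) X)"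
    if a: "a \<in> E \<union> N" for a
  proof -
    have h: "spd ?E w (hv E N H (Base a)) X = - ((-1) ^ sdeg E a * spd ?E w (?A a H) X)"
      "spd ?E w (hv E N H (Anti a)) X = - ((-1) ^ sdeg E a * spd ?E w (?B a H) X)"
      unfolding hv_def[abs_def] tcoord.case
      using spd_uminus[OF UT X superfun_sign[OF UT superfun_spd[OF UT H]]] spd_sign[OF UT X superfun_spd[OF UT H]]
      by simp_all
    have cA: "spd ?E w (?A a H) X = (-1) ^ (?s * Suc (sdeg E a)) * ?A a (spd ?E w H) X"
      using spd_commute[OF UT X H, of w "Anti a"] sdeg_Anti[OF EN a]
      by (cases "a \<in> E") (simp_all add: sdeg_def)
    have cB: "spd ?E w (?B a H) X = (-1) ^ (?s * sdeg E a) * ?B a (spd ?E w H) X"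
      using spd_commute[OF UT X H, of w "Base a"] by (simp add: sdeg_Base)
    have w0: "gpar ?s (spd ?E w H Y)" if "Y \<in> tU E N U" for Y
      using gpar_spd[OF UT that H_even, where a = w] by simp
    have b0: "gpar (0 + sdeg E a) (?B a H X)" by (rule gpar_spd_Base[OF EN U X]) (rule H_even)
    have a0: "gpar (Suc (0 + sdeg E a)) (?A a H X)" by (rule gpar_spd_Anti[OF EN U X _ a]) (rule H_even)
    have 1: "?A a (spd ?E w H) X * ?B a H X = (-1) ^ (Suc (?s + sdeg E a) * sdeg E a) * (?B a H X * ?A a (spd ?E w H) X)"
      by (rule gpar_commute[OF gpar_spd_Anti[OF EN U X _ a] b0[simplified]]) (rule w0)
    have 2: "?B a (spd ?E w H) X * ?A a H X = (-1) ^ ((?s + sdeg E a) * Suc (sdeg E a)) * (?A a H X * ?B a (spd ?E w H) X)"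
      by (rule gpar_commute[OF gpar_spd_Base[OF EN U X] a0[simplified]]) (rule w0)
    show "spd ?E w (hv E N H (Base a)) X * ?B a H X = (-1) ^ ?s * (hv E N H (Anti a) X * ?A a (spd ?E w H) X)"
      unfolding h cA hv_def tcoord.case using 1
      by (cases "even ?s"; cases "even (sdeg E a)") simp_all
    show "spd ?E w (hv E N H (Anti a)) X * ?A a H X = (-1) ^ ?s * (hv E N H (Base a) X * ?B a (spd ?E w H) X)"
      unfolding h cB hv_def tcoord.case using 2
      by (cases "even ?s"; cases "even (sdeg E a)") simp_all
  qed
  have "(\<Sum>z\<in>tE E N \<union> tN E N. spd ?E w (hv E N H z) X * spd ?E z H X)
      = (-1) ^ ?s * dapp (tE E N) (tN E N) (hv E N H) (spd ?E w H) X"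
    unfolding dapp_def sum_tcoords sum_distrib_left
    by (intro sum.cong refl) (simp add: t distrib_left add.commute)
  then show ?thesis
    using spd_dapp[OF hv_facts X H, where w = w] by (simp add: scaleR_2)
qed

lemma ham_dapp_dapp:
  assumes self: "\<And>X. X \<in> tU E N U \<Longrightarrow> dapp (tE E N) (tN E N) (hv E N H) H X = 0"
    and X: "X \<in> tU E N U" and f: "superfun (tE E N) (tN E N) (tU E N U) f"
  shows "dapp (tE E N) (tN E N) (hv E N H) (dapp (tE E N) (tN E N) (hv E N H) f) X = 0"
proof (rule dapp_dapp[OF hv_facts X f])
  let ?D = "dapp (tE E N) (tN E N) (hv E N H)"
  have d: "?D (spd (tE E N) w H) X = 0" if "w \<in> tE E N \<union> tN E N" for w
  proof -
    have "spd (tE E N) w (?D H) X = spd (tE E N) w (\<lambda>X. 0) X"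
      using self by (intro spd_cong[OF UT X])
    then have "2 *\<^sub>R ((-1) ^ sdeg (tE E N) w * ?D (spd (tE E N) w H) X) = 0"
      using spd_ham_self[OF X that] spd_zero[OF UT] by simp
    then show ?thesis by (cases "even (sdeg (tE E N) w)") auto
  qed
  fix w assume w: "w \<in> tE E N \<union> tN E N"
  show "?D (hv E N H w) X = 0"
  proof (cases w)
    case (Base a)
    then have "Anti a \<in> tE E N \<union> tN E N" using w by auto
    then show ?thesis
      unfolding Base hv_def[of E N H "Base a", abs_def] tcoord.case
      using dapp_uminus[OF hv_facts X superfun_sign[OF UT superfun_spd[OF UT H]]]
        dapp_sign[OF hv_facts X superfun_spd[OF UT H]] d by simp
  next
    case (Anti a)
    then have "Base a \<in> tE E N \<union> tN E N" using w by auto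
    then show ?thesis
      unfolding Anti hv_def[of E N H "Anti a", abs_def] tcoord.case
      using dapp_uminus[OF hv_facts X superfun_sign[OF UT superfun_spd[OF UT H]]]
        dapp_sign[OF hv_facts X superfun_spd[OF UT H]] d by simp
  qed
qed

end

lemma hv_add_scaleR:
  assumes "ev_open E U" "X \<in> tU E N U" "superfun (tE E N) (tN E N) (tU E N U) F" "superfun (tE E N) (tN E N) (tU E N U) G"
  shows "hv E N (\<lambda>Y. F Y + r *\<^sub>R G Y) z X = hv E N F z X + r *\<^sub>R hv E N G z X"
  using spd_add[OF ev_open_tU[OF assms(1)] assms(2,3) superfun_scaleR[OF ev_open_tU[OF assms(1)] Cinf_const assms(4)]]
    spd_scaleR[OF ev_open_tU[OF assms(1)] assms(2,4)]
  by (cases z) (simp_all add: hv_def minus_one_power_iff)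

text \<open>The Schouten bracket is symmetric on even functions: of a base derivative and the
  conjugate momentum derivative one is even, so the two commute.\<close>

lemma ham_symmetric:
  assumes EN: "E \<inter> N = {}" and U: "ev_open E U" and X: "X \<in> tU E N U"
    and F: "\<And>Y. Y \<in> tU E N U \<Longrightarrow> gpar 0 (F Y)" and G: "\<And>Y. Y \<in> tU E N U \<Longrightarrow> gpar 0 (G Y)"
  shows "dapp (tE E N) (tN E N) (hv E N F) G X = dapp (tE E N) (tN E N) (hv E N G) F X"
  unfolding dapp_def sum_tcoords
proof (intro sum.cong refl)
  fix a assume a: "a \<in> E \<union> N"
  let ?A = "spd (tE E N) (Anti a)" and ?B = "spd (tE E N) (Base a)"
  have 1: "?A K X * ?B L X = ?B L X * ?A K X"
    if "\<And>Y. Y \<in> tU E N U \<Longrightarrow> gpar 0 (K Y)" "\<And>Y. Y \<in> tU E N U \<Longrightarrow> gpar 0 (L Y)" for K L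
    using gpar_commute[OF gpar_spd_Anti[OF EN U X that(1) a] gpar_spd_Base[OF EN U X that(2), where a = a]] by simp
  show "hv E N F (Base a) X * ?B G X + hv E N F (Anti a) X * ?A G X
    = hv E N G (Base a) X * ?B F X + hv E N G (Anti a) X * ?A F X"
    using 1[OF F G] 1[OF G F] by (cases "even (sdeg E a)") (simp_all add: hv_def)
qed

section \<open>The Euler field of the fibres and basic functions\<close>

section \<open>Functions quadratic in the momenta\<close>

lemma ginvol_add: "ginvol (f + g) = ginvol f + ginvol g"
  by (rule grass_eqI) (simp add: gcoeff_ginvol distrib_left)

lemma gpart_decomp: "g = gpart 0 g + gpart 1 g"
  by (rule grass_eqI) (auto simp: gcoeff_gpart mod2_eq_iff)

lemma gpar_gpart: "gpar k (gpart k g)"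
  by (auto simp: gpar_def gcoeff_gpart mod2_eq_iff)

lemma odd_commute:
  fixes y u :: "'i::{finite,linorder} grass"
  assumes "gpar 1 y" shows "y * ginvol u = u * y"
proof -
  have "y * ginvol (gpart k u) = gpart k u * y" for k
    using gpar_commute[OF gpar_gpart assms, of k u] ginvol_gpar[OF gpar_gpart, of k u]
    by (cases "even k") simp_all
  from this[of 0] this[of 1] have "y * (ginvol (gpart 0 u) + ginvol (gpart 1 u)) = (gpart 0 u + gpart 1 u) * y"
    by (simp only: distrib_left distrib_right)
  then show ?thesis by (simp only: ginvol_add[symmetric] gpart_decomp[symmetric])
qed

lemma glift_ginvol: "glift (ginvol u) = ginvol (glift u)"
proof (rule grass_eqI)
  fix S show "gcoeff (glift (ginvol u)) S = gcoeff (ginvol (glift u)) S"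
    by (cases S rule: Base_subset_cases)
      (simp add: gcoeff_glift_image gcoeff_ginvol card_image inj_on_def, auto simp: gcoeff_glift gcoeff_ginvol split: if_splits)
qed

lemma zero_sec_glift: "F (tzero x) = glift u \<Longrightarrow> zero_sec F x = u"
  by (rule grass_eqI) (simp add: zero_sec_def gcoeff_glift_image)

lemma superfun_ginvol: "ev_open E U \<Longrightarrow> superfun E N U f \<Longrightarrow> superfun E N U (\<lambda>x. ginvol (f x))"
  by (intro superfunI) (auto simp: gcoeff_ginvol superfun_def intro!: Cinf_mult)

context
  fixes E N :: "'i::{finite,linorder} set" and U
  assumes EN: "E \<inter> N = {}" and U: "ev_open E U"
begin

private abbreviation (input) mom :: "'i \<Rightarrow> 'i tcoord sfun" where
  "mom a \<equiv> coord (tE E N) (Anti a)"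

private abbreviation (input) dmom :: "'i \<Rightarrow> 'i tcoord sfun \<Rightarrow> 'i tcoord sfun" where
  "dmom a \<equiv> spd (tE E N) (Anti a)"

private abbreviation (input) euler :: "'i tcoord sfun \<Rightarrow> 'i tcoord sfun" where
  "euler f X \<equiv> \<Sum>a\<in>E \<union> N. mom a X * dmom a f X"

text \<open>A momentum and the derivative in its direction have the same parity, so the sign with
  which the derivative passes u is undone when the momentum passes u. This makes the Euler field an
  even derivation in \<open>euler_mult\<close>.\<close>

lemma mom_swap:
  assumes "a \<in> E \<union> N" shows "mom a X * (if a \<in> N then u else ginvol u) = u * mom a X"
proof -
  have p: "gpar (if a \<in> N then 0 else 1) (mom a X)"
    using gpar_coord[of "tE E N" "Anti a" X] by (simp add: sdeg_def)
  show ?thesis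
  proof (cases "a \<in> N")
    case True then show ?thesis using even_commute[of "mom a X" u] p by simp
  next
    case False then show ?thesis using odd_commute[of "mom a X" u] p by simp
  qed
qed

lemma euler_mult:
  assumes X: "X \<in> tU E N U" and f: "superfun (tE E N) (tN E N) (tU E N U) f" and g: "superfun (tE E N) (tN E N) (tU E N U) g"
  shows "euler (\<lambda>Y. f Y * g Y) X = euler f X * g X + f X * euler g X"
proof -
  have "mom a X * dmom a (\<lambda>Y. f Y * g Y) X = mom a X * dmom a f X * g X + f X * (mom a X * dmom a g X)" if a: "a \<in> E \<union> N" for a
  proof -
    have "mom a X * dmom a (\<lambda>Y. f Y * g Y) X
      = mom a X * dmom a f X * g X + mom a X * (if a \<in> N then f X else ginvol (f X)) * dmom a g X"
      using spd_mult[OF ev_open_tU[OF U] X f g, of "Anti a"] by (simp only: tE_simps distrib_left mult.assoc)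
    then show ?thesis by (simp only: mom_swap[OF a] mult.assoc)
  qed
  then have "euler (\<lambda>Y. f Y * g Y) X = (\<Sum>a\<in>E \<union> N. mom a X * dmom a f X * g X + f X * (mom a X * dmom a g X))"
    by (intro sum.cong refl)
  then show ?thesis by (simp add: sum.distrib sum_distrib_left sum_distrib_right)
qed

lemma euler_lift: "euler (lift_fun f) X = 0"
  by (simp add: spd_lift_Anti)

lemma euler_mom: "b \<in> E \<union> N \<Longrightarrow> euler (mom b) X = mom b X"
  by (simp add: spd_coord mult_if_delta if_distrib sum.delta cong: if_cong)

text \<open>The commutator of a momentum derivative with the Euler field is the derivative itself,
  since it lowers the fibre degree by one.\<close>

lemma spd_euler:
  assumes X: "X \<in> tU E N U" and f: "superfun (tE E N) (tN E N) (tU E N U) f" and b: "b \<in> E \<union> N"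
  shows "dmom b (euler f) X = dmom b f X + euler (dmom b f) X"
proof -
  note UT = ev_open_tU[OF U, of N]
  have "dmom b (euler f) X = (\<Sum>a\<in>E \<union> N. dmom b (\<lambda>X. mom a X * dmom a f X) X)"
    by (rule spd_sum[OF UT X finite superfun_mult[OF UT superfun_coord_Anti superfun_spd[OF UT f]]])
  also have "\<dots> = (\<Sum>a\<in>E \<union> N. (if a = b then dmom b f X else 0) + mom a X * dmom a (dmom b f) X)"
  proof (intro sum.cong refl)
    fix a assume a: "a \<in> E \<union> N"
    show "dmom b (\<lambda>X. mom a X * dmom a f X) X = (if a = b then dmom b f X else 0) + mom a X * dmom a (dmom b f) X"
      unfolding spd_mult_gpar[OF UT X superfun_coord_Anti[OF a] superfun_spd[OF UT f] gpar_coord]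
        spd_commute[OF UT X f, of "Anti b" "Anti a"] spd_coord
      by (cases "even (sdeg (tE E N) (Anti b))"; cases "even (sdeg (tE E N) (Anti a))") simp_all
  qed
  finally show ?thesis using b by (simp add: sum.distrib)
qed

text \<open>Functions lifted from the base. By \<open>basic_zero_sec\<close> the restriction to the
  zero section recovers them, so that \<open>hess\<close> can be evaluated there without
  loss.\<close>

definition basic_on :: "'i tcoord sfun \<Rightarrow> bool" where
  "basic_on F \<longleftrightarrow> (\<exists>k. superfun E N U k \<and> (\<forall>X\<in>tU E N U. F X = lift_fun k X))"

lemma basic_zero_sec:
  assumes "basic_on F"
  shows "superfun E N U (zero_sec F)" and "X \<in> tU E N U \<Longrightarrow> F X = lift_fun (zero_sec F) X"
proof -
  obtain k where k: "superfun E N U k" "\<And>X. X \<in> tU E N U \<Longrightarrow> F X = lift_fun k X"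
    using assms unfolding basic_on_def by blast
  have z: "zero_sec F x = k x" if "x \<in> U" for x
    using k(2)[OF tzero_tU[OF U that]] by (intro zero_sec_glift) (simp add: lift_fun_glift tproj_tzero)
  show "superfun E N U (zero_sec F)" using superfun_cong[OF U, of "zero_sec F" k N] z k(1) by blast
  show "F X = lift_fun (zero_sec F) X" if "X \<in> tU E N U"
    using k(2)[OF that] z[OF tU_proj(1)[OF that]] by (simp add: lift_fun_glift)
qed

lemma basic_sum: "finite I \<Longrightarrow> (\<And>i. i \<in> I \<Longrightarrow> basic_on (F i)) \<Longrightarrow> basic_on (\<lambda>X. \<Sum>i\<in>I. F i X)"
proof -
  assume "finite I" "\<And>i. i \<in> I \<Longrightarrow> basic_on (F i)"
  then have "superfun E N U (\<lambda>x. \<Sum>i\<in>I. zero_sec (F i) x)"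
    "X \<in> tU E N U \<Longrightarrow> (\<Sum>i\<in>I. F i X) = lift_fun (\<lambda>x. \<Sum>i\<in>I. zero_sec (F i) x) X" for X
    using basic_zero_sec by (auto intro!: superfun_sum[OF U] simp: lift_fun_glift glift_sum intro: sum.cong)
  then show "basic_on (\<lambda>X. \<Sum>i\<in>I. F i X)" unfolding basic_on_def by blast
qed

lemma basic_cong: "basic_on F \<Longrightarrow> (\<And>X. X \<in> tU E N U \<Longrightarrow> F X = G X) \<Longrightarrow> basic_on G"
  unfolding basic_on_def by auto

lemma basic_scaleR: "superfun E N U k \<Longrightarrow> basic_on (\<lambda>X. r *\<^sub>R lift_fun k X)"
  unfolding basic_on_def
  by (intro exI[of _ "\<lambda>x. r *\<^sub>R k x"]) (auto simp: lift_fun_glift glift_scaleR intro: superfun_scaleR[OF U])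

text \<open>Two momentum derivatives exhaust a quadratic monomial and leave its coefficient, up to a
  scalar and signs.\<close>

lemma dmom_dmom_quadratic:
  assumes c: "superfun E N U c" and ab: "a \<in> E \<union> N" "b \<in> E \<union> N" and de: "d \<in> E \<union> N" "e \<in> E \<union> N"
  shows "basic_on (dmom a (dmom b (\<lambda>Y. lift_fun c Y * (mom e Y * mom d Y))))"
proof -
  note UT = ev_open_tU[OF U, of N]
  \<comment> \<open>\<open>s b c\<close> absorbs into the coefficient the sign with which
    \<open>dmom b\<close> passes it; being a function on the base, it can be lifted again.\<close>
  define s where "s = (\<lambda>b (c :: 'i sfun) x. if b \<in> N then c x else ginvol (c x))"
  have ss: "superfun E N U (s b c)" if "superfun E N U c" for b c
    using that superfun_ginvol[OF U that] by (cases "b \<in> N") (simp_all add: s_def)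
  have sl: "(if b \<in> N then lift_fun c X else ginvol (lift_fun c X)) = lift_fun (s b c) X" for b c X
    by (simp add: s_def lift_fun_glift glift_ginvol)
  define n where "n = sdeg (tE E N) (Anti b) * sdeg (tE E N) (Anti e)"
  \<comment> \<open>The scalars in front of the surviving momentum after the first derivative. They
    are kept apart since b may equal both d and e.\<close>
  define u1 u2 :: real where "u1 = (if b = e then 1 else 0)" and "u2 = (if b = d then (-1) ^ n else 0)"
  let ?G = "\<lambda>Y. u1 *\<^sub>R mom d Y + u2 *\<^sub>R mom e Y"
  have y2: "superfun (tE E N) (tN E N) (tU E N U) (\<lambda>Y. mom e Y * mom d Y)"
    by (intro superfun_mult UT superfun_coord_Anti de)
  have G: "superfun (tE E N) (tN E N) (tU E N U) ?G"
    by (intro superfun_add superfun_scaleR Cinf_const UT superfun_coord_Anti de)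
  have 1: "dmom b (\<lambda>Y. lift_fun c Y * (mom e Y * mom d Y)) Y = lift_fun (s b c) Y * ?G Y" if Y: "Y \<in> tU E N U" for Y
  proof -
    have "dmom b (\<lambda>Y. mom e Y * mom d Y) Y = ?G Y"
      unfolding spd_mult_gpar[OF UT Y superfun_coord_Anti[OF de(2)] superfun_coord_Anti[OF de(1)] gpar_coord] spd_coord
      by (auto simp: u1_def u2_def n_def minus_one_power_iff)
    then show ?thesis
      unfolding spd_lift_mult_Anti[OF EN U Y c y2] sl by simp
  qed
  define r where "r = (if a = d then u1 else 0) + (if a = e then u2 else 0)"
  have "dmom a (dmom b (\<lambda>Y. lift_fun c Y * (mom e Y * mom d Y))) X = r *\<^sub>R lift_fun (s a (s b c)) X" if X: "X \<in> tU E N U" for X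
  proof -
    have "dmom a (dmom b (\<lambda>Y. lift_fun c Y * (mom e Y * mom d Y))) X = dmom a (\<lambda>Y. lift_fun (s b c) Y * ?G Y) X"
      by (rule spd_cong[OF UT X 1])
    also have "\<dots> = lift_fun (s a (s b c)) X * dmom a ?G X"
      unfolding spd_lift_mult_Anti[OF EN U X ss[OF c] G] sl ..
    also have "dmom a ?G X = of_real r"
      using spd_add[OF UT X superfun_scaleR[OF UT Cinf_const superfun_coord_Anti[OF de(1)]] superfun_scaleR[OF UT Cinf_const superfun_coord_Anti[OF de(2)]], of "Anti a" u1 u2]
        spd_scaleR[OF UT X superfun_coord_Anti[OF de(1)], of "Anti a" u1] spd_scaleR[OF UT X superfun_coord_Anti[OF de(2)], of "Anti a" u2]
      by (auto simp: r_def spd_coord of_real_def scaleR_left_distrib)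
    finally show ?thesis by (simp add: of_real_def)
  qed
  then show ?thesis
    by (intro basic_cong[OF basic_scaleR[OF ss[OF ss[OF c]], of r a b]]) simp
qed

end

section \<open>The brackets of Q' with itself and with P\<close>

section \<open>Bivector fields and linear Hamiltonians\<close>

text \<open>The minus sign is the factor (-1)^1 of \<open>theta\<close> for an odd field.\<close>

definition qham :: "'i set \<Rightarrow> 'i set \<Rightarrow> ('i \<Rightarrow> 'i sfun) \<Rightarrow> 'i::{finite,linorder} tcoord sfun" where
  "qham E N Q Y = - (\<Sum>a\<in>E \<union> N. lift_fun (Q a) Y * coord (tE E N) (Anti a) Y)"

text \<open>The coefficients of a bivector are not unique, as only their graded symmetric part
  enters P. The second momentum derivatives depend on P alone, so parity, weight and the derivation
  property can be stated for them.\<close>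

definition hess :: "'i set \<Rightarrow> 'i set \<Rightarrow> 'i tcoord sfun \<Rightarrow> 'i \<Rightarrow> 'i \<Rightarrow> 'i::{finite,linorder} sfun" where
  "hess E N P a b = zero_sec (spd (tE E N) (Anti a) (spd (tE E N) (Anti b) P))"

definition is_bivector :: "'i set \<Rightarrow> 'i set \<Rightarrow> (real, 'i) vec set \<Rightarrow> 'i::{finite,linorder} tcoord sfun \<Rightarrow> bool" where
  "is_bivector E N U P \<longleftrightarrow> superfun (tE E N) (tN E N) (tU E N U) P \<and> (\<forall>X\<in>tU E N U. gpar 0 (P X)) \<and>
     (\<exists>c. (\<forall>a\<in>E \<union> N. \<forall>b\<in>E \<union> N. superfun E N U (c a b)) \<and>
       (\<forall>X\<in>tU E N U. P X = (1/2) *\<^sub>R (\<Sum>a\<in>E \<union> N. \<Sum>b\<in>E \<union> N.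
          lift_fun (c a b) X * (coord (tE E N) (Anti b) X * coord (tE E N) (Anti a) X))))"

context
  fixes E N :: "'i::{finite,linorder} set" and U and P :: "'i tcoord sfun"
  assumes EN: "E \<inter> N = {}" and U: "ev_open E U" and P: "is_bivector E N U P"
begin

private abbreviation (input) y :: "'i \<Rightarrow> 'i tcoord sfun" where
  "y a \<equiv> coord (tE E N) (Anti a)"

private abbreviation (input) dy :: "'i \<Rightarrow> 'i tcoord sfun \<Rightarrow> 'i tcoord sfun" where
  "dy a \<equiv> spd (tE E N) (Anti a)"

private lemmas UTb = ev_open_tU[OF U, of N]

lemma bivector_superfun: "superfun (tE E N) (tN E N) (tU E N U) P"
  using P by (simp add: is_bivector_def)

lemma bivector_gpar: "X \<in> tU E N U \<Longrightarrow> gpar 0 (P X)"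
  using P by (simp add: is_bivector_def)

lemma bivector_coeffs:
  obtains c where "\<forall>a\<in>E \<union> N. \<forall>b\<in>E \<union> N. superfun E N U (c a b)"
    "\<forall>X\<in>tU E N U. P X = (1/2) *\<^sub>R (\<Sum>a\<in>E \<union> N. \<Sum>b\<in>E \<union> N. lift_fun (c a b) X * (y b X * y a X))"
  using P unfolding is_bivector_def by (elim conjE exE) (rule that)

lemma hess_basic:
  assumes ab: "a \<in> E \<union> N" "b \<in> E \<union> N"
  shows "superfun E N U (hess E N P a b)"
    and "X \<in> tU E N U \<Longrightarrow> dy a (dy b P) X = lift_fun (hess E N P a b) X"
proof -
  obtain c where c0: "\<forall>a\<in>E \<union> N. \<forall>b\<in>E \<union> N. superfun E N U (c a b)"
    "\<forall>X\<in>tU E N U. P X = (1/2) *\<^sub>R (\<Sum>a\<in>E \<union> N. \<Sum>b\<in>E \<union> N. lift_fun (c a b) X * (y b X * y a X))"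
    by (rule bivector_coeffs)
  note c = c0[rule_format]
  define R where "R = (\<lambda>p X. lift_fun (\<lambda>x. (1/2) *\<^sub>R c (fst p) (snd p) x) X * (y (snd p) X * y (fst p) X))"
  have cs: "superfun E N U (\<lambda>x. (1/2) *\<^sub>R c (fst p) (snd p) x)" if "p \<in> (E \<union> N) \<times> (E \<union> N)" for p
    using that c(1) by (intro superfun_scaleR[OF U] Cinf_const) auto
  have R: "superfun (tE E N) (tN E N) (tU E N U) (R p)" if "p \<in> (E \<union> N) \<times> (E \<union> N)" for p
    unfolding R_def using that by (intro superfun_mult UTb superfun_lift U cs superfun_coord_Anti) auto
  have PR: "P X = (\<Sum>p\<in>(E \<union> N) \<times> (E \<union> N). R p X)" if "X \<in> tU E N U" for X
    unfolding c(2)[OF that] R_def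
    by (simp add: sum.cartesian_product case_prod_beta scaleR_sum_right lift_fun_glift glift_scaleR)
  have 1: "dy b P X = (\<Sum>p\<in>(E \<union> N) \<times> (E \<union> N). dy b (R p) X)" if X: "X \<in> tU E N U" for X
  proof -
    have "dy b P X = dy b (\<lambda>X. \<Sum>p\<in>(E \<union> N) \<times> (E \<union> N). R p X) X"
      by (rule spd_cong[OF UTb X PR])
    also have "\<dots> = (\<Sum>p\<in>(E \<union> N) \<times> (E \<union> N). dy b (R p) X)"
      by (rule spd_sum[OF UTb X _ R]) auto
    finally show ?thesis .
  qed
  have 2: "dy a (dy b P) X = (\<Sum>p\<in>(E \<union> N) \<times> (E \<union> N). dy a (dy b (R p)) X)" if X: "X \<in> tU E N U" for X
  proof -
    have "dy a (dy b P) X = dy a (\<lambda>X. \<Sum>p\<in>(E \<union> N) \<times> (E \<union> N). dy b (R p) X) X"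
      by (rule spd_cong[OF UTb X 1])
    also have "\<dots> = (\<Sum>p\<in>(E \<union> N) \<times> (E \<union> N). dy a (dy b (R p)) X)"
      by (rule spd_sum[OF UTb X _ superfun_spd[OF UTb R]]) auto
    finally show ?thesis .
  qed
  have "basic_on E N U (dy a (dy b (R p)))" if "p \<in> (E \<union> N) \<times> (E \<union> N)" for p
    unfolding R_def using that by (intro dmom_dmom_quadratic[OF EN U cs[OF that] ab]) auto
  then have "basic_on E N U (\<lambda>X. \<Sum>p\<in>(E \<union> N) \<times> (E \<union> N). dy a (dy b (R p)) X)"
    by (intro basic_sum[OF EN U]) auto
  then have "basic_on E N U (dy a (dy b P))"
    by (rule basic_cong[OF EN U]) (simp add: 2)
  then show "superfun E N U (hess E N P a b)"
    "X \<in> tU E N U \<Longrightarrow> dy a (dy b P) X = lift_fun (hess E N P a b) X"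
    unfolding hess_def using basic_zero_sec[OF EN U] by blast+
qed

lemma bivector_euler:
  assumes X: "X \<in> tU E N U"
  shows "(\<Sum>a\<in>E \<union> N. y a X * dy a P X) = 2 *\<^sub>R P X"
proof -
  obtain c where c0: "\<forall>a\<in>E \<union> N. \<forall>b\<in>E \<union> N. superfun E N U (c a b)"
    "\<forall>X\<in>tU E N U. P X = (1/2) *\<^sub>R (\<Sum>a\<in>E \<union> N. \<Sum>b\<in>E \<union> N. lift_fun (c a b) X * (y b X * y a X))"
    by (rule bivector_coeffs)
  note c = c0[rule_format]
  define R where "R = (\<lambda>p X. lift_fun (\<lambda>x. (1/2) *\<^sub>R c (fst p) (snd p) x) X * (y (snd p) X * y (fst p) X))"
  let ?e = "\<lambda>f X. \<Sum>a\<in>E \<union> N. y a X * dy a f X"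
  let ?I = "(E \<union> N) \<times> (E \<union> N)"
  have cs: "superfun E N U (\<lambda>x. (1/2) *\<^sub>R c (fst p) (snd p) x)" if "p \<in> ?I" for p
    using that c(1) by (intro superfun_scaleR[OF U] Cinf_const) auto
  have y2: "superfun (tE E N) (tN E N) (tU E N U) (\<lambda>X. y (snd p) X * y (fst p) X)" if "p \<in> ?I" for p
    using that by (intro superfun_mult UTb superfun_coord_Anti) auto
  have R: "superfun (tE E N) (tN E N) (tU E N U) (R p)" if "p \<in> ?I" for p
    unfolding R_def by (intro superfun_mult UTb superfun_lift U cs y2 that)
  have PR: "P X = (\<Sum>p\<in>?I. R p X)" if "X \<in> tU E N U" for X
    unfolding c(2)[OF that] R_def
    by (simp add: sum.cartesian_product case_prod_beta scaleR_sum_right lift_fun_glift glift_scaleR)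
  have d: "dy a P X = (\<Sum>p\<in>?I. dy a (R p) X)" for a
  proof -
    have "dy a P X = dy a (\<lambda>X. \<Sum>p\<in>?I. R p X) X"
      by (rule spd_cong[OF UTb X PR])
    also have "\<dots> = (\<Sum>p\<in>?I. dy a (R p) X)"
      by (rule spd_sum[OF UTb X _ R]) auto
    finally show ?thesis .
  qed
  have "?e P X = (\<Sum>p\<in>?I. ?e (R p) X)"
    unfolding d sum_distrib_left by (rule sum.swap)
  also have "\<dots> = (\<Sum>p\<in>?I. 2 *\<^sub>R R p X)"
  proof (intro sum.cong refl)
    fix p assume p: "p \<in> ?I"
    then have pp: "fst p \<in> E \<union> N" "snd p \<in> E \<union> N" by auto
    have "?e (\<lambda>X. y (snd p) X * y (fst p) X) X = 2 *\<^sub>R (y (snd p) X * y (fst p) X)"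
      using euler_mult[OF EN U X superfun_coord_Anti[OF pp(2)] superfun_coord_Anti[OF pp(1)]]
        euler_mom[OF EN U pp(1), of X] euler_mom[OF EN U pp(2), of X] by (simp add: scaleR_2)
    then show "?e (R p) X = 2 *\<^sub>R R p X"
      using euler_mult[OF EN U X superfun_lift[OF U cs[OF p]] y2[OF p]] euler_lift[OF EN U, where f = "\<lambda>x. (1/2) *\<^sub>R c (fst p) (snd p) x" and X = X]
      by (simp add: R_def)
  qed
  also have "\<dots> = 2 *\<^sub>R P X" unfolding PR[OF X] by (simp add: scaleR_sum_right)
  finally show ?thesis .
qed

text \<open>Euler's identity is used twice: for P, of fibre degree 2, and for its momentum
  derivatives, of fibre degree 1.\<close>

lemma bivector_hess:
  assumes X: "X \<in> tU E N U"
  shows "P X = (1/2) *\<^sub>R (\<Sum>b\<in>E \<union> N. \<Sum>a\<in>E \<union> N. y b X * (y a X * lift_fun (hess E N P a b) X))"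
proof -
  let ?e = "\<lambda>f X. \<Sum>a\<in>E \<union> N. y a X * dy a f X"
  \<comment> \<open>Differentiating Euler's identity for P and subtracting the commutator
    \<open>spd_euler\<close> lowers the degree from 2 to 1.\<close>
  have e: "?e (dy b P) X = dy b P X" if b: "b \<in> E \<union> N" for b
  proof -
    have "dy b (?e P) X = dy b (\<lambda>Y. 2 *\<^sub>R P Y) X"
      by (rule spd_cong[OF UTb X bivector_euler])
    also have "\<dots> = dy b P X + dy b P X"
      unfolding spd_scaleR[OF UTb X bivector_superfun] by (rule scaleR_2)
    finally show ?thesis using spd_euler[OF EN U X bivector_superfun b] by simp
  qed
  have "2 *\<^sub>R P X = (\<Sum>b\<in>E \<union> N. y b X * ?e (dy b P) X)"
    using bivector_euler[OF X] e by simp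
  also have "\<dots> = (\<Sum>b\<in>E \<union> N. \<Sum>a\<in>E \<union> N. y b X * (y a X * lift_fun (hess E N P a b) X))"
    using hess_basic(2)[OF _ _ X] by (simp add: sum_distrib_left)
  finally have "(1/2) *\<^sub>R 2 *\<^sub>R P X = (1/2) *\<^sub>R (\<Sum>b\<in>E \<union> N. \<Sum>a\<in>E \<union> N. y b X * (y a X * lift_fun (hess E N P a b) X))"
    by simp
  then show ?thesis by simp
qed

text \<open>Each momentum derivative shifts the parity by one beyond that of its index, and the two
  shifts cancel.\<close>

lemma gpar_hess:
  assumes ab: "a \<in> E \<union> N" "b \<in> E \<union> N" and x: "x \<in> U"
  shows "gpar (sdeg E a + sdeg E b) (hess E N P a b x)"
proof -
  have X: "tzero x \<in> tU E N U" by (rule tzero_tU[OF U x])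
  have 1: "gpar (Suc (0 + sdeg E b)) (dy b P Y)" if "Y \<in> tU E N U" for Y
    by (rule gpar_spd_Anti[OF EN U that bivector_gpar ab(2)])
  have "gpar (Suc (Suc (0 + sdeg E b) + sdeg E a)) (dy a (dy b P) (tzero x))"
    by (rule gpar_spd_Anti[OF EN U X 1 ab(1)])
  then have "gpar (Suc (Suc (0 + sdeg E b) + sdeg E a)) (glift (hess E N P a b x))"
    using hess_basic(2)[OF ab X] by (simp add: lift_fun_glift tproj_tzero)
  moreover have "gpar k u" if "gpar k (glift u)" for k and u :: "'i grass"
    unfolding gpar_def
  proof (intro allI impI)
    fix S assume "gcoeff u S \<noteq> 0"
    then have "gcoeff (glift u) (Base ` S) \<noteq> 0" by (simp add: gcoeff_glift_image)
    then have "even (card (Base ` S)) = even k" using that by (simp add: gpar_def)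
    then show "even (card S) = even k" by (simp add: card_image inj_on_def)
  qed
  ultimately have "gpar (Suc (Suc (0 + sdeg E b) + sdeg E a)) (hess E N P a b x)" by blast
  then show ?thesis by (subst gpar_cong[of _ "Suc (Suc (0 + sdeg E b) + sdeg E a)"]) auto
qed

end

context
  fixes E N :: "'i::{finite,linorder} set" and U and Q :: "'i \<Rightarrow> 'i sfun"
  assumes EN: "E \<inter> N = {}" and U: "ev_open E U"
    and Q: "\<And>a. a \<in> E \<union> N \<Longrightarrow> superfun E N U (Q a)"
    and Q_odd: "\<And>a x. a \<in> E \<union> N \<Longrightarrow> x \<in> U \<Longrightarrow> gpar (Suc (sdeg E a)) (Q a x)"
begin

private lemmas UTq = ev_open_tU[OF U, of N]

lemma superfun_qham: "superfun (tE E N) (tN E N) (tU E N U) (qham E N Q)"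
  unfolding qham_def[abs_def] by (intro superfun_uminus superfun_sum superfun_mult UTq superfun_lift U Q superfun_coord_Anti)

lemma gpar_qham: "X \<in> tU E N U \<Longrightarrow> gpar 0 (qham E N Q X)"
  unfolding qham_def
proof (intro gpar_uminus gpar_sum)
  fix a assume X: "X \<in> tU E N U" and a: "a \<in> E \<union> N"
  have "gpar (Suc (sdeg E a) + Suc (sdeg E a)) (lift_fun (Q a) X * coord (tE E N) (Anti a) X)"
    unfolding lift_fun_glift by (intro gpar_mult gpar_glift Q_odd a tU_proj(1)[OF X] gpar_coord_Anti EN)
  then show "gpar 0 (lift_fun (Q a) X * coord (tE E N) (Anti a) X)"
    by (subst gpar_cong[of _ "Suc (sdeg E a) + Suc (sdeg E a)"]) auto
qed

lemma hv_qham: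
  assumes X: "X \<in> tU E N U" and a: "a \<in> E \<union> N"
  shows "hv E N (qham E N Q) (Base a) X = - lift_fun (Q a) X"
    and "hv E N (qham E N Q) (Anti a) X
      = (-1) ^ sdeg E a * (\<Sum>b\<in>E \<union> N. lift_fun (spd E a (Q b)) X * coord (tE E N) (Anti b) X)"
proof -
  let ?L = "\<lambda>Y. \<Sum>a\<in>E \<union> N. lift_fun (Q a) Y * coord (tE E N) (Anti a) Y"
  have L: "superfun (tE E N) (tN E N) (tU E N U) ?L"
    by (rule superfun_momentum_linear[OF EN U X Q])
  have m: "spd (tE E N) z (qham E N Q) X = - spd (tE E N) z ?L X" for z
    unfolding qham_def[abs_def] by (rule spd_uminus[OF UTq X L])
  have "spd (tE E N) (Anti a) ?L X = (-1) ^ (Suc (sdeg E a) * Suc (sdeg E a)) * lift_fun (Q a) X"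
    by (rule spd_Anti_momentum_linear[where g = Q, OF EN U X Q a Q_odd[OF a tU_proj(1)[OF X]]])
  then show "hv E N (qham E N Q) (Base a) X = - lift_fun (Q a) X"
    unfolding hv_def tcoord.case m by (cases "even (sdeg E a)") simp_all
  show "hv E N (qham E N Q) (Anti a) X
      = (-1) ^ sdeg E a * (\<Sum>b\<in>E \<union> N. lift_fun (spd E a (Q b)) X * coord (tE E N) (Anti b) X)"
    unfolding hv_def tcoord.case m using spd_Base_momentum_linear[OF EN U X Q] by simp
qed

text \<open>With the sign conventions of the bracket and of \<open>theta\<close>, the Hamiltonian
  field of Q' projects to -Q rather than to Q.\<close>

lemma dapp_qham_lift:
  assumes X: "X \<in> tU E N U"
  shows "dapp (tE E N) (tN E N) (hv E N (qham E N Q)) (lift_fun f) X = - lift_fun (dapp E N Q f) X"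
proof -
  have "hv E N (qham E N Q) (Base a) X * spd (tE E N) (Base a) (lift_fun f) X
      + hv E N (qham E N Q) (Anti a) X * spd (tE E N) (Anti a) (lift_fun f) X
    = - glift (Q a (tproj X) * spd E a f (tproj X))" if "a \<in> E \<union> N" for a
    unfolding hv_qham(1)[OF X that] spd_lift_Base spd_lift_Anti lift_fun_glift by (simp add: glift_mult)
  then show ?thesis
    unfolding dapp_def sum_tcoords by (simp add: lift_fun_glift glift_sum sum_negf)
qed

lemma superfun_hv_qham: "superfun (tE E N) (tN E N) (tU E N U) (hv E N (qham E N Q) z)"
  by (rule superfun_hv[OF EN U superfun_qham gpar_qham])

lemma gpar_hv_qham: "z \<in> tE E N \<union> tN E N \<Longrightarrow> X \<in> tU E N U \<Longrightarrow> gpar (Suc (sdeg (tE E N) z)) (hv E N (qham E N Q) z X)"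
  by (rule gpar_hv[OF EN U superfun_qham gpar_qham])

lemmas qham_facts = UTq superfun_hv_qham gpar_hv_qham

text \<open>The Leibniz rule gives two terms for each a. The first contains Q applied to its
  component a; in the second the coefficient of the momentum b adds up, over a, to Q applied to its
  component b.\<close>

lemma dapp_qham_self:
  assumes QQ: "\<And>b x. b \<in> E \<union> N \<Longrightarrow> x \<in> U \<Longrightarrow> dapp E N Q (Q b) x = 0" and X: "X \<in> tU E N U"
  shows "dapp (tE E N) (tN E N) (hv E N (qham E N Q)) (qham E N Q) X = 0"
proof -
  let ?D = "dapp (tE E N) (tN E N) (hv E N (qham E N Q))" and ?y = "\<lambda>a. coord (tE E N) (Anti a)"
  note x = tU_proj(1)[OF X]
  have s: "superfun (tE E N) (tN E N) (tU E N U) (\<lambda>Y. lift_fun (Q a) Y * ?y a Y)" if "a \<in> E \<union> N" for a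
    using that by (intro superfun_mult UTq superfun_lift U Q superfun_coord_Anti)
  have "?D (qham E N Q) X = - ?D (\<lambda>Y. \<Sum>a\<in>E \<union> N. lift_fun (Q a) Y * ?y a Y) X"
    unfolding qham_def[of E N Q, abs_def]
    by (rule dapp_uminus[OF qham_facts[unfolded qham_def[of E N Q, abs_def]] X superfun_momentum_linear[OF EN U X Q]])
  also have "?D (\<lambda>Y. \<Sum>a\<in>E \<union> N. lift_fun (Q a) Y * ?y a Y) X = (\<Sum>a\<in>E \<union> N. ?D (\<lambda>Y. lift_fun (Q a) Y * ?y a Y) X)"
    by (rule dapp_sum[OF qham_facts X finite s])
  also have "\<dots> = (\<Sum>a\<in>E \<union> N. \<Sum>b\<in>E \<union> N. - (glift (Q a (tproj X)) * glift (spd E a (Q b) (tproj X)) * ?y b X))"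
  proof (intro sum.cong refl)
    fix a assume a: "a \<in> E \<union> N"
    then have A: "Anti a \<in> tE E N \<union> tN E N" by auto
    have "gpar (Suc (sdeg E a)) (lift_fun (Q a) X)" unfolding lift_fun_glift by (intro gpar_glift Q_odd a x)
    from dapp_mult[OF qham_facts X superfun_lift[OF U Q[OF a]] superfun_coord_Anti[OF a] this]
    show "?D (\<lambda>Y. lift_fun (Q a) Y * ?y a Y) X = (\<Sum>b\<in>E \<union> N. - (glift (Q a (tproj X)) * glift (spd E a (Q b) (tproj X)) * ?y b X))"
      unfolding dapp_qham_lift[OF X] dapp_coord[OF A] hv_qham(2)[OF X a]
      using QQ[OF a x] by (cases "even (sdeg E a)") (simp_all add: lift_fun_glift sum_distrib_left sum_negf mult.assoc)
  qed
  also have "\<dots> = (\<Sum>b\<in>E \<union> N. - (glift (dapp E N Q (Q b) (tproj X)) * ?y b X))"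
    by (subst sum.swap) (simp add: dapp_def glift_sum glift_mult sum_distrib_right sum_negf)
  also have "\<dots> = 0" using QQ[OF _ x] by simp
  finally show ?thesis by simp
qed

text \<open>The odd derivation is applied to P as expressed by \<open>bivector_hess\<close>.
  \<open>T1\<close> and \<open>T2\<close> come from the two momenta, \<open>T3\<close> and
  \<open>T4\<close> from the Hessian through \<open>deriv\<close>; after renaming indices,
  \<open>T1\<close> cancels \<open>T4\<close> and \<open>T2\<close> cancels
  \<open>T3\<close>.\<close>

lemma dapp_qham_bivector:
  assumes P: "is_bivector E N U P" and X: "X \<in> tU E N U"
    and deriv: "\<And>a b x. a \<in> E \<union> N \<Longrightarrow> b \<in> E \<union> N \<Longrightarrow> x \<in> U \<Longrightarrow> dapp E N Q (hess E N P a b) x =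
      (\<Sum>c\<in>E \<union> N. (-1) ^ (sdeg E c * sdeg E a) * (spd E c (Q a) x * hess E N P c b x)
        + (-1) ^ (sdeg E a + sdeg E b + sdeg E c) * (hess E N P a c x * spd E c (Q b) x))"
  shows "dapp (tE E N) (tN E N) (hv E N (qham E N Q)) P X = 0"
proof -
  let ?C = "E \<union> N" and ?p = "sdeg E"
  let ?D = "dapp (tE E N) (tN E N) (hv E N (qham E N Q))" and ?y = "\<lambda>a. coord (tE E N) (Anti a)"
  let ?h = "hess E N P"
  note x = tU_proj(1)[OF X]
  define y where "y = (\<lambda>a. ?y a X)"
  define h where "h = (\<lambda>a b. glift (?h a b (tproj X)))"
  define q where "q = (\<lambda>b c. glift (spd E b (Q c) (tproj X)))"
  note hs = hess_basic(1)[OF EN U P]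
  have yp: "gpar (Suc (?p a)) (y a)" if "a \<in> ?C" for a unfolding y_def by (rule gpar_coord_Anti[OF EN that])
  have hp: "gpar (?p a + ?p b) (h a b)" if "a \<in> ?C" "b \<in> ?C" for a b
    unfolding h_def by (intro gpar_glift gpar_hess[OF EN U P] that x)
  have qp: "gpar (Suc (?p c) + ?p b) (q b c)" if "c \<in> ?C" for b c
    unfolding q_def by (intro gpar_glift gpar_spd[OF U x] Q_odd that)
  have lh: "superfun (tE E N) (tN E N) (tU E N U) (lift_fun (?h a b))" if "a \<in> ?C" "b \<in> ?C" for a b
    by (rule superfun_lift[OF U hs[OF that]])
  have s1: "superfun (tE E N) (tN E N) (tU E N U) (\<lambda>Y. ?y a Y * lift_fun (?h a b) Y)" if "a \<in> ?C" "b \<in> ?C" for a b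
    by (intro superfun_mult UTq superfun_coord_Anti lh that)
  have s2: "superfun (tE E N) (tN E N) (tU E N U) (\<lambda>Y. ?y b Y * (?y a Y * lift_fun (?h a b) Y))" if "a \<in> ?C" "b \<in> ?C" for a b
    by (intro superfun_mult[OF UTq superfun_coord_Anti s1] that)
  have s3: "superfun (tE E N) (tN E N) (tU E N U) (\<lambda>Y. \<Sum>a\<in>?C. ?y b Y * (?y a Y * lift_fun (?h a b) Y))" if "b \<in> ?C" for b
    by (intro superfun_sum[OF UTq] s2 that)
  have s4: "superfun (tE E N) (tN E N) (tU E N U) (\<lambda>Y. \<Sum>b\<in>?C. \<Sum>a\<in>?C. ?y b Y * (?y a Y * lift_fun (?h a b) Y))"
    by (intro superfun_sum[OF UTq] s3)
  have yv: "?D (?y a) X = (-1) ^ ?p a * (\<Sum>c\<in>?C. q a c * y c)" if a: "a \<in> ?C" for a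
  proof -
    have "Anti a \<in> tE E N \<union> tN E N" using a by auto
    then show ?thesis
      using dapp_coord[of "Anti a" "tE E N" "tN E N"] hv_qham(2)[OF X a] by (simp add: q_def y_def lift_fun_glift)
  qed
  define T1 where "T1 = (\<lambda>a b c. (-1) ^ ?p b * (q b c * (y c * (y a * h a b))))"
  define T2 where "T2 = (\<lambda>a b c. - ((-1) ^ (?p a + ?p b) * (y b * (q a c * (y c * h a b)))))"
  define T3 where "T3 = (\<lambda>a b c. - ((-1) ^ (?p a + ?p b + ?p c * ?p a) * (y b * (y a * (q c a * h c b)))))"
  define T4 where "T4 = (\<lambda>a b c. - ((-1) ^ ?p c * (y b * (y a * (h a c * q c b)))))"
  \<comment> \<open>As real scalars the signs move freely through products, so that the four sums
    can be brought to normal form.\<close>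
  have sgn: "(-1) ^ n * z = ((-1) ^ n :: real) *\<^sub>R z" for n and z :: "'i tcoord grass"
    by (simp add: minus_one_power_iff)
  have t: "?D (\<lambda>Y. ?y b Y * (?y a Y * lift_fun (?h a b) Y)) X
    = (\<Sum>c\<in>?C. T1 a b c) + (\<Sum>c\<in>?C. T2 a b c) + ((\<Sum>c\<in>?C. T3 a b c) + (\<Sum>c\<in>?C. T4 a b c))"
    if ab: "a \<in> ?C" "b \<in> ?C" for a b
  proof -
    have "?D (\<lambda>Y. ?y b Y * (?y a Y * lift_fun (?h a b) Y)) X
      = (-1) ^ ?p b * (\<Sum>c\<in>?C. q b c * y c) * (y a * h a b)
        - (-1) ^ ?p b * (y b * ((-1) ^ ?p a * (\<Sum>c\<in>?C. q a c * y c) * h a b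
            + (-1) ^ ?p a * (y a * glift (dapp E N Q (?h a b) (tproj X)))))"
      using dapp_mult[OF qham_facts X superfun_coord_Anti[OF ab(2)] s1[OF ab] yp[OF ab(2), unfolded y_def]]
        dapp_mult[OF qham_facts X superfun_coord_Anti[OF ab(1)] lh[OF ab] yp[OF ab(1), unfolded y_def]]
        dapp_qham_lift[OF X, of "?h a b"] yv[OF ab(1)] yv[OF ab(2)]
      by (simp add: y_def h_def lift_fun_glift)
    also have "glift (dapp E N Q (?h a b) (tproj X)) = (\<Sum>c\<in>?C. (-1) ^ (?p c * ?p a) * (q c a * h c b)
        + (-1) ^ (?p a + ?p b + ?p c) * (h a c * q c b))"
      unfolding deriv[OF ab x] glift_sum q_def h_def
      by (intro sum.cong refl) (simp add: glift_add glift_mult glift_uminus glift_one minus_one_power_iff)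
    finally show ?thesis
      unfolding T1_def T2_def T3_def T4_def
      by (cases "even (?p a)"; cases "even (?p b)")
        (simp_all add: sgn sum_distrib_left sum_distrib_right sum.distrib sum_negf sum_subtractf distrib_left right_diff_distrib mult.assoc power_add scaleR_sum_right)
  qed
  have "?D (\<lambda>Y. \<Sum>b\<in>?C. \<Sum>a\<in>?C. ?y b Y * (?y a Y * lift_fun (?h a b) Y)) X
    = (\<Sum>b\<in>?C. ?D (\<lambda>Y. \<Sum>a\<in>?C. ?y b Y * (?y a Y * lift_fun (?h a b) Y)) X)"
    by (rule dapp_sum[OF qham_facts X finite s3])
  also have "\<dots> = (\<Sum>b\<in>?C. \<Sum>a\<in>?C. ?D (\<lambda>Y. ?y b Y * (?y a Y * lift_fun (?h a b) Y)) X)"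
    by (rule sum.cong[OF refl dapp_sum[OF qham_facts X finite s2]])
  also have "\<dots> = ((\<Sum>b\<in>?C. \<Sum>a\<in>?C. \<Sum>c\<in>?C. T1 a b c) + (\<Sum>b\<in>?C. \<Sum>a\<in>?C. \<Sum>c\<in>?C. T2 a b c))
    + ((\<Sum>b\<in>?C. \<Sum>a\<in>?C. \<Sum>c\<in>?C. T3 a b c) + (\<Sum>b\<in>?C. \<Sum>a\<in>?C. \<Sum>c\<in>?C. T4 a b c))"
    unfolding sum.distrib[symmetric] by (intro sum.cong refl t[folded sum.distrib])
  also have "(\<Sum>b\<in>?C. \<Sum>a\<in>?C. \<Sum>c\<in>?C. T1 a b c) = - (\<Sum>b\<in>?C. \<Sum>a\<in>?C. \<Sum>c\<in>?C. T4 a b c)"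
  proof -
    \<comment> \<open>With b and c exchanged the two terms have the same factors;
      \<open>q c b\<close> has to pass both momenta and the Hessian.\<close>
    have 1: "T1 a c b = - T4 a b c" if abc: "a \<in> ?C" "b \<in> ?C" "c \<in> ?C" for a b c
    proof -
      have "q c b * (y b * (y a * h a c)) = (-1) ^ ((Suc (?p b) + ?p c) * (Suc (?p b) + (Suc (?p a) + (?p a + ?p c)))) * ((y b * (y a * h a c)) * q c b)"
        by (intro gpar_commute gpar_mult qp yp hp abc)
      then show ?thesis
        unfolding T1_def T4_def
        by (cases "even (?p a)"; cases "even (?p b)"; cases "even (?p c)") (simp_all add: mult.assoc)
    qed
    have "(\<Sum>b\<in>?C. \<Sum>a\<in>?C. \<Sum>c\<in>?C. T1 a b c) = (\<Sum>a\<in>?C. \<Sum>b\<in>?C. \<Sum>c\<in>?C. T1 a b c)" by (rule sum.swap)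
    also have "\<dots> = (\<Sum>a\<in>?C. \<Sum>b\<in>?C. \<Sum>c\<in>?C. T1 a c b)" by (intro sum.cong refl sum.swap)
    also have "\<dots> = (\<Sum>a\<in>?C. \<Sum>b\<in>?C. \<Sum>c\<in>?C. - T4 a b c)" by (intro sum.cong refl 1)
    also have "\<dots> = (\<Sum>b\<in>?C. \<Sum>a\<in>?C. \<Sum>c\<in>?C. - T4 a b c)" by (rule sum.swap)
    finally show ?thesis by (simp add: sum_negf)
  qed
  also have "(\<Sum>b\<in>?C. \<Sum>a\<in>?C. \<Sum>c\<in>?C. T2 a b c) = - (\<Sum>b\<in>?C. \<Sum>a\<in>?C. \<Sum>c\<in>?C. T3 a b c)"
  proof -
    \<comment> \<open>With a and c exchanged the terms differ by a swap of the adjacent factors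
      \<open>q c a\<close> and \<open>y a\<close>.\<close>
    have 1: "T2 c b a = - T3 a b c" if abc: "a \<in> ?C" "b \<in> ?C" "c \<in> ?C" for a b c
    proof -
      have "q c a * y a = (-1) ^ ((Suc (?p a) + ?p c) * Suc (?p a)) * (y a * q c a)"
        by (intro gpar_commute qp yp abc)
      from arg_cong[OF this, of "\<lambda>u. y b * (u * h c b)"] show ?thesis
        unfolding T2_def T3_def
        by (cases "even (?p a)"; cases "even (?p b)"; cases "even (?p c)") (simp_all add: mult.assoc)
    qed
    have "(\<Sum>b\<in>?C. \<Sum>a\<in>?C. \<Sum>c\<in>?C. T2 a b c) = (\<Sum>b\<in>?C. \<Sum>a\<in>?C. \<Sum>c\<in>?C. T2 c b a)" by (intro sum.cong refl sum.swap)
    also have "\<dots> = (\<Sum>b\<in>?C. \<Sum>a\<in>?C. \<Sum>c\<in>?C. - T3 a b c)" by (intro sum.cong refl 1)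
    finally show ?thesis by (simp add: sum_negf)
  qed
  finally have z: "?D (\<lambda>Y. \<Sum>b\<in>?C. \<Sum>a\<in>?C. ?y b Y * (?y a Y * lift_fun (?h a b) Y)) X = 0" by simp
  have "?D P X = ?D (\<lambda>Y. (1/2) *\<^sub>R (\<Sum>b\<in>?C. \<Sum>a\<in>?C. ?y b Y * (?y a Y * lift_fun (?h a b) Y))) X"
    by (rule dapp_cong[OF qham_facts X bivector_hess[OF EN U P]])
  also have "\<dots> = 0"
    using dapp_scaleR[OF qham_facts X s4] z by simp
  finally show ?thesis .
qed

end

section \<open>The derivation property in terms of the Hessian\<close>

section \<open>The Schouten and Poisson brackets\<close>

lemma gpart_gpar: "gpar k u \<Longrightarrow> gpart l u = (if even l = even k then u else 0)"
  by (rule grass_eqI) (auto simp: gpar_def gcoeff_gpart mod2_eq_iff)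

context
  fixes M :: "('c, 'i::{finite,linorder}) atlas" and i :: 'c
  assumes M: "supermanifold M" and i: "i \<in> charts M"
begin

text \<open>Of the two parity components in the definition of \<open>schouten\<close> only the one
  with the parity of F survives.\<close>

lemma schouten_homogeneous:
  assumes X: "X \<in> tU (evens M) (odds M) (cdom M i)"
    and F: "\<And>Y. Y \<in> tU (evens M) (odds M) (cdom M i) \<Longrightarrow> gpar k (F Y)" and k: "k = 0 \<or> k = 1"
  shows "schouten M F g X = (\<Sum>a\<in>coords M.
      (-1) ^ (Suc (sdeg (evens M) a) * Suc k) * (spd (tE (evens M) (odds M)) (Anti a) F X * spd (tE (evens M) (odds M)) (Base a) g X)
    - (-1) ^ (sdeg (evens M) a * Suc k) * (spd (tE (evens M) (odds M)) (Base a) F X * spd (tE (evens M) (odds M)) (Anti a) g X))"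
proof -
  note UT = ev_open_tU[OF ev_open_cdom[OF M i], of "odds M"]
  let ?E = "tE (evens M) (odds M)"
  have d: "spd ?E z (\<lambda>Y. gpart l (F Y)) X = (if l = k then spd ?E z F X else 0)" if "l \<in> {0, 1}" for l z
  proof -
    have "spd ?E z (\<lambda>Y. gpart l (F Y)) X = spd ?E z (if l = k then F else (\<lambda>Y. 0)) X"
      using k that by (intro spd_cong[OF UT X]) (auto simp: gpart_gpar[OF F])
    then show ?thesis using spd_zero[OF UT] by simp
  qed
  have "schouten M F g X = (\<Sum>l\<in>{0, 1}. if l = k then (\<Sum>a\<in>coords M.
      (-1) ^ (Suc (sdeg (evens M) a) * Suc k) * (spd ?E (Anti a) F X * spd ?E (Base a) g X)
    - (-1) ^ (sdeg (evens M) a * Suc k) * (spd ?E (Base a) F X * spd ?E (Anti a) g X)) else 0)"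
    unfolding schouten_def anticotangent_simps
    by (intro sum.cong refl) (auto simp: d cpar_sdeg[OF M] mult.assoc intro!: sum.cong)
  also have "\<dots> = (\<Sum>a\<in>coords M.
      (-1) ^ (Suc (sdeg (evens M) a) * Suc k) * (spd ?E (Anti a) F X * spd ?E (Base a) g X)
    - (-1) ^ (sdeg (evens M) a * Suc k) * (spd ?E (Base a) F X * spd ?E (Anti a) g X))"
    using k by auto
  finally show ?thesis .
qed

text \<open>Turns brackets with an even function into the action of its Hamiltonian field, where the
  results for odd vector fields apply.\<close>

lemma schouten_even:
  assumes X: "X \<in> tU (evens M) (odds M) (cdom M i)"
    and F: "\<And>Y. Y \<in> tU (evens M) (odds M) (cdom M i) \<Longrightarrow> gpar 0 (F Y)"
  shows "schouten M F g X = dapp (tE (evens M) (odds M)) (tN (evens M) (odds M)) (hv (evens M) (odds M) F) g X"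
  unfolding schouten_homogeneous[where k = 0 and F = F, OF X F, simplified] dapp_def sum_tcoords hv_def tcoord.case
  by (intro sum.cong refl) (simp add: mult.assoc)

lemma schouten_lift:
  assumes X: "X \<in> tU (evens M) (odds M) (cdom M i)"
    and f: "\<And>y. y \<in> cdom M i \<Longrightarrow> gpar k (f y)" and k: "k = 0 \<or> k = 1"
  shows "schouten M (lift_fun f) g X = - (\<Sum>a\<in>coords M.
      (-1) ^ (sdeg (evens M) a * Suc k) * (lift_fun (partial M a f) X * spd (tE (evens M) (odds M)) (Anti a) g X))"
proof -
  have "gpar k (lift_fun f Y)" if "Y \<in> tU (evens M) (odds M) (cdom M i)" for Y
    unfolding lift_fun_glift by (rule gpar_glift[OF f[OF tU_proj(1)[OF that]]])
  from schouten_homogeneous[OF X this k] show ?thesis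
    by (simp add: spd_lift_Base spd_lift_Anti sum_negf)
qed

text \<open>Lifted functions have no momentum derivatives, which leaves one product in each bracket.
  The inner bracket differentiates P once in the momenta and the outer one a second time, so the
  Hessian appears.\<close>

lemma poisson_bracket_hess:
  assumes P: "is_bivector (evens M) (odds M) (cdom M i) P" and x: "x \<in> cdom M i"
    and f: "\<And>y. y \<in> cdom M i \<Longrightarrow> gpar k (f y)" and k: "k = 0 \<or> k = 1"
    and g: "superfun (evens M) (odds M) (cdom M i) g"
  shows "poisson_bracket M P f g x = (\<Sum>a\<in>coords M. \<Sum>c\<in>coords M.
      (-1) ^ (sdeg (evens M) a * Suc k + sdeg (evens M) c) *
        (partial M a f x * (hess (evens M) (odds M) P a c x * partial M c g x)))"
proof -
  let ?E = "tE (evens M) (odds M)" and ?p = "sdeg (evens M)" and ?h = "hess (evens M) (odds M) P"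
  note dis = coords_disjoint[OF M] and U = ev_open_cdom[OF M i]
  note UT = ev_open_tU[OF U, of "odds M"]
  have X: "tzero x \<in> tU (evens M) (odds M) (cdom M i)" (is "?X \<in> _") by (rule tzero_tU[OF U x])
  note sP = bivector_superfun[OF dis U P]
  have dg: "superfun (evens M) (odds M) (cdom M i) (partial M c g)" for c by (rule superfun_spd[OF U g])
  have s: "superfun ?E (tN (evens M) (odds M)) (tU (evens M) (odds M) (cdom M i)) (\<lambda>Y. spd ?E (Anti c) P Y * lift_fun (partial M c g) Y)" for c
    by (intro superfun_mult UT superfun_spd sP superfun_lift U dg)
  have 1: "schouten M P (lift_fun g) Y = (\<Sum>c\<in>coords M. - ((-1) ^ ?p c * (spd ?E (Anti c) P Y * lift_fun (partial M c g) Y)))"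
    if "Y \<in> tU (evens M) (odds M) (cdom M i)" for Y
  proof -
    have "schouten M P (lift_fun g) Y = dapp ?E (tN (evens M) (odds M)) (hv (evens M) (odds M) P) (lift_fun g) Y"
      by (rule schouten_even[OF that]) (rule bivector_gpar[OF dis U P])
    then show ?thesis
      unfolding dapp_def sum_tcoords hv_def tcoord.case by (simp add: spd_lift_Base spd_lift_Anti mult.assoc)
  qed
  have 2: "spd ?E (Anti a) (schouten M P (lift_fun g)) ?X = (\<Sum>c\<in>coords M. - ((-1) ^ ?p c * glift (?h a c x * partial M c g x)))"
    if a: "a \<in> coords M" for a
  proof -
    have "spd ?E (Anti a) (schouten M P (lift_fun g)) ?X
      = spd ?E (Anti a) (\<lambda>Y. \<Sum>c\<in>coords M. - ((-1) ^ ?p c * (spd ?E (Anti c) P Y * lift_fun (partial M c g) Y))) ?X"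
      by (rule spd_cong[OF UT X 1])
    also have "\<dots> = (\<Sum>c\<in>coords M. spd ?E (Anti a) (\<lambda>Y. - ((-1) ^ ?p c * (spd ?E (Anti c) P Y * lift_fun (partial M c g) Y))) ?X)"
      by (rule spd_sum[OF UT X finite superfun_uminus[OF UT superfun_sign[OF UT s]]])
    also have "\<dots> = (\<Sum>c\<in>coords M. - ((-1) ^ ?p c * glift (?h a c x * partial M c g x)))"
    proof (intro sum.cong refl)
      fix c assume c: "c \<in> coords M"
      have "spd ?E (Anti a) (\<lambda>Y. spd ?E (Anti c) P Y * lift_fun (partial M c g) Y) ?X
        = spd ?E (Anti a) (spd ?E (Anti c) P) ?X * lift_fun (partial M c g) ?X"
        unfolding spd_mult[OF UT X superfun_spd[OF UT sP] superfun_lift[OF U dg]] spd_lift_Anti by simp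
      also have "\<dots> = glift (?h a c x * partial M c g x)"
        using hess_basic(2)[OF dis U P a c X] by (simp add: lift_fun_glift glift_mult tproj_tzero)
      finally show "spd ?E (Anti a) (\<lambda>Y. - ((-1) ^ ?p c * (spd ?E (Anti c) P Y * lift_fun (partial M c g) Y))) ?X
          = - ((-1) ^ ?p c * glift (?h a c x * partial M c g x))"
        unfolding spd_uminus[OF UT X superfun_sign[OF UT s]] spd_sign[OF UT X s] by simp
    qed
    finally show ?thesis .
  qed
  have "schouten M (lift_fun f) (schouten M P (lift_fun g)) ?X
    = - (\<Sum>a\<in>coords M. (-1) ^ (?p a * Suc k) * (lift_fun (partial M a f) ?X * (\<Sum>c\<in>coords M. - ((-1) ^ ?p c * glift (?h a c x * partial M c g x)))))"
  proof -
    have "schouten M (lift_fun f) (schouten M P (lift_fun g)) ?X = - (\<Sum>a\<in>coords M. (-1) ^ (?p a * Suc k) *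
        (lift_fun (partial M a f) ?X * spd ?E (Anti a) (schouten M P (lift_fun g)) ?X))"
      by (rule schouten_lift[OF X _ k]) (rule f)
    also have "\<dots> = - (\<Sum>a\<in>coords M. (-1) ^ (?p a * Suc k) * (lift_fun (partial M a f) ?X *
        (\<Sum>c\<in>coords M. - ((-1) ^ ?p c * glift (?h a c x * partial M c g x)))))"
      by (rule arg_cong[where f = uminus]) (intro sum.cong refl arg_cong2[where f = "(*)"] 2)
    finally show ?thesis .
  qed
  also have "\<dots> = glift (\<Sum>a\<in>coords M. \<Sum>c\<in>coords M. (-1) ^ (?p a * Suc k + ?p c) * (partial M a f x * (?h a c x * partial M c g x)))"
    unfolding sum_negf[symmetric] glift_sum sum_distrib_left
    by (intro sum.cong refl)
      (auto simp: lift_fun_glift tproj_tzero glift_mult glift_uminus glift_one minus_one_power_iff)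
  finally show ?thesis
    unfolding poisson_bracket_def by (rule zero_sec_glift)
qed

text \<open>The derivation property is evaluated on the coordinate functions a and b: their Poisson
  bracket is the Hessian entry up to sign, see \<open>B1b\<close>, and the field sends them to its
  components.\<close>

lemma derivation_hess:
  assumes P: "is_bivector (evens M) (odds M) (cdom M i) (P i)"
    and Q: "\<And>a. a \<in> coords M \<Longrightarrow> superfun (evens M) (odds M) (cdom M i) (Q i a)"
    and Q_odd: "\<And>a x. a \<in> coords M \<Longrightarrow> x \<in> cdom M i \<Longrightarrow> gpar (Suc (sdeg (evens M) a)) (Q i a x)"
    and deriv: "bracket_derivation M 1 Q P"
    and ab: "a \<in> coords M" "b \<in> coords M" and x: "x \<in> cdom M i"
  shows "dapp (evens M) (odds M) (Q i) (hess (evens M) (odds M) (P i) a b) x =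
      (\<Sum>c\<in>coords M. (-1) ^ (sdeg (evens M) c * sdeg (evens M) a) * (partial M c (Q i a) x * hess (evens M) (odds M) (P i) c b x)
        + (-1) ^ (sdeg (evens M) a + sdeg (evens M) b + sdeg (evens M) c) * (hess (evens M) (odds M) (P i) a c x * partial M c (Q i b) x))"
proof -
  let ?p = "sdeg (evens M)" and ?h = "hess (evens M) (odds M) (P i)" and ?x = "coord (evens M)"
  note dis = coords_disjoint[OF M] and U = ev_open_cdom[OF M i]
  have cf: "chart_fun M i (?x c)" if "c \<in> coords M" for c
    unfolding chart_fun_def by (rule sw_UNIV[OF sw_coord[OF U dis that]])
  have k: "?p c = 0 \<or> ?p c = 1" for c by (simp add: sdeg_def)
  have "vf_app M (Q i) (poisson_bracket M (P i) (?x a) (?x b)) x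
     = poisson_bracket M (P i) (vf_app M (Q i) (?x a)) (?x b) x
       + (-1) ^ (1 * ?p a) * poisson_bracket M (P i) (?x a) (vf_app M (Q i) (?x b)) x"
    using deriv[unfolded bracket_derivation_def, rule_format, OF i, of "?x a" "?p a" "?x b" x] cf ab x
    by (simp add: parity_on_iff gpar_coord)
  moreover have "vf_app M (Q i) (?x c) = Q i c" if "c \<in> coords M" for c
    unfolding vf_app_dapp using dapp_coord[OF that] by (simp add: fun_eq_iff)
  ultimately have main: "dapp (evens M) (odds M) (Q i) (poisson_bracket M (P i) (?x a) (?x b)) x
     = poisson_bracket M (P i) (Q i a) (?x b) x + (-1) ^ ?p a * poisson_bracket M (P i) (?x a) (Q i b) x"
    using ab by (simp add: vf_app_dapp)
  have even_sq: "(-1) ^ (?p a * Suc (?p a)) = (1 :: 'i grass)" by (simp add: sdeg_def)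
  have d: "(if c = a then 1 else 0) * u = (if c = a then u else 0)" "u * (if c = a then 1 else 0) = (if c = a then u else 0)"
    for c a :: 'i and u :: "'i grass" by auto
  have B1: "poisson_bracket M (P i) (?x a) g y = (\<Sum>c\<in>coords M. (-1) ^ ?p c * (?h a c y * partial M c g y))"
    if y: "y \<in> cdom M i" and g: "superfun (evens M) (odds M) (cdom M i) g" for g y
  proof -
    have "poisson_bracket M (P i) (?x a) g y = (\<Sum>a'\<in>coords M. if a' = a then
       (\<Sum>c\<in>coords M. (-1) ^ (?p a * Suc (?p a) + ?p c) * (?h a c y * partial M c g y)) else 0)"
      unfolding poisson_bracket_hess[OF P y gpar_coord k g]
      by (intro sum.cong refl) (auto simp: spd_coord)
    also have "\<dots> = (\<Sum>c\<in>coords M. (-1) ^ (?p a * Suc (?p a) + ?p c) * (?h a c y * partial M c g y))"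
      using ab(1) by (subst sum.delta) auto
    finally show ?thesis unfolding power_add even_sq by simp
  qed
  have B1b: "poisson_bracket M (P i) (?x a) (?x b) y = (-1) ^ ?p b * ?h a b y" if y: "y \<in> cdom M i" for y
  proof -
    have "poisson_bracket M (P i) (?x a) (?x b) y = (\<Sum>c\<in>coords M. if c = b then (-1) ^ ?p b * ?h a b y else 0)"
      unfolding B1[OF y superfun_coord[OF ab(2)]] by (intro sum.cong refl) (auto simp: spd_coord)
    then show ?thesis using ab(2) by (simp add: sum.delta)
  qed
  have hs: "superfun (evens M) (odds M) (cdom M i) (?h a b)" by (rule hess_basic(1)[OF dis U P ab])
  have L: "dapp (evens M) (odds M) (Q i) (poisson_bracket M (P i) (?x a) (?x b)) x = (-1) ^ ?p b * dapp (evens M) (odds M) (Q i) (?h a b) x"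
  proof -
    have "dapp (evens M) (odds M) (Q i) (poisson_bracket M (P i) (?x a) (?x b)) x = dapp (evens M) (odds M) (Q i) (\<lambda>y. (-1) ^ ?p b * ?h a b y) x"
      by (rule dapp_cong[OF U Q Q_odd x B1b])
    then show ?thesis using dapp_sign[OF U Q Q_odd x hs] by simp
  qed
  \<comment> \<open>\<open>Q i a\<close> has parity \<open>Suc (?p a)\<close>, whereas
    \<open>poisson_bracket_hess\<close> asks for 0 or 1; this is the representative.\<close>
  define k' where "k' = (if ?p a = 0 then 1 else 0 :: nat)"
  have Qa: "gpar k' (Q i a y)" if "y \<in> cdom M i" for y
    using Q_odd[OF ab(1) that] by (subst gpar_cong[of _ "Suc (?p a)"]) (auto simp: k'_def sdeg_def)
  have B2: "poisson_bracket M (P i) (Q i a) (?x b) x = (\<Sum>c\<in>coords M. (-1) ^ (?p c * ?p a + ?p b) * (partial M c (Q i a) x * ?h c b x))"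
  proof -
    have k': "k' = 0 \<or> k' = 1" by (simp add: k'_def)
    have "poisson_bracket M (P i) (Q i a) (?x b) x
      = (\<Sum>c\<in>coords M. \<Sum>c'\<in>coords M. if c' = b then (-1) ^ (?p c * Suc k' + ?p b) * (partial M c (Q i a) x * ?h c b x) else 0)"
    proof -
      have "poisson_bracket M (P i) (Q i a) (?x b) x = (\<Sum>c\<in>coords M. \<Sum>c'\<in>coords M.
          (-1) ^ (?p c * Suc k' + ?p c') * (partial M c (Q i a) x * (?h c c' x * partial M c' (?x b) x)))"
        by (rule poisson_bracket_hess[OF P x _ k' superfun_coord[OF ab(2)]]) (rule Qa)
      also have "\<dots> = (\<Sum>c\<in>coords M. \<Sum>c'\<in>coords M. if c' = b then (-1) ^ (?p c * Suc k' + ?p b) * (partial M c (Q i a) x * ?h c b x) else 0)"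
        by (intro sum.cong refl) (auto simp: spd_coord)
      finally show ?thesis .
    qed
    also have "\<dots> = (\<Sum>c\<in>coords M. (-1) ^ (?p c * Suc k' + ?p b) * (partial M c (Q i a) x * ?h c b x))"
      using ab(2) by (simp add: sum.delta)
    also have "\<dots> = (\<Sum>c\<in>coords M. (-1) ^ (?p c * ?p a + ?p b) * (partial M c (Q i a) x * ?h c b x))"
      by (intro sum.cong refl arg_cong2[where f="(*)"] minus_one_power_sum_even) (auto simp: k'_def sdeg_def)
    finally show ?thesis .
  qed
  \<comment> \<open>Multiplying by the sign of b isolates the Hessian entry on the left.\<close>
  from main[unfolded L B1[OF x Q[OF ab(2)]] B2]
  have "(-1) ^ ?p b * ((-1) ^ ?p b * dapp (evens M) (odds M) (Q i) (?h a b) x)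
    = (-1) ^ ?p b * ((\<Sum>c\<in>coords M. (-1) ^ (?p c * ?p a + ?p b) * (partial M c (Q i a) x * ?h c b x))
        + (-1) ^ ?p a * (\<Sum>c\<in>coords M. (-1) ^ ?p c * (?h a c x * partial M c (Q i b) x)))"
    by simp
  also have "(-1) ^ ?p b * ((-1) ^ ?p b * dapp (evens M) (odds M) (Q i) (?h a b) x) = dapp (evens M) (odds M) (Q i) (?h a b) x"
    by (simp add: minus_one_power_iff)
  also have "(-1) ^ ?p b * ((\<Sum>c\<in>coords M. (-1) ^ (?p c * ?p a + ?p b) * (partial M c (Q i a) x * ?h c b x))
        + (-1) ^ ?p a * (\<Sum>c\<in>coords M. (-1) ^ ?p c * (?h a c x * partial M c (Q i b) x)))
     = (\<Sum>c\<in>coords M. (-1) ^ ?p b * ((-1) ^ (?p c * ?p a + ?p b) * (partial M c (Q i a) x * ?h c b x))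
        + (-1) ^ ?p b * ((-1) ^ ?p a * ((-1) ^ ?p c * (?h a c x * partial M c (Q i b) x))))"
    by (simp only: distrib_left sum_distrib_left sum.distrib)
  also have "\<dots> = (\<Sum>c\<in>coords M. (-1) ^ (?p c * ?p a) * (partial M c (Q i a) x * ?h c b x)
        + (-1) ^ (?p a + ?p b + ?p c) * (?h a c x * partial M c (Q i b) x))"
    by (intro sum.cong refl) (simp add: minus_one_power_iff)
  finally show ?thesis .
qed

end

section \<open>Assembling the Hamiltonian: self bracket, weight and invariance\<close>

section \<open>The homological vector field on the anticotangent bundle\<close>

lemma theta_qham: "theta M 1 Q i = qham (evens M) (odds M) (Q i)"
  by (simp add: theta_def qham_def fun_eq_iff)

lemma even_bivector_local:
  assumes P: "even_bivector M P" and i: "i \<in> charts M"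
  shows "is_bivector (evens M) (odds M) (cdom M i) (P i)"
  unfolding is_bivector_def
proof (intro conjI ballI)
  have fo: "function_on (anticotangent M) P" and fp: "function_parity (anticotangent M) P 0"
    using P by (simp_all add: even_bivector_def)
  show "superfun (tE (evens M) (odds M)) (tN (evens M) (odds M)) (tU (evens M) (odds M) (cdom M i)) (P i)"
    using fo i sw_superfun unfolding function_on_def chart_fun_def anticotangent_simps by blast
  show "gpar 0 (P i X)" if "X \<in> tU (evens M) (odds M) (cdom M i)" for X
    using fp i that by (simp add: function_parity_def parity_on_iff)
  obtain c where c: "\<forall>a\<in>coords M. \<forall>b\<in>coords M. chart_fun M i (c a b)"
    "\<forall>Y\<in>cdom (anticotangent M) i. P i Y = (1/2) *\<^sub>R (\<Sum>a\<in>coords M. \<Sum>b\<in>coords M.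
           lift_fun (c a b) Y * tcoord_fun M (Anti b) Y * tcoord_fun M (Anti a) Y)"
    using P i unfolding even_bivector_def by blast
  show "\<exists>c. (\<forall>a\<in>coords M. \<forall>b\<in>coords M. superfun (evens M) (odds M) (cdom M i) (c a b)) \<and>
       (\<forall>X\<in>tU (evens M) (odds M) (cdom M i). P i X = (1/2) *\<^sub>R (\<Sum>a\<in>coords M. \<Sum>b\<in>coords M.
          lift_fun (c a b) X * (coord (tE (evens M) (odds M)) (Anti b) X * coord (tE (evens M) (odds M)) (Anti a) X)))"
  proof (intro exI[of _ c] conjI ballI)
    show "superfun (evens M) (odds M) (cdom M i) (c a b)" if "a \<in> coords M" "b \<in> coords M" for a b
      using c(1) that sw_superfun unfolding chart_fun_def by blast
    show "P i X = (1/2) *\<^sub>R (\<Sum>a\<in>coords M. \<Sum>b\<in>coords M.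
        lift_fun (c a b) X * (coord (tE (evens M) (odds M)) (Anti b) X * coord (tE (evens M) (odds M)) (Anti a) X))"
      if "X \<in> tU (evens M) (odds M) (cdom M i)" for X
      using c(2) that by (simp add: mult.assoc)
  qed
qed

context
  fixes M :: "('c, 'i::{finite,linorder}) atlas"
    and Q :: "'c \<Rightarrow> 'i \<Rightarrow> 'i sfun"
    and P :: "'c \<Rightarrow> 'i tcoord sfun"
    and q p :: int and lam :: real
  assumes QP: "graded_QP_manifold M Q P"
    and Qq: "vf_weight M Q q"
    and Pp: "function_weight (anticotangent M) P p"
begin

abbreviation (input) hamiltonian :: "'c \<Rightarrow> 'i tcoord sfun" where
  "hamiltonian i \<equiv> (\<lambda>Y. qham (evens M) (odds M) (Q i) Y + lam *\<^sub>R P i Y)"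

lemma QP_facts:
  shows "graded_manifold M" "supermanifold M" "homological M Q" "vector_field M Q" "vf_parity M Q 1"
    "even_bivector M P" "bracket_derivation M 1 Q P"
    "i \<in> charts M \<Longrightarrow> Y \<in> cdom (anticotangent M) i \<Longrightarrow> schouten M (P i) (P i) Y = 0"
  using QP unfolding graded_QP_manifold_def graded_Q_manifold_def poisson_bivector_def homological_def graded_manifold_def
  by blast+

private lemmas sm = QP_facts(2)

lemma Q_superfun: "i \<in> charts M \<Longrightarrow> a \<in> coords M \<Longrightarrow> superfun (evens M) (odds M) (cdom M i) (Q i a)"
  using QP_facts(4) sw_superfun unfolding vector_field_def chart_fun_def by blast

lemma Q_gpar: "i \<in> charts M \<Longrightarrow> a \<in> coords M \<Longrightarrow> x \<in> cdom M i \<Longrightarrow> gpar (Suc (sdeg (evens M) a)) (Q i a x)"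
  using QP_facts(5) cpar_sdeg[OF sm, of a] unfolding vf_parity_def parity_on_iff by (metis Suc_eq_plus1)

text \<open>On a coordinate function the square of the field is the field acting on its own
  component.\<close>

lemma Q_square:
  assumes i: "i \<in> charts M" and b: "b \<in> coords M" and x: "x \<in> cdom M i"
  shows "dapp (evens M) (odds M) (Q i) (Q i b) x = 0"
proof -
  have "chart_fun M i (coord (evens M) b)"
    unfolding chart_fun_def by (rule sw_UNIV[OF sw_coord[OF ev_open_cdom[OF sm i] coords_disjoint[OF sm] b]])
  then have "vf_app M (Q i) (vf_app M (Q i) (coord (evens M) b)) x = 0"
    using QP_facts(3) i x unfolding homological_def by blast
  moreover have "vf_app M (Q i) (coord (evens M) b) = Q i b"
    unfolding vf_app_dapp using dapp_coord[OF b] by (simp add: fun_eq_iff)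
  ultimately show ?thesis by (simp add: vf_app_dapp)
qed

context
  fixes i assumes i: "i \<in> charts M"
begin

private lemmas Uo = ev_open_cdom[OF sm i]
private lemmas UTo = ev_open_tU[OF Uo, of "odds M"]
private lemmas dis = coords_disjoint[OF sm]
private lemmas bv = even_bivector_local[OF QP_facts(6) i]

lemma qham_chart:
  "superfun (tE (evens M) (odds M)) (tN (evens M) (odds M)) (tU (evens M) (odds M) (cdom M i)) (qham (evens M) (odds M) (Q i))"
  "X \<in> tU (evens M) (odds M) (cdom M i) \<Longrightarrow> gpar 0 (qham (evens M) (odds M) (Q i) X)"
  by (rule superfun_qham[OF dis Uo Q_superfun[OF i] Q_gpar[OF i]]; assumption)
    (rule gpar_qham[OF dis Uo Q_superfun[OF i] Q_gpar[OF i]]; assumption)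

lemma superfun_hamiltonian:
  "superfun (tE (evens M) (odds M)) (tN (evens M) (odds M)) (tU (evens M) (odds M) (cdom M i)) (hamiltonian i)"
  by (intro superfun_add superfun_scaleR UTo Cinf_const qham_chart bivector_superfun[OF dis Uo bv])

lemma gpar_hamiltonian: "X \<in> tU (evens M) (odds M) (cdom M i) \<Longrightarrow> gpar 0 (hamiltonian i X)"
  by (intro gpar_add gpar_scaleR qham_chart bivector_gpar[OF dis Uo bv])

lemma QD_hv:
  assumes X: "X \<in> tU (evens M) (odds M) (cdom M i)" and z: "z \<in> coords (anticotangent M)"
  shows "QD M Q P lam i z X = hv (evens M) (odds M) (hamiltonian i) z X"
proof -
  let ?E = "evens M" and ?N = "odds M"
  have e: "ham M F i z X = hv ?E ?N (F i) z X" if "\<And>Y. Y \<in> tU ?E ?N (cdom M i) \<Longrightarrow> gpar 0 (F i Y)" for F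
  proof -
    have "schouten M (F i) (coord (tE ?E ?N) z) X = dapp (tE ?E ?N) (tN ?E ?N) (hv ?E ?N (F i)) (coord (tE ?E ?N) z) X"
      by (rule schouten_even[OF sm i X]) (rule that)
    then show ?thesis using z by (simp add: ham_def dapp_coord)
  qed
  have "ham M (theta M 1 Q) i z X = hv ?E ?N (theta M 1 Q i) z X" by (rule e) (simp only: theta_qham qham_chart(2))
  moreover have "ham M P i z X = hv ?E ?N (P i) z X" by (rule e) (rule bivector_gpar[OF dis Uo bv])
  ultimately show ?thesis
    using hv_add_scaleR[OF Uo X qham_chart(1) bivector_superfun[OF dis Uo bv]] by (simp only: QD_def theta_qham)
qed

lemma vf_app_QD:
  assumes X: "X \<in> tU (evens M) (odds M) (cdom M i)"
  shows "vf_app (anticotangent M) (QD M Q P lam i) f X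
    = dapp (tE (evens M) (odds M)) (tN (evens M) (odds M)) (hv (evens M) (odds M) (hamiltonian i)) f X"
  unfolding vf_app_dapp dapp_def using QD_hv[OF X] by (intro sum.cong) auto

lemma hamiltonian_self:
  assumes X: "X \<in> tU (evens M) (odds M) (cdom M i)"
  shows "dapp (tE (evens M) (odds M)) (tN (evens M) (odds M)) (hv (evens M) (odds M) (hamiltonian i)) (hamiltonian i) X = 0"
proof -
  let ?E = "evens M" and ?N = "odds M"
  let ?q = "qham ?E ?N (Q i)"
  let ?D = "\<lambda>F. dapp (tE ?E ?N) (tN ?E ?N) (hv ?E ?N F)"
  note sP = bivector_superfun[OF dis Uo bv] and gP = bivector_gpar[OF dis Uo bv]
  have lin: "?D (hamiltonian i) f X = ?D ?q f X + lam *\<^sub>R ?D (P i) f X" for f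
    unfolding dapp_def hv_add_scaleR[OF Uo X qham_chart(1) sP] by (simp add: distrib_right sum.distrib scaleR_sum_right)
  have sl: "superfun (tE ?E ?N) (tN ?E ?N) (tU ?E ?N (cdom M i)) (\<lambda>Y. lam *\<^sub>R P i Y)"
    by (intro superfun_scaleR UTo Cinf_const sP)
  have add: "?D F (hamiltonian i) X = ?D F ?q X + lam *\<^sub>R ?D F (P i) X" for F
    unfolding dapp_def spd_add[OF UTo X qham_chart(1) sl] spd_scaleR[OF UTo X sP]
    by (simp add: distrib_left sum.distrib scaleR_sum_right)
  have qq: "?D ?q ?q X = 0"
    by (rule dapp_qham_self[OF dis Uo Q_superfun[OF i] Q_gpar[OF i] Q_square[OF i] X])
  have qP: "?D ?q (P i) X = 0"
  proof (rule dapp_qham_bivector[OF dis Uo _ _ bv X])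
    show "superfun ?E ?N (cdom M i) (Q i a)" if "a \<in> coords M" for a by (rule Q_superfun[OF i that])
    show "gpar (Suc (sdeg ?E a)) (Q i a x)" if "a \<in> coords M" "x \<in> cdom M i" for a x by (rule Q_gpar[OF i that])
  qed (rule derivation_hess[OF sm i bv Q_superfun[OF i] Q_gpar[OF i] QP_facts(7)])
  \<comment> \<open>Symmetry on even functions reduces the second mixed bracket to the
    first.\<close>
  have "?D (P i) ?q X = ?D ?q (P i) X"
    by (rule ham_symmetric[OF dis Uo X gP qham_chart(2)])
  moreover have "?D (P i) (P i) X = 0"
  proof -
    have "schouten M (P i) (P i) X = ?D (P i) (P i) X" by (rule schouten_even[OF sm i X gP])
    then show ?thesis using QP_facts(8)[OF i, of X] X by simp
  qed
  ultimately show ?thesis unfolding lin add using qq qP by simp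
qed

lemma QD_square:
  assumes X: "X \<in> tU (evens M) (odds M) (cdom M i)"
    and f: "superfun (tE (evens M) (odds M)) (tN (evens M) (odds M)) (tU (evens M) (odds M) (cdom M i)) f"
  shows "vf_app (anticotangent M) (QD M Q P lam i) (vf_app (anticotangent M) (QD M Q P lam i) f) X = 0"
proof -
  let ?E = "evens M" and ?N = "odds M"
  let ?D = "dapp (tE ?E ?N) (tN ?E ?N) (hv ?E ?N (hamiltonian i))"
  have "vf_app (anticotangent M) (QD M Q P lam i) (vf_app (anticotangent M) (QD M Q P lam i) f) X
    = ?D (vf_app (anticotangent M) (QD M Q P lam i) f) X"
    by (rule vf_app_QD[OF X])
  also have "\<dots> = ?D (?D f) X"
    by (rule dapp_cong[OF hv_facts[OF dis Uo superfun_hamiltonian gpar_hamiltonian] X vf_app_QD])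
  also have "\<dots> = 0"
    by (rule ham_dapp_dapp[OF dis Uo superfun_hamiltonian gpar_hamiltonian hamiltonian_self X f])
  finally show ?thesis .
qed

text \<open>The weight of P is given for the induced weight, not for the total one. The Hessian on
  the zero section contains no momenta, so its weight is the same for both; P is then reassembled
  with momenta of the total weight.\<close>

lemma sw_hamiltonian:
  assumes w: "\<And>a. w (Base a) = weight M i a" "\<And>a. w (Anti a) = q - p - weight M i a"
  shows "superfun_weights (tE (evens M) (odds M)) (tN (evens M) (odds M)) w {2 * q - p}
    (tU (evens M) (odds M) (cdom M i)) (hamiltonian i)"
proof -
  let ?E = "evens M" and ?N = "odds M" and ?U = "cdom M i"
  let ?SW = "\<lambda>k. superfun_weights (tE ?E ?N) (tN ?E ?N) w {k} (tU ?E ?N ?U)"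
  let ?y = "\<lambda>a. coord (tE ?E ?N) (Anti a)"
  have eq: "?SW k f" if "?SW l f" "l = k" for f k l using that by simp
  have y: "?SW (q - p - weight M i a) (?y a)" if "a \<in> coords M" for a
    using sw_coord[OF UTo tE_disjoint[OF dis], of "Anti a" w] that by (auto simp: w(2))
  have Qw: "superfun_weights ?E ?N (weight M i) {q + weight M i a} ?U (Q i a)" if "a \<in> coords M" for a
    using Qq i that by (simp add: vf_weight_def)
  note lft = sw_lift[where wT = w and w = "weight M i", OF Uo dis w(1)]
  have 1: "?SW (2 * q - p) (qham ?E ?N (Q i))"
    unfolding qham_def[abs_def]
    by (intro sw_uminus[OF UTo] sw_sum[OF UTo] eq[OF sw_mult[OF UTo lft[OF Qw] y]]) auto
  have h: "superfun_weights ?E ?N (weight M i) {p + weight M i a + weight M i b} ?U (hess ?E ?N (P i) a b)"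
    if ab: "a \<in> coords M" "b \<in> coords M" for a b
  proof -
    have wi: "weight (anticotangent M) i (Base a) = weight M i a" for a by simp
    have Pw: "superfun_weights (tE ?E ?N) (tN ?E ?N) (weight (anticotangent M) i) {p} (tU ?E ?N ?U) (P i)"
      using Pp i by (simp add: function_weight_def)
    have A: "Anti c \<in> tE ?E ?N \<union> tN ?E ?N" if "c \<in> coords M" for c using that by auto
    have "superfun_weights (tE ?E ?N) (tN ?E ?N) (weight (anticotangent M) i) {p + weight M i a + weight M i b} (tU ?E ?N ?U)
        (spd (tE ?E ?N) (Anti a) (spd (tE ?E ?N) (Anti b) (P i)))"
      using sw_spd[OF UTo sw_spd[OF UTo Pw A[OF ab(2)]] A[OF ab(1)]] by (simp add: algebra_simps)
    then show ?thesis
      unfolding hess_def by (rule sw_zero_sec[where wT = "weight (anticotangent M) i" and w = "weight M i", OF Uo dis wi])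
  qed
  have 2: "?SW (2 * q - p) (P i)"
  proof (rule sw_cong[OF UTo])
    show "(1/2) *\<^sub>R (\<Sum>b\<in>coords M. \<Sum>a\<in>coords M. ?y b X * (?y a X * lift_fun (hess ?E ?N (P i) a b) X)) = P i X"
      if "X \<in> tU ?E ?N ?U" for X
      using bivector_hess[OF dis Uo bv that] by simp
    show "?SW (2 * q - p) (\<lambda>X. (1/2) *\<^sub>R (\<Sum>b\<in>coords M. \<Sum>a\<in>coords M. ?y b X * (?y a X * lift_fun (hess ?E ?N (P i) a b) X)))"
      by (intro sw_scaleR[OF UTo] sw_sum[OF UTo] eq[OF sw_mult[OF UTo y sw_mult[OF UTo y lft[OF h]]]]) auto
  qed
  show ?thesis by (intro sw_add[OF UTo] sw_scaleR[OF UTo] 1 2)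
qed

lemma sw_QD:
  assumes z: "z \<in> coords (anticotangent M)"
    and w: "\<And>a. w (Base a) = weight M i a" "\<And>a. w (Anti a) = q - p - weight M i a"
  shows "superfun_weights (tE (evens M) (odds M)) (tN (evens M) (odds M)) w {q + w z}
    (tU (evens M) (odds M) (cdom M i)) (QD M Q P lam i z)"
proof -
  let ?E = "evens M" and ?N = "odds M" and ?U = "cdom M i"
  have H: "superfun_weights (tE ?E ?N) (tN ?E ?N) w {2 * q - p} (tU ?E ?N ?U) (hamiltonian i)"
    by (rule sw_hamiltonian[OF w])
  \<comment> \<open>To be applied with z' the coordinate conjugate to z, for which the two weights
    add up to \<open>q - p\<close>.\<close>
  have d: "superfun_weights (tE ?E ?N) (tN ?E ?N) w {q + w z} (tU ?E ?N ?U)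
      (\<lambda>X. - ((-1) ^ n * spd (tE ?E ?N) z' (hamiltonian i) X))"
    if "z' \<in> tE ?E ?N \<union> tN ?E ?N" "2 * q - p - w z' = q + w z" for z' n
    using sw_uminus[OF UTo sw_sign[OF UTo sw_spd[OF UTo H that(1)]]] that(2) by simp
  have "superfun_weights (tE ?E ?N) (tN ?E ?N) w {q + w z} (tU ?E ?N ?U) (hv ?E ?N (hamiltonian i) z)"
  proof (cases z)
    case (Base a)
    then show ?thesis using d[of "Anti a"] z by (auto simp: hv_def[abs_def] w)
  next
    case (Anti a)
    then show ?thesis using d[of "Base a"] z by (auto simp: hv_def[abs_def] w)
  qed
  then show ?thesis by (rule sw_cong[OF UTo]) (rule QD_hv[OF _ z, symmetric])
qed

end

text \<open>The components of Q and the momenta transform with mutually inverse matrices. With the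
  factors kept in order, the two matrices meet in the middle and contract by
  \<open>jac_inverse_right\<close>.\<close>

lemma qham_global:
  assumes ij: "i \<in> charts M" "j \<in> charts M" and X: "X \<in> tU (evens M) (odds M) (overlap M i j)"
  shows "cpull (anticotangent M) i j (qham (evens M) (odds M) (Q j)) X = qham (evens M) (odds M) (Q i) X"
proof -
  let ?E = "evens M" and ?N = "odds M" and ?T = "anticotangent M" and ?x = "tproj X"
  let ?y = "\<lambda>a. coord (tE ?E ?N) (Anti a)"
  note x = tU_proj(1)[OF X]
  have ev: "X \<in> evspace (tE ?E ?N)" using X by (simp add: tU_def)
  note W = ev_open_overlap[OF sm ij(2,1)] and bx = cbody_overlap[OF sm ij x]
  note m = morphism_trans_T[OF sm ij]
  have sQ: "superfun ?E ?N (overlap M j i) (Q j b)" if "b \<in> coords M" for b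
    by (rule superfun_subset[OF Q_superfun[OF ij(2) that] overlap_cdom[OF sm ij(2,1)]])
  have s: "superfun (tE ?E ?N) (tN ?E ?N) (tU ?E ?N (overlap M j i)) (\<lambda>Y. lift_fun (Q j b) Y * ?y b Y)" if "b \<in> coords M" for b
    by (intro superfun_mult ev_open_tU W superfun_lift sQ superfun_coord_Anti that)
  have "cpull ?T i j (qham ?E ?N (Q j)) X = - cpull ?T i j (\<lambda>Y. \<Sum>b\<in>coords M. lift_fun (Q j b) Y * ?y b Y) X"
    unfolding qham_def[abs_def] anticotangent_simps
    by (rule pullback_uminus[OF m superfun_sum[OF ev_open_tU[OF W] s] X])
  also have "cpull ?T i j (\<lambda>Y. \<Sum>b\<in>coords M. lift_fun (Q j b) Y * ?y b Y) X
      = (\<Sum>b\<in>coords M. cpull ?T i j (\<lambda>Y. lift_fun (Q j b) Y * ?y b Y) X)"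
    unfolding anticotangent_simps by (rule pullback_sum[OF m finite s X])
  also have "\<dots> = (\<Sum>b\<in>coords M. \<Sum>a\<in>coords M. glift (\<Sum>d\<in>coords M. Q i d ?x * (partial M d (trans M i j b) ?x * jac M i j a b ?x)) * ?y a X)"
  proof (intro sum.cong refl)
    fix b assume b: "b \<in> coords M"
    then have A: "Anti b \<in> tE ?E ?N \<union> tN ?E ?N" by auto
    have "cpull M i j (Q j b) ?x = (\<Sum>d\<in>coords M. Q i d ?x * partial M d (trans M i j b) ?x)"
      using QP_facts(4) ij b x unfolding vector_field_def vf_app_def by blast
    then have "cpull ?T i j (lift_fun (Q j b)) X = glift (\<Sum>d\<in>coords M. Q i d ?x * partial M d (trans M i j b) ?x)"
      using cpull_T_lift[OF sm ij W sQ[OF b] x ev bx] by (simp add: lift_fun_glift)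
    moreover have "cpull ?T i j (?y b) X = (\<Sum>a\<in>coords M. glift (jac M i j a b ?x) * ?y a X)"
      using pullback_coord[OF m X A] by (simp add: lift_fun_glift)
    ultimately have "cpull ?T i j (\<lambda>Y. lift_fun (Q j b) Y * ?y b Y) X
      = glift (\<Sum>d\<in>coords M. Q i d ?x * partial M d (trans M i j b) ?x) * (\<Sum>a\<in>coords M. glift (jac M i j a b ?x) * ?y a X)"
      using pullback_mult[OF m superfun_lift[OF W sQ[OF b]] superfun_coord_Anti[OF b] X] by simp
    also have "\<dots> = (\<Sum>a\<in>coords M. glift ((\<Sum>d\<in>coords M. Q i d ?x * partial M d (trans M i j b) ?x) * jac M i j a b ?x) * ?y a X)"
      by (simp only: sum_distrib_left glift_mult mult.assoc)
    finally show "cpull ?T i j (\<lambda>Y. lift_fun (Q j b) Y * ?y b Y) X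
      = (\<Sum>a\<in>coords M. glift (\<Sum>d\<in>coords M. Q i d ?x * (partial M d (trans M i j b) ?x * jac M i j a b ?x)) * ?y a X)"
      by (simp only: sum_distrib_right mult.assoc)
  qed
  also have "\<dots> = (\<Sum>a\<in>coords M. glift (\<Sum>d\<in>coords M. Q i d ?x * (\<Sum>b\<in>coords M. partial M d (trans M i j b) ?x * jac M i j a b ?x)) * ?y a X)"
  proof (subst sum.swap, intro sum.cong refl)
    fix a
    have "(\<Sum>b\<in>coords M. \<Sum>d\<in>coords M. Q i d ?x * (partial M d (trans M i j b) ?x * jac M i j a b ?x))
      = (\<Sum>d\<in>coords M. Q i d ?x * (\<Sum>b\<in>coords M. partial M d (trans M i j b) ?x * jac M i j a b ?x))"
      unfolding sum_distrib_left by (rule sum.swap)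
    then show "(\<Sum>b\<in>coords M. glift (\<Sum>d\<in>coords M. Q i d ?x * (partial M d (trans M i j b) ?x * jac M i j a b ?x)) * ?y a X)
      = glift (\<Sum>d\<in>coords M. Q i d ?x * (\<Sum>b\<in>coords M. partial M d (trans M i j b) ?x * jac M i j a b ?x)) * ?y a X"
      by (simp only: sum_distrib_right[symmetric] glift_sum[symmetric])
  qed
  also have "\<dots> = (\<Sum>a\<in>coords M. lift_fun (Q i a) X * ?y a X)"
  proof (intro sum.cong refl)
    fix a assume a: "a \<in> coords M"
    have "(\<Sum>d\<in>coords M. Q i d ?x * (\<Sum>b\<in>coords M. partial M d (trans M i j b) ?x * jac M i j a b ?x))
      = (\<Sum>d\<in>coords M. if d = a then Q i a ?x else 0)"
      using jac_inverse_right[OF sm ij x a] by (intro sum.cong refl) simp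
    also have "\<dots> = Q i a ?x" using a by (subst sum.delta) auto
    finally show "glift (\<Sum>d\<in>coords M. Q i d ?x * (\<Sum>b\<in>coords M. partial M d (trans M i j b) ?x * jac M i j a b ?x)) * ?y a X
      = lift_fun (Q i a) X * ?y a X" by (simp add: lift_fun_glift)
  qed
  finally show ?thesis by (simp add: qham_def[abs_def])
qed

lemma overlap_T_cdom: "i \<in> charts M \<Longrightarrow> j \<in> charts M \<Longrightarrow> tU (evens M) (odds M) (overlap M i j) \<subseteq> tU (evens M) (odds M) (cdom M i)"
  using overlap_cdom[OF sm, of i j] by (auto simp: tU_def)

lemma hamiltonian_global:
  assumes ij: "i \<in> charts M" "j \<in> charts M" and X: "X \<in> tU (evens M) (odds M) (overlap M i j)"
  shows "cpull (anticotangent M) i j (hamiltonian j) X = hamiltonian i X"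
proof -
  let ?E = "evens M" and ?N = "odds M"
  note m = morphism_trans_T[OF sm ij]
  note sub = superfun_subset[OF _ overlap_T_cdom[OF ij(2,1)]]
  note sP = sub[OF bivector_superfun[OF coords_disjoint[OF sm] ev_open_cdom[OF sm ij(2)] even_bivector_local[OF QP_facts(6) ij(2)]]]
  note UT = ev_open_tU[OF ev_open_overlap[OF sm ij(2,1)], of ?N]
  have "function_on (anticotangent M) P" using QP_facts(6) by (simp add: even_bivector_def)
  then have "cpull (anticotangent M) i j (P j) X = P i X"
    unfolding function_on_def using ij X by auto
  then show ?thesis
    using pullback_add[OF m sub[OF qham_chart(1)[OF ij(2)]] superfun_scaleR[OF UT Cinf_const sP] X]
      pullback_scaleR[OF m sP X] qham_global[OF ij X] by simp
qed

text \<open>Canonical transformations preserve Hamiltonian fields. As the Hamiltonian is global, the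
  chain rule expresses its derivatives in the chart j by those in the chart i with the coefficients
  from \<open>jac_T\<close>; differentiating \<open>trans\<close> gives the same coefficients with
  conjugate indices.\<close>

lemma QD_transform:
  assumes ij: "i \<in> charts M" "j \<in> charts M" and X: "X \<in> tU (evens M) (odds M) (overlap M i j)"
    and z: "z \<in> coords (anticotangent M)"
  shows "cpull (anticotangent M) i j (QD M Q P lam j z) X = vf_app (anticotangent M) (QD M Q P lam i) (trans (anticotangent M) i j z) X"
proof -
  let ?E = "evens M" and ?N = "odds M" and ?T = "anticotangent M" and ?x = "tproj X" and ?p = "sdeg (evens M)"
  let ?A = "\<lambda>a. spd (tE ?E ?N) (Anti a) (hamiltonian i) X" and ?B = "\<lambda>a. spd (tE ?E ?N) (Base a) (hamiltonian i) X"
  note x = tU_proj(1)[OF X]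
  note dis = coords_disjoint[OF sm]
  note m = morphism_trans_T[OF sm ij]
  note Uij = ev_open_overlap[OF sm ij] and Uji = ev_open_overlap[OF sm ij(2,1)]
  note UTij = ev_open_tU[OF Uij, of ?N] and UTji = ev_open_tU[OF Uji, of ?N]
  have Xi: "X \<in> tU ?E ?N (cdom M i)" using overlap_T_cdom[OF ij] X by blast
  have sH: "superfun (tE ?E ?N) (tN ?E ?N) (tU ?E ?N (overlap M j i)) (hamiltonian j)"
    by (rule superfun_subset[OF superfun_hamiltonian[OF ij(2)] overlap_T_cdom[OF ij(2,1)]])
  have chain: "cpull ?T i j (spd (tE ?E ?N) w (hamiltonian j)) X = (\<Sum>a\<in>coords M. jac ?T i j (Base a) w X * ?B a + jac ?T i j (Anti a) w X * ?A a)" for w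
  proof -
    have d: "spd (tE ?E ?N) v (cpull ?T i j (hamiltonian j)) X = spd (tE ?E ?N) v (hamiltonian i) X" for v
      using hamiltonian_global[OF ij] by (intro spd_cong[OF UTij X]) simp
    have "cpull ?T i j (partial ?T w (hamiltonian j)) X
      = (\<Sum>v\<in>coords ?T. jac ?T i j v w X * partial ?T v (cpull ?T i j (hamiltonian j)) X)"
      using ij X UTji sH morphism_facts(6)[OF m X]
      by (intro cpull_partial[OF supermanifold_T[OF sm], where W = "tU ?E ?N (overlap M j i)"]) simp_all
    also have "\<dots> = (\<Sum>v\<in>tE ?E ?N \<union> tN ?E ?N. jac ?T i j v w X * spd (tE ?E ?N) v (hamiltonian i) X)"
      by (simp add: d[unfolded anticotangent_simps])
    finally show ?thesis unfolding sum_tcoords by simp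
  qed
  \<comment> \<open>Up to sign, the component at v is the derivative of the Hamiltonian along the
    coordinate w conjugate to v.\<close>
  have pull: "cpull ?T i j (QD M Q P lam j v) X = - ((-1) ^ n * cpull ?T i j (spd (tE ?E ?N) w (hamiltonian j)) X)"
    if "v \<in> coords ?T" "\<And>Y. hv ?E ?N (hamiltonian j) v Y = - ((-1) ^ n * spd (tE ?E ?N) w (hamiltonian j) Y)" for v w n
  proof -
    have "cpull ?T i j (QD M Q P lam j v) X = cpull ?T i j (\<lambda>Y. - ((-1) ^ n * spd (tE ?E ?N) w (hamiltonian j) Y)) X"
      unfolding anticotangent_simps
      using QD_hv[OF ij(2) _ that(1)] overlap_T_cdom[OF ij(2,1)] that(2)
      by (intro pullback_cong[OF m X]) auto
    also have "\<dots> = - ((-1) ^ n * cpull ?T i j (spd (tE ?E ?N) w (hamiltonian j)) X)"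
      unfolding anticotangent_simps
      using pullback_uminus[OF m superfun_sign[OF UTji superfun_spd[OF UTji sH]] X] pullback_sign[OF m superfun_spd[OF UTji sH] X]
      by simp
    finally show ?thesis .
  qed
  have hB: "hv ?E ?N (hamiltonian j) (Base b) Y = - ((-1) ^ ?p b * spd (tE ?E ?N) (Anti b) (hamiltonian j) Y)"
    and hA: "hv ?E ?N (hamiltonian j) (Anti b) Y = - ((-1) ^ ?p b * spd (tE ?E ?N) (Base b) (hamiltonian j) Y)" for b Y
    by (simp_all add: hv_def)
  have pA: "gpar (Suc (?p a)) (?A a)" if "a \<in> coords M" for a
    using gpar_spd_Anti[where f = "hamiltonian i" and k = 0, OF dis ev_open_cdom[OF sm ij(1)] Xi gpar_hamiltonian[OF ij(1)] that] by simp
  have pB: "gpar (?p a) (?B a)" for a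
    using gpar_spd_Base[where f = "hamiltonian i" and k = 0 and a = a, OF dis ev_open_cdom[OF sm ij(1)] Xi gpar_hamiltonian[OF ij(1)]] by simp
  have R: "vf_app ?T (QD M Q P lam i) f X = (\<Sum>a\<in>coords M.
      - ((-1) ^ ?p a * ?A a) * spd (tE ?E ?N) (Base a) f X + - ((-1) ^ ?p a * ?B a) * spd (tE ?E ?N) (Anti a) f X)" for f
    unfolding vf_app_QD[OF ij(1) Xi] dapp_def sum_tcoords hv_def tcoord.case ..
  show ?thesis
  proof (cases z)
    case (Base b)
    then have b: "b \<in> coords M" using z by auto
    have "cpull ?T i j (QD M Q P lam j z) X = (\<Sum>a\<in>coords M. - ((-1) ^ ?p b * (jac ?T i j (Base a) (Anti b) X * ?B a + jac ?T i j (Anti a) (Anti b) X * ?A a)))"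
      using pull[OF z, of "?p b" "Anti b"] hB[of b] unfolding Base chain by (simp add: sum_distrib_left sum_negf)
    also have "\<dots> = vf_app ?T (QD M Q P lam i) (trans ?T i j z) X"
      unfolding R Base anticotangent_simps
    proof (intro sum.cong refl)
      fix a assume a: "a \<in> coords M"
      have c: "lift_fun (partial M a (trans M i j b)) X * ?A a
        = (-1) ^ ((?p b + ?p a) * Suc (?p a)) * (?A a * lift_fun (partial M a (trans M i j b)) X)"
        unfolding lift_fun_glift by (intro gpar_commute gpar_glift gpar_partial_trans[OF sm ij b x] pA[OF a])
      show "- ((-1) ^ ?p b * (jac ?T i j (Base a) (Anti b) X * ?B a + jac ?T i j (Anti a) (Anti b) X * ?A a))
        = - ((-1) ^ ?p a * ?A a) * spd (tE ?E ?N) (Base a) (lift_fun (trans M i j b)) X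
          + - ((-1) ^ ?p a * ?B a) * spd (tE ?E ?N) (Anti a) (lift_fun (trans M i j b)) X"
        unfolding jac_T(2,3)[OF sm ij X a b] spd_lift_Base spd_lift_Anti using c
        by (cases "even (?p a)"; cases "even (?p b)") (simp_all add: mult.assoc)
    qed
    finally show ?thesis .
  next
    case (Anti b)
    then have b: "b \<in> coords M" using z by auto
    \<comment> \<open>\<open>K a\<close> plays two roles: it is the derivative of the new momentum b
      along the base coordinate a, and up to sign the mixed entry of the Jacobian.\<close>
    define K where "K = (\<lambda>a. \<Sum>d\<in>coords M. lift_fun (partial M a (jac M i j d b)) X * coord (tE ?E ?N) (Anti d) X)"
    have dB: "spd (tE ?E ?N) (Base a) (trans ?T i j (Anti b)) X = K a" for a
      unfolding anticotangent_simps K_def by (rule spd_Base_momentum_linear[OF dis Uij X superfun_jac[OF sm ij]])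
    have dA: "spd (tE ?E ?N) (Anti a) (trans ?T i j (Anti b)) X = (-1) ^ (Suc (?p a) * (?p a + ?p b)) * lift_fun (jac M i j a b) X"
      if a: "a \<in> coords M" for a
      unfolding anticotangent_simps
      by (rule spd_Anti_momentum_linear[where g = "\<lambda>a. jac M i j a b", OF dis Uij X superfun_jac[OF sm ij] a gpar_jac[OF sm ij a x]])
    have pK: "gpar (Suc (?p b) + ?p a) (K a)" for a
    proof -
      have "gpar (Suc (?p b)) (trans ?T i j (Anti b) Y)" if "Y \<in> tU ?E ?N (overlap M i j)" for Y
        using superfun_trans_T(2)[OF sm ij, of "Anti b" Y] that z Anti sdeg_Anti[OF dis b]
        by (subst gpar_cong[of _ "sdeg (tE ?E ?N) (Anti b)"]) (auto simp: sdeg_def)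
      from gpar_spd_Base[where f = "trans ?T i j (Anti b)", OF dis Uij X this] show ?thesis by (simp only: dB)
    qed
    have "cpull ?T i j (QD M Q P lam j z) X = (\<Sum>a\<in>coords M. - ((-1) ^ ?p b * (jac ?T i j (Base a) (Base b) X * ?B a + jac ?T i j (Anti a) (Base b) X * ?A a)))"
      using pull[OF z, of "?p b" "Base b"] hA[of b] unfolding Anti chain by (simp add: sum_distrib_left sum_negf)
    also have "\<dots> = vf_app ?T (QD M Q P lam i) (trans ?T i j z) X"
      unfolding R Anti
    proof (intro sum.cong refl)
      fix a assume a: "a \<in> coords M"
      have 1: "lift_fun (jac M i j a b) X * ?B a = (-1) ^ ((?p a + ?p b) * ?p a) * (?B a * lift_fun (jac M i j a b) X)"
        unfolding lift_fun_glift by (intro gpar_commute gpar_glift gpar_jac[OF sm ij a x] pB)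
      have 2: "K a * ?A a = (-1) ^ ((Suc (?p b) + ?p a) * Suc (?p a)) * (?A a * K a)"
        by (intro gpar_commute pK pA[OF a])
      have j: "jac ?T i j (Anti a) (Base b) X = - ((-1) ^ (?p a * ?p b) * K a)"
        unfolding K_def by (rule jac_T(4)[OF sm ij X a b])
      show "- ((-1) ^ ?p b * (jac ?T i j (Base a) (Base b) X * ?B a + jac ?T i j (Anti a) (Base b) X * ?A a))
        = - ((-1) ^ ?p a * ?A a) * spd (tE ?E ?N) (Base a) (trans ?T i j (Anti b)) X
          + - ((-1) ^ ?p a * ?B a) * spd (tE ?E ?N) (Anti a) (trans ?T i j (Anti b)) X"
        unfolding jac_T(1)[OF sm ij X a b] j dB dA[OF a] using 1 2
        by (cases "even (?p a)"; cases "even (?p b)") (simp_all add: mult.assoc)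
    qed
    finally show ?thesis .
  qed
qed

end

theorem theorem5p2:
  fixes M :: "('c, 'i::{finite,linorder}) atlas"
    and Q :: "'c \<Rightarrow> 'i \<Rightarrow> 'i sfun"
    and P :: "'c \<Rightarrow> 'i tcoord sfun"
    and q p :: int and lam :: real
  assumes "graded_QP_manifold M Q P"
    and "vf_weight M Q q"
    and "function_weight (anticotangent M) P p"
  shows "graded_Q_manifold (anticotangent_wt M (q - p)) (QD M Q P lam)
       \<and> vf_weight (anticotangent_wt M (q - p)) (QD M Q P lam) q"
proof -
  let ?T = "anticotangent_wt M (q - p)" and ?X = "QD M Q P lam"
  note sm = QP_facts(2)[OF assms]
  note sT = supermanifold_T[OF sm]
  \<comment> \<open>Weights do not enter the action of a vector field, so the chart computations
    carry over to the bundle with the shifted weight.\<close>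
  have va: "vf_app ?T = vf_app (anticotangent M)" by (simp add: vf_app_def fun_eq_iff)
  have w: "vf_weight ?T ?X q"
    unfolding vf_weight_def
  proof (intro ballI)
    fix i z assume "i \<in> charts ?T" "z \<in> coords ?T"
    then show "weighted ?T i {q + weight ?T i z} (cdom ?T i) (?X i z)"
      using sw_QD[OF assms, of i z "weight ?T i"] by (simp add: algebra_simps)
  qed
  have "vector_field ?T ?X"
    unfolding vector_field_def
  proof (intro conjI ballI)
    fix i z assume "i \<in> charts ?T" "z \<in> coords ?T"
    then show "chart_fun ?T i (?X i z)"
      using w sw_UNIV unfolding chart_fun_def vf_weight_def by blast
  next
    fix i j z X assume "i \<in> charts ?T" "j \<in> charts ?T" "z \<in> coords ?T" "X \<in> overlap ?T i j"
    then show "cpull ?T i j (?X j z) X = vf_app ?T (?X i) (trans ?T i j z) X"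
      using QD_transform[OF assms, of i j X z] by (simp add: va)
  qed
  moreover have "vf_parity ?T ?X 1"
    unfolding vf_parity_def parity_on_iff
  proof (intro ballI)
    fix i z X assume a: "i \<in> charts ?T" "z \<in> coords ?T" "X \<in> cdom ?T i"
    then have i: "i \<in> charts M" and X: "X \<in> tU (evens M) (odds M) (cdom M i)" and z: "z \<in> coords (anticotangent M)" by auto
    have "gpar (Suc (sdeg (tE (evens M) (odds M)) z)) (?X i z X)"
      unfolding QD_hv[OF assms i X z]
      using z by (intro gpar_hv[OF coords_disjoint[OF sm] ev_open_cdom[OF sm i] superfun_hamiltonian[OF assms i]
            gpar_hamiltonian[OF assms i] _ X]) simp_all
    then show "gpar (cpar ?T z + 1) (?X i z X)"
      using cpar_sdeg[OF sT z] by (simp add: cpar_anticotangent_wt)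
  qed
  moreover have "vf_app ?T (?X i) (vf_app ?T (?X i) f) X = 0"
    if "i \<in> charts ?T" "chart_fun ?T i f" "X \<in> cdom ?T i" for i f X
    using that QD_square[OF assms, of i X f] sw_superfun unfolding chart_fun_def by (simp add: va) blast
  ultimately show ?thesis
    using graded_manifold_anticotangent_wt[OF QP_facts(1)[OF assms]] w
    unfolding graded_Q_manifold_def homological_def by blast
qed

end
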